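(* Let $n=3$, $s_0,s_1,s_2,b_0,b_1,b_2\in\mathbb{R}$, $S=s_0+s_1+s_2$. Assume (a) $b_0<0<b_1,b_2$; (b) $b_0+b_1+b_2\ge\frac12$; (c) $b_0+b_1\ge0$; (d) $b_0+b_2\ge0$; (e) $S\ge2-(b_0+b_1+b_2)$; (f) $S\ge\frac32-(b_0+b_1)$; (g) $S\ge\frac32-(b_0+b_2)$; (h) $S\ge1-b_0$; (i) $s_0+2(s_1+s_2)+b_0\ge\frac32$; (j) $s_1+s_2\ge-b_0$; (k) $s_0+s_2\ge0$; (l) $s_0+s_1\ge0$; together with the exceptions: if $b_1=\frac12$ then (e) and (f) are strict; if $b_2=\frac12$ then (e) and (g) are strict; if $b_1+b_2=1$ then (e) is strict; (i) is strict whenever $s_0+b_0\in\{\frac12,\frac32-2b_1,\frac32-2b_2,\frac52-2(b_1+b_2)\}$; if (b) is an equality then (c) and (d) are strict; if one of (e)–(h) is an equality then (j), (k), (l) are strict. Then $\begin{pmatrix} s_0 & s_1 & s_2\\ b_0 & b_1 & b_2\end{pmatrix}$ is a product.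
   Context: For $u\in\mathcal S(\mathbb{R}^{1+n})$ let $\widetilde u(\tau,\xi)=\iint e^{-i(t\tau+x\cdot\xi)}u(t,x)\,dt\,dx$, $(\tau,\xi)\in\mathbb{R}\times\mathbb{R}^n$, and $\langle x\rangle=(1+|x|^2)^{1/2}$. For $s,b\in\mathbb{R}$ the wave-Sobolev space $H^{s,b}=H^{s,b}(\mathbb{R}^{1+n})$ is the completion of $\mathcal S(\mathbb{R}^{1+n})$ with respect to the norm $\|u\|_{H^{s,b}}=\|\langle\xi\rangle^s\langle|\tau|-|\xi|\rangle^b\widetilde u(\tau,\xi)\|_{L^2_{\tau,\xi}}$. A real matrix $\begin{pmatrix} s_0 & s_1 & s_2\\ b_0 & b_1 & b_2\end{pmatrix}$ is called a product (in dimension $n$) if there is a constant $C$ such that $\|uv\|_{H^{-s_0,-b_0}}\le C\|u\|_{H^{s_1,b_1}}\|v\|_{H^{s_2,b_2}}$ for all $u,v\in\mathcal S(\mathbb{R}^{1+n})$. "Strict" means the inequality holds with $>$. *)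

theory Defs
  imports "HOL-Analysis.Analysis"
begin

fun iter_dderiv :: "'a::euclidean_space list \<Rightarrow> ('a \<Rightarrow> complex) \<Rightarrow> 'a \<Rightarrow> complex" where
  "iter_dderiv [] f = f"
| "iter_dderiv (v # vs) f = (\<lambda>z. frechet_derivative (iter_dderiv vs f) (at z) v)"

definition schwartz :: "('a::euclidean_space \<Rightarrow> complex) \<Rightarrow> bool" where
  "schwartz f \<longleftrightarrow> (\<forall>vs. set vs \<subseteq> Basis \<longrightarrow>
      (\<forall>z. iter_dderiv vs f differentiable (at z)) \<and>
      (\<forall>N::nat. \<exists>C. \<forall>z. (1 + norm z) ^ N * norm (iter_dderiv vs f z) \<le> C))"

text \<open>Space-time Fourier transform on R^(1+n), points written (t,x), dual (tau,xi):
  the inner product on the product type is t*tau + x.xi.\<close>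
definition fourier :: "(real \<times> (real^'n) \<Rightarrow> complex) \<Rightarrow> real \<times> (real^'n) \<Rightarrow> complex" where
  "fourier u w = (\<integral>z. cis (- (z \<bullet> w)) * u z \<partial>lborel)"

definition japbr :: "real \<Rightarrow> real" where
  "japbr x = sqrt (1 + x\<^sup>2)"

definition H_norm_sq :: "real \<Rightarrow> real \<Rightarrow> (real \<times> (real^'n) \<Rightarrow> complex) \<Rightarrow> ennreal" where
  "H_norm_sq s b u = (\<integral>\<^sup>+ w. ennreal ((japbr (norm (snd w)) powr s * japbr (\<bar>fst w\<bar> - norm (snd w)) powr b
        * cmod (fourier u w))\<^sup>2) \<partial>lborel)"

text \<open>The matrix ((s0,s1,s2),(b0,b1,b2)) is a product in dimension n = CARD('n):
  ||uv||_{H^{-s0,-b0}} <= C ||u||_{H^{s1,b1}} ||v||_{H^{s2,b2}} for Schwartz u, v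
  (stated equivalently for squared norms, with constant C = C'^2).\<close>
definition is_product :: "'n::finite itself \<Rightarrow> real \<Rightarrow> real \<Rightarrow> real \<Rightarrow> real \<Rightarrow> real \<Rightarrow> real \<Rightarrow> bool" where
  "is_product _ s0 s1 s2 b0 b1 b2 \<longleftrightarrow> (\<exists>C::real. \<forall>u v :: real \<times> (real^'n) \<Rightarrow> complex.
      schwartz u \<longrightarrow> schwartz v \<longrightarrow>
      H_norm_sq (- s0) (- b0) (\<lambda>z. u z * v z) \<le> ennreal C * H_norm_sq s1 b1 u * H_norm_sq s2 b2 v)"

end

theory Submission
  imports Defs "HOL-Probability.Characteristic_Functions" "HOL-Probability.Sinc_Integral"
begin

text \<open>
  Since the Fourier transform of \<open>u v\<close> is dominated by the convolution of the absolute values of those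
  of \<open>u\<close> and \<open>v\<close>, duality turns the product estimate into the boundedness on \<open>L^2\<close> of a trilinear form
  whose positive kernel is the quotient of the three weights. The space-time frequencies \<open>x\<close>, \<open>y\<close> and
  \<open>x + y\<close> are compared through their frequency sizes \<open>NN\<close> and modulations \<open>LL\<close>. In most regions
  Cauchy--Schwarz with the square of the kernel attached to \<open>x\<close> or to \<open>x + y\<close> suffices; it reduces
  the bound to the volume of a ball or of the intersection of two thickened cones, the latter computed
  in bipolar coordinates.

  The remaining case is that of two high frequencies producing a low one at high output modulation.
  There \<open>snd x\<close> is first localised to small balls on which the two cones are transversal: with equal
  signs of the time frequencies the scale is that of the output frequency, with opposite signs it is
  the geometric mean of the output frequency and the output modulation, which also controls the angle
  between the two input frequencies. Orthogonality over the balls replaces the loss from counting them.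
  The remaining dyadic sums are geometric series. The exceptions for equalities ensure that these
  converge, and the logarithms at \<open>bi = 1/2\<close> are absorbed by a small power.
\<close>

subsection \<open>Trilinear forms on the Fourier side\<close>

text \<open>All exponents refer to squared weights, since a Schur test compares the square of the
  kernel with a volume. As b0 is negative, the output weight is a positive power of the output
  modulation, and the difficult region is the one where that modulation exceeds both input
  modulations. For two high frequencies with opposite signs the cones are then nearly tangent: their
  normals differ only by an angle of order sqrt (NN (x + y) * LL (x + y)) / NN x. The localisation
  radius is the displacement that turns a normal by a small fraction of this angle. Hypothesis (i)
  comes from this region: the sum over output frequencies starts near sqrt (NN x), and for a
  negative exponent this lower end governs it. Only the output is decomposed dyadically, and only in
  the localised cases; elsewhere powers of \<open>NN\<close> and \<open>LL\<close> are integrated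
  directly. Away from bi = 1/2 the growth exponents are gi = max 0 (1 - 2 * bi). Then (e) to (h) are
  the four cases of the single inequality \<open>total\<close>, and (b), (c), (d) are the cases of
  \<open>tail\<close>.\<close>

lemma ennreal_square_le_imp_le:
  fixes x y :: ennreal
  assumes "x\<^sup>2 \<le> y\<^sup>2"
  shows "x \<le> y"
proof (rule ccontr)
  assume "\<not> x \<le> y"
  then have "y < x" by simp
  then obtain r where r: "y = ennreal r" "0 \<le> r" by (cases y) auto
  show False
  proof (cases x)
    case (real s)
    with r \<open>y < x\<close> have "r < s" by (simp add: ennreal_less_iff)
    with r have "r\<^sup>2 < s\<^sup>2" by (simp add: power_strict_mono)
    moreover from assms r real have "s\<^sup>2 \<le> r\<^sup>2" by (simp add: ennreal_power ennreal_le_iff del: power_mono_iff)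
    ultimately show False by simp
  next
    case top
    with assms r show False by (simp add: ennreal_power top_unique top_power_ennreal)
  qed
qed

text \<open>Cauchy--Schwarz for an integrand that is only known to lie below a geometric mean. The
  factors \<open>g\<close> and \<open>h\<close> are already squares, so each use decides freely how
  the kernel and the three functions are shared between them.\<close>

lemma nn_integral_square_le:
  fixes f g h :: "'a \<Rightarrow> ennreal"
  assumes [measurable]: "g \<in> borel_measurable M" "h \<in> borel_measurable M"
    and le: "\<And>x. x \<in> space M \<Longrightarrow> (f x)\<^sup>2 \<le> g x * h x"
  shows "(\<integral>\<^sup>+x. f x \<partial>M)\<^sup>2 \<le> (\<integral>\<^sup>+x. g x \<partial>M) * (\<integral>\<^sup>+x. h x \<partial>M)"
proof -
  \<comment> \<open>A square root on the extended reals, with infinity as its own root; it turns the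
    hypothesis into a bound by a product of two functions.\<close>
  define r :: "ennreal \<Rightarrow> ennreal" where "r x = (if x = \<infinity> then \<infinity> else ennreal (sqrt (enn2real x)))" for x
  have r2: "(r x)\<^sup>2 = x" for x
    by (cases x) (auto simp: r_def ennreal_power top_power_ennreal)
  have [measurable]: "r \<in> borel_measurable borel" unfolding r_def by measurable
  have "(\<integral>\<^sup>+x. f x \<partial>M) \<le> (\<integral>\<^sup>+x. r (g x) * r (h x) \<partial>M)"
  proof (rule nn_integral_mono)
    fix x assume "x \<in> space M"
    then have "(f x)\<^sup>2 \<le> (r (g x) * r (h x))\<^sup>2"
      using le unfolding power_mult_distrib r2 by blast
    then show "f x \<le> r (g x) * r (h x)" by (rule ennreal_square_le_imp_le)
  qed
  then have "(\<integral>\<^sup>+x. f x \<partial>M)\<^sup>2 \<le> (\<integral>\<^sup>+x. r (g x) * r (h x) \<partial>M)\<^sup>2"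
    by (intro power_mono) auto
  also have "\<dots> \<le> (\<integral>\<^sup>+x. (r (g x))\<^sup>2 \<partial>M) * (\<integral>\<^sup>+x. (r (h x))\<^sup>2 \<partial>M)"
    by (rule Cauchy_Schwarz_nn_integral) measurable
  finally show ?thesis by (simp add: r2)
qed

lemma nn_integral_lborel_shift:
  fixes f :: "'a::euclidean_space \<Rightarrow> ennreal"
  assumes [measurable]: "f \<in> borel_measurable borel"
  shows "(\<integral>\<^sup>+x. f (c + x) \<partial>lborel) = (\<integral>\<^sup>+x. f x \<partial>lborel)"
proof -
  have "(\<integral>\<^sup>+x. f x \<partial>lborel) = (\<integral>\<^sup>+x. f x \<partial>(distr lborel borel ((+) c)))"
    by (simp add: lborel_distr_plus)
  also have "\<dots> = (\<integral>\<^sup>+x. f (c + x) \<partial>lborel)" by (subst nn_integral_distr) auto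
  finally show ?thesis by simp
qed

lemma nn_integral_lborel_reflect:
  fixes f :: "'a::euclidean_space \<Rightarrow> ennreal"
  assumes [measurable]: "f \<in> borel_measurable borel"
  shows "(\<integral>\<^sup>+x. f (c - x) \<partial>lborel) = (\<integral>\<^sup>+x. f x \<partial>lborel)"
proof -
  have "(lborel :: 'a measure) = density (distr lborel borel (\<lambda>x. c + (-1) *\<^sub>R x)) (\<lambda>_. 1)"
    using lborel_affine[of "-1" c] by simp
  then have "(lborel :: 'a measure) = distr lborel borel (\<lambda>x. c - x)" by (simp add: density_1)
  then have "(\<integral>\<^sup>+x. f x \<partial>lborel) = (\<integral>\<^sup>+x. f x \<partial>(distr lborel borel (\<lambda>x. c - x)))" by simp
  also have "\<dots> = (\<integral>\<^sup>+x. f (c - x) \<partial>lborel)" by (subst nn_integral_distr) auto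
  finally show ?thesis by simp
qed

text \<open>The inequality is stated for squares because Cauchy--Schwarz yields it in this form and
  no roots of extended reals arise. The constant is a real number, hence finite;
  \<open>ennreal\<close> sends a negative one to 0.\<close>

definition trilinear_bound ::
    "('a::euclidean_space \<Rightarrow> 'a \<Rightarrow> ennreal) \<Rightarrow> bool" where
  "trilinear_bound k \<longleftrightarrow> (\<exists>C::real. \<forall>F0 F1 F2 :: 'a \<Rightarrow> ennreal.
     F0 \<in> borel_measurable borel \<longrightarrow> F1 \<in> borel_measurable borel \<longrightarrow> F2 \<in> borel_measurable borel \<longrightarrow>
     (\<integral>\<^sup>+x. \<integral>\<^sup>+y. k x y * F0 (x + y) * F1 x * F2 y \<partial>lborel \<partial>lborel)\<^sup>2
       \<le> ennreal C * (\<integral>\<^sup>+x. (F0 x)\<^sup>2 \<partial>lborel) * (\<integral>\<^sup>+x. (F1 x)\<^sup>2 \<partial>lborel) * (\<integral>\<^sup>+x. (F2 x)\<^sup>2 \<partial>lborel))"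

lemma ennreal_square_add_le:
  fixes x y :: ennreal shows "(x + y)\<^sup>2 \<le> 2 * (x\<^sup>2 + y\<^sup>2)"
  using sum_of_squares_ge_ennreal[of x y]
  by (auto simp: power2_sum algebra_simps mult_2 intro!: add_mono)

lemma trilinear_bound_add:
  assumes "trilinear_bound k" "trilinear_bound k'"
    and "case_prod k \<in> borel_measurable borel" "case_prod k' \<in> borel_measurable borel"
  shows "trilinear_bound (\<lambda>x y. k x y + k' x y)"
proof -
  have m[measurable]: "case_prod k \<in> borel_measurable (borel \<Otimes>\<^sub>M borel)"
    "case_prod k' \<in> borel_measurable (borel \<Otimes>\<^sub>M borel)" using assms(3,4) by (simp_all add: borel_prod)
  define R where "R F0 F1 F2 = (\<integral>\<^sup>+x. (F0 x)\<^sup>2 \<partial>lborel) * (\<integral>\<^sup>+x. (F1 x)\<^sup>2 \<partial>lborel) * (\<integral>\<^sup>+x. (F2 x)\<^sup>2 \<partial>lborel)"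
    for F0 F1 F2 :: "'a \<Rightarrow> ennreal"
  have ex: "\<exists>C\<ge>0. \<forall>F0\<in>borel_measurable borel. \<forall>F1\<in>borel_measurable borel. \<forall>F2\<in>borel_measurable borel.
     (\<integral>\<^sup>+x. \<integral>\<^sup>+y. k x y * F0 (x + y) * F1 x * F2 y \<partial>lborel \<partial>lborel)\<^sup>2 \<le> ennreal C * R F0 F1 F2"
    if "trilinear_bound k" for k :: "'a \<Rightarrow> 'a \<Rightarrow> ennreal"
  proof -
    from that obtain C where "\<And>F0 F1 F2. F0 \<in> borel_measurable borel \<Longrightarrow> F1 \<in> borel_measurable borel \<Longrightarrow> F2 \<in> borel_measurable borel \<Longrightarrow>
     (\<integral>\<^sup>+x. \<integral>\<^sup>+y. k x y * F0 (x + y) * F1 x * F2 y \<partial>lborel \<partial>lborel)\<^sup>2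
       \<le> ennreal C * R F0 F1 F2"
      unfolding trilinear_bound_def R_def mult.assoc by blast
    \<comment> \<open>Passing to the positive part does not change the bound and lets the two
      constants be added under \<open>ennreal\<close>.\<close>
    moreover have "ennreal C = ennreal (max 0 C)" by (metis ennreal_max_0)
    ultimately show ?thesis by (intro exI[of _ "max 0 C"]) auto
  qed
  from ex[OF assms(1)] ex[OF assms(2)] obtain C D where CD: "C \<ge> 0" "D \<ge> 0" and
   C: "\<And>F0 F1 F2. F0 \<in> borel_measurable borel \<Longrightarrow> F1 \<in> borel_measurable borel \<Longrightarrow> F2 \<in> borel_measurable borel \<Longrightarrow>
     (\<integral>\<^sup>+x. \<integral>\<^sup>+y. k x y * F0 (x + y) * F1 x * F2 y \<partial>lborel \<partial>lborel)\<^sup>2 \<le> ennreal C * R F0 F1 F2" and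
   D: "\<And>F0 F1 F2. F0 \<in> borel_measurable borel \<Longrightarrow> F1 \<in> borel_measurable borel \<Longrightarrow> F2 \<in> borel_measurable borel \<Longrightarrow>
     (\<integral>\<^sup>+x. \<integral>\<^sup>+y. k' x y * F0 (x + y) * F1 x * F2 y \<partial>lborel \<partial>lborel)\<^sup>2 \<le> ennreal D * R F0 F1 F2"
    by blast
  show ?thesis unfolding trilinear_bound_def
  proof (intro exI[of _ "2 * (C + D)"] allI impI)
    fix F0 F1 F2 :: "'a \<Rightarrow> ennreal"
    assume F[measurable]: "F0 \<in> borel_measurable borel" "F1 \<in> borel_measurable borel" "F2 \<in> borel_measurable borel"
    have "(\<integral>\<^sup>+x. \<integral>\<^sup>+y. (k x y + k' x y) * F0 (x + y) * F1 x * F2 y \<partial>lborel \<partial>lborel)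
      = (\<integral>\<^sup>+x. (\<integral>\<^sup>+y. k x y * F0 (x + y) * F1 x * F2 y \<partial>lborel) + (\<integral>\<^sup>+y. k' x y * F0 (x + y) * F1 x * F2 y \<partial>lborel) \<partial>lborel)"
      by (intro nn_integral_cong) (simp add: distrib_right nn_integral_add)
    also have "\<dots> = (\<integral>\<^sup>+x. \<integral>\<^sup>+y. k x y * F0 (x + y) * F1 x * F2 y \<partial>lborel \<partial>lborel)
      + (\<integral>\<^sup>+x. \<integral>\<^sup>+y. k' x y * F0 (x + y) * F1 x * F2 y \<partial>lborel \<partial>lborel)"
      by (rule nn_integral_add) measurable
    finally have "(\<integral>\<^sup>+x. \<integral>\<^sup>+y. (k x y + k' x y) * F0 (x + y) * F1 x * F2 y \<partial>lborel \<partial>lborel)\<^sup>2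
      \<le> 2 * (ennreal C * R F0 F1 F2 + ennreal D * R F0 F1 F2)"
      by (auto intro!: order_trans[OF ennreal_square_add_le] mult_left_mono add_mono C[OF F] D[OF F])
    also have "\<dots> = ennreal (2 * (C + D)) * R F0 F1 F2"
    proof -
      have "ennreal (2 * (C + D)) = 2 * (ennreal C + ennreal D)"
        unfolding ennreal_plus[OF CD, symmetric] ennreal_numeral[symmetric]
        by (rule ennreal_mult') simp
      then show ?thesis by (simp only: distrib_right mult.assoc)
    qed
    finally show "(\<integral>\<^sup>+x. \<integral>\<^sup>+y. (k x y + k' x y) * F0 (x + y) * F1 x * F2 y \<partial>lborel \<partial>lborel)\<^sup>2 \<le>
       ennreal (2 * (C + D)) * (\<integral>\<^sup>+x. (F0 x)\<^sup>2 \<partial>lborel) * (\<integral>\<^sup>+x. (F1 x)\<^sup>2 \<partial>lborel) * (\<integral>\<^sup>+x. (F2 x)\<^sup>2 \<partial>lborel)"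
      by (simp add: R_def mult.assoc)
  qed
qed

text \<open>The argument of \<open>F0\<close> is symmetric in the two inputs. Exchanging them makes
  an ordering by frequency or by modulation no loss of generality.\<close>

lemma trilinear_bound_swap:
  assumes "trilinear_bound k" "case_prod k \<in> borel_measurable borel"
  shows "trilinear_bound (\<lambda>x y. k y x)"
proof -
  have m[measurable]: "case_prod k \<in> borel_measurable (borel \<Otimes>\<^sub>M borel)" using assms(2) by (simp add: borel_prod)
  from assms(1) obtain C where C: "\<And>F0 F1 F2. F0 \<in> borel_measurable borel \<Longrightarrow> F1 \<in> borel_measurable borel \<Longrightarrow> F2 \<in> borel_measurable borel \<Longrightarrow>
     (\<integral>\<^sup>+x. \<integral>\<^sup>+y. k x y * F0 (x + y) * F1 x * F2 y \<partial>lborel \<partial>lborel)\<^sup>2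
       \<le> ennreal C * (\<integral>\<^sup>+x. (F0 x)\<^sup>2 \<partial>lborel) * (\<integral>\<^sup>+x. (F1 x)\<^sup>2 \<partial>lborel) * (\<integral>\<^sup>+x. (F2 x)\<^sup>2 \<partial>lborel)"
    unfolding trilinear_bound_def by blast
  show ?thesis unfolding trilinear_bound_def
  proof (intro exI[of _ C] allI impI)
    fix F0 F1 F2 :: "'a \<Rightarrow> ennreal"
    assume F[measurable]: "F0 \<in> borel_measurable borel" "F1 \<in> borel_measurable borel" "F2 \<in> borel_measurable borel"
    have "(\<integral>\<^sup>+x. \<integral>\<^sup>+y. k y x * F0 (x + y) * F1 x * F2 y \<partial>lborel \<partial>lborel)
      = (\<integral>\<^sup>+y. \<integral>\<^sup>+x. k y x * F0 (x + y) * F1 x * F2 y \<partial>lborel \<partial>lborel)"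
      by (rule lborel_pair.Fubini') measurable
    also have "\<dots> = (\<integral>\<^sup>+x. \<integral>\<^sup>+y. k x y * F0 (x + y) * F2 x * F1 y \<partial>lborel \<partial>lborel)"
      by (simp add: ac_simps)
    finally show "(\<integral>\<^sup>+x. \<integral>\<^sup>+y. k y x * F0 (x + y) * F1 x * F2 y \<partial>lborel \<partial>lborel)\<^sup>2 \<le>
       ennreal C * (\<integral>\<^sup>+x. (F0 x)\<^sup>2 \<partial>lborel) * (\<integral>\<^sup>+x. (F1 x)\<^sup>2 \<partial>lborel) * (\<integral>\<^sup>+x. (F2 x)\<^sup>2 \<partial>lborel)"
      using C[OF F(1,3,2)] by (simp add: ac_simps)
  qed
qed

text \<open>Schur-type tests: Cauchy--Schwarz with the square of the kernel attached to one of the three factors.\<close>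

lemma trilinear_bound_fix_first:
  assumes "case_prod k \<in> borel_measurable borel"
    and "\<And>x. (\<integral>\<^sup>+y. (k x y)\<^sup>2 \<partial>lborel) \<le> ennreal C"
  shows "trilinear_bound k"
proof -
  have m[measurable]: "case_prod k \<in> borel_measurable (borel \<Otimes>\<^sub>M borel)" using assms(1) by (simp add: borel_prod)
  show ?thesis unfolding trilinear_bound_def
  proof (intro exI[of _ C] allI impI)
    fix F0 F1 F2 :: "'a \<Rightarrow> ennreal"
    assume F[measurable]: "F0 \<in> borel_measurable borel" "F1 \<in> borel_measurable borel" "F2 \<in> borel_measurable borel"
    let ?f = "\<lambda>(x,y). k x y * F0 (x + y) * F1 x * F2 y"
    \<comment> \<open>The kernel goes with \<open>F1 x\<close>. The other factor
      \<open>F0 (x + y) * F2 y\<close> is integrated in \<open>x\<close> at a fixed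
      \<open>y\<close>, where translation invariance removes \<open>y\<close> from
      \<open>F0\<close>.\<close>
    let ?g = "\<lambda>(x,y). (k x y)\<^sup>2 * (F1 x)\<^sup>2" and ?h = "\<lambda>(x,y). (F0 (y + x))\<^sup>2 * (F2 y)\<^sup>2"
    have "(\<integral>\<^sup>+x. \<integral>\<^sup>+y. k x y * F0 (x + y) * F1 x * F2 y \<partial>lborel \<partial>lborel)\<^sup>2 = (\<integral>\<^sup>+p. ?f p \<partial>(lborel \<Otimes>\<^sub>M lborel))\<^sup>2"
      by (subst lborel.nn_integral_fst[symmetric]) auto
    also have "\<dots> \<le> (\<integral>\<^sup>+p. ?g p \<partial>(lborel \<Otimes>\<^sub>M lborel)) * (\<integral>\<^sup>+p. ?h p \<partial>(lborel \<Otimes>\<^sub>M lborel))"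
      by (rule nn_integral_square_le) (auto simp: power_mult_distrib ac_simps)
    also have "(\<integral>\<^sup>+p. ?g p \<partial>(lborel \<Otimes>\<^sub>M lborel)) = (\<integral>\<^sup>+x. (\<integral>\<^sup>+y. (k x y)\<^sup>2 \<partial>lborel) * (F1 x)\<^sup>2 \<partial>lborel)"
      by (subst lborel.nn_integral_fst[symmetric]) (auto simp: nn_integral_multc)
    also have "(\<integral>\<^sup>+p. ?h p \<partial>(lborel \<Otimes>\<^sub>M lborel)) = (\<integral>\<^sup>+y. (\<integral>\<^sup>+x. (F0 (y + x))\<^sup>2 \<partial>lborel) * (F2 y)\<^sup>2 \<partial>lborel)"
      by (subst lborel_pair.nn_integral_snd[symmetric]) (auto simp: nn_integral_multc)
    also have "\<dots> = (\<integral>\<^sup>+x. (F0 x)\<^sup>2 \<partial>lborel) * (\<integral>\<^sup>+x. (F2 x)\<^sup>2 \<partial>lborel)"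
      by (subst nn_integral_lborel_shift[of "\<lambda>x. (F0 x)\<^sup>2"]) (auto simp: nn_integral_cmult)
    also have "(\<integral>\<^sup>+x. (\<integral>\<^sup>+y. (k x y)\<^sup>2 \<partial>lborel) * (F1 x)\<^sup>2 \<partial>lborel) \<le> (\<integral>\<^sup>+x. ennreal C * (F1 x)\<^sup>2 \<partial>lborel)"
      using assms(2) by (intro nn_integral_mono mult_right_mono) auto
    also have "\<dots> = ennreal C * (\<integral>\<^sup>+x. (F1 x)\<^sup>2 \<partial>lborel)" by (simp add: nn_integral_cmult)
    finally show "(\<integral>\<^sup>+x. \<integral>\<^sup>+y. k x y * F0 (x + y) * F1 x * F2 y \<partial>lborel \<partial>lborel)\<^sup>2 \<le>
       ennreal C * (\<integral>\<^sup>+x. (F0 x)\<^sup>2 \<partial>lborel) * (\<integral>\<^sup>+x. (F1 x)\<^sup>2 \<partial>lborel) * (\<integral>\<^sup>+x. (F2 x)\<^sup>2 \<partial>lborel)"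
      by (simp add: ac_simps mult_right_mono)
  qed
qed

lemma nn_integral_conv_change:
  fixes f :: "'a::euclidean_space \<Rightarrow> 'a \<Rightarrow> ennreal"
  assumes "case_prod f \<in> borel_measurable borel"
  shows "(\<integral>\<^sup>+x. \<integral>\<^sup>+y. f x y \<partial>lborel \<partial>lborel) = (\<integral>\<^sup>+z. \<integral>\<^sup>+x. f x (z - x) \<partial>lborel \<partial>lborel)"
proof -
  have m[measurable]: "case_prod f \<in> borel_measurable (borel \<Otimes>\<^sub>M borel)" using assms(1) by (simp add: borel_prod)
  have "(\<integral>\<^sup>+x. \<integral>\<^sup>+y. f x y \<partial>lborel \<partial>lborel) = (\<integral>\<^sup>+x. \<integral>\<^sup>+z. f x (- x + z) \<partial>lborel \<partial>lborel)"
    by (intro nn_integral_cong nn_integral_lborel_shift[symmetric]) simp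
  also have "\<dots> = (\<integral>\<^sup>+z. \<integral>\<^sup>+x. f x (- x + z) \<partial>lborel \<partial>lborel)"
    by (rule lborel_pair.Fubini') measurable
  finally show ?thesis by simp
qed

lemma trilinear_bound_fix_sum:
  assumes "case_prod k \<in> borel_measurable borel"
    and "\<And>z. (\<integral>\<^sup>+x. (k x (z - x))\<^sup>2 \<partial>lborel) \<le> ennreal C"
  shows "trilinear_bound k"
proof -
  have m[measurable]: "case_prod k \<in> borel_measurable (borel \<Otimes>\<^sub>M borel)" using assms(1) by (simp add: borel_prod)
  show ?thesis unfolding trilinear_bound_def
  proof (intro exI[of _ C] allI impI)
    fix F0 F1 F2 :: "'a \<Rightarrow> ennreal"
    assume F[measurable]: "F0 \<in> borel_measurable borel" "F1 \<in> borel_measurable borel" "F2 \<in> borel_measurable borel"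
    let ?f = "\<lambda>(x,y). k x y * F0 (x + y) * F1 x * F2 y"
    \<comment> \<open>Here the kernel goes with the output function, and the other factor is a
      product of functions of separate variables.\<close>
    let ?g = "\<lambda>(x,y). (k x y)\<^sup>2 * (F0 (x + y))\<^sup>2" and ?h = "\<lambda>(x,y). (F1 x)\<^sup>2 * (F2 y)\<^sup>2"
    have "(\<integral>\<^sup>+x. \<integral>\<^sup>+y. k x y * F0 (x + y) * F1 x * F2 y \<partial>lborel \<partial>lborel)\<^sup>2 = (\<integral>\<^sup>+p. ?f p \<partial>(lborel \<Otimes>\<^sub>M lborel))\<^sup>2"
      by (subst lborel.nn_integral_fst[symmetric]) auto
    also have "\<dots> \<le> (\<integral>\<^sup>+p. ?g p \<partial>(lborel \<Otimes>\<^sub>M lborel)) * (\<integral>\<^sup>+p. ?h p \<partial>(lborel \<Otimes>\<^sub>M lborel))"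
      by (rule nn_integral_square_le) (auto simp: power_mult_distrib ac_simps)
    also have "(\<integral>\<^sup>+p. ?h p \<partial>(lborel \<Otimes>\<^sub>M lborel)) = (\<integral>\<^sup>+x. (F1 x)\<^sup>2 \<partial>lborel) * (\<integral>\<^sup>+x. (F2 x)\<^sup>2 \<partial>lborel)"
      by (subst lborel.nn_integral_fst[symmetric]) (auto simp: nn_integral_cmult nn_integral_multc)
    also have "(\<integral>\<^sup>+p. ?g p \<partial>(lborel \<Otimes>\<^sub>M lborel)) = (\<integral>\<^sup>+x. \<integral>\<^sup>+y. (k x y)\<^sup>2 * (F0 (x + y))\<^sup>2 \<partial>lborel \<partial>lborel)"
      by (subst lborel.nn_integral_fst[symmetric]) auto
    also have "\<dots> = (\<integral>\<^sup>+z. \<integral>\<^sup>+x. (k x (z - x))\<^sup>2 * (F0 (x + (z - x)))\<^sup>2 \<partial>lborel \<partial>lborel)"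
      by (rule nn_integral_conv_change) (simp add: borel_prod[symmetric])
    also have "\<dots> = (\<integral>\<^sup>+z. (\<integral>\<^sup>+x. (k x (z - x))\<^sup>2 \<partial>lborel) * (F0 z)\<^sup>2 \<partial>lborel)"
      by (simp add: nn_integral_multc)
    also have "\<dots> \<le> (\<integral>\<^sup>+x. ennreal C * (F0 x)\<^sup>2 \<partial>lborel)"
      using assms(2) by (intro nn_integral_mono mult_right_mono) auto
    also have "\<dots> = ennreal C * (\<integral>\<^sup>+x. (F0 x)\<^sup>2 \<partial>lborel)" by (simp add: nn_integral_cmult)
    finally show "(\<integral>\<^sup>+x. \<integral>\<^sup>+y. k x y * F0 (x + y) * F1 x * F2 y \<partial>lborel \<partial>lborel)\<^sup>2 \<le>
       ennreal C * (\<integral>\<^sup>+x. (F0 x)\<^sup>2 \<partial>lborel) * (\<integral>\<^sup>+x. (F1 x)\<^sup>2 \<partial>lborel) * (\<integral>\<^sup>+x. (F2 x)\<^sup>2 \<partial>lborel)"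
      by (simp add: ac_simps mult_right_mono)
  qed
qed

text \<open>Duality: test against the truncations of the function itself, which are square integrable.\<close>

lemma trilinear_bound_imp_convolution_bound:
  assumes "trilinear_bound k" "case_prod k \<in> borel_measurable borel"
  obtains C where "\<And>F1 F2. F1 \<in> borel_measurable borel \<Longrightarrow> F2 \<in> borel_measurable borel \<Longrightarrow>
     (\<integral>\<^sup>+z. (\<integral>\<^sup>+x. k x (z - x) * F1 x * F2 (z - x) \<partial>lborel)\<^sup>2 \<partial>lborel)
       \<le> ennreal C * (\<integral>\<^sup>+x. (F1 x)\<^sup>2 \<partial>lborel) * (\<integral>\<^sup>+x. (F2 x)\<^sup>2 \<partial>lborel)"
proof -
  have m[measurable]: "case_prod k \<in> borel_measurable (borel \<Otimes>\<^sub>M borel)" using assms(2) by (simp add: borel_prod)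
  from assms(1) obtain C where C: "\<And>F0 F1 F2. F0 \<in> borel_measurable borel \<Longrightarrow> F1 \<in> borel_measurable borel \<Longrightarrow> F2 \<in> borel_measurable borel \<Longrightarrow>
     (\<integral>\<^sup>+x. \<integral>\<^sup>+y. k x y * F0 (x + y) * F1 x * F2 y \<partial>lborel \<partial>lborel)\<^sup>2
       \<le> ennreal C * (\<integral>\<^sup>+x. (F0 x)\<^sup>2 \<partial>lborel) * (\<integral>\<^sup>+x. (F1 x)\<^sup>2 \<partial>lborel) * (\<integral>\<^sup>+x. (F2 x)\<^sup>2 \<partial>lborel)"
    unfolding trilinear_bound_def by blast
  show ?thesis
  proof (rule that[of C])
    fix F1 F2 :: "'a \<Rightarrow> ennreal"
    assume F[measurable]: "F1 \<in> borel_measurable borel" "F2 \<in> borel_measurable borel"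
    define \<Phi> where "\<Phi> z = (\<integral>\<^sup>+x. k x (z - x) * F1 x * F2 (z - x) \<partial>lborel)" for z
    have [measurable]: "\<Phi> \<in> borel_measurable borel" unfolding \<Phi>_def by measurable
    let ?P = "ennreal C * (\<integral>\<^sup>+x. (F1 x)\<^sup>2 \<partial>lborel) * (\<integral>\<^sup>+x. (F2 x)\<^sup>2 \<partial>lborel)"
    \<comment> \<open>Truncation in height and in support makes the integral of the square finite,
      so that one factor of it can be cancelled below.\<close>
    define G where "G n z = min (\<Phi> z) (of_nat n) * indicator (cball 0 (real n)) z" for n :: nat and z
    have [measurable]: "cball 0 r \<in> sets (borel :: 'a measure)" for r by simp
    have [measurable]: "G n \<in> borel_measurable borel" for n unfolding G_def by measurable
    have G_le: "(\<integral>\<^sup>+z. (G n z)\<^sup>2 \<partial>lborel) \<le> ?P" for n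
    proof -
      have "(\<integral>\<^sup>+z. (G n z)\<^sup>2 \<partial>lborel) \<le> (\<integral>\<^sup>+z. (of_nat n)\<^sup>2 * indicator (cball (0::'a) (real n)) z \<partial>lborel)"
        by (intro nn_integral_mono) (auto simp: G_def indicator_def intro!: power_mono)
      also have "\<dots> = (of_nat n)\<^sup>2 * emeasure lborel (cball (0::'a) (real n))"
        by (simp add: nn_integral_cmult)
      also have "\<dots> < \<infinity>"
        using emeasure_lborel_cball_finite[of "0::'a" "real n"] by (simp add: ennreal_mult_less_top power_less_top_ennreal of_nat_less_top)
      finally have fin: "(\<integral>\<^sup>+z. (G n z)\<^sup>2 \<partial>lborel) < \<infinity>" .
      \<comment> \<open>Since \<open>G n\<close> is at most \<open>\<Phi>\<close>, its square is
        bounded by \<open>\<Phi> * G n\<close>, whose integral is the trilinear form tested with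
        \<open>G n\<close> in the place of \<open>F0\<close>.\<close>
      have "(\<integral>\<^sup>+z. (G n z)\<^sup>2 \<partial>lborel) \<le> (\<integral>\<^sup>+z. \<Phi> z * G n z \<partial>lborel)"
        by (intro nn_integral_mono) (auto simp: G_def indicator_def power2_eq_square intro!: mult_mono)
      also have "\<dots> = (\<integral>\<^sup>+z. \<integral>\<^sup>+x. k x (z - x) * G n (x + (z - x)) * F1 x * F2 (z - x) \<partial>lborel \<partial>lborel)"
        unfolding \<Phi>_def by (subst nn_integral_multc[symmetric]) (auto simp: ac_simps)
      also have "\<dots> = (\<integral>\<^sup>+x. \<integral>\<^sup>+y. k x y * G n (x + y) * F1 x * F2 y \<partial>lborel \<partial>lborel)"
        by (rule nn_integral_conv_change[symmetric]) (simp add: borel_prod[symmetric])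
      finally have "(\<integral>\<^sup>+z. (G n z)\<^sup>2 \<partial>lborel)\<^sup>2 \<le> (\<integral>\<^sup>+x. \<integral>\<^sup>+y. k x y * G n (x + y) * F1 x * F2 y \<partial>lborel \<partial>lborel)\<^sup>2"
        by (intro power_mono) auto
      also have "\<dots> \<le> (\<integral>\<^sup>+z. (G n z)\<^sup>2 \<partial>lborel) * ?P"
        using C[of "G n" F1 F2] by (simp add: ac_simps)
      finally have le: "(\<integral>\<^sup>+z. (G n z)\<^sup>2 \<partial>lborel)\<^sup>2 \<le> (\<integral>\<^sup>+z. (G n z)\<^sup>2 \<partial>lborel) * ?P" .
      show ?thesis
      proof (cases "(\<integral>\<^sup>+z. (G n z)\<^sup>2 \<partial>lborel) = 0")
        case False
        with fin le show ?thesis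
          by (simp add: power2_eq_square ennreal_mult_le_mult_iff)
      qed simp
    qed
    have inc: "incseq (\<lambda>n z. (G n z)\<^sup>2)"
      by (auto simp: incseq_def le_fun_def G_def indicator_def intro!: power_mono min.mono)
    have sup: "(SUP n. (G n z)\<^sup>2) = (\<Phi> z)\<^sup>2" for z
    proof (rule LIMSEQ_unique[OF LIMSEQ_SUP])
      show "incseq (\<lambda>n. (G n z)\<^sup>2)" using inc by (auto simp: incseq_def le_fun_def)
      have "eventually (\<lambda>n. z \<in> cball 0 (real n)) sequentially"
        using eventually_ge_at_top[of "nat \<lceil>norm z\<rceil>"] by eventually_elim (simp add: nat_le_iff ceiling_le_iff)
      then have ev: "eventually (\<lambda>n. (min (\<Phi> z) (of_nat n))\<^sup>2 = (G n z)\<^sup>2) sequentially"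
        by eventually_elim (simp add: G_def)
      have "(\<lambda>n. min (\<Phi> z) (of_nat n)) \<longlonglongrightarrow> min (\<Phi> z) top"
        by (intro tendsto_min tendsto_const of_nat_tendsto_top_ennreal)
      then have "(\<lambda>n. (min (\<Phi> z) (of_nat n))\<^sup>2) \<longlonglongrightarrow> (\<Phi> z)\<^sup>2"
        unfolding power2_eq_square by (intro tendsto_mult_ennreal) simp_all
      then show "(\<lambda>n. (G n z)\<^sup>2) \<longlonglongrightarrow> (\<Phi> z)\<^sup>2" using ev by (rule Lim_transform_eventually)
    qed
    have "(\<integral>\<^sup>+z. (\<Phi> z)\<^sup>2 \<partial>lborel) = (\<integral>\<^sup>+z. (SUP n. (G n z)\<^sup>2) \<partial>lborel)" by (simp add: sup)
    also have "\<dots> = (SUP n. \<integral>\<^sup>+z. (G n z)\<^sup>2 \<partial>lborel)"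
      by (rule nn_integral_monotone_convergence_SUP[OF inc]) measurable
    also have "\<dots> \<le> ?P" using G_le by (auto intro!: SUP_least)
    finally show "(\<integral>\<^sup>+z. (\<integral>\<^sup>+x. k x (z - x) * F1 x * F2 (z - x) \<partial>lborel)\<^sup>2 \<partial>lborel) \<le> ?P"
      by (simp add: \<Phi>_def)
  qed
qed

section \<open>Localisation of one input frequency to balls\<close>

lemma nn_integral_lborel_pair:
  fixes f :: "'a::euclidean_space \<times> 'b::euclidean_space \<Rightarrow> ennreal"
  assumes "f \<in> borel_measurable borel"
  shows "(\<integral>\<^sup>+p. f p \<partial>lborel) = (\<integral>\<^sup>+x. \<integral>\<^sup>+y. f (x, y) \<partial>lborel \<partial>lborel)"
    and "(\<integral>\<^sup>+p. f p \<partial>lborel) = (\<integral>\<^sup>+y. \<integral>\<^sup>+x. f (x, y) \<partial>lborel \<partial>lborel)"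
proof -
  have "f \<in> borel_measurable (lborel \<Otimes>\<^sub>M lborel)" using assms by (simp add: lborel_prod)
  from lborel.nn_integral_fst[OF this] lborel_pair.nn_integral_snd[OF this]
  show "(\<integral>\<^sup>+p. f p \<partial>lborel) = (\<integral>\<^sup>+x. \<integral>\<^sup>+y. f (x, y) \<partial>lborel \<partial>lborel)"
    "(\<integral>\<^sup>+p. f p \<partial>lborel) = (\<integral>\<^sup>+y. \<integral>\<^sup>+x. f (x, y) \<partial>lborel \<partial>lborel)"
    by (simp_all add: lborel_prod)
qed

lemma borel_measurable_pairI:
  "f \<in> borel_measurable (borel \<Otimes>\<^sub>M borel) \<Longrightarrow>
    (f :: 'a::euclidean_space \<times> 'b::euclidean_space \<Rightarrow> ennreal) \<in> borel_measurable borel"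
  by (simp add: borel_prod)

lemma borel_measurable_snd_euclidean [measurable]:
  "(snd :: 'a::euclidean_space \<times> 'b::euclidean_space \<Rightarrow> 'b) \<in> borel_measurable borel"
  by (intro borel_measurable_continuous_onI continuous_intros)

lemma borel_measurable_fst_euclidean [measurable]:
  "(fst :: 'a::euclidean_space \<times> 'b::euclidean_space \<Rightarrow> 'a) \<in> borel_measurable borel"
  by (intro borel_measurable_continuous_onI continuous_intros)

text \<open>The frequency \<open>snd x\<close> of the second factor is localised to balls \<open>cball w \<rho>\<close>, averaging over
  the centre \<open>w\<close>; \<open>M\<close> bounds the overlap of the regions that the third factor then sees.\<close>

lemma localized_bound:
  fixes k q :: "real \<times> 'b::euclidean_space \<Rightarrow> real \<times> 'b \<Rightarrow> ennreal"
  assumes "case_prod k \<in> borel_measurable borel" "case_prod q \<in> borel_measurable borel"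
    and [measurable]: "\<phi> \<in> borel_measurable borel" "S \<in> sets borel"
    and "{p. Z (fst p) (snd p)} \<in> sets (borel :: ('b \<times> real \<times> 'b) measure)"
    and \<rho>: "\<rho> > 0"
    and kq: "\<And>x y. (k x y)\<^sup>2 \<le> \<phi> x * q x y"
    and kS: "\<And>x y. k x y \<noteq> 0 \<Longrightarrow> x + y \<in> S"
    and kZ: "\<And>x y w. k x y \<noteq> 0 \<Longrightarrow> dist (snd x) w \<le> \<rho> \<Longrightarrow> Z w y"
    and A: "\<And>w z. (\<integral>\<^sup>+x. (if dist (snd x) w \<le> \<rho> then q x (z - x) else 0) \<partial>lborel) \<le> A"
    and M: "\<And>y. emeasure lborel {w. Z w y} \<le> M"
    and [measurable]: "F0 \<in> borel_measurable borel" "F1 \<in> borel_measurable borel" "F2 \<in> borel_measurable borel"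
  shows "emeasure lborel (cball (0::'b) \<rho>) * (\<integral>\<^sup>+x. \<integral>\<^sup>+y. k x y * F0 (x + y) * F1 x * F2 y \<partial>lborel \<partial>lborel)\<^sup>2
    \<le> A * M * (\<integral>\<^sup>+z. (F0 z)\<^sup>2 * indicator S z \<partial>lborel) * (\<integral>\<^sup>+x. \<phi> x * (F1 x)\<^sup>2 \<partial>lborel) * (\<integral>\<^sup>+x. (F2 x)\<^sup>2 \<partial>lborel)"
proof -
  define V where "V = emeasure lborel (cball (0::'b) \<rho>)"
  have V: "0 < V" "V < \<infinity>" "V \<noteq> 0" "V \<noteq> top"
  proof -
    show "V < \<infinity>" unfolding V_def by (rule emeasure_lborel_cball_finite)
    have "measure lborel (cball (0::'b) \<rho>) > 0" using content_cball_pos[OF \<rho>] by simp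
    then show "V > 0" unfolding V_def by (auto simp: measure_def zero_less_iff_neq_zero)
    then show "V \<noteq> 0" by simp
    show "V \<noteq> top" using \<open>V < \<infinity>\<close> by simp
  qed
  have [measurable]: "case_prod k \<in> borel_measurable (borel \<Otimes>\<^sub>M borel)"
    "case_prod q \<in> borel_measurable (borel \<Otimes>\<^sub>M borel)" using assms(1,2) by (simp_all add: borel_prod)
  have Zs: "{p. Z (fst p) (snd p)} \<in> sets (borel \<Otimes>\<^sub>M borel)" unfolding borel_prod by (rule assms(5))
  then have Zp[measurable]: "Measurable.pred (borel \<Otimes>\<^sub>M borel) (\<lambda>p. Z (fst p) (snd p))"
    by (simp add: pred_def space_pair_measure)
  have Zc[measurable]: "Measurable.pred borel (\<lambda>w. Z w y)" for y
  proof -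
    have "(\<lambda>w. (w, y)) \<in> borel \<rightarrow>\<^sub>M borel \<Otimes>\<^sub>M borel" by measurable
    from measurable_compose[OF this Zp] show ?thesis by simp
  qed
  have Zr[measurable]: "Measurable.pred borel (\<lambda>y. Z w y)" for w
  proof -
    have "(\<lambda>y. (w, y)) \<in> borel \<rightarrow>\<^sub>M borel \<Otimes>\<^sub>M borel" by measurable
    from measurable_compose[OF this Zp] show ?thesis by simp
  qed
  have Zsw[measurable]: "Measurable.pred (borel \<Otimes>\<^sub>M borel) (\<lambda>p. Z (snd p) (fst p))"
  proof -
    have "(\<lambda>p. (snd p, fst p)) \<in> borel \<Otimes>\<^sub>M borel \<rightarrow>\<^sub>M borel \<Otimes>\<^sub>M borel" by measurable
    from measurable_compose[OF this Zp] show ?thesis by simp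
  qed
  have [measurable]: "{w. Z w y} \<in> sets borel" for y using Zc[of y] by (simp add: pred_def)
  have ball: "(\<integral>\<^sup>+w. (if dist u w \<le> \<rho> then 1 else 0) \<partial>lborel) = V" for u :: 'b
  proof -
    have "(\<integral>\<^sup>+w. (if dist u w \<le> \<rho> then 1 else 0) \<partial>lborel) = (\<integral>\<^sup>+w. indicator (cball u \<rho>) w \<partial>lborel)"
      by (intro nn_integral_cong) (auto simp: indicator_def)
    also have "\<dots> = V" unfolding V_def using \<rho> by (simp add: emeasure_cball)
    finally show ?thesis .
  qed
  \<comment> \<open>The form with \<open>snd x\<close> confined to the ball about \<open>w\<close>.
    Its integral over \<open>w\<close> counts every pair with weight \<open>V\<close>.\<close>
  define T where "T w = (\<integral>\<^sup>+p. (if dist (snd (fst p)) w \<le> \<rho> then k (fst p) (snd p) * F0 (fst p + snd p) * F1 (fst p) * F2 (snd p) else 0) \<partial>lborel)" for w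
  define G0 where "G0 = (\<integral>\<^sup>+z. (F0 z)\<^sup>2 * indicator S z \<partial>lborel)"
  define f1 where "f1 w = (\<integral>\<^sup>+x. (if dist (snd x) w \<le> \<rho> then \<phi> x * (F1 x)\<^sup>2 else 0) \<partial>lborel)" for w
  define f2 where "f2 w = (\<integral>\<^sup>+y. (if Z w y then (F2 y)\<^sup>2 else 0) \<partial>lborel)" for w
  have [measurable]: "f1 \<in> borel_measurable borel" "f2 \<in> borel_measurable borel" unfolding f1_def f2_def by measurable
  \<comment> \<open>Cauchy--Schwarz on one ball: \<open>q\<close> is paired with \<open>F0\<close>
    on \<open>S\<close>, the weight \<open>\<phi>\<close> with \<open>F1\<close>, and by
    \<open>kZ\<close> only points \<open>y\<close> with \<open>Z w y\<close> contribute. The second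
    factor is a product of integrals in separate variables.\<close>
  have Tle: "(T w)\<^sup>2 \<le> (A * G0 * f1 w) * f2 w" for w
  proof -
    have "(T w)\<^sup>2 \<le> (\<integral>\<^sup>+p. (if dist (snd (fst p)) w \<le> \<rho> then q (fst p) (snd p) * ((F0 (fst p + snd p))\<^sup>2 * indicator S (fst p + snd p)) else 0) \<partial>lborel)
       * (\<integral>\<^sup>+p. (if dist (snd (fst p)) w \<le> \<rho> then \<phi> (fst p) * (F1 (fst p))\<^sup>2 else 0) * (if Z w (snd p) then (F2 (snd p))\<^sup>2 else 0) \<partial>lborel)"
      unfolding T_def
    proof (rule nn_integral_square_le)
      fix p :: "(real \<times> 'b) \<times> (real \<times> 'b)"
      obtain x y where p: "p = (x, y)" by (cases p)
      show "(if dist (snd (fst p)) w \<le> \<rho> then k (fst p) (snd p) * F0 (fst p + snd p) * F1 (fst p) * F2 (snd p) else 0)\<^sup>2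
        \<le> (if dist (snd (fst p)) w \<le> \<rho> then q (fst p) (snd p) * ((F0 (fst p + snd p))\<^sup>2 * indicator S (fst p + snd p)) else 0) *
          ((if dist (snd (fst p)) w \<le> \<rho> then \<phi> (fst p) * (F1 (fst p))\<^sup>2 else 0) * (if Z w (snd p) then (F2 (snd p))\<^sup>2 else 0))"
      proof (cases "k x y = 0 \<or> \<not> dist (snd x) w \<le> \<rho>")
        case False
        then have "x + y \<in> S" "Z w y" using kS kZ by blast+
        with False show ?thesis
          using mult_right_mono[OF kq[of x y], of "(F0 (x + y))\<^sup>2 * (F1 x)\<^sup>2 * (F2 y)\<^sup>2"]
          by (simp add: p power_mult_distrib ac_simps)
      qed (auto simp: p)
    qed (unfold measurable_lborel1 measurable_lborel2, (rule borel_measurable_pairI, measurable)+)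
    also have "(\<integral>\<^sup>+p. (if dist (snd (fst p)) w \<le> \<rho> then \<phi> (fst p) * (F1 (fst p))\<^sup>2 else 0) * (if Z w (snd p) then (F2 (snd p))\<^sup>2 else 0) \<partial>lborel)
       = f1 w * f2 w"
    proof -
      define g1 where "g1 x = (if dist (snd x) w \<le> \<rho> then \<phi> x * (F1 x)\<^sup>2 else 0)" for x
      define g2 where "g2 y = (if Z w y then (F2 y)\<^sup>2 else 0)" for y
      have g[measurable]: "g1 \<in> borel_measurable borel" "g2 \<in> borel_measurable borel"
        unfolding g1_def g2_def by measurable
      have "(\<integral>\<^sup>+p. g1 (fst p) * g2 (snd p) \<partial>lborel) = (\<integral>\<^sup>+x. g1 x \<partial>lborel) * (\<integral>\<^sup>+y. g2 y \<partial>lborel)"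
        using nn_integral_lborel_pair(1)[of "\<lambda>p. g1 (fst p) * g2 (snd p)"]
        by (simp add: nn_integral_cmult nn_integral_multc)
      then show ?thesis by (simp add: g1_def g2_def f1_def f2_def)
    qed
    also have "(\<integral>\<^sup>+p. (if dist (snd (fst p)) w \<le> \<rho> then q (fst p) (snd p) * ((F0 (fst p + snd p))\<^sup>2 * indicator S (fst p + snd p)) else 0) \<partial>lborel)
      = (\<integral>\<^sup>+x. \<integral>\<^sup>+y. (if dist (snd x) w \<le> \<rho> then q x y * ((F0 (x + y))\<^sup>2 * indicator S (x + y)) else 0) \<partial>lborel \<partial>lborel)"
    proof -
      have Q: "(\<lambda>p. if dist (snd (fst p)) w \<le> \<rho> then q (fst p) (snd p) * ((F0 (fst p + snd p))\<^sup>2 * indicator S (fst p + snd p)) else 0) \<in> borel_measurable borel"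
        by (rule borel_measurable_pairI) measurable
      show ?thesis unfolding nn_integral_lborel_pair(1)[OF Q] fst_conv snd_conv ..
    qed
    also have "\<dots> = (\<integral>\<^sup>+z. \<integral>\<^sup>+x. (if dist (snd x) w \<le> \<rho> then q x (z - x) * ((F0 (x + (z - x)))\<^sup>2 * indicator S (x + (z - x))) else 0) \<partial>lborel \<partial>lborel)"
      by (rule nn_integral_conv_change, rule borel_measurable_pairI) measurable
    also have "\<dots> = (\<integral>\<^sup>+z. (\<integral>\<^sup>+x. (if dist (snd x) w \<le> \<rho> then q x (z - x) else 0) \<partial>lborel) * ((F0 z)\<^sup>2 * indicator S z) \<partial>lborel)"
      by (subst nn_integral_multc[symmetric]) (auto intro!: nn_integral_cong)
    also have "\<dots> \<le> (\<integral>\<^sup>+z. A * ((F0 z)\<^sup>2 * indicator S z) \<partial>lborel)"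
      by (intro nn_integral_mono mult_right_mono A) auto
    also have "\<dots> = A * G0" by (simp add: nn_integral_cmult G0_def)
    finally show ?thesis by (simp add: mult.assoc mult_right_mono)
  qed
  \<comment> \<open>Exchanging the integrals in \<open>w\<close> and \<open>y\<close> replaces the
    regions seen from each \<open>w\<close> by their overlap at a fixed \<open>y\<close>, which is
    at most \<open>M\<close>.\<close>
  have "(\<integral>\<^sup>+w. f2 w \<partial>lborel) = (\<integral>\<^sup>+y. \<integral>\<^sup>+w. (if Z w y then (F2 y)\<^sup>2 else 0) \<partial>lborel \<partial>lborel)"
    unfolding f2_def by (rule lborel_pair.Fubini') measurable
  also have "\<dots> = (\<integral>\<^sup>+y. emeasure lborel {w. Z w y} * (F2 y)\<^sup>2 \<partial>lborel)"
  proof (intro nn_integral_cong)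
    fix y
    have "(\<integral>\<^sup>+w. (if Z w y then (F2 y)\<^sup>2 else 0) \<partial>lborel) = (\<integral>\<^sup>+w. (F2 y)\<^sup>2 * indicator {w. Z w y} w \<partial>lborel)"
      by (intro nn_integral_cong) (auto simp: indicator_def)
    also have "\<dots> = (F2 y)\<^sup>2 * emeasure lborel {w. Z w y}"
      by (rule nn_integral_cmult_indicator) measurable
    finally show "(\<integral>\<^sup>+w. (if Z w y then (F2 y)\<^sup>2 else 0) \<partial>lborel) = emeasure lborel {w. Z w y} * (F2 y)\<^sup>2"
      by (simp add: mult.commute)
  qed
  also have "\<dots> \<le> (\<integral>\<^sup>+y. M * (F2 y)\<^sup>2 \<partial>lborel)"
    by (intro nn_integral_mono mult_right_mono M) auto
  also have "\<dots> = M * (\<integral>\<^sup>+y. (F2 y)\<^sup>2 \<partial>lborel)" by (simp add: nn_integral_cmult)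
  finally have IF2: "(\<integral>\<^sup>+w. f2 w \<partial>lborel) \<le> M * (\<integral>\<^sup>+y. (F2 y)\<^sup>2 \<partial>lborel)" .
  have Uf[measurable]: "(\<lambda>p. k (fst p) (snd p) * F0 (fst p + snd p) * F1 (fst p) * F2 (snd p)) \<in> borel_measurable borel"
    by (rule borel_measurable_pairI) measurable
  have "V * (\<integral>\<^sup>+x. \<integral>\<^sup>+y. k x y * F0 (x + y) * F1 x * F2 y \<partial>lborel \<partial>lborel)
    = V * (\<integral>\<^sup>+p. k (fst p) (snd p) * F0 (fst p + snd p) * F1 (fst p) * F2 (snd p) \<partial>lborel)"
    using nn_integral_lborel_pair(1)[of "\<lambda>p. k (fst p) (snd p) * F0 (fst p + snd p) * F1 (fst p) * F2 (snd p)", OF Uf]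
    by (simp add: Uf)
  also have "\<dots> = (\<integral>\<^sup>+p. (\<integral>\<^sup>+w. (if dist (snd (fst p)) w \<le> \<rho> then 1 else 0) \<partial>lborel) * (k (fst p) (snd p) * F0 (fst p + snd p) * F1 (fst p) * F2 (snd p)) \<partial>lborel)"
    by (simp add: ball nn_integral_cmult)
  also have "\<dots> = (\<integral>\<^sup>+p. \<integral>\<^sup>+w. (if dist (snd (fst p)) w \<le> \<rho> then k (fst p) (snd p) * F0 (fst p + snd p) * F1 (fst p) * F2 (snd p) else 0) \<partial>lborel \<partial>lborel)"
    by (subst nn_integral_multc[symmetric]) (auto intro!: nn_integral_cong)
  also have "\<dots> = (\<integral>\<^sup>+w. T w \<partial>lborel)" unfolding T_def
    by (rule lborel_pair.Fubini') measurable
  finally have "(V * (\<integral>\<^sup>+x. \<integral>\<^sup>+y. k x y * F0 (x + y) * F1 x * F2 y \<partial>lborel \<partial>lborel))\<^sup>2 = (\<integral>\<^sup>+w. T w \<partial>lborel)\<^sup>2"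
    by simp
  also have "\<dots> \<le> (\<integral>\<^sup>+w. A * G0 * f1 w \<partial>lborel) * (\<integral>\<^sup>+w. f2 w \<partial>lborel)"
    by (rule nn_integral_square_le[OF _ _ Tle]) measurable
  also have "(\<integral>\<^sup>+w. A * G0 * f1 w \<partial>lborel) = A * G0 * (\<integral>\<^sup>+w. f1 w \<partial>lborel)"
    by (rule nn_integral_cmult) measurable
  also have "(\<integral>\<^sup>+w. f1 w \<partial>lborel) = (\<integral>\<^sup>+x. \<integral>\<^sup>+w. (if dist (snd x) w \<le> \<rho> then \<phi> x * (F1 x)\<^sup>2 else 0) \<partial>lborel \<partial>lborel)"
    unfolding f1_def by (rule lborel_pair.Fubini') measurable
  also have "\<dots> = (\<integral>\<^sup>+x. (\<integral>\<^sup>+w. (if dist (snd x) w \<le> \<rho> then 1 else 0) \<partial>lborel) * (\<phi> x * (F1 x)\<^sup>2) \<partial>lborel)"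
    by (subst nn_integral_multc[symmetric]) (auto intro!: nn_integral_cong)
  also have "\<dots> = V * (\<integral>\<^sup>+x. \<phi> x * (F1 x)\<^sup>2 \<partial>lborel)"
    by (simp add: ball nn_integral_cmult)
  finally have "(V * (\<integral>\<^sup>+x. \<integral>\<^sup>+y. k x y * F0 (x + y) * F1 x * F2 y \<partial>lborel \<partial>lborel))\<^sup>2
    \<le> A * G0 * (V * (\<integral>\<^sup>+x. \<phi> x * (F1 x)\<^sup>2 \<partial>lborel)) * (\<integral>\<^sup>+w. f2 w \<partial>lborel)" .
  also have "\<dots> \<le> A * G0 * (V * (\<integral>\<^sup>+x. \<phi> x * (F1 x)\<^sup>2 \<partial>lborel)) * (M * (\<integral>\<^sup>+y. (F2 y)\<^sup>2 \<partial>lborel))"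
    by (intro mult_left_mono IF2) simp
  \<comment> \<open>One factor \<open>V\<close> on the right came from the \<open>F1\<close>
    integral. Cancelling it leaves a single ball volume on the left, against which
    \<open>A * M\<close> is to be compared.\<close>
  finally have "V * (V * (\<integral>\<^sup>+x. \<integral>\<^sup>+y. k x y * F0 (x + y) * F1 x * F2 y \<partial>lborel \<partial>lborel)\<^sup>2)
    \<le> V * (A * M * G0 * (\<integral>\<^sup>+x. \<phi> x * (F1 x)\<^sup>2 \<partial>lborel) * (\<integral>\<^sup>+x. (F2 x)\<^sup>2 \<partial>lborel))"
    by (simp add: power2_eq_square ac_simps)
  with V show ?thesis
    by (subst (asm) ennreal_mult_le_mult_iff) (auto simp: V_def[symmetric] G0_def)
qed

text \<open>Cauchy--Schwarz in \<open>i\<close> separates the mass of \<open>F0\<close> on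
  \<open>S i\<close>, which adds up to at most the full norm because the \<open>S i\<close> are
  disjoint, from the remaining factors, whose weights \<open>B i * \<phi> i x\<close> are summed
  pointwise in \<open>x\<close>. Thus \<open>B i\<close> measures what \<open>A i * M i\<close>
  loses against the volume of a localisation ball.\<close>

lemma trilinear_bound_localized:
  fixes k q :: "'i::countable \<Rightarrow> real \<times> 'b::euclidean_space \<Rightarrow> real \<times> 'b \<Rightarrow> ennreal"
  assumes k: "\<And>i. case_prod (k i) \<in> borel_measurable borel" and q: "\<And>i. case_prod (q i) \<in> borel_measurable borel"
    and \<phi>: "\<And>i. \<phi> i \<in> borel_measurable borel" and S: "\<And>i. S i \<in> sets borel"
    and Z: "\<And>i. {p. Z i (fst p) (snd p)} \<in> sets (borel :: ('b \<times> real \<times> 'b) measure)"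
    and \<rho>: "\<And>i. \<rho> i > 0"
    and kq: "\<And>i x y. (k i x y)\<^sup>2 \<le> \<phi> i x * q i x y"
    and kS: "\<And>i x y. k i x y \<noteq> 0 \<Longrightarrow> x + y \<in> S i"
    and kZ: "\<And>i x y w. k i x y \<noteq> 0 \<Longrightarrow> dist (snd x) w \<le> \<rho> i \<Longrightarrow> Z i w y"
    and A: "\<And>i w z. (\<integral>\<^sup>+x. (if dist (snd x) w \<le> \<rho> i then q i x (z - x) else 0) \<partial>lborel) \<le> A i"
    and M: "\<And>i y. emeasure lborel {w. Z i w y} \<le> M i"
    and disj: "\<And>i j. i \<noteq> j \<Longrightarrow> S i \<inter> S j = {}"
    and B: "\<And>i. A i * M i \<le> B i * emeasure lborel (cball (0::'b) (\<rho> i))"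
    and sum: "\<And>x. (\<integral>\<^sup>+i. B i * \<phi> i x \<partial>count_space UNIV) \<le> ennreal C"
  shows "trilinear_bound (\<lambda>x y. \<integral>\<^sup>+i. k i x y \<partial>count_space UNIV)"
  unfolding trilinear_bound_def
proof (intro exI[of _ C] allI impI)
  fix F0 F1 F2 :: "real \<times> 'b \<Rightarrow> ennreal"
  assume F[measurable]: "F0 \<in> borel_measurable borel" "F1 \<in> borel_measurable borel" "F2 \<in> borel_measurable borel"
  note \<phi>[measurable] S[measurable]
  have [measurable]: "case_prod (k i) \<in> borel_measurable (borel \<Otimes>\<^sub>M borel)" for i using k by (simp add: borel_prod)
  define T where "T i = (\<integral>\<^sup>+x. \<integral>\<^sup>+y. k i x y * F0 (x + y) * F1 x * F2 y \<partial>lborel \<partial>lborel)" for i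
  define G0 where "G0 i = (\<integral>\<^sup>+z. (F0 z)\<^sup>2 * indicator (S i) z \<partial>lborel)" for i
  define G1 where "G1 i = (\<integral>\<^sup>+x. \<phi> i x * (F1 x)\<^sup>2 \<partial>lborel)" for i
  define G2 where "G2 = (\<integral>\<^sup>+x. (F2 x)\<^sup>2 \<partial>lborel)"
  have Ti: "(T i)\<^sup>2 \<le> G0 i * (B i * G1 i * G2)" for i
  proof -
    let ?V = "emeasure lborel (cball (0::'b) (\<rho> i))"
    have V: "?V < \<infinity>" by (rule emeasure_lborel_cball_finite)
    have "measure lborel (cball (0::'b) (\<rho> i)) > 0" using content_cball_pos[OF \<rho>] by simp
    then have V0: "?V \<noteq> 0" by (auto simp: measure_def)
    have "?V * (T i)\<^sup>2 \<le> A i * M i * G0 i * G1 i * G2"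
      unfolding T_def G0_def G1_def G2_def
      by (rule localized_bound[OF k q \<phi> S Z \<rho> kq kS kZ A M]) measurable
    also have "\<dots> \<le> (B i * ?V) * G0 i * G1 i * G2" by (intro mult_right_mono B) auto
    finally have "?V * (T i)\<^sup>2 \<le> ?V * (G0 i * (B i * G1 i * G2))" by (simp add: ac_simps)
    with V V0 show ?thesis by (subst (asm) ennreal_mult_le_mult_iff) auto
  qed
  have "(\<integral>\<^sup>+x. \<integral>\<^sup>+y. (\<integral>\<^sup>+i. k i x y \<partial>count_space UNIV) * F0 (x + y) * F1 x * F2 y \<partial>lborel \<partial>lborel)
    = (\<integral>\<^sup>+x. \<integral>\<^sup>+y. (\<integral>\<^sup>+i. k i x y * F0 (x + y) * F1 x * F2 y \<partial>count_space UNIV) \<partial>lborel \<partial>lborel)"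
    by (simp add: nn_integral_multc)
  also have "\<dots> = (\<integral>\<^sup>+x. (\<integral>\<^sup>+i. \<integral>\<^sup>+y. k i x y * F0 (x + y) * F1 x * F2 y \<partial>lborel \<partial>count_space UNIV) \<partial>lborel)"
    by (intro nn_integral_cong nn_integral_count_space_nn_integral) auto
  also have "\<dots> = (\<integral>\<^sup>+i. T i \<partial>count_space UNIV)"
    unfolding T_def by (rule nn_integral_count_space_nn_integral) auto
  finally have "(\<integral>\<^sup>+x. \<integral>\<^sup>+y. (\<integral>\<^sup>+i. k i x y \<partial>count_space UNIV) * F0 (x + y) * F1 x * F2 y \<partial>lborel \<partial>lborel)\<^sup>2
    = (\<integral>\<^sup>+i. T i \<partial>count_space UNIV)\<^sup>2" by simp
  also have "\<dots> \<le> (\<integral>\<^sup>+i. G0 i \<partial>count_space UNIV) * (\<integral>\<^sup>+i. B i * G1 i * G2 \<partial>count_space UNIV)"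
    by (rule nn_integral_square_le[OF _ _ Ti]) auto
  also have "(\<integral>\<^sup>+i. G0 i \<partial>count_space UNIV) = (\<integral>\<^sup>+z. \<integral>\<^sup>+i. (F0 z)\<^sup>2 * indicator (S i) z \<partial>count_space UNIV \<partial>lborel)"
    unfolding G0_def by (rule nn_integral_count_space_nn_integral[symmetric]) auto
  also have "\<dots> \<le> (\<integral>\<^sup>+z. (F0 z)\<^sup>2 \<partial>lborel)"
  proof (rule nn_integral_mono)
    fix z
    have "(\<integral>\<^sup>+i. indicator (S i) z \<partial>count_space UNIV) \<le> (1::ennreal)"
    proof (cases "\<exists>j. z \<in> S j")
      case True
      then obtain j where j: "z \<in> S j" by blast
      have "indicator (S i) z = (indicator {j} i :: ennreal)" for i
        using disj[of i j] j by (auto simp: indicator_def)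
      then show ?thesis by simp
    qed (simp add: indicator_def)
    then show "(\<integral>\<^sup>+i. (F0 z)\<^sup>2 * indicator (S i) z \<partial>count_space UNIV) \<le> (F0 z)\<^sup>2"
      using mult_left_mono[of _ 1 "(F0 z)\<^sup>2"] by (simp add: nn_integral_cmult)
  qed
  also have "(\<integral>\<^sup>+i. B i * G1 i * G2 \<partial>count_space UNIV) = (\<integral>\<^sup>+i. B i * G1 i \<partial>count_space UNIV) * G2"
    by (rule nn_integral_multc) simp
  also have "(\<integral>\<^sup>+i. B i * G1 i \<partial>count_space UNIV) = (\<integral>\<^sup>+i. \<integral>\<^sup>+x. B i * \<phi> i x * (F1 x)\<^sup>2 \<partial>lborel \<partial>count_space UNIV)"
    unfolding G1_def by (simp add: nn_integral_cmult[symmetric] mult.assoc)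
  also have "\<dots> = (\<integral>\<^sup>+x. \<integral>\<^sup>+i. B i * \<phi> i x * (F1 x)\<^sup>2 \<partial>count_space UNIV \<partial>lborel)"
    by (rule nn_integral_count_space_nn_integral[symmetric]) auto
  also have "\<dots> = (\<integral>\<^sup>+x. (\<integral>\<^sup>+i. B i * \<phi> i x \<partial>count_space UNIV) * (F1 x)\<^sup>2 \<partial>lborel)"
    by (simp add: nn_integral_multc)
  also have "\<dots> \<le> (\<integral>\<^sup>+x. ennreal C * (F1 x)\<^sup>2 \<partial>lborel)"
    by (intro nn_integral_mono mult_right_mono sum) auto
  also have "\<dots> = ennreal C * (\<integral>\<^sup>+x. (F1 x)\<^sup>2 \<partial>lborel)" by (simp add: nn_integral_cmult)
  finally show "(\<integral>\<^sup>+x. \<integral>\<^sup>+y. (\<integral>\<^sup>+i. k i x y \<partial>count_space UNIV) * F0 (x + y) * F1 x * F2 y \<partial>lborel \<partial>lborel)\<^sup>2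
    \<le> ennreal C * (\<integral>\<^sup>+x. (F0 x)\<^sup>2 \<partial>lborel) * (\<integral>\<^sup>+x. (F1 x)\<^sup>2 \<partial>lborel) * (\<integral>\<^sup>+x. (F2 x)\<^sup>2 \<partial>lborel)"
    by (simp add: G2_def ac_simps mult_left_mono mult_right_mono)
qed

section \<open>Dyadic sums and integrals\<close>

text \<open>For \<open>\<kappa> = 0\<close> the exponent is negative and the series converges. For
  \<open>\<kappa> > 0\<close> the exponent may be raised to \<open>\<kappa>\<close>, and a growing
  geometric series is bounded by a multiple of its last term. With \<open>\<kappa>\<close> as a
  separate parameter the logarithm at exponent 0 is covered by any positive
  \<open>\<kappa>\<close>.\<close>

lemma sum_two_powr_le:
  fixes x \<kappa> :: real
  assumes "0 \<le> \<kappa>" "x \<le> \<kappa>" "\<kappa> = 0 \<Longrightarrow> x < 0"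
  obtains C where "0 \<le> C" "\<And>R. 1 \<le> R \<Longrightarrow>
    (\<Sum>n. ennreal (if 2 ^ n \<le> R then 2 powr (x * real n) else 0)) \<le> ennreal (C * R powr \<kappa>)"
proof (cases "\<kappa> = 0")
  case True
  with assms have x: "x < 0" by simp
  define q where "q = 2 powr x"
  have q: "0 < q" "q < 1" using x by (auto simp: q_def powr_less_one)
  have eq: "2 powr (x * real n) = q ^ n" for n
    unfolding q_def by (simp add: powr_powr[symmetric] powr_realpow)
  show ?thesis
  proof (rule that[of "1 / (1 - q)"])
    show "0 \<le> 1 / (1 - q)" using q by simp
    fix R :: real assume "1 \<le> R"
    have "(\<Sum>n. ennreal (if 2 ^ n \<le> R then 2 powr (x * real n) else 0)) \<le> (\<Sum>n. ennreal (q ^ n))"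
      using q by (intro suminf_le) (auto simp: eq)
    also have "\<dots> = ennreal (\<Sum>n. q ^ n)" using q by (intro suminf_ennreal2) auto
    also have "\<dots> = ennreal (1 / (1 - q) * R powr \<kappa>)"
      using q True \<open>1 \<le> R\<close> by (simp add: suminf_geometric)
    finally show "(\<Sum>n. ennreal (if 2 ^ n \<le> R then 2 powr (x * real n) else 0)) \<le> ennreal (1 / (1 - q) * R powr \<kappa>)" .
  qed
next
  case False
  with assms have k: "\<kappa> > 0" by simp
  define q where "q = 2 powr \<kappa>"
  have q: "q > 1" using k by (auto simp: q_def)
  show ?thesis
  proof (rule that[of "q / (q - 1)"])
    show "0 \<le> q / (q - 1)" using q by simp
    fix R :: real assume R: "1 \<le> R"
    define m where "m = nat \<lfloor>log 2 R\<rfloor>"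
    have le: "n \<le> m" if "2 ^ n \<le> R" for n
    proof -
      from that R have "real n \<le> log 2 R" by (simp add: le_log_iff powr_realpow)
      then show ?thesis by (simp add: m_def le_nat_iff le_floor_iff)
    qed
    have mR: "2 ^ m \<le> R"
    proof -
      have "real m \<le> log 2 R" using R by (simp add: m_def)
      then show ?thesis using R by (simp add: le_log_iff powr_realpow)
    qed
    have geo: "(\<Sum>n\<le>m. q ^ n) \<le> q / (q - 1) * q ^ m" for m
    proof (induction m)
      case (Suc m)
      then show ?case using q by (simp add: field_simps)
    qed (use q in \<open>simp add: field_simps\<close>)
    have "(\<Sum>n. ennreal (if 2 ^ n \<le> R then 2 powr (x * real n) else 0))
      = (\<Sum>n\<le>m. ennreal (if 2 ^ n \<le> R then 2 powr (x * real n) else 0))"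
      by (intro suminf_finite) (use le in force)+
    also have "\<dots> \<le> (\<Sum>n\<le>m. ennreal (q ^ n))"
    proof (intro sum_mono ennreal_leI)
      fix n
      have "x * real n \<le> \<kappa> * real n" using assms by (intro mult_right_mono) auto
      then have "2 powr (x * real n) \<le> q ^ n"
        unfolding q_def by (simp add: powr_realpow[symmetric] powr_powr)
      then show "(if 2 ^ n \<le> R then 2 powr (x * real n) else 0) \<le> q ^ n" using q by auto
    qed
    also have "\<dots> = ennreal (\<Sum>n\<le>m. q ^ n)" using q by (intro sum_ennreal) auto
    also have "\<dots> \<le> ennreal (q / (q - 1) * R powr \<kappa>)"
    proof (intro ennreal_leI order_trans[OF geo] mult_left_mono)
      have "q ^ m = (2 ^ m) powr \<kappa>" unfolding q_def
        by (simp add: powr_realpow[symmetric] powr_powr mult.commute)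
      also have "\<dots> \<le> R powr \<kappa>" using mR k by (intro powr_mono2) auto
      finally show "q ^ m \<le> R powr \<kappa>" .
    qed (use q in simp)
    finally show "(\<Sum>n. ennreal (if 2 ^ n \<le> R then 2 powr (x * real n) else 0)) \<le> ennreal (q / (q - 1) * R powr \<kappa>)" .
  qed
qed

text \<open>A power of \<open>N\<close> is integrated over \<open>N \<le> R\<close> by splitting into the dyadic shells \<open>2 ^ n \<le> N < 2 ^ (n + 1)\<close>.\<close>

lemma dyadic_integral_bound:
  fixes M :: "'m measure" and \<beta> d \<kappa> :: real
  assumes "0 \<le> \<kappa>" "\<beta> + d \<le> \<kappa>" "\<kappa> = 0 \<Longrightarrow> \<beta> + d < 0" "0 \<le> d"
  obtains C where "0 \<le> C" "\<And>g N R A. g \<in> borel_measurable M \<Longrightarrow> N \<in> borel_measurable M \<Longrightarrow> (\<And>x. 1 \<le> N x) \<Longrightarrow>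
    (\<And>t. 1 \<le> t \<Longrightarrow> t \<le> R \<Longrightarrow> (\<integral>\<^sup>+x. (if N x \<le> t then g x else 0) \<partial>M) \<le> ennreal (t powr d) * A) \<Longrightarrow>
    (\<integral>\<^sup>+x. (if N x \<le> R then ennreal (N x powr \<beta>) * g x else 0) \<partial>M) \<le> ennreal (C * R powr \<kappa>) * A"
proof -
  obtain C where C: "0 \<le> C" "\<And>R. 1 \<le> R \<Longrightarrow>
    (\<Sum>n. ennreal (if 2 ^ n \<le> R then 2 powr ((\<beta> + d) * real n) else 0)) \<le> ennreal (C * R powr \<kappa>)"
    using sum_two_powr_le[OF assms(1-3)] by blast
  \<comment> \<open>On a shell \<open>N powr \<beta>\<close> exceeds its value at
    \<open>2 ^ n\<close> by a factor of at most \<open>2 powr \<bar>\<beta>\<bar>\<close>, and the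
    passage to the outer radius \<open>2 ^ Suc n\<close> costs \<open>2 powr d\<close>.\<close>
  define D where "D = 2 powr (\<bar>\<beta>\<bar> + d)"
  have D: "D > 0" by (simp add: D_def)
  show ?thesis
  proof (rule that[of "D * C"])
    show "0 \<le> D * C" using C D by simp
    fix g :: "'m \<Rightarrow> ennreal" and N :: "'m \<Rightarrow> real" and R :: real and A :: ennreal
    assume [measurable]: "g \<in> borel_measurable M" "N \<in> borel_measurable M" and N: "\<And>x. 1 \<le> N x"
      and A: "\<And>t. 1 \<le> t \<Longrightarrow> t \<le> R \<Longrightarrow> (\<integral>\<^sup>+x. (if N x \<le> t then g x else 0) \<partial>M) \<le> ennreal (t powr d) * A"
    show "(\<integral>\<^sup>+x. (if N x \<le> R then ennreal (N x powr \<beta>) * g x else 0) \<partial>M) \<le> ennreal (D * C * R powr \<kappa>) * A"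
    proof (cases "1 \<le> R")
      case False
      then have "\<not> N x \<le> R" for x using N[of x] by linarith
      then show ?thesis by simp
    next
      case R: True
      let ?c = "\<lambda>n. if 2 ^ n \<le> R then 2 powr (\<bar>\<beta>\<bar> + \<beta> * real n) else 0"
      \<comment> \<open>The last shell may reach beyond \<open>R\<close>, whereas the volume
        hypothesis is available only up to \<open>R\<close>.\<close>
      let ?t = "\<lambda>n. min (2 ^ Suc n) R"
      have "(\<integral>\<^sup>+x. (if N x \<le> R then ennreal (N x powr \<beta>) * g x else 0) \<partial>M)
        \<le> (\<integral>\<^sup>+x. (\<Sum>n. ennreal (?c n) * (if N x \<le> ?t n then g x else 0)) \<partial>M)"
      proof (rule nn_integral_mono)
        fix x
        define n where "n = nat \<lfloor>log 2 (N x)\<rfloor>"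
        have n0: "0 \<le> log 2 (N x)" using N[of x] by simp
        have "real n \<le> log 2 (N x)" using n0 by (simp add: n_def)
        then have n1: "2 ^ n \<le> N x" using N[of x] by (simp add: le_log_iff powr_realpow)
        have "log 2 (N x) \<le> real (Suc n)" using n0 by (simp add: n_def) linarith
        then have n2': "N x \<le> 2 powr real (Suc n)" using N[of x] by (simp only: log_le_iff)
        then have n2: "N x \<le> 2 ^ Suc n" by (metis powr_realpow zero_less_numeral)
        have "(if N x \<le> R then ennreal (N x powr \<beta>) * g x else 0) \<le> ennreal (?c n) * (if N x \<le> ?t n then g x else 0)"
        proof (cases "N x \<le> R")
          case True
          have "N x powr \<beta> \<le> 2 powr (\<bar>\<beta>\<bar> + \<beta> * real n)"
          proof (cases "\<beta> \<ge> 0")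
            case True
            then have "N x powr \<beta> \<le> (2 powr real (Suc n)) powr \<beta>"
              using n2' N[of x] by (intro powr_mono2) auto
            also have "\<dots> = 2 powr (\<bar>\<beta>\<bar> + \<beta> * real n)" using True by (simp add: powr_powr algebra_simps)
            finally show ?thesis .
          next
            case False
            then have "N x powr \<beta> \<le> (2 powr real n) powr \<beta>"
              using n1 N[of x] by (intro powr_mono2') (auto simp: powr_realpow)
            also have "\<dots> \<le> 2 powr (\<bar>\<beta>\<bar> + \<beta> * real n)" by (simp add: powr_powr algebra_simps)
            finally show ?thesis .
          qed
          with True n1 n2 show ?thesis by (auto intro!: mult_right_mono ennreal_leI)
        qed simp
        also have "\<dots> = (\<Sum>n\<in>{n}. ennreal (?c n) * (if N x \<le> ?t n then g x else 0))" by simp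
        also have "\<dots> \<le> (\<Sum>n. ennreal (?c n) * (if N x \<le> ?t n then g x else 0))"
          by (rule sum_le_suminf) auto
        finally show "(if N x \<le> R then ennreal (N x powr \<beta>) * g x else 0) \<le> (\<Sum>n. ennreal (?c n) * (if N x \<le> ?t n then g x else 0))" .
      qed
      also have "\<dots> = (\<Sum>n. ennreal (?c n) * (\<integral>\<^sup>+x. (if N x \<le> ?t n then g x else 0) \<partial>M))"
        by (simp add: nn_integral_suminf nn_integral_cmult)
      also have "\<dots> \<le> (\<Sum>n. ennreal D * ennreal (if 2 ^ n \<le> R then 2 powr ((\<beta> + d) * real n) else 0) * A)"
      proof (rule suminf_le)
        fix n
        have t: "?t n powr d \<le> 2 powr (d + d * real n)"
        proof -
          have "?t n powr d \<le> (2 ^ Suc n) powr d" using R assms(4) by (intro powr_mono2) auto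
          also have "\<dots> = 2 powr (d + d * real n)"
            by (subst powr_realpow[symmetric]) (auto simp add: powr_powr algebra_simps)
          finally show ?thesis .
        qed
        have "ennreal (?c n) * (\<integral>\<^sup>+x. (if N x \<le> ?t n then g x else 0) \<partial>M) \<le> ennreal (?c n) * (ennreal (?t n powr d) * A)"
          using R one_le_power[of "2::real" "Suc n"] by (intro mult_left_mono A) (auto simp del: power_Suc)
        also have "\<dots> \<le> ennreal (?c n) * (ennreal (2 powr (d + d * real n)) * A)"
          using t by (intro mult_left_mono mult_right_mono ennreal_leI) auto
        also have "\<dots> = ennreal (?c n * 2 powr (d + d * real n)) * A"
          by (simp only: ennreal_mult'' powr_ge_zero mult.assoc)
        also have "?c n * 2 powr (d + d * real n) = D * (if 2 ^ n \<le> R then 2 powr ((\<beta> + d) * real n) else 0)"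
          by (simp add: D_def powr_add[symmetric] algebra_simps)
        also have "ennreal \<dots> = ennreal D * ennreal (if 2 ^ n \<le> R then 2 powr ((\<beta> + d) * real n) else 0)"
          using D by (intro ennreal_mult') simp
        finally show "ennreal (?c n) * (\<integral>\<^sup>+x. (if N x \<le> ?t n then g x else 0) \<partial>M)
          \<le> ennreal D * ennreal (if 2 ^ n \<le> R then 2 powr ((\<beta> + d) * real n) else 0) * A" .
      qed auto
      also have "\<dots> = ennreal D * (\<Sum>n. ennreal (if 2 ^ n \<le> R then 2 powr ((\<beta> + d) * real n) else 0)) * A"
        by (simp only: ennreal_suminf_multc ennreal_suminf_cmult)
      also have "\<dots> \<le> ennreal D * ennreal (C * R powr \<kappa>) * A"
        by (intro mult_right_mono mult_left_mono C(2) R) auto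
      also have "\<dots> = ennreal (D * C * R powr \<kappa>) * A"
        using D by (simp only: mult.assoc ennreal_mult'[OF less_imp_le])
      finally show ?thesis .
    qed
  qed
qed

subsection \<open>Fourier transforms of products of Schwartz functions\<close>

lemma borel_measurable_cis [measurable]: "cis \<in> borel_measurable borel"
  by (intro borel_measurable_continuous_onI continuous_intros)

text \<open>\<open>lborel\<close> is the image of a finite product of one-dimensional measures under
  the coordinate map, so a function that factors over the coordinates is integrated one coordinate
  at a time. This serves both the Gaussian and the majorant of a Schwartz function.\<close>

lemma has_bochner_integral_lborel_prod:
  fixes f :: "'a::euclidean_space \<Rightarrow> real \<Rightarrow> complex"
  assumes "\<And>b. b \<in> Basis \<Longrightarrow> integrable lborel (f b)"
  shows "integrable lborel (\<lambda>x. \<Prod>b\<in>Basis. f b (x \<bullet> b))"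
    and "(\<integral>x. (\<Prod>b\<in>Basis. f b (x \<bullet> b)) \<partial>lborel) = (\<Prod>b\<in>Basis. \<integral>x. f b x \<partial>lborel)"
proof -
  interpret product_sigma_finite "\<lambda>b::'a. lborel :: real measure" ..
  have [measurable]: "f b \<in> borel_measurable borel" if "b \<in> Basis" for b
    using borel_measurable_integrable[OF assms[OF that]] by simp
  have T[measurable]: "(\<lambda>g. \<Sum>b\<in>Basis. g b *\<^sub>R b) \<in> (\<Pi>\<^sub>M b\<in>(Basis::'a set). lborel) \<rightarrow>\<^sub>M borel"
    by measurable
  have m: "(\<lambda>x::'a. \<Prod>b\<in>Basis. f b (x \<bullet> b)) \<in> borel_measurable borel" by measurable
  have eq: "(\<Prod>b\<in>Basis. f b ((\<Sum>b\<in>Basis. g b *\<^sub>R b) \<bullet> b)) = (\<Prod>b\<in>Basis. f b (g b))" for g :: "'a \<Rightarrow> real"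
    by (intro prod.cong) auto
  show "integrable lborel (\<lambda>x. \<Prod>b\<in>Basis. f b (x \<bullet> b))"
    by (subst lborel_eq) (simp add: integrable_distr_eq[OF T m] eq product_integrable_prod assms)
  show "(\<integral>x. (\<Prod>b\<in>Basis. f b (x \<bullet> b)) \<partial>lborel) = (\<Prod>b\<in>Basis. \<integral>x. f b x \<partial>lborel)"
    by (subst lborel_eq) (simp add: integral_distr[OF T m] eq product_integral_prod assms)
qed

section \<open>The Gaussian and its Fourier transform\<close>

text \<open>The function \<open>exp (- (norm x)\<^sup>2 / 2)\<close>, written as a product over
  coordinates so that product integration applies to it.\<close>

definition gauss :: "'a::euclidean_space \<Rightarrow> complex" where
  "gauss x = (\<Prod>b\<in>Basis. complex_of_real (exp (- (x \<bullet> b)\<^sup>2 / 2)))"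

lemma norm_gauss_le_1: "norm (gauss x) \<le> 1"
proof -
  have "norm (gauss x) = (\<Prod>b\<in>Basis. exp (- (x \<bullet> b)\<^sup>2 / 2))"
    unfolding gauss_def prod_norm[symmetric] by (intro prod.cong) auto
  also have "\<dots> \<le> 1" by (intro prod_le_1) auto
  finally show ?thesis .
qed

lemma gauss_0: "gauss 0 = 1"
  by (simp add: gauss_def)

lemma continuous_gauss: "continuous_on UNIV gauss"
  unfolding gauss_def by (intro continuous_intros) auto

lemma borel_measurable_gauss [measurable]: "gauss \<in> borel_measurable borel"
  by (intro borel_measurable_continuous_onI continuous_gauss)

lemma gauss_integrable_1d: "integrable lborel (\<lambda>x. complex_of_real (exp (- x\<^sup>2 / 2)))"
proof -
  have "integrable lborel (\<lambda>x. sqrt (2 * pi) * std_normal_density x)" by (intro integrable_mult_right) simp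
  then have "integrable lborel (\<lambda>x. exp (- x\<^sup>2 / 2) :: real)" by (simp add: std_normal_density_def)
  then show ?thesis by (rule integrable_of_real)
qed

text \<open>The characteristic function of the standard normal distribution, rescaled by its
  normalising factor.\<close>

lemma gauss_fourier_1d:
  "(\<integral>x. complex_of_real (exp (- x\<^sup>2 / 2)) * cis (t * x) \<partial>lborel) = complex_of_real (sqrt (2 * pi) * exp (- t\<^sup>2 / 2))"
proof -
  have "complex_of_real (exp (- t\<^sup>2 / 2)) = (\<integral>x. std_normal_density x *\<^sub>R cis (t * x) \<partial>lborel)"
    using fun_cong[OF char_std_normal_distribution, of t]
    unfolding char_def by (subst (asm) integral_density) (auto simp: cis_conv_exp)
  also have "\<dots> = (\<integral>x. complex_of_real (1 / sqrt (2 * pi)) * (complex_of_real (exp (- x\<^sup>2 / 2)) * cis (t * x)) \<partial>lborel)"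
    by (intro Bochner_Integration.integral_cong) (auto simp: std_normal_density_def scaleR_conv_of_real)
  also have "\<dots> = complex_of_real (1 / sqrt (2 * pi)) * (\<integral>x. complex_of_real (exp (- x\<^sup>2 / 2)) * cis (t * x) \<partial>lborel)"
    by (rule integral_mult_right_zero)
  finally show ?thesis by (simp add: field_simps)
qed

lemma cis_sum: "finite A \<Longrightarrow> cis (\<Sum>i\<in>A. f i) = (\<Prod>i\<in>A. cis (f i))"
  by (induction rule: finite_induct) (auto simp: cis_mult[symmetric])

lemma integrable_gauss: "integrable lborel (gauss :: 'a::euclidean_space \<Rightarrow> complex)"
  unfolding gauss_def by (intro has_bochner_integral_lborel_prod(1) gauss_integrable_1d)

lemma integrable_cis_mult:
  assumes "integrable M f" "\<theta> \<in> borel_measurable M"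
  shows "integrable M (\<lambda>x. cis (\<theta> x) * f x)"
proof (rule Bochner_Integration.integrable_bound[OF assms(1)])
  show "(\<lambda>x. cis (\<theta> x) * f x) \<in> borel_measurable M"
    using assms by measurable
qed (simp add: norm_mult)

lemma fourier_gauss:
  fixes y :: "'a::euclidean_space"
  shows "(\<integral>x. cis (x \<bullet> y) * gauss x \<partial>lborel) = complex_of_real (sqrt (2 * pi) ^ DIM('a)) * gauss y"
proof -
  have "(\<integral>x. cis (x \<bullet> y) * gauss x \<partial>lborel)
     = (\<integral>x. (\<Prod>b\<in>Basis. complex_of_real (exp (- (x \<bullet> b)\<^sup>2 / 2)) * cis ((y \<bullet> b) * (x \<bullet> b))) \<partial>lborel)"
    by (intro Bochner_Integration.integral_cong refl, subst euclidean_inner)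
       (simp add: gauss_def cis_sum prod.distrib mult.commute)
  also have "\<dots> = (\<Prod>b\<in>Basis. \<integral>x. complex_of_real (exp (- x\<^sup>2 / 2)) * cis ((y \<bullet> b) * x) \<partial>lborel)"
  proof (rule has_bochner_integral_lborel_prod(2))
    fix b :: 'a
    show "integrable lborel (\<lambda>x. complex_of_real (exp (- x\<^sup>2 / 2)) * cis ((y \<bullet> b) * x))"
      by (subst mult.commute) (intro integrable_cis_mult gauss_integrable_1d, measurable)
  qed
  also have "\<dots> = complex_of_real (sqrt (2 * pi) ^ DIM('a)) * gauss y"
    unfolding gauss_fourier_1d by (simp add: gauss_def prod.distrib)
  finally show ?thesis .
qed

lemma integral_lborel_affine:
  fixes f :: "'a::euclidean_space \<Rightarrow> complex"
  assumes [measurable]: "f \<in> borel_measurable borel" and "c > 0"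
  shows "(\<integral>x. f x \<partial>lborel) = complex_of_real (c ^ DIM('a)) * (\<integral>x. f (t + c *\<^sub>R x) \<partial>lborel)"
proof -
  have "(\<integral>x. f x \<partial>lborel) = (\<integral>x. f x \<partial>density (distr lborel borel (\<lambda>x. t + c *\<^sub>R x)) (\<lambda>_. ennreal (\<bar>c\<bar> ^ DIM('a))))"
    using lborel_affine[of c t] assms(2) by simp
  also have "\<dots> = (\<integral>x. (c ^ DIM('a)) *\<^sub>R f x \<partial>distr lborel borel (\<lambda>x. t + c *\<^sub>R x))"
    using assms(2) by (subst integral_density) auto
  also have "\<dots> = (\<integral>x. (c ^ DIM('a)) *\<^sub>R f (t + c *\<^sub>R x) \<partial>lborel)"
    by (subst integral_distr) auto
  finally show ?thesis by (simp add: scaleR_conv_of_real)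
qed

text \<open>For every real phase the double integrand has absolute value
  \<open>norm (h x) * norm (u z)\<close>, a product of integrable functions. The phase is kept
  general because the transforms of \<open>v\<close> and of \<open>u\<close> are undone with
  different ones.\<close>

lemma fourier_Fubini:
  fixes h u :: "'a::euclidean_space \<Rightarrow> complex" and \<theta> :: "'a \<Rightarrow> 'a \<Rightarrow> real"
  assumes h: "integrable lborel h" and u: "integrable lborel u"
    and \<theta>[measurable]: "(\<lambda>p. \<theta> (fst p) (snd p)) \<in> borel_measurable (borel \<Otimes>\<^sub>M borel)"
  shows "(\<integral>x. h x * (\<integral>z. cis (\<theta> x z) * u z \<partial>lborel) \<partial>lborel) = (\<integral>z. u z * (\<integral>x. cis (\<theta> x z) * h x \<partial>lborel) \<partial>lborel)"
proof -
  have [measurable]: "h \<in> borel_measurable borel" "u \<in> borel_measurable borel"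
    using borel_measurable_integrable[OF h] borel_measurable_integrable[OF u] by auto
  have \<theta>2: "\<theta> x \<in> borel_measurable borel" for x
  proof -
    have "(\<lambda>z. (x, z)) \<in> borel \<rightarrow>\<^sub>M borel \<Otimes>\<^sub>M borel" by measurable
    from measurable_compose[OF this \<theta>] show ?thesis by simp
  qed
  have int: "integrable (lborel \<Otimes>\<^sub>M lborel) (\<lambda>(x,z). h x * (cis (\<theta> x z) * u z))"
  proof (rule lborel_pair.Fubini_integrable)
    have [measurable]: "(\<lambda>p. \<theta> (fst p) (snd p)) \<in> borel_measurable (lborel \<Otimes>\<^sub>M lborel)" using \<theta> by simp
    show "(\<lambda>(x,z). h x * (cis (\<theta> x z) * u z)) \<in> borel_measurable (lborel \<Otimes>\<^sub>M lborel)"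
      unfolding case_prod_beta by measurable
    have "(\<lambda>x. \<integral>z. norm (case (x, z) of (x, z) \<Rightarrow> h x * (cis (\<theta> x z) * u z)) \<partial>lborel) = (\<lambda>x. norm (h x) * (\<integral>z. norm (u z) \<partial>lborel))"
      by (simp add: norm_mult)
    then show "integrable lborel (\<lambda>x. \<integral>z. norm (case (x, z) of (x, z) \<Rightarrow> h x * (cis (\<theta> x z) * u z)) \<partial>lborel)"
      using h by simp
    show "AE x in lborel. integrable lborel (\<lambda>z. case (x, z) of (x, z) \<Rightarrow> h x * (cis (\<theta> x z) * u z))"
      by (intro AE_I2) (auto intro!: integrable_mult_right integrable_cis_mult u \<theta>2)
  qed
  have "(\<integral>x. h x * (\<integral>z. cis (\<theta> x z) * u z \<partial>lborel) \<partial>lborel) = (\<integral>x. \<integral>z. h x * (cis (\<theta> x z) * u z) \<partial>lborel \<partial>lborel)"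
    by simp
  also have "\<dots> = (\<integral>z. \<integral>x. h x * (cis (\<theta> x z) * u z) \<partial>lborel \<partial>lborel)"
    using lborel_pair.Fubini_integral[OF int] by simp
  also have "\<dots> = (\<integral>z. \<integral>x. u z * (cis (\<theta> x z) * h x) \<partial>lborel \<partial>lborel)"
    by (simp add: ac_simps)
  finally show ?thesis by simp
qed

text \<open>A Gaussian cut-off in frequency replaces Fourier inversion, so that no integrability of
  the transforms is needed.\<close>

lemma fourier_product_le_convolution:
  fixes u v :: "'a::euclidean_space \<Rightarrow> complex"
  assumes u: "integrable lborel u" and v: "integrable lborel v"
    and cont: "continuous_on UNIV u" and bdd: "\<And>z. norm (u z) \<le> B"
  defines "FT \<equiv> \<lambda>f w. (\<integral>z. cis (- (z \<bullet> w)) * f z \<partial>lborel)"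
  shows "ennreal (((2 * pi) ^ DIM('a)) * cmod (FT (\<lambda>z. u z * v z) w))
    \<le> (\<integral>\<^sup>+x. ennreal (cmod (FT u x)) * ennreal (cmod (FT v (w - x))) \<partial>lborel)"
proof -
  define \<kappa> :: complex where "\<kappa> = complex_of_real (sqrt (2 * pi) ^ DIM('a))"
  have [measurable]: "u \<in> borel_measurable borel" "v \<in> borel_measurable borel"
    using borel_measurable_integrable[OF u] borel_measurable_integrable[OF v] by auto
  have FTm[measurable]: "FT f \<in> borel_measurable borel" if [measurable]: "f \<in> borel_measurable borel" for f
    unfolding FT_def by measurable
  have FTb: "norm (FT u x) \<le> (\<integral>z. norm (u z) \<partial>lborel)" for x
    unfolding FT_def by (rule order_trans[OF integral_norm_bound]) (simp add: norm_mult)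
  \<comment> \<open>The convolution of the two transforms with a Gaussian cut-off. As the Gaussian
    is at most 1 in absolute value, every scale obeys the desired upper bound.\<close>
  define J where "J \<epsilon> = (\<integral>x. gauss (\<epsilon> *\<^sub>R x) * FT u x * FT v (w - x) \<partial>lborel)" for \<epsilon> :: real
  have J_le: "ennreal (norm (J \<epsilon>)) \<le> (\<integral>\<^sup>+x. ennreal (cmod (FT u x)) * ennreal (cmod (FT v (w - x))) \<partial>lborel)" for \<epsilon>
  \<comment> \<open>A Bochner integral that does not exist has the value 0, for which the bound is
    trivial.\<close>
  proof (cases "integrable lborel (\<lambda>x. gauss (\<epsilon> *\<^sub>R x) * FT u x * FT v (w - x))")
    case True
    have "ennreal (norm (J \<epsilon>)) \<le> (\<integral>\<^sup>+x. ennreal (norm (gauss (\<epsilon> *\<^sub>R x) * FT u x * FT v (w - x))) \<partial>lborel)"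
      unfolding J_def by (rule integral_norm_bound_ennreal[OF True])
    also have "\<dots> \<le> (\<integral>\<^sup>+x. ennreal (cmod (FT u x)) * ennreal (cmod (FT v (w - x))) \<partial>lborel)"
    proof (rule nn_integral_mono)
      fix x
      have "norm (gauss (\<epsilon> *\<^sub>R x) * FT u x * FT v (w - x)) \<le> 1 * cmod (FT u x) * cmod (FT v (w - x))"
        unfolding norm_mult by (intro mult_right_mono norm_gauss_le_1) auto
      then show "ennreal (norm (gauss (\<epsilon> *\<^sub>R x) * FT u x * FT v (w - x))) \<le> ennreal (cmod (FT u x)) * ennreal (cmod (FT v (w - x)))"
        by (simp add: ennreal_mult[symmetric] ennreal_leI)
    qed
    finally show ?thesis .
  qed (simp add: J_def not_integrable_integral_eq)
  \<comment> \<open>Undoing both transforms by Fubini leaves the Fourier integral of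
    \<open>v\<close> times an average of \<open>u\<close> against the Gaussian at scale
    \<open>\<epsilon>\<close>. The factor \<open>\<kappa>\<close> comes from transforming the
    Gaussian.\<close>
  have J_eq: "J \<epsilon> = \<kappa> * (\<integral>z. cis (- (z \<bullet> w)) * v z * (\<integral>y. u (z - \<epsilon> *\<^sub>R y) * gauss y \<partial>lborel) \<partial>lborel)" if \<epsilon>: "\<epsilon> > 0" for \<epsilon>
  proof -
    have gi: "integrable lborel (\<lambda>x::'a. gauss (\<epsilon> *\<^sub>R x))"
      unfolding gauss_def inner_scaleR_left
    proof (rule has_bochner_integral_lborel_prod(1))
      show "integrable lborel (\<lambda>x. complex_of_real (exp (- (\<epsilon> * x)\<^sup>2 / 2)))"
        using lborel_integrable_real_affine[OF gauss_integrable_1d, of \<epsilon> 0] \<epsilon> by simp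
    qed
    have hi: "integrable lborel (\<lambda>x. gauss (\<epsilon> *\<^sub>R x) * FT u x)"
    proof (rule Bochner_Integration.integrable_bound)
      show "integrable lborel (\<lambda>x::'a. complex_of_real (\<integral>z. norm (u z) \<partial>lborel) * gauss (\<epsilon> *\<^sub>R x))"
        using gi by simp
      show "AE x in lborel. norm (gauss (\<epsilon> *\<^sub>R x) * FT u x) \<le> norm (complex_of_real (\<integral>z. norm (u z) \<partial>lborel) * gauss (\<epsilon> *\<^sub>R x))"
      proof (rule AE_I2)
        fix x :: 'a
        have "cmod (gauss (\<epsilon> *\<^sub>R x)) * cmod (FT u x) \<le> cmod (gauss (\<epsilon> *\<^sub>R x)) * (\<integral>z. norm (u z) \<partial>lborel)"
          by (intro mult_left_mono FTb) simp
        then show "norm (gauss (\<epsilon> *\<^sub>R x) * FT u x) \<le> norm (complex_of_real (\<integral>z. norm (u z) \<partial>lborel) * gauss (\<epsilon> *\<^sub>R x))"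
          by (simp add: norm_mult mult.commute)
      qed
    qed measurable
    have inner: "(\<integral>x. cis (x \<bullet> y) * gauss (\<epsilon> *\<^sub>R x) \<partial>lborel) = complex_of_real (1 / \<epsilon> ^ DIM('a)) * \<kappa> * gauss ((1 / \<epsilon>) *\<^sub>R y)" for y :: 'a
    proof -
      have "(\<integral>x. cis (x \<bullet> y) * gauss (\<epsilon> *\<^sub>R x) \<partial>lborel)
        = complex_of_real ((1 / \<epsilon>) ^ DIM('a)) * (\<integral>x. cis ((0 + (1 / \<epsilon>) *\<^sub>R x) \<bullet> y) * gauss (\<epsilon> *\<^sub>R (0 + (1 / \<epsilon>) *\<^sub>R x)) \<partial>lborel)"
        using \<epsilon> by (intro integral_lborel_affine) auto
      also have "(\<integral>x. cis ((0 + (1 / \<epsilon>) *\<^sub>R x) \<bullet> y) * gauss (\<epsilon> *\<^sub>R (0 + (1 / \<epsilon>) *\<^sub>R x)) \<partial>lborel)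
        = (\<integral>x. cis (x \<bullet> ((1 / \<epsilon>) *\<^sub>R y)) * gauss x \<partial>lborel)"
        using \<epsilon> by (intro Bochner_Integration.integral_cong) auto
      finally show ?thesis unfolding fourier_gauss by (simp add: \<kappa>_def power_divide)
    qed
    have "J \<epsilon> = (\<integral>x. (gauss (\<epsilon> *\<^sub>R x) * FT u x) * (\<integral>z. cis (- (z \<bullet> (w - x))) * v z \<partial>lborel) \<partial>lborel)"
      by (simp add: J_def FT_def)
    also have "\<dots> = (\<integral>z. v z * (\<integral>x. cis (- (z \<bullet> (w - x))) * (gauss (\<epsilon> *\<^sub>R x) * FT u x) \<partial>lborel) \<partial>lborel)"
      by (rule fourier_Fubini[OF hi v]) measurable
    also have "\<dots> = (\<integral>z. cis (- (z \<bullet> w)) * v z * (\<kappa> * (\<integral>y. u (z - \<epsilon> *\<^sub>R y) * gauss y \<partial>lborel)) \<partial>lborel)"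
    proof (intro Bochner_Integration.integral_cong refl)
      fix z
      have "(\<integral>x. cis (- (z \<bullet> (w - x))) * (gauss (\<epsilon> *\<^sub>R x) * FT u x) \<partial>lborel)
        = (\<integral>x. cis (- (z \<bullet> w)) * (cis (z \<bullet> x) * gauss (\<epsilon> *\<^sub>R x) * FT u x) \<partial>lborel)"
      proof (intro Bochner_Integration.integral_cong refl)
        fix x
        have "cis (- (z \<bullet> (w - x))) = cis (- (z \<bullet> w)) * cis (z \<bullet> x)"
          by (simp add: cis_mult inner_diff_right)
        then show "cis (- (z \<bullet> (w - x))) * (gauss (\<epsilon> *\<^sub>R x) * FT u x) = cis (- (z \<bullet> w)) * (cis (z \<bullet> x) * gauss (\<epsilon> *\<^sub>R x) * FT u x)"
          by (simp only: mult.assoc)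
      qed
      also have "\<dots> = cis (- (z \<bullet> w)) * (\<integral>x. (cis (z \<bullet> x) * gauss (\<epsilon> *\<^sub>R x)) * (\<integral>y. cis (- (y \<bullet> x)) * u y \<partial>lborel) \<partial>lborel)"
        by (simp add: FT_def)
      also have "(\<integral>x. (cis (z \<bullet> x) * gauss (\<epsilon> *\<^sub>R x)) * (\<integral>y. cis (- (y \<bullet> x)) * u y \<partial>lborel) \<partial>lborel)
        = (\<integral>y. u y * (\<integral>x. cis (- (y \<bullet> x)) * (cis (z \<bullet> x) * gauss (\<epsilon> *\<^sub>R x)) \<partial>lborel) \<partial>lborel)"
        by (intro fourier_Fubini u integrable_cis_mult gi) measurable
      also have "\<dots> = (\<integral>y. u y * (\<integral>x. cis (x \<bullet> (z - y)) * gauss (\<epsilon> *\<^sub>R x) \<partial>lborel) \<partial>lborel)"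
      proof -
        have "cis (- (y \<bullet> x)) * (cis (z \<bullet> x) * gauss (\<epsilon> *\<^sub>R x)) = cis (x \<bullet> (z - y)) * gauss (\<epsilon> *\<^sub>R x)" for x y
        proof -
          have "- (y \<bullet> x) + z \<bullet> x = x \<bullet> (z - y)" by (simp add: inner_diff_right inner_commute)
          then show ?thesis by (simp only: mult.assoc[symmetric] cis_mult)
        qed
        then show ?thesis by (simp only:)
      qed
      also have "\<dots> = (\<integral>y. u y * (complex_of_real (1 / \<epsilon> ^ DIM('a)) * \<kappa> * gauss ((1 / \<epsilon>) *\<^sub>R (z - y))) \<partial>lborel)"
        by (simp only: inner)
      also have "\<dots> = (\<integral>y. (complex_of_real (1 / \<epsilon> ^ DIM('a)) * \<kappa>) * (u y * gauss ((1 / \<epsilon>) *\<^sub>R (z - y))) \<partial>lborel)"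
        by (simp add: ac_simps)
      also have "\<dots> = complex_of_real (1 / \<epsilon> ^ DIM('a)) * \<kappa> * (\<integral>y. u y * gauss ((1 / \<epsilon>) *\<^sub>R (z - y)) \<partial>lborel)"
        by (rule integral_mult_right_zero)
      also have "(\<integral>y. u y * gauss ((1 / \<epsilon>) *\<^sub>R (z - y)) \<partial>lborel)
        = complex_of_real (\<epsilon> ^ DIM('a)) * (\<integral>y. u (z + \<epsilon> *\<^sub>R y) * gauss ((1 / \<epsilon>) *\<^sub>R (z - (z + \<epsilon> *\<^sub>R y))) \<partial>lborel)"
        by (rule integral_lborel_affine[OF _ \<epsilon>]) measurable
      also have "(\<integral>y. u (z + \<epsilon> *\<^sub>R y) * gauss ((1 / \<epsilon>) *\<^sub>R (z - (z + \<epsilon> *\<^sub>R y))) \<partial>lborel) = (\<integral>y. u (z + \<epsilon> *\<^sub>R y) * gauss y \<partial>lborel)"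
        using \<epsilon> by (intro Bochner_Integration.integral_cong refl) (simp add: gauss_def)
      also have "\<dots> = (\<integral>y. u (z - \<epsilon> *\<^sub>R y) * gauss y \<partial>lborel)"
      proof -
        have d: "distr lborel borel uminus = (lborel :: 'a measure)"
          using lborel_affine[of "-1" "0::'a"] by (simp add: density_1)
        have "(\<integral>y. u (z + \<epsilon> *\<^sub>R y) * gauss y \<partial>lborel) = (\<integral>y. u (z + \<epsilon> *\<^sub>R y) * gauss y \<partial>distr lborel borel uminus)"
          by (simp only: d)
        also have "\<dots> = (\<integral>y. u (z - \<epsilon> *\<^sub>R y) * gauss y \<partial>lborel)"
          by (subst integral_distr) (auto simp: gauss_def)
        finally show ?thesis .
      qed
      finally show "v z * (\<integral>x. cis (- (z \<bullet> (w - x))) * (gauss (\<epsilon> *\<^sub>R x) * FT u x) \<partial>lborel)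
        = cis (- (z \<bullet> w)) * v z * (\<kappa> * (\<integral>y. u (z - \<epsilon> *\<^sub>R y) * gauss y \<partial>lborel))"
        using \<epsilon> by (simp add: field_simps)
    qed
    also have "\<dots> = (\<integral>z. \<kappa> * (cis (- (z \<bullet> w)) * v z * (\<integral>y. u (z - \<epsilon> *\<^sub>R y) * gauss y \<partial>lborel)) \<partial>lborel)"
      by (simp add: ac_simps)
    finally show ?thesis by simp
  qed
  define e where "e n = inverse (real (Suc n))" for n
  have e0: "e n > 0" for n by (simp add: e_def)
  have el: "e \<longlonglongrightarrow> 0" unfolding e_def by (rule LIMSEQ_inverse_real_of_nat)
  \<comment> \<open>Continuity of \<open>u\<close> gives pointwise convergence of the averages and
    the bound \<open>B\<close> gives domination. The integral of the Gaussian in the limit supplies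
    a second factor \<open>\<kappa>\<close>.\<close>
  have inner_lim: "(\<lambda>n. \<integral>y. u (z - e n *\<^sub>R y) * gauss y \<partial>lborel) \<longlonglongrightarrow> (\<integral>y. u z * gauss (y::'a) \<partial>lborel)" for z
  proof (rule integral_dominated_convergence[where w = "\<lambda>y::'a. B * norm (gauss y)"])
    show "integrable lborel (\<lambda>y::'a. B * norm (gauss y))" using integrable_gauss by (intro integrable_mult_right integrable_norm)
    show "AE y in lborel. norm (u (z - e n *\<^sub>R y) * gauss y) \<le> B * norm (gauss y)" for n
      using bdd by (intro AE_I2) (simp add: norm_mult mult_right_mono)
    show "AE y in lborel. (\<lambda>n. u (z - e n *\<^sub>R y) * gauss y) \<longlonglongrightarrow> u z * gauss (y::'a)"
    proof (rule AE_I2)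
      fix y :: 'a
      have "(\<lambda>n. z - e n *\<^sub>R y) \<longlonglongrightarrow> z - 0 *\<^sub>R y" by (intro tendsto_intros el)
      moreover have "isCont u z" using cont by (simp add: continuous_on_eq_continuous_at)
      ultimately have "(\<lambda>n. u (z - e n *\<^sub>R y)) \<longlonglongrightarrow> u z"
        by (intro isCont_tendsto_compose[of z u]) auto
      then show "(\<lambda>n. u (z - e n *\<^sub>R y) * gauss y) \<longlonglongrightarrow> u z * gauss (y::'a)" by (intro tendsto_intros)
    qed
  qed measurable
  have gint: "(\<integral>y. gauss (y::'a) \<partial>lborel) = \<kappa>"
    using fourier_gauss[of "0::'a"] by (simp add: gauss_0 \<kappa>_def)
  have "(\<lambda>n. \<integral>z. cis (- (z \<bullet> w)) * v z * (\<integral>y. u (z - e n *\<^sub>R y) * gauss y \<partial>lborel) \<partial>lborel)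
     \<longlonglongrightarrow> (\<integral>z. cis (- (z \<bullet> w)) * v z * (\<integral>y. u z * gauss (y::'a) \<partial>lborel) \<partial>lborel)"
  proof (rule integral_dominated_convergence[where w = "\<lambda>z. norm (v z) * (\<integral>y. B * norm (gauss (y::'a)) \<partial>lborel)"])
    show "integrable lborel (\<lambda>z. norm (v z) * (\<integral>y. B * norm (gauss (y::'a)) \<partial>lborel))"
      using v by (intro integrable_mult_left integrable_norm)
    show "AE z in lborel. (\<lambda>n. cis (- (z \<bullet> w)) * v z * (\<integral>y. u (z - e n *\<^sub>R y) * gauss y \<partial>lborel))
        \<longlonglongrightarrow> cis (- (z \<bullet> w)) * v z * (\<integral>y. u z * gauss (y::'a) \<partial>lborel)"
      by (intro AE_I2 tendsto_intros inner_lim)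
    fix n
    show "AE z in lborel. norm (cis (- (z \<bullet> w)) * v z * (\<integral>y. u (z - e n *\<^sub>R y) * gauss y \<partial>lborel)) \<le> norm (v z) * (\<integral>y. B * norm (gauss (y::'a)) \<partial>lborel)"
    proof (rule AE_I2)
      fix z
      have "norm (\<integral>y. u (z - e n *\<^sub>R y) * gauss y \<partial>lborel) \<le> (\<integral>y. B * norm (gauss (y::'a)) \<partial>lborel)"
      proof -
        have "norm (\<integral>y. u (z - e n *\<^sub>R y) * gauss y \<partial>lborel) \<le> (\<integral>y. norm (u (z - e n *\<^sub>R y) * gauss y) \<partial>lborel)"
          by (rule integral_norm_bound)
        also have "\<dots> \<le> (\<integral>y. B * norm (gauss (y::'a)) \<partial>lborel)"
        proof (rule integral_mono')
          show "integrable lborel (\<lambda>y::'a. B * norm (gauss y))" using integrable_gauss by (intro integrable_mult_right integrable_norm)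
        qed (use bdd order_trans[OF norm_ge_zero bdd[of 0]] in \<open>auto simp: norm_mult intro!: mult_right_mono\<close>)
        finally show ?thesis .
      qed
      then show "norm (cis (- (z \<bullet> w)) * v z * (\<integral>y. u (z - e n *\<^sub>R y) * gauss y \<partial>lborel)) \<le> norm (v z) * (\<integral>y. B * norm (gauss (y::'a)) \<partial>lborel)"
        by (simp add: norm_mult mult_left_mono)
    qed
  qed measurable
  then have "(\<lambda>n. J (e n)) \<longlonglongrightarrow> \<kappa> * (\<integral>z. cis (- (z \<bullet> w)) * v z * (\<integral>y. u z * gauss (y::'a) \<partial>lborel) \<partial>lborel)"
    unfolding J_eq[OF e0] by (intro tendsto_intros)
  also have "(\<integral>z. cis (- (z \<bullet> w)) * v z * (\<integral>y. u z * gauss (y::'a) \<partial>lborel) \<partial>lborel) = (\<integral>z. \<kappa> * (cis (- (z \<bullet> w)) * (u z * v z)) \<partial>lborel)"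
    by (simp add: gint ac_simps)
  also have "\<dots> = \<kappa> * FT (\<lambda>z. u z * v z) w" by (simp add: FT_def)
  finally have "(\<lambda>n. ennreal (norm (J (e n)))) \<longlonglongrightarrow> ennreal (norm (\<kappa> * (\<kappa> * FT (\<lambda>z. u z * v z) w)))"
    by (intro tendsto_ennrealI tendsto_norm)
  then have "ennreal (norm (\<kappa> * (\<kappa> * FT (\<lambda>z. u z * v z) w))) \<le> (\<integral>\<^sup>+x. ennreal (cmod (FT u x)) * ennreal (cmod (FT v (w - x))) \<partial>lborel)"
    by (rule LIMSEQ_le_const2) (use J_le in blast)
  also have "norm (\<kappa> * (\<kappa> * FT (\<lambda>z. u z * v z) w)) = (2 * pi) ^ DIM('a) * cmod (FT (\<lambda>z. u z * v z) w)"
  proof -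
    have "norm \<kappa> * norm \<kappa> = (sqrt (2 * pi) * sqrt (2 * pi)) ^ DIM('a)"
      unfolding \<kappa>_def norm_of_real power_mult_distrib by simp
    also have "\<dots> = (2 * pi) ^ DIM('a)" by (simp only: real_sqrt_mult_self) simp
    finally show ?thesis by (simp only: norm_mult mult.assoc[symmetric])
  qed
  finally show ?thesis .
qed

section \<open>Schwartz functions and their products\<close>

lemma schwartz_continuous: "schwartz u \<Longrightarrow> continuous_on UNIV u"
proof -
  assume "schwartz u"
  then have "u differentiable (at z)" for z unfolding schwartz_def by (auto dest!: spec[of _ "[]"])
  then show ?thesis by (simp add: differentiable_imp_continuous_on differentiable_on_def)
qed

lemma schwartz_decay: "schwartz u \<Longrightarrow> \<exists>C. \<forall>z. (1 + norm z) ^ N * norm (u z) \<le> C"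
  unfolding schwartz_def by (auto dest!: spec[of _ "[]"])

lemma schwartz_bounded: "schwartz u \<Longrightarrow> \<exists>B. \<forall>z. norm (u z) \<le> B"
  using schwartz_decay[of u 0] by simp

text \<open>The majorant is the product of \<open>inverse (1 + x\<^sup>2)\<close> over the
  coordinates. Each coordinate uses up two powers of \<open>1 + norm z\<close>, whence decay of
  order \<open>2 * DIM('a)\<close>.\<close>

lemma schwartz_integrable:
  fixes u :: "'a::euclidean_space \<Rightarrow> complex"
  assumes "schwartz u"
  shows "integrable lborel u"
proof -
  have [measurable]: "u \<in> borel_measurable borel"
    by (rule borel_measurable_continuous_onI[OF schwartz_continuous[OF assms]])
  obtain C where C: "\<And>z. (1 + norm z) ^ (2 * DIM('a)) * norm (u z) \<le> C"
    using schwartz_decay[OF assms] by blast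
  define P where "P z = (\<Prod>b\<in>Basis. complex_of_real (inverse (1 + (z \<bullet> b)\<^sup>2)))" for z :: 'a
  have one: "integrable lborel (\<lambda>x::real. inverse (1 + x\<^sup>2))"
    using integrable_inverse_1_plus_square unfolding set_integrable_def by (simp add: einterval_def)
  have "integrable lborel P" unfolding P_def
    by (intro has_bochner_integral_lborel_prod(1) integrable_of_real one)
  then have "integrable lborel (\<lambda>z. complex_of_real C * P z)" by (rule integrable_mult_right)
  then show ?thesis
  proof (rule Bochner_Integration.integrable_bound)
    show "AE z in lborel. norm (u z) \<le> norm (complex_of_real C * P z)"
    proof (rule AE_I2)
      fix z :: 'a
      have "cmod (u 0) \<le> C" using C[of 0] by simp
      then have C0: "C \<ge> 0" using norm_ge_zero[of "u 0"] by linarith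
      have "(\<Prod>b\<in>Basis. 1 + (z \<bullet> b)\<^sup>2) \<le> (\<Prod>b\<in>(Basis::'a set). (1 + norm z)\<^sup>2)"
      proof (intro prod_mono conjI)
        fix b :: 'a assume "b \<in> Basis"
        then have "\<bar>z \<bullet> b\<bar> \<le> norm z" by (rule Basis_le_norm)
        then have "(z \<bullet> b)\<^sup>2 \<le> (norm z)\<^sup>2" using power_mono[of "\<bar>z \<bullet> b\<bar>" "norm z" 2] by simp
        then show "1 + (z \<bullet> b)\<^sup>2 \<le> (1 + norm z)\<^sup>2" by (simp add: power2_sum add_increasing2)
      qed auto
      also have "\<dots> = (1 + norm z) ^ (2 * DIM('a))" by (simp add: power_mult)
      finally have le: "(\<Prod>b\<in>Basis. 1 + (z \<bullet> b)\<^sup>2) \<le> (1 + norm z) ^ (2 * DIM('a))" .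
      have pos: "0 < (\<Prod>b\<in>Basis. 1 + (z \<bullet> b)\<^sup>2)" by (intro prod_pos) (auto intro: add_pos_nonneg)
      have nP: "norm (P z) = inverse (\<Prod>b\<in>Basis. 1 + (z \<bullet> b)\<^sup>2)"
        unfolding P_def prod_norm[symmetric] norm_of_real prod_inversef[symmetric]
        by (intro prod.cong) (auto simp: abs_of_nonneg)
      have "(\<Prod>b\<in>Basis. 1 + (z \<bullet> b)\<^sup>2) * norm (u z) \<le> C"
        using mult_right_mono[OF le norm_ge_zero[of "u z"]] C[of z] by linarith
      then show "norm (u z) \<le> norm (complex_of_real C * P z)"
        using pos C0 by (simp add: norm_mult nP field_simps)
    qed
  qed measurable
qed

lemma borel_measurable_fourier [measurable]:
  fixes u :: "real \<times> (real^'n) \<Rightarrow> complex"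
  assumes [measurable]: "u \<in> borel_measurable borel"
  shows "fourier u \<in> borel_measurable borel"
  unfolding fourier_def by measurable

lemma fourier_schwartz_mult_le:
  fixes u v :: "real \<times> (real^'n) \<Rightarrow> complex"
  assumes "schwartz u" "schwartz v"
  shows "ennreal (cmod (fourier (\<lambda>z. u z * v z) w))
    \<le> (\<integral>\<^sup>+x. ennreal (cmod (fourier u x)) * ennreal (cmod (fourier v (w - x))) \<partial>lborel)"
proof -
  obtain B where "\<And>z. norm (u z) \<le> B" using schwartz_bounded[OF assms(1)] by blast
  note b = fourier_product_le_convolution[OF schwartz_integrable[OF assms(1)] schwartz_integrable[OF assms(2)]
      schwartz_continuous[OF assms(1)] this, of w, folded fourier_def]
  \<comment> \<open>The convolution inequality carries a power of \<open>2 * pi\<close> on its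
    left-hand side, which is at least 1 and is dropped.\<close>
  have "1 \<le> (2 * pi) ^ DIM(real \<times> (real^'n))" using pi_ge_two by (intro one_le_power) linarith
  then have "1 * cmod (fourier (\<lambda>z. u z * v z) w) \<le> (2 * pi) ^ DIM(real \<times> (real^'n)) * cmod (fourier (\<lambda>z. u z * v z) w)"
    by (intro mult_right_mono) auto
  then have "ennreal (cmod (fourier (\<lambda>z. u z * v z) w)) \<le> ennreal ((2 * pi) ^ DIM(real \<times> (real^'n)) * cmod (fourier (\<lambda>z. u z * v z) w))"
    by (intro ennreal_leI) simp
  also note b
  finally show ?thesis .
qed

subsection \<open>Volumes of thin sets\<close>

lemma emeasure_cball_le:
  fixes c :: "real^3"
  assumes "0 \<le> r"
  shows "emeasure lborel (cball c r) \<le> ennreal (5 * r ^ 3)"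
    and "ennreal (4 * r ^ 3) \<le> emeasure lborel (cball c r)"
proof -
  have v: "unit_ball_vol (real DIM(real^3)) = 4 / 3 * pi" by (simp add: eval_unit_ball_vol)
  have e: "emeasure lborel (cball c r) = ennreal (4 / 3 * pi * r ^ 3)"
    unfolding emeasure_cball[OF assms] v by simp
  \<comment> \<open>These bounds place \<open>4 / 3 * pi\<close> between 4 and 5.\<close>
  have "3 < pi" "pi < 15 / 4" using pi_approx by simp_all
  moreover have "0 \<le> r ^ 3" using assms by simp
  ultimately have "4 * r ^ 3 \<le> 4 / 3 * pi * r ^ 3" "4 / 3 * pi * r ^ 3 \<le> 5 * r ^ 3"
    by (intro mult_right_mono; simp)+
  then show "emeasure lborel (cball c r) \<le> ennreal (5 * r ^ 3)"
    "ennreal (4 * r ^ 3) \<le> emeasure lborel (cball c r)"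
    unfolding e by (intro ennreal_leI; simp)+
qed

text \<open>About \<open>\<rho> / \<eta>\<close> translates of \<open>A\<close> in direction \<open>d\<close> are disjoint and fit into a ball of radius \<open>2 * \<rho>\<close>.\<close>

lemma emeasure_packing_le:
  fixes A :: "(real^3) set"
  assumes [measurable]: "A \<in> sets borel" and sub: "A \<subseteq> cball y \<rho>" and "0 < \<rho>" "0 < \<eta>"
    and d: "norm d = 1" and thin: "\<And>x t. x \<in> A \<Longrightarrow> x + t *\<^sub>R d \<in> A \<Longrightarrow> \<bar>t\<bar> < \<eta>"
  shows "emeasure lborel A \<le> ennreal (80 * \<rho>\<^sup>2 * \<eta>)"
proof (cases "\<rho> < \<eta>")
  \<comment> \<open>A thickness above the radius is no restriction: the volume of the ball alone is
    small enough.\<close>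
  case True
  have "emeasure lborel A \<le> emeasure lborel (cball y \<rho>)" by (rule emeasure_mono[OF sub]) simp
  also have "\<dots> \<le> ennreal (5 * \<rho> ^ 3)" using assms by (intro emeasure_cball_le) auto
  also have "\<dots> \<le> ennreal (80 * \<rho>\<^sup>2 * \<eta>)"
  proof (rule ennreal_leI)
    have "\<rho>\<^sup>2 * \<rho> \<le> \<rho>\<^sup>2 * \<eta>" using True by (intro mult_left_mono) auto
    moreover have "0 \<le> \<rho>\<^sup>2 * \<eta>" using assms by simp
    ultimately show "5 * \<rho> ^ 3 \<le> 80 * \<rho>\<^sup>2 * \<eta>" unfolding power3_eq_cube power2_eq_square by linarith
  qed
  finally show ?thesis .
next
  case False
  define n where "n = nat \<lfloor>\<rho> / \<eta>\<rfloor>"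
  have 1: "1 \<le> \<rho> / \<eta>" using False assms by (simp add: field_simps)
  then have n1: "real n \<le> \<rho> / \<eta>" and n0: "n \<ge> 1" unfolding n_def by (simp_all add: le_nat_iff le_floor_iff)
  \<comment> \<open>Rounding down loses at most a factor 2, because the quotient is at least 1.
    Together with the ball of radius \<open>2 * \<rho>\<close> this gives
    \<open>2 * 5 * 8 = 80\<close>.\<close>
  have n2: "\<rho> / \<eta> \<le> 2 * real n" using 1 n0 unfolding n_def by linarith
  define T where "T k = (\<lambda>x. - (real k * \<eta>) *\<^sub>R d + x) -` A" for k :: nat
  have Tm[measurable]: "T k \<in> sets borel" for k
    unfolding T_def by (rule measurable_sets_borel[OF _ assms(1)]) measurable
  have Te: "emeasure lborel (T k) = emeasure lborel A" for k
  proof -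
    have "emeasure lborel A = emeasure (distr lborel borel ((+) (- (real k * \<eta>) *\<^sub>R d))) A"
      by (simp only: lborel_distr_plus)
    also have "\<dots> = emeasure lborel (T k)"
      by (subst emeasure_distr) (auto simp: T_def vimage_def)
    finally show ?thesis by simp
  qed
  have disj: "disjoint_family_on T {..<n}"
    unfolding disjoint_family_on_def
  proof (intro ballI impI)
    fix j k :: nat assume "j \<noteq> k"
    show "T j \<inter> T k = {}"
    proof (rule ccontr)
      assume "T j \<inter> T k \<noteq> {}"
      then obtain x where x: "- (real j * \<eta>) *\<^sub>R d + x \<in> A" "- (real k * \<eta>) *\<^sub>R d + x \<in> A" by (auto simp: T_def)
      have "- (real k * \<eta>) *\<^sub>R d + x = (- (real j * \<eta>) *\<^sub>R d + x) + ((real j - real k) * \<eta>) *\<^sub>R d"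
        by (simp add: algebra_simps)
      with x(2) have "(- (real j * \<eta>) *\<^sub>R d + x) + ((real j - real k) * \<eta>) *\<^sub>R d \<in> A" by (simp only:)
      from thin[OF x(1) this] have "\<bar>(real j - real k) * \<eta>\<bar> < \<eta>" .
      then have "\<bar>real j - real k\<bar> * \<eta> < 1 * \<eta>" using assms(4) by (simp add: abs_mult)
      then have "\<bar>real j - real k\<bar> < 1" using assms(4) by (simp only: mult_less_cancel_right)
      with \<open>j \<noteq> k\<close> show False by linarith
    qed
  qed
  have "of_nat n * emeasure lborel A = (\<Sum>k<n. emeasure lborel (T k))" by (simp add: Te)
  also have "\<dots> = emeasure lborel (\<Union>k<n. T k)"
    by (rule sum_emeasure) (use disj in auto)
  also have "\<dots> \<le> emeasure lborel (cball y (2 * \<rho>))"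
  proof (rule emeasure_mono)
    show "(\<Union>k<n. T k) \<subseteq> cball y (2 * \<rho>)"
    proof
      fix x assume "x \<in> (\<Union>k<n. T k)"
      then obtain k where k: "k < n" "- (real k * \<eta>) *\<^sub>R d + x \<in> A" by (auto simp: T_def)
      then have *: "dist y (- (real k * \<eta>) *\<^sub>R d + x) \<le> \<rho>" using sub by auto
      have "dist (- (real k * \<eta>) *\<^sub>R d + x) x = real k * \<eta>" using d assms(4) by (simp add: dist_norm)
      moreover have "real k * \<eta> \<le> \<rho>"
      proof -
        have "real k * \<eta> \<le> \<rho> / \<eta> * \<eta>" using k n1 assms(4) by (intro mult_right_mono) auto
        then show ?thesis using assms(4) by simp
      qed
      ultimately show "x \<in> cball y (2 * \<rho>)"
        using * dist_triangle[of y x "- (real k * \<eta>) *\<^sub>R d + x"] by simp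
    qed
  qed simp
  also have "\<dots> \<le> ennreal (5 * (2 * \<rho>) ^ 3)" using assms by (intro emeasure_cball_le) auto
  finally have le: "of_nat n * emeasure lborel A \<le> ennreal (40 * \<rho> ^ 3)" by (simp add: power_mult_distrib)
  have "emeasure lborel A \<le> emeasure lborel (cball y \<rho>)" by (rule emeasure_mono[OF sub]) simp
  then have "emeasure lborel A < \<infinity>" using emeasure_lborel_cball_finite[of y \<rho>] by (rule order.strict_trans1)
  then obtain a where a: "emeasure lborel A = ennreal a" "0 \<le> a" by (cases "emeasure lborel A") auto
  have "ennreal (real n * a) \<le> ennreal (40 * \<rho> ^ 3)"
    using le a by (simp add: ennreal_mult ennreal_of_nat_eq_real_of_nat)
  then have na: "real n * a \<le> 40 * \<rho> ^ 3" using assms by (simp add: ennreal_le_iff)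
  have "\<rho> / \<eta> * a \<le> 2 * real n * a" using n2 a by (intro mult_right_mono)
  with na have "\<rho> / \<eta> * a \<le> 80 * \<rho> ^ 3" by simp
  then have "\<rho> * a \<le> \<rho> * (80 * \<rho>\<^sup>2 * \<eta>)" using assms(4) by (simp add: field_simps power2_eq_square power3_eq_cube)
  then have "a \<le> 80 * \<rho>\<^sup>2 * \<eta>" using assms(3) by simp
  then show ?thesis unfolding a by (rule ennreal_leI)
qed

text \<open>A chain of balls of radius \<open>2 * b\<close>, centred on the axis at the multiples of
  \<open>b\<close>, covers the cylinder: the axial rounding error and the distance from the axis are
  each at most \<open>b\<close>.\<close>

lemma emeasure_cylinder_le:
  fixes e :: "real^3"
  assumes e: "norm e = 1" and "0 \<le> a" "0 < b"
  shows "emeasure lborel {x. \<bar>x \<bullet> e\<bar> \<le> a \<and> norm (x - (x \<bullet> e) *\<^sub>R e) \<le> b} \<le> ennreal (40 * b\<^sup>2 * (2 * a + 3 * b))"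
proof -
  define K where "K = \<lceil>a / b\<rceil>"
  have "0 \<le> a / b" using assms by simp
  then have K0: "0 \<le> K" unfolding K_def by linarith
  have K1: "real_of_int K \<le> a / b + 1" unfolding K_def by linarith
  have "{x. \<bar>x \<bullet> e\<bar> \<le> a \<and> norm (x - (x \<bullet> e) *\<^sub>R e) \<le> b} \<subseteq> (\<Union>k\<in>{-K..K}. cball ((real_of_int k * b) *\<^sub>R e) (2 * b))"
  proof
    fix x assume "x \<in> {x. \<bar>x \<bullet> e\<bar> \<le> a \<and> norm (x - (x \<bullet> e) *\<^sub>R e) \<le> b}"
    then have x: "\<bar>x \<bullet> e\<bar> \<le> a" "norm (x - (x \<bullet> e) *\<^sub>R e) \<le> b" by auto
    define k where "k = \<lfloor>(x \<bullet> e) / b\<rfloor>"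
    have q: "\<bar>(x \<bullet> e) / b\<bar> \<le> a / b" using x(1) assms(3) by (simp add: abs_divide divide_right_mono)
    have "real_of_int (- K) \<le> - (a / b)" unfolding K_def by simp
    also have "\<dots> \<le> (x \<bullet> e) / b" using q by linarith
    finally have k1: "- K \<le> k" unfolding k_def by (simp only: le_floor_iff)
    have "(x \<bullet> e) / b \<le> real_of_int K" using q unfolding K_def by linarith
    then have k2: "k \<le> K" unfolding k_def by linarith
    have kd: "\<bar>(x \<bullet> e) / b - real_of_int k\<bar> \<le> 1" unfolding k_def by linarith
    have "\<bar>x \<bullet> e - real_of_int k * b\<bar> = \<bar>(x \<bullet> e) / b - real_of_int k\<bar> * b"
      using assms(3) by (simp add: abs_mult[symmetric] abs_of_pos field_simps)
    also have "\<dots> \<le> 1 * b" using kd assms(3) by (intro mult_right_mono) auto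
    finally have n1: "norm ((x \<bullet> e - real_of_int k * b) *\<^sub>R e) \<le> b" using e by simp
    have "x - (real_of_int k * b) *\<^sub>R e = (x - (x \<bullet> e) *\<^sub>R e) + (x \<bullet> e - real_of_int k * b) *\<^sub>R e"
      by (simp add: algebra_simps)
    then have "norm (x - (real_of_int k * b) *\<^sub>R e) \<le> b + b"
      using x(2) n1 norm_triangle_mono by metis
    then have "x \<in> cball ((real_of_int k * b) *\<^sub>R e) (2 * b)" by (simp add: dist_norm norm_minus_commute)
    with k1 k2 show "x \<in> (\<Union>k\<in>{-K..K}. cball ((real_of_int k * b) *\<^sub>R e) (2 * b))" by auto
  qed
  then have "emeasure lborel {x. \<bar>x \<bullet> e\<bar> \<le> a \<and> norm (x - (x \<bullet> e) *\<^sub>R e) \<le> b}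
    \<le> emeasure lborel (\<Union>k\<in>{-K..K}. cball ((real_of_int k * b) *\<^sub>R e) (2 * b))"
    by (rule emeasure_mono) (auto intro: sets.finite_UN)
  also have "\<dots> \<le> (\<Sum>k\<in>{-K..K}. emeasure lborel (cball ((real_of_int k * b) *\<^sub>R e) (2 * b)))"
    by (rule emeasure_subadditive_finite) auto
  also have "\<dots> \<le> (\<Sum>k\<in>{-K..K}. ennreal (5 * (2 * b) ^ 3))"
    using assms by (intro sum_mono emeasure_cball_le) auto
  also have "\<dots> = ennreal (real (card {-K..K}) * (5 * (2 * b) ^ 3))"
    using assms by (simp add: ennreal_mult ennreal_of_nat_eq_real_of_nat)
  also have "\<dots> \<le> ennreal (40 * b\<^sup>2 * (2 * a + 3 * b))"
  proof (rule ennreal_leI)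
    have "real (card {-K..K}) = 2 * real_of_int K + 1" using K0 by simp
    also have "\<dots> \<le> 2 * (a / b) + 3" using K1 by simp
    finally have "real (card {-K..K}) * (5 * (2 * b) ^ 3) \<le> (2 * (a / b) + 3) * (5 * (2 * b) ^ 3)"
      using assms by (intro mult_right_mono) auto
    also have "\<dots> = 40 * b\<^sup>2 * (2 * a + 3 * b)"
      using assms by (simp add: field_simps power2_eq_square power3_eq_cube)
    finally show "real (card {-K..K}) * (5 * (2 * b) ^ 3) \<le> 40 * b\<^sup>2 * (2 * a + 3 * b)" .
  qed
  finally show ?thesis .
qed

lemma emeasure_real_diameter_le:
  fixes A :: "real set"
  assumes [measurable]: "A \<in> sets borel" and "0 \<le> D" "\<And>x y. x \<in> A \<Longrightarrow> y \<in> A \<Longrightarrow> \<bar>x - y\<bar> \<le> D"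
  shows "emeasure lborel A \<le> ennreal (2 * D)"
proof (cases "A = {}")
  case False
  then obtain x where "x \<in> A" by blast
  then have "A \<subseteq> {x - D..x + D}" using assms(3) by force
  then have "emeasure lborel A \<le> emeasure lborel {x - D..x + D}" by (rule emeasure_mono) simp
  also have "\<dots> = ennreal (2 * D)" using assms by simp
  finally show ?thesis .
qed simp

section \<open>Bipolar coordinates in three dimensions\<close>

text \<open>The disc \<open>(norm z)\<^sup>2 \<le> a\<close> has area \<open>pi * a\<close>, linear
  in \<open>a\<close>; so the squared modulus has a constant density, and half-lines suffice to
  identify the measures.\<close>

lemma distr_norm_square_complex:
  "distr (lborel :: complex measure) borel (\<lambda>z. (norm z)\<^sup>2) = density lborel (\<lambda>q. ennreal pi * indicator {0..} q)"
proof (rule measure_eqI_generator_eq[where \<Omega> = UNIV and E = "range (\<lambda>a::real. {..a})" and A = "\<lambda>n. {..real n}"])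
  show "Int_stable (range (\<lambda>a::real. {..a}))" by (auto simp: Int_stable_def)
  show "sets (distr (lborel :: complex measure) borel (\<lambda>z. (norm z)\<^sup>2)) = sigma_sets UNIV (range (\<lambda>a::real. {..a}))"
    "sets (density lborel (\<lambda>q::real. ennreal pi * indicator {0..} q)) = sigma_sets UNIV (range (\<lambda>a::real. {..a}))"
    by (simp_all add: borel_eq_atMost)
  show "(\<Union>n. {..real n}) = UNIV" using real_arch_simple by auto
  have e: "emeasure (distr (lborel :: complex measure) borel (\<lambda>z. (norm z)\<^sup>2)) {..a} = (if a \<ge> 0 then ennreal (pi * a) else 0)" for a
  proof -
    have "emeasure (distr (lborel :: complex measure) borel (\<lambda>z. (norm z)\<^sup>2)) {..a} = emeasure lborel {z::complex. (norm z)\<^sup>2 \<le> a}"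
      by (subst emeasure_distr) (auto simp: vimage_def)
    also have "\<dots> = (if a \<ge> 0 then ennreal (pi * a) else 0)"
    proof (cases "a \<ge> 0")
      case True
      then have "{z::complex. (norm z)\<^sup>2 \<le> a} = cball 0 (sqrt a)" by (auto intro: real_le_rsqrt dest!: sqrt_ge_absD[of "norm _", unfolded abs_norm_cancel])
      then show ?thesis using True by (simp add: emeasure_cball eval_unit_ball_vol)
    next
      case False
      then have "{z::complex. (norm z)\<^sup>2 \<le> a} = {}" by (auto simp: not_le intro: order.strict_trans2)
      then show ?thesis using False by simp
    qed
    finally show ?thesis .
  qed
  show "emeasure (distr (lborel :: complex measure) borel (\<lambda>z. (norm z)\<^sup>2)) X = emeasure (density lborel (\<lambda>q. ennreal pi * indicator {0..} q)) X"
    if "X \<in> range (\<lambda>a::real. {..a})" for X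
  proof -
    from that obtain a where X: "X = {..a}" by auto
    have "emeasure (density lborel (\<lambda>q. ennreal pi * indicator {0..} q)) {..a} = (\<integral>\<^sup>+q. ennreal pi * indicator {0..a} q \<partial>lborel)"
      by (subst emeasure_density) (auto intro!: nn_integral_cong simp: indicator_def)
    also have "\<dots> = (if a \<ge> 0 then ennreal (pi * a) else 0)"
      by (simp add: nn_integral_cmult_indicator ennreal_mult)
    finally show ?thesis unfolding X e ..
  qed
  show "emeasure (distr (lborel :: complex measure) borel (\<lambda>z. (norm z)\<^sup>2)) {..real n} \<noteq> \<infinity>" for n
    unfolding e by simp
qed auto

lemma nn_integral_norm_square_complex:
  assumes [measurable]: "h \<in> borel_measurable borel"
  shows "(\<integral>\<^sup>+z. h ((norm (z :: complex))\<^sup>2) \<partial>lborel) = ennreal pi * (\<integral>\<^sup>+q. h q * indicator {0..} q \<partial>lborel)"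
proof -
  have "(\<integral>\<^sup>+z. h ((norm (z :: complex))\<^sup>2) \<partial>lborel) = (\<integral>\<^sup>+q. h q \<partial>(distr (lborel :: complex measure) borel (\<lambda>z. (norm z)\<^sup>2)))"
    by (rule nn_integral_distr[symmetric]) auto
  also have "\<dots> = (\<integral>\<^sup>+q. ennreal pi * indicator {0..} q * h q \<partial>lborel)"
    unfolding distr_norm_square_complex by (rule nn_integral_density) auto
  also have "\<dots> = (\<integral>\<^sup>+q. ennreal pi * (h q * indicator {0..} q) \<partial>lborel)" by (simp add: ac_simps)
  also have "\<dots> = ennreal pi * (\<integral>\<^sup>+q. h q * indicator {0..} q \<partial>lborel)" by (rule nn_integral_cmult) measurable
  finally show ?thesis .
qed

lemma distr_orthogonal_transformation:
  fixes g :: "real^3 \<Rightarrow> real^3"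
  assumes g: "orthogonal_transformation g"
  shows "distr lborel borel g = lborel"
proof (rule lborel_eqI[symmetric])
  have lin: "linear g" using g by (simp add: orthogonal_transformation_linear)
  then have [measurable]: "g \<in> borel_measurable borel"
    by (intro borel_measurable_continuous_onI linear_continuous_on) (simp add: linear_conv_bounded_linear)
  define h where "h = inv g"
  have h: "orthogonal_transformation h" unfolding h_def by (rule orthogonal_transformation_inv[OF g])
  have bij: "bij g" by (rule orthogonal_transformation_bij[OF g])
  fix l u :: "real^3" assume le: "\<And>b. b \<in> Basis \<Longrightarrow> l \<bullet> b \<le> u \<bullet> b"
  have "emeasure (distr lborel borel g) (box l u) = emeasure lborel (g -` box l u)"
    by (subst emeasure_distr) auto
  also have "g -` box l u = h ` box l u" unfolding h_def by (rule bij_vimage_eq_inv_image[OF bij])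
  also have "emeasure lborel (h ` box l u) = emeasure lebesgue (h ` box l u)"
  proof -
    have "h ` box l u = g -` box l u" unfolding h_def by (rule bij_vimage_eq_inv_image[OF bij, symmetric])
    also have "\<dots> \<in> sets borel" by (rule measurable_sets_borel[of g borel]) auto
    finally show ?thesis by simp
  qed
  also have "\<dots> = ennreal (measure lebesgue (h ` box l u))"
    using measurable_orthogonal_image[OF h, of "box l u"] by (intro emeasure_eq_measure2) simp_all
  also have "measure lebesgue (h ` box l u) = measure lebesgue (box l u)"
    by (rule measure_orthogonal_image[OF h]) simp
  also have "ennreal (measure lebesgue (box l u)) = (\<Prod>b\<in>Basis. (u - l) \<bullet> b)"
    using le by (simp add: measure_lborel_box_eq)
  finally show "emeasure (distr lborel borel g) (box l u) = ennreal (\<Prod>b\<in>Basis. (u - l) \<bullet> b)" .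
qed simp

lemma borel_measurable_vec3:
  "(\<lambda>p::real \<times> complex. vector [fst p, Re (snd p), Im (snd p)] :: real^3) \<in> borel_measurable borel"
proof (rule borel_measurable_continuous_onI)
  have "(vector [fst p, Re (snd p), Im (snd p)] :: real^3) = (\<chi> i. if i = 1 then fst p else if i = 2 then Re (snd p) else Im (snd p))"
    for p :: "real \<times> complex"
    unfolding vec_eq_iff forall_3 by (simp add: vector_3)
  moreover have "continuous_on UNIV (\<lambda>p::real \<times> complex. (\<chi> i. if i = (1::3) then fst p else if i = 2 then Re (snd p) else Im (snd p)))"
  proof (rule continuous_on_vec_lambda)
    fix i :: 3
    show "continuous_on UNIV (\<lambda>p::real \<times> complex. if i = 1 then fst p else if i = 2 then Re (snd p) else Im (snd p))"
      by (cases "i = 1"; cases "i = 2") (auto intro!: continuous_intros)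
  qed
  ultimately show "continuous_on UNIV (\<lambda>p::real \<times> complex. vector [fst p, Re (snd p), Im (snd p)] :: real^3)" by simp
qed

lemma distr_real_complex_vec3:
  "distr (lborel :: (real \<times> complex) measure) borel (\<lambda>p. vector [fst p, Re (snd p), Im (snd p)] :: real^3) = lborel"
proof (rule lborel_eqI[symmetric])
  let ?f = "\<lambda>p::real \<times> complex. vector [fst p, Re (snd p), Im (snd p)] :: real^3"
  have [measurable]: "?f \<in> borel_measurable borel"
    by (rule borel_measurable_vec3)
  fix l u :: "real^3" assume le: "\<And>b. b \<in> Basis \<Longrightarrow> l \<bullet> b \<le> u \<bullet> b"
  have le': "l $ i \<le> u $ i" for i using le[of "axis i 1"] by (simp add: inner_axis)
  have "emeasure (distr lborel borel ?f) (box l u) = emeasure lborel (?f -` box l u)"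
    by (subst emeasure_distr) auto
  also have "?f -` box l u = box (l $ 1) (u $ 1) \<times> box (Complex (l $ 2) (l $ 3)) (Complex (u $ 2) (u $ 3))"
    by (auto simp: mem_box_cart forall_3 vector_3 in_box_complex_iff box_real)
  also have "emeasure lborel \<dots> = emeasure lborel (box (l $ 1) (u $ 1)) * emeasure lborel (box (Complex (l $ 2) (l $ 3)) (Complex (u $ 2) (u $ 3)))"
    unfolding lborel_prod[symmetric] by (rule lborel.emeasure_pair_measure_Times) auto
  also have "\<dots> = ennreal ((u $ 1 - l $ 1) * ((u $ 2 - l $ 2) * (u $ 3 - l $ 3)))"
  proof -
    have "emeasure lborel (box (Complex (l $ 2) (l $ 3)) (Complex (u $ 2) (u $ 3))) = ennreal ((u $ 2 - l $ 2) * (u $ 3 - l $ 3))"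
      using le'[of 2] le'[of 3] by (subst emeasure_lborel_box) (auto simp: Basis_complex_def)
    moreover have "emeasure lborel (box (l $ 1) (u $ 1)) = ennreal (u $ 1 - l $ 1)"
      using le'[of 1] by (simp add: box_real)
    ultimately show ?thesis using le'[of 1] le'[of 2] le'[of 3] by (simp add: ennreal_mult)
  qed
  also have "(u $ 1 - l $ 1) * ((u $ 2 - l $ 2) * (u $ 3 - l $ 3)) = (\<Prod>i\<in>UNIV. (u - l) $ i)"
    unfolding UNIV_3 by simp
  also have "\<dots> = (\<Prod>b\<in>Basis. (u - l) \<bullet> b)"
  proof -
    have B: "(Basis :: (real^3) set) = (\<lambda>i. axis i 1) ` UNIV" by (auto simp: Basis_vec_def)
    have "inj (\<lambda>i::3. axis i (1::real))" by (auto simp: inj_def axis_eq_axis)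
    then show ?thesis unfolding B by (subst prod.reindex) (auto simp: inner_axis)
  qed
  finally show "emeasure (distr lborel borel ?f) (box l u) = ennreal (\<Prod>b\<in>Basis. (u - l) \<bullet> b)" .
qed simp

text \<open>The first coordinate is the component along \<open>e\<close>, and the perpendicular
  plane is read as the complex numbers, so that radial integration in it can use the squared
  modulus. A rotation takes the first axis to \<open>e\<close>.\<close>

lemma adapted_coordinates:
  fixes e :: "real^3"
  assumes "norm e = 1"
  shows "\<exists>f :: real \<times> complex \<Rightarrow> real^3. f \<in> borel_measurable borel \<and> distr lborel borel f = lborel \<and>
    (\<forall>p. (norm (f p))\<^sup>2 = (fst p)\<^sup>2 + (norm (snd p))\<^sup>2) \<and> (\<forall>p. f p \<bullet> e = fst p)"
proof -
  let ?f = "\<lambda>p::real \<times> complex. vector [fst p, Re (snd p), Im (snd p)] :: real^3"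
  have f[measurable]: "?f \<in> borel_measurable borel"
    by (rule borel_measurable_vec3)
  have "\<exists>g :: real^3 \<Rightarrow> real^3. orthogonal_transformation g \<and> g (axis 1 1) = e"
  proof (rule orthogonal_transformation_exists)
    show "norm (axis (1::3) (1::real)) = norm e" using assms by simp
  qed blast
  then obtain g :: "real^3 \<Rightarrow> real^3" where g: "orthogonal_transformation g" "g (axis 1 1) = e" by blast
  have lin: "linear g" using g by (simp add: orthogonal_transformation_linear)
  then have gm[measurable]: "g \<in> borel_measurable borel"
    by (intro borel_measurable_continuous_onI linear_continuous_on) (simp add: linear_conv_bounded_linear)
  show ?thesis
  proof (intro exI[of _ "g \<circ> ?f"] conjI allI)
    show "g \<circ> ?f \<in> borel_measurable borel" by (rule measurable_comp[OF f gm])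
    have "distr lborel borel (g \<circ> ?f) = distr (distr lborel borel ?f) borel g"
      by (subst distr_distr) auto
    then show "distr lborel borel (g \<circ> ?f) = lborel"
      by (simp only: distr_real_complex_vec3 distr_orthogonal_transformation[OF g(1)])
    fix p
    have "(norm ((g \<circ> ?f) p))\<^sup>2 = (norm (?f p))\<^sup>2"
      using g(1) by (simp add: orthogonal_transformation_norm)
    also have "\<dots> = (fst p)\<^sup>2 + (norm (snd p))\<^sup>2"
      by (simp add: norm_vec_def L2_set_def sum_3 vector_3 cmod_power2)
    finally show "(norm ((g \<circ> ?f) p))\<^sup>2 = (fst p)\<^sup>2 + (norm (snd p))\<^sup>2" .
    have "(g \<circ> ?f) p \<bullet> e = g (?f p) \<bullet> g (axis 1 1)" by (simp add: g(2))
    also have "\<dots> = ?f p \<bullet> axis 1 1" using g(1) by (simp add: orthogonal_transformation_def)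
    also have "\<dots> = fst p" by (simp add: inner_axis vector_3)
    finally show "(g \<circ> ?f) p \<bullet> e = fst p" .
  qed
qed

text \<open>In the coordinates \<open>v = |x|^2\<close>, \<open>u = |p - x|^2\<close> Lebesgue measure has density \<open>pi / (2 * |p|)\<close>.\<close>

lemma emeasure_bipolar_le:
  fixes p :: "real^3"
  assumes "p \<noteq> 0" and "0 \<le> M" "0 \<le> R" "0 \<le> l"
  shows "emeasure lborel {x. norm x \<le> M \<and> norm (p - x) \<le> R \<and> \<bar>norm (p - x) + \<sigma> * norm x - c\<bar> \<le> l}
    \<le> ennreal (16 * M\<^sup>2 * R * l / norm p)"
proof -
  define e where "e = p /\<^sub>R norm p"
  define P where "P = norm p"
  have P: "P > 0" using assms by (simp add: P_def)
  have e: "norm e = 1" using assms(1) by (simp add: e_def)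
  have p: "p = P *\<^sub>R e" unfolding e_def scaleR_scaleR using P by (simp add: P_def[symmetric])
  obtain f :: "real \<times> complex \<Rightarrow> real^3" where f[measurable]: "f \<in> borel_measurable borel" and fd: "distr lborel borel f = (lborel :: (real^3) measure)"
    and fn: "\<And>p. (norm (f p))\<^sup>2 = (fst p)\<^sup>2 + (norm (snd p))\<^sup>2" and fe: "\<And>p. f p \<bullet> e = fst p"
    using adapted_coordinates[OF e] by blast
  \<comment> \<open>The set in terms of the axial coordinate \<open>x\<close> and the squared norm
    \<open>v\<close> of the point. The other squared distance is
    \<open>P\<^sup>2 - 2 * P * x + v\<close>, affine in \<open>x\<close>.\<close>
  define G where "G x v = (sqrt v \<le> M \<and> sqrt (P\<^sup>2 - 2 * P * x + v) \<le> R \<and> \<bar>sqrt (P\<^sup>2 - 2 * P * x + v) + \<sigma> * sqrt v - c\<bar> \<le> l \<and> 0 \<le> v \<and> 0 \<le> P\<^sup>2 - 2 * P * x + v)" for x v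
  have [measurable]: "Measurable.pred (borel \<Otimes>\<^sub>M borel) (\<lambda>p. G (fst p) (snd p))" unfolding G_def by measurable
  have [measurable]: "Measurable.pred borel (\<lambda>v. G x v)" "Measurable.pred borel (\<lambda>x. G x v)" for x v unfolding G_def by measurable
  let ?A = "{x. norm x \<le> M \<and> norm (p - x) \<le> R \<and> \<bar>norm (p - x) + \<sigma> * norm x - c\<bar> \<le> l}"
  have [measurable]: "?A \<in> sets borel" by measurable
  have fA: "f (x, z) \<in> ?A \<longleftrightarrow> G x (x\<^sup>2 + (norm z)\<^sup>2)" for x z
  proof -
    have n: "(norm (f (x, z)))\<^sup>2 = x\<^sup>2 + (norm z)\<^sup>2" using fn[of "(x, z)"] by simp
    have "(norm (p - f (x, z)))\<^sup>2 = (norm p)\<^sup>2 - 2 * (p \<bullet> f (x, z)) + (norm (f (x, z)))\<^sup>2"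
      by (simp add: power2_norm_eq_inner inner_diff_left inner_diff_right inner_commute)
    moreover have "p \<bullet> f (x, z) = P * x" using fe[of "(x, z)"] by (subst p) (simp add: inner_commute)
    ultimately have "(norm (p - f (x, z)))\<^sup>2 = P\<^sup>2 - 2 * P * x + (norm (f (x, z)))\<^sup>2"
      by (simp add: P_def)
    then have m: "(norm (p - f (x, z)))\<^sup>2 = P\<^sup>2 - 2 * P * x + (x\<^sup>2 + (norm z)\<^sup>2)" using n by simp
    have "norm (f (x, z)) = sqrt (x\<^sup>2 + (norm z)\<^sup>2)" using n by (metis norm_ge_zero real_sqrt_unique)
    moreover have "norm (p - f (x, z)) = sqrt (P\<^sup>2 - 2 * P * x + (x\<^sup>2 + (norm z)\<^sup>2))" using m by (metis norm_ge_zero real_sqrt_unique)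
    moreover have "0 \<le> P\<^sup>2 - 2 * P * x + (x\<^sup>2 + (norm z)\<^sup>2)" using m by (metis zero_le_power2)
    ultimately show ?thesis by (simp add: G_def)
  qed
  have "emeasure lborel ?A = (\<integral>\<^sup>+y. indicator ?A y \<partial>(distr lborel borel f))" by (simp add: fd)
  also have "\<dots> = (\<integral>\<^sup>+q. indicator ?A (f q) \<partial>lborel)" by (rule nn_integral_distr) auto
  also have "\<dots> = (\<integral>\<^sup>+x. \<integral>\<^sup>+z. indicator ?A (f (x, z)) \<partial>lborel \<partial>lborel)"
    by (rule nn_integral_lborel_pair(1)) measurable
  also have "\<dots> = (\<integral>\<^sup>+x. \<integral>\<^sup>+z. (if G x (x\<^sup>2 + (norm (z::complex))\<^sup>2) then 1 else 0) \<partial>lborel \<partial>lborel)"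
    unfolding indicator_def fA of_bool_def ..
  also have "\<dots> = (\<integral>\<^sup>+x. ennreal pi * (\<integral>\<^sup>+q. (if G x (x\<^sup>2 + q) then 1 else 0) * indicator {0..} q \<partial>lborel) \<partial>lborel)"
    by (intro nn_integral_cong nn_integral_norm_square_complex) (simp add: G_def)
  also have "\<dots> \<le> (\<integral>\<^sup>+x. ennreal pi * (\<integral>\<^sup>+q. (if G x (x\<^sup>2 + q) then 1 else 0) \<partial>lborel) \<partial>lborel)"
    by (intro nn_integral_mono mult_left_mono) (auto simp: indicator_def)
  also have "\<dots> = (\<integral>\<^sup>+x. ennreal pi * (\<integral>\<^sup>+v. (if G x v then 1 else 0) \<partial>lborel) \<partial>lborel)"
  proof (intro nn_integral_cong)
    fix x
    show "ennreal pi * (\<integral>\<^sup>+q. (if G x (x\<^sup>2 + q) then 1 else 0) \<partial>lborel) = ennreal pi * (\<integral>\<^sup>+v. (if G x v then 1 else 0) \<partial>lborel)"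
      by (subst nn_integral_lborel_shift[of "\<lambda>v. if G x v then 1 else 0" "x\<^sup>2", symmetric]) auto
  qed
  also have "\<dots> = ennreal pi * (\<integral>\<^sup>+x. \<integral>\<^sup>+v. (if G x v then 1 else 0) \<partial>lborel \<partial>lborel)"
    by (rule nn_integral_cmult) (simp add: G_def)
  also have "(\<integral>\<^sup>+x. \<integral>\<^sup>+v. (if G x v then 1 else 0) \<partial>lborel \<partial>lborel) = (\<integral>\<^sup>+v. \<integral>\<^sup>+x. (if G x v then (1::ennreal) else 0) \<partial>lborel \<partial>lborel)"
    by (rule lborel_pair.Fubini') (simp add: G_def case_prod_beta)
  also have "(\<integral>\<^sup>+v. \<integral>\<^sup>+x. (if G x v then (1::ennreal) else 0) \<partial>lborel \<partial>lborel) \<le> (\<integral>\<^sup>+v. ennreal (4 * l * R / P) * indicator {0..M\<^sup>2} v \<partial>lborel)"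
  proof (rule nn_integral_mono)
    fix v :: real
    show "(\<integral>\<^sup>+x. (if G x v then (1::ennreal) else 0) \<partial>lborel) \<le> ennreal (4 * l * R / P) * indicator {0..M\<^sup>2} v"
    proof (cases "v \<in> {0..M\<^sup>2}")
      case False
      then have "\<not> G x v" for x unfolding G_def using assms by (auto simp: real_sqrt_le_iff' dest!: sqrt_le_D)
      then show ?thesis by simp
    next
      case True
      have "(\<integral>\<^sup>+x. (if G x v then (1::ennreal) else 0) \<partial>lborel) = (\<integral>\<^sup>+x. indicator {x. G x v} x \<partial>lborel)"
        by (intro nn_integral_cong) (auto simp: indicator_def)
      also have "\<dots> = emeasure lborel {x. G x v}" by (rule nn_integral_indicator) (simp add: G_def)
      also have "\<dots> \<le> ennreal (2 * (2 * l * R / P))"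
      \<comment> \<open>For a fixed \<open>v\<close> the other distance lies below \<open>R\<close>
        in an interval of length \<open>2 * l\<close>, so its square varies by at most
        \<open>4 * l * R\<close>; division by the slope \<open>2 * P\<close> bounds the spread of
        the axial coordinate.\<close>
      proof (rule emeasure_real_diameter_le)
        show "{x. G x v} \<in> sets borel" by (simp add: G_def)
        show "0 \<le> 2 * l * R / P" using P assms by simp
        fix x y assume xy: "x \<in> {x. G x v}" "y \<in> {x. G x v}"
        define r where "r x = sqrt (P\<^sup>2 - 2 * P * x + v)" for x
        have r2: "(r x)\<^sup>2 = P\<^sup>2 - 2 * P * x + v" "(r y)\<^sup>2 = P\<^sup>2 - 2 * P * y + v"
          using xy by (auto simp: r_def G_def)
        have rr: "0 \<le> r x" "r x \<le> R" "0 \<le> r y" "r y \<le> R" "\<bar>r x - r y\<bar> \<le> 2 * l"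
          using xy by (auto simp: r_def G_def)
        have "(r x)\<^sup>2 - (r y)\<^sup>2 = - (2 * P * (x - y))" unfolding r2 by (simp add: algebra_simps)
        then have "2 * P * \<bar>x - y\<bar> = \<bar>(r x)\<^sup>2 - (r y)\<^sup>2\<bar>" using P by (simp add: abs_mult)
        also have "\<dots> = \<bar>r x - r y\<bar> * (r x + r y)"
          using rr by (simp add: power2_eq_square square_diff_square_factored abs_mult)
        also have "\<dots> \<le> (2 * l) * (2 * R)" using rr assms by (intro mult_mono) auto
        finally show "\<bar>x - y\<bar> \<le> 2 * l * R / P" using P by (simp add: field_simps)
      qed
      finally show ?thesis using True by (simp add: mult.assoc)
    qed
  qed
  also have "\<dots> = ennreal (4 * l * R / P) * ennreal (M\<^sup>2)" by (simp add: nn_integral_cmult_indicator)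
  finally have "emeasure lborel ?A \<le> ennreal pi * (ennreal (4 * l * R / P) * ennreal (M\<^sup>2))"
    by (simp add: mult_left_mono)
  also have "\<dots> = ennreal (pi * (4 * l * R / P * M\<^sup>2))"
  proof -
    have "0 \<le> 4 * l * R / P" using assms P by simp
    then show ?thesis by (simp only: ennreal_mult' pi_ge_zero)
  qed
  also have "\<dots> \<le> ennreal (4 * (4 * l * R / P * M\<^sup>2))"
    using pi_less_4 assms P by (intro ennreal_leI mult_right_mono) auto
  also have "4 * (4 * l * R / P * M\<^sup>2) = 16 * M\<^sup>2 * R * l / norm p" by (simp add: P_def)
  finally show ?thesis .
qed

text \<open>At a fixed \<open>\<xi>\<close> the time frequency lies in the intersection of two
  intervals, whose length is at most twice the smaller radius. The intersection is empty unless the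
  phase is within \<open>l1 + l2\<close> of \<open>\<tau>0\<close>.\<close>

lemma emeasure_slab_le:
  fixes \<xi>0 :: "real^3" and P :: "real^3 \<Rightarrow> bool"
  assumes [measurable]: "Measurable.pred borel P" and "0 \<le> l1" "0 \<le> l2"
  shows "emeasure lborel {x. P (snd x) \<and> \<bar>fst x - \<sigma>1 * norm (snd x)\<bar> \<le> l1 \<and> \<bar>\<tau>0 - fst x - \<sigma>2 * norm (\<xi>0 - snd x)\<bar> \<le> l2}
    \<le> ennreal (2 * min l1 l2) * emeasure lborel {\<xi>. P \<xi> \<and> \<bar>\<sigma>1 * norm \<xi> + \<sigma>2 * norm (\<xi>0 - \<xi>) - \<tau>0\<bar> \<le> l1 + l2}"
proof -
  let ?A = "{x. P (snd x) \<and> \<bar>fst x - \<sigma>1 * norm (snd x)\<bar> \<le> l1 \<and> \<bar>\<tau>0 - fst x - \<sigma>2 * norm (\<xi>0 - snd x)\<bar> \<le> l2}"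
  let ?B = "{\<xi>. P \<xi> \<and> \<bar>\<sigma>1 * norm \<xi> + \<sigma>2 * norm (\<xi>0 - \<xi>) - \<tau>0\<bar> \<le> l1 + l2}"
  have A[measurable]: "?A \<in> sets borel" by measurable
  have B[measurable]: "?B \<in> sets borel" by measurable
  have "emeasure lborel ?A = (\<integral>\<^sup>+x. indicator ?A x \<partial>lborel)" by simp
  also have "\<dots> = (\<integral>\<^sup>+\<xi>. \<integral>\<^sup>+\<tau>. indicator ?A (\<tau>, \<xi>) \<partial>lborel \<partial>lborel)"
    by (rule nn_integral_lborel_pair(2)) measurable
  also have "\<dots> \<le> (\<integral>\<^sup>+\<xi>. ennreal (2 * min l1 l2) * indicator ?B \<xi> \<partial>lborel)"
  proof (rule nn_integral_mono)
    fix \<xi> :: "real^3"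
    show "(\<integral>\<^sup>+\<tau>. indicator ?A (\<tau>, \<xi>) \<partial>lborel) \<le> ennreal (2 * min l1 l2) * indicator ?B \<xi>"
    proof (cases "\<xi> \<in> ?B")
      case False
      then have "(\<tau>, \<xi>) \<notin> ?A" for \<tau> by (auto simp: abs_le_iff)
      then have "indicator ?A (\<tau>, \<xi>) = (0::ennreal)" for \<tau> by (meson indicator_simps(2))
      then have "(\<integral>\<^sup>+\<tau>. indicator ?A (\<tau>, \<xi>) \<partial>lborel) = integral\<^sup>N lborel (\<lambda>_::real. 0)" by (simp only:)
      also have "\<dots> = 0" by simp
      finally show ?thesis by (simp only: zero_le)
    next
      case True
      define c w where "c = (if l1 \<le> l2 then \<sigma>1 * norm \<xi> else \<tau>0 - \<sigma>2 * norm (\<xi>0 - \<xi>))" and "w = min l1 l2"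
      have "(\<integral>\<^sup>+\<tau>. indicator ?A (\<tau>, \<xi>) \<partial>lborel) \<le> (\<integral>\<^sup>+\<tau>. indicator {c - w..c + w} \<tau> \<partial>lborel)"
        by (intro nn_integral_mono) (auto simp: indicator_def c_def w_def abs_le_iff)
      also have "\<dots> = ennreal (2 * w)"
      proof -
        have "0 \<le> w" using assms by (simp add: w_def)
        then show ?thesis by simp
      qed
      also have "\<dots> = ennreal (2 * min l1 l2)" by (simp add: w_def)
      finally show ?thesis using True by simp
    qed
  qed
  also have "\<dots> = ennreal (2 * min l1 l2) * emeasure lborel ?B"
    by (rule nn_integral_cmult_indicator) measurable
  finally show ?thesis .
qed

subsection \<open>Frequency and modulation weights\<close>

lemma emeasure_eq_nn_integral_if:
  assumes "Measurable.pred M P"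
  shows "(\<integral>\<^sup>+x. (if P x then 1 else 0) \<partial>M) = emeasure M {x \<in> space M. P x}"
proof -
  have [measurable]: "{x \<in> space M. P x} \<in> sets M" using assms by simp
  have "(\<integral>\<^sup>+x. (if P x then 1 else 0) \<partial>M) = (\<integral>\<^sup>+x. indicator {x \<in> space M. P x} x \<partial>M)"
    by (intro nn_integral_cong) (auto simp: indicator_def)
  then show ?thesis by simp
qed

section \<open>Integrals of powers of modulation and frequency\<close>

text \<open>The dyadic bound with linear volume growth, which is the growth in a modulation. The
  conditions on \<open>\<gamma>\<close> say that it is an admissible growth exponent for the
  integral of \<open>L powr (- 2 * b)\<close>.\<close>

lemma weight_integral_bound:
  fixes b \<gamma> :: real
  assumes "0 \<le> \<gamma>" "1 - 2 * b \<le> \<gamma>" "\<gamma> = 0 \<Longrightarrow> 1 - 2 * b < 0"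
  obtains C where "0 \<le> C" "\<And>(Q :: 'x::euclidean_space \<Rightarrow> bool) g L \<Lambda> V. Measurable.pred borel Q \<Longrightarrow> g \<in> borel_measurable borel \<Longrightarrow> L \<in> borel_measurable borel \<Longrightarrow>
     (\<And>x. 1 \<le> L x) \<Longrightarrow>
     (\<And>l. 1 \<le> l \<Longrightarrow> l \<le> \<Lambda> \<Longrightarrow> (\<integral>\<^sup>+x. (if Q x \<and> L x \<le> l then g x else 0) \<partial>lborel) \<le> ennreal l * V) \<Longrightarrow>
     (\<integral>\<^sup>+x. (if Q x \<and> L x \<le> \<Lambda> then g x * ennreal (L x powr (- 2 * b)) else 0) \<partial>lborel) \<le> ennreal (C * \<Lambda> powr \<gamma>) * V"
proof -
  have "- 2 * b + 1 \<le> \<gamma>" "\<gamma> = 0 \<Longrightarrow> - 2 * b + 1 < 0" using assms by auto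
  from dyadic_integral_bound[where M = "lborel :: 'x measure", OF assms(1) this zero_le_one]
  obtain C where C: "0 \<le> C" "\<And>(g :: 'x \<Rightarrow> ennreal) N R A. g \<in> borel_measurable lborel \<Longrightarrow> N \<in> borel_measurable lborel \<Longrightarrow> (\<And>x. 1 \<le> N x) \<Longrightarrow>
    (\<And>t. 1 \<le> t \<Longrightarrow> t \<le> R \<Longrightarrow> (\<integral>\<^sup>+x. (if N x \<le> t then g x else 0) \<partial>lborel) \<le> ennreal (t powr 1) * A) \<Longrightarrow>
    (\<integral>\<^sup>+x. (if N x \<le> R then ennreal (N x powr (- 2 * b)) * g x else 0) \<partial>lborel) \<le> ennreal (C * R powr \<gamma>) * A"
    by blast
  show ?thesis
  proof (rule that[OF C(1)])
    fix Q :: "'x \<Rightarrow> bool" and g :: "'x \<Rightarrow> ennreal" and L :: "'x \<Rightarrow> real" and \<Lambda> :: real and V :: ennreal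
    assume [measurable]: "Measurable.pred borel Q" "g \<in> borel_measurable borel" "L \<in> borel_measurable borel"
      and L: "\<And>x. 1 \<le> L x"
      and V: "\<And>l. 1 \<le> l \<Longrightarrow> l \<le> \<Lambda> \<Longrightarrow> (\<integral>\<^sup>+x. (if Q x \<and> L x \<le> l then g x else 0) \<partial>lborel) \<le> ennreal l * V"
    have eq: "(if Q x \<and> L x \<le> l then g x else 0) = (if L x \<le> l then (if Q x then g x else 0) else 0)" for x l by simp
    have "(\<integral>\<^sup>+x. (if L x \<le> \<Lambda> then ennreal (L x powr (- 2 * b)) * (if Q x then g x else 0) else 0) \<partial>lborel) \<le> ennreal (C * \<Lambda> powr \<gamma>) * V"
    proof (rule C(2))
      fix t :: real assume "1 \<le> t" "t \<le> \<Lambda>"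
      then show "(\<integral>\<^sup>+x. (if L x \<le> t then (if Q x then g x else 0) else 0) \<partial>lborel) \<le> ennreal (t powr 1) * V"
        using V[of t] by (simp add: eq)
    qed (use L in auto)
    also have "(\<integral>\<^sup>+x. (if L x \<le> \<Lambda> then ennreal (L x powr (- 2 * b)) * (if Q x then g x else 0) else 0) \<partial>lborel)
       = (\<integral>\<^sup>+x. (if Q x \<and> L x \<le> \<Lambda> then g x * ennreal (L x powr (- 2 * b)) else 0) \<partial>lborel)"
      by (intro nn_integral_cong) (auto simp: mult.commute)
    finally show "(\<integral>\<^sup>+x. (if Q x \<and> L x \<le> \<Lambda> then g x * ennreal (L x powr (- 2 * b)) else 0) \<partial>lborel) \<le> ennreal (C * \<Lambda> powr \<gamma>) * V" .
  qed
qed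

text \<open>The modulation is integrated below each frequency bound, and then the frequency. Because
  the volume hypothesis has product form, the two growth exponents decouple.\<close>

lemma frequency_modulation_integral_bound:
  fixes b \<gamma> \<beta> d \<kappa> :: real
  assumes g: "0 \<le> \<gamma>" "1 - 2 * b \<le> \<gamma>" "\<gamma> = 0 \<Longrightarrow> 1 - 2 * b < 0"
    and k: "0 \<le> \<kappa>" "\<beta> + d \<le> \<kappa>" "\<kappa> = 0 \<Longrightarrow> \<beta> + d < 0" "0 \<le> d"
  obtains C where "0 \<le> C" "\<And>(Q :: 'x::euclidean_space \<Rightarrow> bool) N L R \<Lambda> V. Measurable.pred borel Q \<Longrightarrow> N \<in> borel_measurable borel \<Longrightarrow> L \<in> borel_measurable borel \<Longrightarrow>
     (\<And>x. 1 \<le> N x) \<Longrightarrow> (\<And>x. 1 \<le> L x) \<Longrightarrow> 0 \<le> V \<Longrightarrow>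
     (\<And>m l. 1 \<le> m \<Longrightarrow> m \<le> R \<Longrightarrow> 1 \<le> l \<Longrightarrow> l \<le> \<Lambda> \<Longrightarrow> emeasure lborel {x. Q x \<and> N x \<le> m \<and> L x \<le> l} \<le> ennreal (m powr d * l * V)) \<Longrightarrow>
     (\<integral>\<^sup>+x. (if Q x \<and> N x \<le> R \<and> L x \<le> \<Lambda> then ennreal (N x powr \<beta> * L x powr (- 2 * b)) else 0) \<partial>lborel) \<le> ennreal (C * R powr \<kappa> * \<Lambda> powr \<gamma> * V)"
proof -
  obtain C1 where C1: "0 \<le> C1" "\<And>(Q :: 'x \<Rightarrow> bool) g L \<Lambda> V. Measurable.pred borel Q \<Longrightarrow> g \<in> borel_measurable borel \<Longrightarrow> L \<in> borel_measurable borel \<Longrightarrow>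
     (\<And>x. 1 \<le> L x) \<Longrightarrow>
     (\<And>l. 1 \<le> l \<Longrightarrow> l \<le> \<Lambda> \<Longrightarrow> (\<integral>\<^sup>+x. (if Q x \<and> L x \<le> l then g x else 0) \<partial>lborel) \<le> ennreal l * V) \<Longrightarrow>
     (\<integral>\<^sup>+x. (if Q x \<and> L x \<le> \<Lambda> then g x * ennreal (L x powr (- 2 * b)) else 0) \<partial>lborel) \<le> ennreal (C1 * \<Lambda> powr \<gamma>) * V"
    by (rule weight_integral_bound[OF g]) auto
  obtain C2 where C2: "0 \<le> C2" "\<And>(g :: 'x \<Rightarrow> ennreal) N R A. g \<in> borel_measurable lborel \<Longrightarrow> N \<in> borel_measurable lborel \<Longrightarrow> (\<And>x. 1 \<le> N x) \<Longrightarrow>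
    (\<And>t. 1 \<le> t \<Longrightarrow> t \<le> R \<Longrightarrow> (\<integral>\<^sup>+x. (if N x \<le> t then g x else 0) \<partial>lborel) \<le> ennreal (t powr d) * A) \<Longrightarrow>
    (\<integral>\<^sup>+x. (if N x \<le> R then ennreal (N x powr \<beta>) * g x else 0) \<partial>lborel) \<le> ennreal (C2 * R powr \<kappa>) * A"
    using dyadic_integral_bound[where M = "lborel :: 'x measure", OF k] by blast
  show ?thesis
  proof (rule that[of "C2 * C1"])
    show "0 \<le> C2 * C1" using C1 C2 by simp
    fix Q :: "'x \<Rightarrow> bool" and N L :: "'x \<Rightarrow> real" and R \<Lambda> V :: real
    assume [measurable]: "Measurable.pred borel Q" "N \<in> borel_measurable borel" "L \<in> borel_measurable borel"
      and N: "\<And>x. 1 \<le> N x" and L: "\<And>x. 1 \<le> L x" and V0: "0 \<le> V"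
      and V: "\<And>m l. 1 \<le> m \<Longrightarrow> m \<le> R \<Longrightarrow> 1 \<le> l \<Longrightarrow> l \<le> \<Lambda> \<Longrightarrow> emeasure lborel {x. Q x \<and> N x \<le> m \<and> L x \<le> l} \<le> ennreal (m powr d * l * V)"
    define g where "g x = (if Q x \<and> L x \<le> \<Lambda> then ennreal (L x powr (- 2 * b)) else 0)" for x
    have [measurable]: "g \<in> borel_measurable borel" unfolding g_def by measurable
    have "(\<integral>\<^sup>+x. (if N x \<le> R then ennreal (N x powr \<beta>) * g x else 0) \<partial>lborel) \<le> ennreal (C2 * R powr \<kappa>) * ennreal (C1 * \<Lambda> powr \<gamma> * V)"
    proof (rule C2(2))
      fix t assume t: "1 \<le> t" "t \<le> R"
      have "(\<integral>\<^sup>+x. (if N x \<le> t then g x else 0) \<partial>lborel)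
        = (\<integral>\<^sup>+x. (if (Q x \<and> N x \<le> t) \<and> L x \<le> \<Lambda> then 1 * ennreal (L x powr (- 2 * b)) else 0) \<partial>lborel)"
        by (intro nn_integral_cong) (auto simp: g_def)
      also have "\<dots> \<le> ennreal (C1 * \<Lambda> powr \<gamma>) * ennreal (t powr d * V)"
      proof (rule C1(2))
        fix l assume l: "1 \<le> l" "l \<le> \<Lambda>"
        have "(\<integral>\<^sup>+x. (if (Q x \<and> N x \<le> t) \<and> L x \<le> l then 1 else 0) \<partial>lborel) = emeasure lborel {x. Q x \<and> N x \<le> t \<and> L x \<le> l}"
          by (subst emeasure_eq_nn_integral_if) auto
        also have "\<dots> \<le> ennreal (t powr d * l * V)" by (rule V[OF t l])
        also have "\<dots> = ennreal l * ennreal (t powr d * V)" using l V0 by (subst ennreal_mult'[symmetric]) (auto simp: ac_simps)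
        finally show "(\<integral>\<^sup>+x. (if (Q x \<and> N x \<le> t) \<and> L x \<le> l then 1 else 0) \<partial>lborel) \<le> ennreal l * ennreal (t powr d * V)" .
      qed (use L in auto)
      also have "\<dots> = ennreal (t powr d) * ennreal (C1 * \<Lambda> powr \<gamma> * V)"
        using C1 V0 by (subst (1 2) ennreal_mult'[symmetric]) (auto simp: ac_simps)
      finally show "(\<integral>\<^sup>+x. (if N x \<le> t then g x else 0) \<partial>lborel) \<le> ennreal (t powr d) * ennreal (C1 * \<Lambda> powr \<gamma> * V)" .
    qed (use N in auto)
    also have "\<dots> = ennreal (C2 * C1 * R powr \<kappa> * \<Lambda> powr \<gamma> * V)"
      using C2 C1 V0 by (subst ennreal_mult'[symmetric]) (auto simp: ac_simps)
    also have "(\<integral>\<^sup>+x. (if N x \<le> R then ennreal (N x powr \<beta>) * g x else 0) \<partial>lborel)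
       = (\<integral>\<^sup>+x. (if Q x \<and> N x \<le> R \<and> L x \<le> \<Lambda> then ennreal (N x powr \<beta> * L x powr (- 2 * b)) else 0) \<partial>lborel)"
      by (intro nn_integral_cong) (auto simp: g_def ennreal_mult)
    finally show "(\<integral>\<^sup>+x. (if Q x \<and> N x \<le> R \<and> L x \<le> \<Lambda> then ennreal (N x powr \<beta> * L x powr (- 2 * b)) else 0) \<partial>lborel) \<le> ennreal (C2 * C1 * R powr \<kappa> * \<Lambda> powr \<gamma> * V)" .
  qed
qed

text \<open>The first modulation takes the place of the frequency, with volume exponent 1.\<close>

lemma two_modulations_integral_bound:
  fixes b1 b2 g1 g2 :: real
  assumes g: "0 \<le> g1" "1 - 2 * b1 \<le> g1" "g1 = 0 \<Longrightarrow> 1 - 2 * b1 < 0"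
    "0 \<le> g2" "1 - 2 * b2 \<le> g2" "g2 = 0 \<Longrightarrow> 1 - 2 * b2 < 0"
  obtains C where "0 \<le> C" "\<And>(Q :: 'x::euclidean_space \<Rightarrow> bool) L1 L2 \<Lambda> V. Measurable.pred borel Q \<Longrightarrow> L1 \<in> borel_measurable borel \<Longrightarrow> L2 \<in> borel_measurable borel \<Longrightarrow>
     (\<And>x. 1 \<le> L1 x) \<Longrightarrow> (\<And>x. 1 \<le> L2 x) \<Longrightarrow> 0 \<le> V \<Longrightarrow>
     (\<And>l m. 1 \<le> l \<Longrightarrow> l \<le> \<Lambda> \<Longrightarrow> 1 \<le> m \<Longrightarrow> m \<le> \<Lambda> \<Longrightarrow> emeasure lborel {x. Q x \<and> L1 x \<le> l \<and> L2 x \<le> m} \<le> ennreal (l * m * V)) \<Longrightarrow>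
     (\<integral>\<^sup>+x. (if Q x \<and> L1 x \<le> \<Lambda> \<and> L2 x \<le> \<Lambda> then ennreal (L1 x powr (- 2 * b1) * L2 x powr (- 2 * b2)) else 0) \<partial>lborel) \<le> ennreal (C * \<Lambda> powr (g1 + g2) * V)"
proof -
  have "- 2 * b1 + 1 \<le> g1" "g1 = 0 \<Longrightarrow> - 2 * b1 + 1 < 0" using g by auto
  from frequency_modulation_integral_bound[where 'x = 'x, OF g(4-6) g(1) this zero_le_one]
  obtain C where C: "0 \<le> C" "\<And>(Q :: 'x \<Rightarrow> bool) N L R \<Lambda> V. Measurable.pred borel Q \<Longrightarrow> N \<in> borel_measurable borel \<Longrightarrow> L \<in> borel_measurable borel \<Longrightarrow>
     (\<And>x. 1 \<le> N x) \<Longrightarrow> (\<And>x. 1 \<le> L x) \<Longrightarrow> 0 \<le> V \<Longrightarrow>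
     (\<And>m l. 1 \<le> m \<Longrightarrow> m \<le> R \<Longrightarrow> 1 \<le> l \<Longrightarrow> l \<le> \<Lambda> \<Longrightarrow> emeasure lborel {x. Q x \<and> N x \<le> m \<and> L x \<le> l} \<le> ennreal (m powr 1 * l * V)) \<Longrightarrow>
     (\<integral>\<^sup>+x. (if Q x \<and> N x \<le> R \<and> L x \<le> \<Lambda> then ennreal (N x powr (- 2 * b1) * L x powr (- 2 * b2)) else 0) \<partial>lborel) \<le> ennreal (C * R powr g1 * \<Lambda> powr g2 * V)"
    by blast
  show ?thesis
  proof (rule that[OF C(1)])
    fix Q :: "'x \<Rightarrow> bool" and L1 L2 :: "'x \<Rightarrow> real" and \<Lambda> V :: real
    assume A: "Measurable.pred borel Q" "L1 \<in> borel_measurable borel" "L2 \<in> borel_measurable borel"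
     "\<And>x. 1 \<le> L1 x" "\<And>x. 1 \<le> L2 x" "0 \<le> V"
     "\<And>l m. 1 \<le> l \<Longrightarrow> l \<le> \<Lambda> \<Longrightarrow> 1 \<le> m \<Longrightarrow> m \<le> \<Lambda> \<Longrightarrow> emeasure lborel {x. Q x \<and> L1 x \<le> l \<and> L2 x \<le> m} \<le> ennreal (l * m * V)"
    have "(\<integral>\<^sup>+x. (if Q x \<and> L1 x \<le> \<Lambda> \<and> L2 x \<le> \<Lambda> then ennreal (L1 x powr (- 2 * b1) * L2 x powr (- 2 * b2)) else 0) \<partial>lborel)
      \<le> ennreal (C * \<Lambda> powr g1 * \<Lambda> powr g2 * V)"
      by (rule C(2)) (use A in auto)
    then show "(\<integral>\<^sup>+x. (if Q x \<and> L1 x \<le> \<Lambda> \<and> L2 x \<le> \<Lambda> then ennreal (L1 x powr (- 2 * b1) * L2 x powr (- 2 * b2)) else 0) \<partial>lborel) \<le> ennreal (C * \<Lambda> powr (g1 + g2) * V)"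
      by (simp add: powr_add mult.assoc)
  qed
qed

section \<open>Arithmetic of frequencies and modulations\<close>

text \<open>\<open>NN\<close> and \<open>LL\<close> agree with the Japanese brackets of the norm up
  to constant factors. With \<open>1 +\<close> in place of the square root the triangle inequality
  needs no constants and comparisons are piecewise linear.\<close>

definition NN :: "real \<times> (real^3) \<Rightarrow> real" where "NN x = 1 + norm (snd x)"
definition LL :: "real \<times> (real^3) \<Rightarrow> real" where "LL x = 1 + \<bar>\<bar>fst x\<bar> - norm (snd x)\<bar>"

lemma NN_ge_1 [simp]: "1 \<le> NN x" and LL_ge_1 [simp]: "1 \<le> LL x"
  by (simp_all add: NN_def LL_def)

lemma NN_pos [simp]: "0 < NN x" and LL_pos [simp]: "0 < LL x"
  by (simp_all add: NN_def LL_def add_pos_nonneg)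

lemma borel_measurable_NN [measurable]: "NN \<in> borel_measurable borel"
  and borel_measurable_LL [measurable]: "LL \<in> borel_measurable borel"
  unfolding NN_def[abs_def] LL_def[abs_def] by measurable

lemma NN_add_le: "NN (x + y) \<le> NN x + NN y"
  and NN_le_add: "NN x \<le> NN (x + y) + NN y"
  and NN_le_add': "NN y \<le> NN (x + y) + NN x"
  using norm_triangle_ineq[of "snd x" "snd y"] norm_triangle_ineq4[of "snd x + snd y" "snd y"]
    norm_triangle_ineq4[of "snd x + snd y" "snd x"]
  by (simp_all add: NN_def)

text \<open>Modulations are subadditive up to a defect coming from the signs and the three norms;
  this defect is at most twice the frequency of one input.\<close>

lemma LL_add_le: "LL (x + y) \<le> LL x + LL y + 2 * NN y"
proof -
  define t1 t2 r0 r1 r2 where d: "t1 = fst x" "t2 = fst y" "r0 = norm (snd x + snd y)" "r1 = norm (snd x)" "r2 = norm (snd y)"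
  have "r0 \<le> r1 + r2" "r1 \<le> r0 + r2" "r2 \<le> r0 + r1" "0 \<le> r1" "0 \<le> r2" "0 \<le> r0"
    using norm_triangle_ineq[of "snd x" "snd y"] norm_triangle_ineq4[of "snd x + snd y" "snd y"]
    norm_triangle_ineq4[of "snd x + snd y" "snd x"] by (simp_all add: d)
  then have "\<bar>\<bar>t1 + t2\<bar> - r0\<bar> \<le> \<bar>\<bar>t1\<bar> - r1\<bar> + \<bar>\<bar>t2\<bar> - r2\<bar> + 2 * r2" by arith
  then show ?thesis by (simp add: LL_def NN_def d)
qed

text \<open>At a given frequency the time frequency lies in one of two intervals of length
  \<open>2 * l\<close>, about \<open>norm \<xi>\<close> and about
  \<open>- norm \<xi>\<close>.\<close>

lemma emeasure_modulation_le:
  fixes P :: "real^3 \<Rightarrow> bool"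
  assumes [measurable]: "Measurable.pred borel P" and "1 \<le> l"
  shows "emeasure lborel {x. P (snd x) \<and> LL x \<le> l} \<le> ennreal (4 * l) * emeasure lborel {\<xi>. P \<xi>}"
proof -
  let ?A = "{x. P (snd x) \<and> LL x \<le> l}"
  have [measurable]: "?A \<in> sets borel" by measurable
  have [measurable]: "{\<xi>. P \<xi>} \<in> sets borel" by measurable
  have "emeasure lborel ?A = (\<integral>\<^sup>+x. indicator ?A x \<partial>lborel)" by simp
  also have "\<dots> = (\<integral>\<^sup>+\<xi>. \<integral>\<^sup>+\<tau>. indicator ?A (\<tau>, \<xi>) \<partial>lborel \<partial>lborel)"
    by (rule nn_integral_lborel_pair(2)) measurable
  also have "\<dots> \<le> (\<integral>\<^sup>+\<xi>. ennreal (4 * l) * indicator {\<xi>. P \<xi>} \<xi> \<partial>lborel)"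
  proof (rule nn_integral_mono)
    fix \<xi> :: "real^3"
    show "(\<integral>\<^sup>+\<tau>. indicator ?A (\<tau>, \<xi>) \<partial>lborel) \<le> ennreal (4 * l) * indicator {\<xi>. P \<xi>} \<xi>"
    proof (cases "P \<xi>")
      case True
      let ?r = "norm \<xi>"
      have "(\<integral>\<^sup>+\<tau>. indicator ?A (\<tau>, \<xi>) \<partial>lborel) \<le> (\<integral>\<^sup>+\<tau>. indicator ({?r - l..?r + l} \<union> {- ?r - l..- ?r + l}) \<tau> \<partial>lborel)"
        by (intro nn_integral_mono) (auto simp: indicator_def LL_def abs_le_iff abs_if split: if_splits)
      also have "\<dots> = emeasure lborel ({?r - l..?r + l} \<union> {- ?r - l..- ?r + l})" by simp
      also have "\<dots> \<le> emeasure lborel {?r - l..?r + l} + emeasure lborel {- ?r - l..- ?r + l}"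
        by (rule emeasure_subadditive) auto
      also have "\<dots> = ennreal (4 * l)" using assms(2) by (simp add: ennreal_plus[symmetric] del: ennreal_plus)
      finally show ?thesis using True by simp
    qed simp
  qed
  also have "\<dots> = ennreal (4 * l) * emeasure lborel {\<xi>. P \<xi>}"
    by (rule nn_integral_cmult_indicator) measurable
  finally show ?thesis .
qed

lemma emeasure_frequency_modulation_le:
  assumes "1 \<le> m" "1 \<le> l"
  shows "emeasure lborel {x. 1 + norm (snd x - c) \<le> m \<and> LL x \<le> l} \<le> ennreal (m powr 3 * l * 20)"
proof -
  have "emeasure lborel {x. 1 + norm (snd x - c) \<le> m \<and> LL x \<le> l} \<le> ennreal (4 * l) * emeasure lborel {\<xi>. 1 + norm (\<xi> - c) \<le> m}"
    by (rule emeasure_modulation_le) (use assms in auto)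
  also have "\<dots> \<le> ennreal (4 * l) * ennreal (5 * m ^ 3)"
  proof (intro mult_left_mono)
    have "{\<xi>. 1 + norm (\<xi> - c) \<le> m} \<subseteq> cball c m" by (auto simp: dist_norm norm_minus_commute)
    then have "emeasure lborel {\<xi>. 1 + norm (\<xi> - c) \<le> m} \<le> emeasure lborel (cball c m)" by (rule emeasure_mono) simp
    also have "\<dots> \<le> ennreal (5 * m ^ 3)" using assms by (intro emeasure_cball_le) auto
    finally show "emeasure lborel {\<xi>. 1 + norm (\<xi> - c) \<le> m} \<le> ennreal (5 * m ^ 3)" .
  qed simp
  also have "\<dots> = ennreal (m powr 3 * l * 20)"
    using assms by (subst ennreal_mult'[symmetric]) (auto simp: ac_simps powr_realpow)
  finally show ?thesis .
qed

section \<open>Schur tests with power weights\<close>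

text \<open>With \<open>x\<close> fixed, the squared kernel is a power of a distance in frequency
  times a power of \<open>LL y\<close>. The centre \<open>c x\<close> selects the frequency that is
  meant: 0 gives \<open>NN y\<close>, and \<open>- snd x\<close> gives \<open>NN (x + y)\<close>.
  The factor \<open>A x\<close> has to absorb the growth of the integral up to the constant
  \<open>D\<close>.\<close>

lemma trilinear_bound_fix_first_pointwise:
  fixes k :: "real \<times> (real^3) \<Rightarrow> real \<times> (real^3) \<Rightarrow> real"
  assumes g: "0 \<le> \<gamma>" "1 - 2 * b \<le> \<gamma>" "\<gamma> = 0 \<Longrightarrow> 1 - 2 * b < 0"
    and \<kappa>: "0 \<le> \<kappa>" "\<beta> + 3 \<le> \<kappa>" "\<kappa> = 0 \<Longrightarrow> \<beta> + 3 < 0"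
    and km: "(\<lambda>p. k (fst p) (snd p)) \<in> borel_measurable (borel \<Otimes>\<^sub>M borel)"
    and G: "Measurable.pred (borel \<Otimes>\<^sub>M borel) (\<lambda>p. G (fst p) (snd p))"
    and le: "\<And>x y. G x y \<Longrightarrow> 1 + norm (snd y - c x) \<le> R x \<and> LL y \<le> \<Lambda> x \<and>
      (k x y)\<^sup>2 \<le> A x * ((1 + norm (snd y - c x)) powr \<beta> * LL y powr (- 2 * b))"
    and A0: "\<And>x. 0 \<le> A x" and D: "\<And>x. A x * (R x powr \<kappa> * \<Lambda> x powr \<gamma>) \<le> D"
  shows "trilinear_bound (\<lambda>x y. if G x y then ennreal (k x y) else 0)"
proof -
  obtain C where C: "0 \<le> C" "\<And>(Q :: real \<times> (real^3) \<Rightarrow> bool) N L R \<Lambda> V. Measurable.pred borel Q \<Longrightarrow> N \<in> borel_measurable borel \<Longrightarrow> L \<in> borel_measurable borel \<Longrightarrow>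
     (\<And>x. 1 \<le> N x) \<Longrightarrow> (\<And>x. 1 \<le> L x) \<Longrightarrow> 0 \<le> V \<Longrightarrow>
     (\<And>m l. 1 \<le> m \<Longrightarrow> m \<le> R \<Longrightarrow> 1 \<le> l \<Longrightarrow> l \<le> \<Lambda> \<Longrightarrow> emeasure lborel {x. Q x \<and> N x \<le> m \<and> L x \<le> l} \<le> ennreal (m powr 3 * l * V)) \<Longrightarrow>
     (\<integral>\<^sup>+x. (if Q x \<and> N x \<le> R \<and> L x \<le> \<Lambda> then ennreal (N x powr \<beta> * L x powr (- 2 * b)) else 0) \<partial>lborel) \<le> ennreal (C * R powr \<kappa> * \<Lambda> powr \<gamma> * V)"
    by (rule frequency_modulation_integral_bound[OF g \<kappa>, where 'x = "real \<times> (real^3)"]) auto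
  show ?thesis
  proof (rule trilinear_bound_fix_first[where C = "C * D * 20"])
    show "(\<lambda>(x, y). if G x y then ennreal (k x y) else 0) \<in> borel_measurable borel"
    proof (rule borel_measurable_pairI)
      note km[measurable] G[measurable]
      show "(\<lambda>(x, y). if G x y then ennreal (k x y) else 0) \<in> borel_measurable (borel \<Otimes>\<^sub>M borel)"
        unfolding case_prod_beta by measurable
    qed
    fix x :: "real \<times> (real^3)"
    let ?N = "\<lambda>y::real \<times> (real^3). 1 + norm (snd y - c x)"
    have "(\<integral>\<^sup>+y. (if G x y then ennreal (k x y) else 0)\<^sup>2 \<partial>lborel)
      \<le> (\<integral>\<^sup>+y. ennreal (A x) * (if True \<and> ?N y \<le> R x \<and> LL y \<le> \<Lambda> x then ennreal (?N y powr \<beta> * LL y powr (- 2 * b)) else 0) \<partial>lborel)"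
    proof (rule nn_integral_mono)
      fix y
      show "(if G x y then ennreal (k x y) else 0)\<^sup>2 \<le> ennreal (A x) * (if True \<and> ?N y \<le> R x \<and> LL y \<le> \<Lambda> x then ennreal (?N y powr \<beta> * LL y powr (- 2 * b)) else 0)"
      proof (cases "G x y")
        case True
        have "(ennreal (k x y))\<^sup>2 \<le> ennreal ((k x y)\<^sup>2)"
          by (cases "0 \<le> k x y") (auto simp: ennreal_power ennreal_neg)
        also have "\<dots> \<le> ennreal (A x * (?N y powr \<beta> * LL y powr (- 2 * b)))" using le[OF True] by (intro ennreal_leI) auto
        also have "\<dots> = ennreal (A x) * ennreal (?N y powr \<beta> * LL y powr (- 2 * b))" by (rule ennreal_mult'[OF A0])
        finally show ?thesis using True le[OF True] by simp
      qed simp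
    qed
    also have "\<dots> = ennreal (A x) * (\<integral>\<^sup>+y. (if True \<and> ?N y \<le> R x \<and> LL y \<le> \<Lambda> x then ennreal (?N y powr \<beta> * LL y powr (- 2 * b)) else 0) \<partial>lborel)"
      by (rule nn_integral_cmult) measurable
    also have "\<dots> \<le> ennreal (A x) * ennreal (C * R x powr \<kappa> * \<Lambda> x powr \<gamma> * 20)"
    proof (intro mult_left_mono C(2))
      fix m l :: real assume "1 \<le> m" "1 \<le> l"
      then show "emeasure lborel {y. True \<and> ?N y \<le> m \<and> LL y \<le> l} \<le> ennreal (m powr 3 * l * 20)"
        using emeasure_frequency_modulation_le[of m l "c x"] by simp
    qed auto
    also have "\<dots> = ennreal (A x * (C * R x powr \<kappa> * \<Lambda> x powr \<gamma> * 20))" by (rule ennreal_mult'[OF A0, symmetric])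
    also have "\<dots> \<le> ennreal (C * D * 20)"
    proof (rule ennreal_leI)
      have "C * (A x * (R x powr \<kappa> * \<Lambda> x powr \<gamma>)) \<le> C * D" by (rule mult_left_mono[OF D C(1)])
      then show "A x * (C * R x powr \<kappa> * \<Lambda> x powr \<gamma> * 20) \<le> C * D * 20" by (simp add: ac_simps)
    qed
    finally show "(\<integral>\<^sup>+y. (if G x y then ennreal (k x y) else 0)\<^sup>2 \<partial>lborel) \<le> ennreal (C * D * 20)" .
  qed
qed

text \<open>With \<open>z = x + y\<close> fixed, \<open>NN y\<close> is one plus the distance of
  \<open>snd x\<close> from \<open>snd z\<close>. So the frequency of one input and the modulation
  of the other become weights in the single variable \<open>x\<close>, with a volume of product
  form.\<close>

lemma trilinear_bound_fix_sum_pointwise: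
  fixes k :: "real \<times> (real^3) \<Rightarrow> real \<times> (real^3) \<Rightarrow> real"
  assumes g: "0 \<le> \<gamma>" "1 - 2 * b \<le> \<gamma>" "\<gamma> = 0 \<Longrightarrow> 1 - 2 * b < 0"
    and \<kappa>: "0 \<le> \<kappa>" "\<beta> + 3 \<le> \<kappa>" "\<kappa> = 0 \<Longrightarrow> \<beta> + 3 < 0"
    and km: "(\<lambda>p. k (fst p) (snd p)) \<in> borel_measurable (borel \<Otimes>\<^sub>M borel)"
    and G: "Measurable.pred (borel \<Otimes>\<^sub>M borel) (\<lambda>p. G (fst p) (snd p))"
    and le: "\<And>x y. G x y \<Longrightarrow> NN y \<le> R (x + y) \<and> LL x \<le> \<Lambda> (x + y) \<and>
      (k x y)\<^sup>2 \<le> A (x + y) * (NN y powr \<beta> * LL x powr (- 2 * b))"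
    and A0: "\<And>x. 0 \<le> A x" and D: "\<And>x. A x * (R x powr \<kappa> * \<Lambda> x powr \<gamma>) \<le> D"
  shows "trilinear_bound (\<lambda>x y. if G x y then ennreal (k x y) else 0)"
proof -
  obtain C where C: "0 \<le> C" "\<And>(Q :: real \<times> (real^3) \<Rightarrow> bool) N L R \<Lambda> V. Measurable.pred borel Q \<Longrightarrow> N \<in> borel_measurable borel \<Longrightarrow> L \<in> borel_measurable borel \<Longrightarrow>
     (\<And>x. 1 \<le> N x) \<Longrightarrow> (\<And>x. 1 \<le> L x) \<Longrightarrow> 0 \<le> V \<Longrightarrow>
     (\<And>m l. 1 \<le> m \<Longrightarrow> m \<le> R \<Longrightarrow> 1 \<le> l \<Longrightarrow> l \<le> \<Lambda> \<Longrightarrow> emeasure lborel {x. Q x \<and> N x \<le> m \<and> L x \<le> l} \<le> ennreal (m powr 3 * l * V)) \<Longrightarrow>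
     (\<integral>\<^sup>+x. (if Q x \<and> N x \<le> R \<and> L x \<le> \<Lambda> then ennreal (N x powr \<beta> * L x powr (- 2 * b)) else 0) \<partial>lborel) \<le> ennreal (C * R powr \<kappa> * \<Lambda> powr \<gamma> * V)"
    by (rule frequency_modulation_integral_bound[OF g \<kappa>, where 'x = "real \<times> (real^3)"]) auto
  show ?thesis
  proof (rule trilinear_bound_fix_sum[where C = "C * D * 20"])
    show "(\<lambda>(x, y). if G x y then ennreal (k x y) else 0) \<in> borel_measurable borel"
    proof (rule borel_measurable_pairI)
      note km[measurable] G[measurable]
      show "(\<lambda>(x, y). if G x y then ennreal (k x y) else 0) \<in> borel_measurable (borel \<Otimes>\<^sub>M borel)"
        unfolding case_prod_beta by measurable
    qed
    fix z :: "real \<times> (real^3)"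
    let ?N = "\<lambda>x::real \<times> (real^3). 1 + norm (snd x - snd z)"
    have N: "NN (z - x) = ?N x" for x by (simp add: NN_def norm_minus_commute)
    have "(\<integral>\<^sup>+x. (if G x (z - x) then ennreal (k x (z - x)) else 0)\<^sup>2 \<partial>lborel)
      \<le> (\<integral>\<^sup>+x. ennreal (A z) * (if True \<and> ?N x \<le> R z \<and> LL x \<le> \<Lambda> z then ennreal (?N x powr \<beta> * LL x powr (- 2 * b)) else 0) \<partial>lborel)"
    proof (rule nn_integral_mono)
      fix x
      show "(if G x (z - x) then ennreal (k x (z - x)) else 0)\<^sup>2 \<le> ennreal (A z) * (if True \<and> ?N x \<le> R z \<and> LL x \<le> \<Lambda> z then ennreal (?N x powr \<beta> * LL x powr (- 2 * b)) else 0)"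
      proof (cases "G x (z - x)")
        case True
        note l = le[OF True, unfolded N]
        have "(ennreal (k x (z - x)))\<^sup>2 \<le> ennreal ((k x (z - x))\<^sup>2)"
          by (cases "0 \<le> k x (z - x)") (auto simp: ennreal_power ennreal_neg)
        also have "\<dots> \<le> ennreal (A z * (?N x powr \<beta> * LL x powr (- 2 * b)))" using l by (intro ennreal_leI) simp
        also have "\<dots> = ennreal (A z) * ennreal (?N x powr \<beta> * LL x powr (- 2 * b))" by (rule ennreal_mult'[OF A0])
        finally show ?thesis using True l by simp
      qed simp
    qed
    also have "\<dots> = ennreal (A z) * (\<integral>\<^sup>+x. (if True \<and> ?N x \<le> R z \<and> LL x \<le> \<Lambda> z then ennreal (?N x powr \<beta> * LL x powr (- 2 * b)) else 0) \<partial>lborel)"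
      by (rule nn_integral_cmult) measurable
    also have "\<dots> \<le> ennreal (A z) * ennreal (C * R z powr \<kappa> * \<Lambda> z powr \<gamma> * 20)"
    proof (intro mult_left_mono C(2))
      fix m l :: real assume "1 \<le> m" "1 \<le> l"
      then show "emeasure lborel {y. True \<and> ?N y \<le> m \<and> LL y \<le> l} \<le> ennreal (m powr 3 * l * 20)"
        using emeasure_frequency_modulation_le[of m l "snd z"] by simp
    qed auto
    also have "\<dots> = ennreal (A z * (C * R z powr \<kappa> * \<Lambda> z powr \<gamma> * 20))" by (rule ennreal_mult'[OF A0, symmetric])
    also have "\<dots> \<le> ennreal (C * D * 20)"
    proof (rule ennreal_leI)
      have "C * (A z * (R z powr \<kappa> * \<Lambda> z powr \<gamma>)) \<le> C * D" by (rule mult_left_mono[OF D C(1)])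
      then show "A z * (C * R z powr \<kappa> * \<Lambda> z powr \<gamma> * 20) \<le> C * D * 20" by (simp add: ac_simps)
    qed
    finally show "(\<integral>\<^sup>+x. (if G x (z - x) then ennreal (k x (z - x)) else 0)\<^sup>2 \<partial>lborel) \<le> ennreal (C * D * 20)" .
  qed
qed

text \<open>Products of powers are compared through their logarithms, where the estimates are
  linear; summands such as \<open>ln 18\<close> record comparabilities with constants.\<close>

lemma ln_le_ln_add:
  assumes "0 < x" "0 < y" "0 < c" "x \<le> c * y"
  shows "ln x \<le> ln c + ln (y::real)"
  using assms by (metis ln_mult_pos ln_le_cancel_iff mult_pos_pos)

text \<open>For exponents of unknown sign: a two-sided comparison of logarithms costs only the
  absolute value of the exponent.\<close>

lemma mult_le_abs_mult:
  fixes p u l :: real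
  assumes "\<bar>u\<bar> \<le> l" shows "p * u \<le> \<bar>p\<bar> * l"
proof -
  have "p * u \<le> \<bar>p\<bar> * \<bar>u\<bar>" using abs_ge_self[of "p * u"] by (simp add: abs_mult)
  also have "\<dots> \<le> \<bar>p\<bar> * l" by (intro mult_left_mono assms) simp
  finally show ?thesis .
qed

lemma powr_eq_exp: "0 < x \<Longrightarrow> x powr p = exp (p * ln (x::real))"
  by (simp add: powr_def)

text \<open>The value 0 counts as positive, so every pair of time frequencies has a definite sign
  pattern, in agreement with the boolean signs of the two cone sheets.\<close>

definition opposite_signs :: "real \<times> (real^3) \<Rightarrow> real \<times> (real^3) \<Rightarrow> bool" where
  "opposite_signs x y \<longleftrightarrow> (0 \<le> fst x) \<noteq> (0 \<le> fst y)"

lemma pred_opposite_signs [measurable]: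
  "Measurable.pred (borel \<Otimes>\<^sub>M borel) (\<lambda>p. opposite_signs (fst p) (snd p))"
  unfolding opposite_signs_def by measurable

text \<open>For opposite signs the absolute values of the time frequencies subtract, and the defect
  is bounded by the output frequency instead of twice an input frequency.\<close>

lemma LL_add_le_opposite:
  assumes "opposite_signs x y"
  shows "LL (x + y) \<le> LL x + LL y + NN (x + y)"
proof -
  define t1 t2 r0 r1 r2 where d: "t1 = fst x" "t2 = fst y" "r0 = norm (snd x + snd y)" "r1 = norm (snd x)" "r2 = norm (snd y)"
  have "r0 \<le> r1 + r2" "r1 \<le> r0 + r2" "r2 \<le> r0 + r1" "0 \<le> r1" "0 \<le> r2" "0 \<le> r0"
    using norm_triangle_ineq[of "snd x" "snd y"] norm_triangle_ineq4[of "snd x + snd y" "snd y"]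
    norm_triangle_ineq4[of "snd x + snd y" "snd x"] by (simp_all add: d)
  moreover have "(0 \<le> t1 \<and> t2 < 0) \<or> (t1 < 0 \<and> 0 \<le> t2)" using assms by (auto simp: opposite_signs_def d)
  ultimately have "\<bar>\<bar>t1 + t2\<bar> - r0\<bar> \<le> \<bar>\<bar>t1\<bar> - r1\<bar> + \<bar>\<bar>t2\<bar> - r2\<bar> + r0" by arith
  then show ?thesis by (simp add: LL_def NN_def d)
qed

text \<open>As \<open>LL y\<close> is large compared with \<open>NN y\<close>, it is about
  \<open>\<bar>fst y\<bar>\<close>, while the other two time frequencies are, in absolute value,
  close to the norms of \<open>snd x\<close> and \<open>snd (x + y)\<close>. These norms differ by
  at most \<open>norm (snd y)\<close>, so \<open>\<bar>fst y\<bar>\<close> cannot be a difference of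
  the two absolute values; it is their sum, about twice the output frequency.\<close>

lemma LL_high_modulation:
  assumes "16 * LL x \<le> LL y" "16 * NN y \<le> LL y" "8 * LL (x + y) < LL y"
  shows "NN (x + y) \<le> LL y" "LL y \<le> 3 * NN (x + y)"
proof -
  define t1 t2 r0 r1 r2 where d: "t1 = fst x" "t2 = fst y" "r0 = norm (snd x + snd y)" "r1 = norm (snd x)" "r2 = norm (snd y)"
  have "r0 \<le> r1 + r2" "r1 \<le> r0 + r2" "r2 \<le> r0 + r1" "0 \<le> r1" "0 \<le> r2" "0 \<le> r0"
    using norm_triangle_ineq[of "snd x" "snd y"] norm_triangle_ineq4[of "snd x + snd y" "snd y"]
    norm_triangle_ineq4[of "snd x + snd y" "snd x"] by (simp_all add: d)
  moreover have "16 * (1 + \<bar>\<bar>t1\<bar> - r1\<bar>) \<le> 1 + \<bar>\<bar>t2\<bar> - r2\<bar>" "16 * (1 + r2) \<le> 1 + \<bar>\<bar>t2\<bar> - r2\<bar>"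
    "8 * (1 + \<bar>\<bar>t1 + t2\<bar> - r0\<bar>) < 1 + \<bar>\<bar>t2\<bar> - r2\<bar>"
    using assms by (simp_all add: LL_def NN_def d)
  moreover define p0 p1 p2 where p: "p0 = \<bar>t1 + t2\<bar>" "p1 = \<bar>t1\<bar>" "p2 = \<bar>t2\<bar>"
  ultimately have "1 + r0 \<le> 1 + \<bar>p2 - r2\<bar> \<and> 1 + \<bar>p2 - r2\<bar> \<le> 3 * (1 + r0)"
  proof -
    assume A: "r0 \<le> r1 + r2" "r1 \<le> r0 + r2" "r2 \<le> r0 + r1" "0 \<le> r1" "0 \<le> r2" "0 \<le> r0"
      "16 * (1 + \<bar>\<bar>t1\<bar> - r1\<bar>) \<le> 1 + \<bar>\<bar>t2\<bar> - r2\<bar>" "16 * (1 + r2) \<le> 1 + \<bar>\<bar>t2\<bar> - r2\<bar>"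
      "8 * (1 + \<bar>\<bar>t1 + t2\<bar> - r0\<bar>) < 1 + \<bar>\<bar>t2\<bar> - r2\<bar>"
    have "p0 = p1 + p2 \<or> p0 = p1 - p2 \<or> p0 = p2 - p1" unfolding p by arith
    moreover have "0 \<le> p0" "0 \<le> p1" "0 \<le> p2" unfolding p by simp_all
    moreover define A0 A1 A2 where e: "A0 = \<bar>p0 - r0\<bar>" "A1 = \<bar>p1 - r1\<bar>" "A2 = \<bar>p2 - r2\<bar>"
    moreover have "A2 = p2 - r2 \<or> A2 = r2 - p2" "p0 - r0 \<le> A0" "r0 - p0 \<le> A0" "p1 - r1 \<le> A1" "r1 - p1 \<le> A1"
      unfolding e by arith+
    ultimately show ?thesis using A unfolding p[symmetric] e[symmetric]
      by (smt (verit))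
  qed
  then show "NN (x + y) \<le> LL y" "LL y \<le> 3 * NN (x + y)" by (simp_all add: LL_def NN_def d p)
qed

subsection \<open>Interactions fixed by the largest modulation\<close>

text \<open>Here \<open>a = - b0\<close>, and \<open>gi\<close> is the growth exponent of the integral of \<open>L powr (- 2 * bi)\<close> over
  \<open>L \<le> t\<close>; logarithms at \<open>bi = 1/2\<close> are absorbed by taking \<open>gi\<close> slightly positive.\<close>

locale wave_exponents =
  fixes a s0 s1 s2 b1 b2 g1 g2 :: real
  assumes a_pos: "0 < a" and b_ge: "a \<le> b1" "a \<le> b2"
    and g1: "0 \<le> g1" "1 - 2 * b1 \<le> g1" "g1 = 0 \<Longrightarrow> 1 - 2 * b1 < 0"
    and g2: "0 \<le> g2" "1 - 2 * b2 \<le> g2" "g2 = 0 \<Longrightarrow> 1 - 2 * b2 < 0"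
    and total: "2 + 2 * a + g1 + g2 \<le> 2 * (s0 + s1 + s2)"
    and total_eq: "2 + 2 * a + g1 + g2 = 2 * (s0 + s1 + s2) \<Longrightarrow> a < s1 + s2 \<and> 0 < s0 + s1 \<and> 0 < s0 + s2"
    and tail: "2 * a - 2 * b1 + g2 \<le> 0" "2 * a - 2 * b2 + g1 \<le> 0"
    and pairs: "a \<le> s1 + s2" "0 \<le> s0 + s1" "0 \<le> s0 + s2"
    and low: "3 / 2 + a \<le> s0 + 2 * (s1 + s2)"
    and low_eq: "1 + 2 * a - 2 * s0 + 2 * (g1 + g2) = 0 \<Longrightarrow> 3 / 2 + a < s0 + 2 * (s1 + s2)"
begin

definition K :: "real \<times> (real^3) \<Rightarrow> real \<times> (real^3) \<Rightarrow> real" where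
  "K x y = NN (x + y) powr (- s0) * LL (x + y) powr a * (NN x powr (- s1) * LL x powr (- b1)) * (NN y powr (- s2) * LL y powr (- b2))"

lemma K_nonneg: "0 \<le> K x y"
  by (simp add: K_def)

lemma K_measurable [measurable]: "(\<lambda>p. K (fst p) (snd p)) \<in> borel_measurable (borel \<Otimes>\<^sub>M borel)"
  unfolding K_def by measurable

text \<open>The exponent is a linear form in six logarithms. In each region it is bounded by
  inserting the comparisons that hold there.\<close>

lemma K_square: "(K x y)\<^sup>2 = exp (- 2 * s0 * ln (NN (x + y)) + 2 * a * ln (LL (x + y)) - 2 * s1 * ln (NN x)
    - 2 * b1 * ln (LL x) - 2 * s2 * ln (NN y) - 2 * b2 * ln (LL y))"
  by (simp add: K_def powr_eq_exp mult_exp_exp exp_double[symmetric] algebra_simps)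

text \<open>Since \<open>g1\<close> is at least \<open>1 - 2 * b1\<close>, \<open>total\<close> also
  covers the situation in which the decay in one modulation is used pointwise instead of being
  integrated.\<close>

lemma total1: "3 + 2 * a - 2 * b1 + g2 \<le> 2 * (s0 + s1 + s2)"
  and total2: "3 + 2 * a - 2 * b2 + g1 \<le> 2 * (s0 + s1 + s2)"
  using total g1(2) g2(2) by linarith+

text \<open>Equality in the derived condition forces equality in \<open>total\<close>, whose
  exceptional clause then supplies strict pair conditions. This is what is required when a dyadic
  growth exponent vanishes.\<close>

lemma total_eq1: "3 + 2 * a - 2 * b1 + g2 < 2 * (s0 + s1 + s2) \<or> (a < s1 + s2 \<and> 0 < s0 + s1 \<and> 0 < s0 + s2)"
  and total_eq2: "3 + 2 * a - 2 * b2 + g1 < 2 * (s0 + s1 + s2) \<or> (a < s1 + s2 \<and> 0 < s0 + s1 \<and> 0 < s0 + s2)"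
  using total total_eq g1(2) g2(2) by (smt (verit))+

section \<open>One low input frequency\<close>

text \<open>Here \<open>LL x\<close> controls the other modulations. By \<open>tail\<close>, the
  power of \<open>LL x\<close> left after reserving \<open>g2\<close> for the integration in
  \<open>LL y\<close> is nonpositive and may be traded for the same power of the smaller
  \<open>NN y\<close>. What remains is an integral over a frequency ball.\<close>

lemma trilinear_bound_low_second_first_modulation:
  "trilinear_bound (\<lambda>x y. if NN y \<le> NN x \<and> NN x \<le> 18 * NN (x + y) \<and> NN y \<le> LL x \<and> LL y \<le> 16 * LL x
     then ennreal (K x y) else 0)"
proof (rule trilinear_bound_fix_first_pointwise[where c = "\<lambda>_. 0" and R = NN and \<Lambda> = "\<lambda>x. 16 * LL x"
    and \<beta> = "2 * a - 2 * b1 + g2 - 2 * s2" and \<kappa> = "2 * (s0 + s1)" and \<gamma> = g2 and b = b2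
    and A = "\<lambda>x. exp (\<bar>2 * s0\<bar> * ln 18 + 2 * a * ln 19) * exp (- 2 * (s0 + s1) * ln (NN x) - g2 * ln (LL x))"
    and D = "exp (\<bar>2 * s0\<bar> * ln 18 + 2 * a * ln 19 + g2 * ln 16)"])
  show "0 \<le> g2" "1 - 2 * b2 \<le> g2" "g2 = 0 \<Longrightarrow> 1 - 2 * b2 < 0" by (fact g2)+
  show "0 \<le> 2 * (s0 + s1)" "2 * a - 2 * b1 + g2 - 2 * s2 + 3 \<le> 2 * (s0 + s1)"
    "2 * (s0 + s1) = 0 \<Longrightarrow> 2 * a - 2 * b1 + g2 - 2 * s2 + 3 < 0"
    using pairs total1 total_eq1 by (smt (verit))+
  show "(\<lambda>p. K (fst p) (snd p)) \<in> borel_measurable (borel \<Otimes>\<^sub>M borel)" by (rule K_measurable)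
  show "Measurable.pred (borel \<Otimes>\<^sub>M borel) (\<lambda>p. NN (snd p) \<le> NN (fst p) \<and> NN (fst p) \<le> 18 * NN ((fst p) + (snd p)) \<and> NN (snd p) \<le> LL (fst p) \<and> LL (snd p) \<le> 16 * LL (fst p))"
    by measurable
  fix x y :: "real \<times> (real^3)"
  assume H: "NN y \<le> NN x \<and> NN x \<le> 18 * NN (x + y) \<and> NN y \<le> LL x \<and> LL y \<le> 16 * LL x"
  have N: "1 + norm (snd y - 0) = NN y" by (simp add: NN_def)
  have "NN (x + y) \<le> 18 * NN x" using NN_add_le[of x y] H NN_ge_1[of x] by linarith
  then have n0: "\<bar>ln (NN x) - ln (NN (x + y))\<bar> \<le> ln 18"
    using H ln_le_ln_add[of "NN (x + y)" "NN x" 18] ln_le_ln_add[of "NN x" "NN (x + y)" 18] by simp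
  \<comment> \<open>The summands are 1 for \<open>LL x\<close>, 16 for \<open>LL y\<close> and 2 for
    \<open>NN y\<close>.\<close>
  have "LL (x + y) \<le> 19 * LL x" using LL_add_le[of x y] H by linarith
  then have l0: "ln (LL (x + y)) \<le> ln 19 + ln (LL x)" by (intro ln_le_ln_add) auto
  have m: "ln (NN y) \<le> ln (LL x)" using H by simp
  have 1: "2 * s0 * (ln (NN x) - ln (NN (x + y))) \<le> \<bar>2 * s0\<bar> * ln 18" by (rule mult_le_abs_mult[OF n0])
  have 2: "2 * a * ln (LL (x + y)) \<le> 2 * a * (ln 19 + ln (LL x))" using a_pos l0 by (intro mult_left_mono) auto
  have 3: "(2 * a - 2 * b1 + g2) * ln (LL x) \<le> (2 * a - 2 * b1 + g2) * ln (NN y)"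
    by (rule mult_left_mono_neg[OF m tail(1)])
  have "(K x y)\<^sup>2 \<le> exp (\<bar>2 * s0\<bar> * ln 18 + 2 * a * ln 19) * exp (- 2 * (s0 + s1) * ln (NN x) - g2 * ln (LL x)) *
      (NN y powr (2 * a - 2 * b1 + g2 - 2 * s2) * LL y powr (- 2 * b2))"
    unfolding K_square powr_eq_exp[OF NN_pos] powr_eq_exp[OF LL_pos] mult_exp_exp exp_le_cancel_iff
    using 1 2 3 by (simp add: algebra_simps)
  then show "1 + norm (snd y - 0) \<le> NN x \<and> LL y \<le> 16 * LL x \<and> (K x y)\<^sup>2 \<le>
      exp (\<bar>2 * s0\<bar> * ln 18 + 2 * a * ln 19) * exp (- 2 * (s0 + s1) * ln (NN x) - g2 * ln (LL x)) *
      ((1 + norm (snd y - 0)) powr (2 * a - 2 * b1 + g2 - 2 * s2) * LL y powr (- 2 * b2))"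
    unfolding N using H by blast
next
  fix x :: "real \<times> (real^3)"
  have l: "ln (16 * LL x) = ln 16 + ln (LL x)" by (rule ln_mult_pos) auto
  show "exp (\<bar>2 * s0\<bar> * ln 18 + 2 * a * ln 19) * exp (- 2 * (s0 + s1) * ln (NN x) - g2 * ln (LL x)) *
    (NN x powr (2 * (s0 + s1)) * (16 * LL x) powr g2) \<le> exp (\<bar>2 * s0\<bar> * ln 18 + 2 * a * ln 19 + g2 * ln 16)"
    unfolding powr_eq_exp[OF NN_pos] powr_eq_exp[OF mult_pos_pos[OF zero_less_numeral LL_pos]] l mult_exp_exp
    by (simp add: algebra_simps)
qed simp

text \<open>Such a modulation \<open>LL y\<close> forces the output modulation or the output frequency to be comparable
  to it; these are the two choices of \<open>\<mu>\<close>.\<close>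

lemma trilinear_bound_low_second_own_modulation:
  assumes \<mu>: "\<mu> = LL \<or> \<mu> = NN"
  shows "trilinear_bound (\<lambda>x y. if NN y \<le> NN x \<and> NN x \<le> 18 * NN (x + y) \<and> 16 * NN y \<le> LL y \<and> 16 * LL x \<le> LL y \<and>
      \<mu> (x + y) \<le> 2 * LL y \<and> LL y \<le> 8 * \<mu> (x + y)
     then ennreal (K x y) else 0)"
proof (rule trilinear_bound_fix_sum_pointwise[where R = "\<lambda>z. 18 * NN z" and \<Lambda> = "\<lambda>z. 8 * \<mu> z"
    and \<beta> = "2 * a - 2 * b2 + g1 - 2 * s2" and \<kappa> = "2 * (s0 + s1)" and \<gamma> = g1 and b = b1
    and A = "\<lambda>z. exp (\<bar>2 * s1\<bar> * ln 18 + 2 * a * ln 2 + g1 * ln 2) * exp (- 2 * (s0 + s1) * ln (NN z) - g1 * ln (\<mu> z))"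
    and D = "exp (\<bar>2 * s1\<bar> * ln 18 + 2 * a * ln 2 + g1 * ln 2 + 2 * (s0 + s1) * ln 18 + g1 * ln 8)"])
  have lp[simp]: "0 < \<mu> z" for z using \<mu> by auto
  have [measurable]: "\<mu> \<in> borel_measurable borel" using \<mu> by auto
  show "0 \<le> g1" "1 - 2 * b1 \<le> g1" "g1 = 0 \<Longrightarrow> 1 - 2 * b1 < 0" by (fact g1)+
  show "0 \<le> 2 * (s0 + s1)" "2 * a - 2 * b2 + g1 - 2 * s2 + 3 \<le> 2 * (s0 + s1)"
    "2 * (s0 + s1) = 0 \<Longrightarrow> 2 * a - 2 * b2 + g1 - 2 * s2 + 3 < 0"
    using pairs total2 total_eq2 by (smt (verit))+
  show "Measurable.pred (borel \<Otimes>\<^sub>M borel) (\<lambda>p. NN (snd p) \<le> NN (fst p) \<and> NN (fst p) \<le> 18 * NN (fst p + snd p) \<and>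
     16 * NN (snd p) \<le> LL (snd p) \<and> 16 * LL (fst p) \<le> LL (snd p) \<and>
      \<mu> (fst p + snd p) \<le> 2 * LL (snd p) \<and> LL (snd p) \<le> 8 * \<mu> (fst p + snd p))" by measurable
  show "(\<lambda>p. K (fst p) (snd p)) \<in> borel_measurable (borel \<Otimes>\<^sub>M borel)" by (rule K_measurable)
  fix x y :: "real \<times> (real^3)"
  let ?z = "x + y"
  assume H: "NN y \<le> NN x \<and> NN x \<le> 18 * NN ?z \<and> 16 * NN y \<le> LL y \<and> 16 * LL x \<le> LL y \<and>
     \<mu> ?z \<le> 2 * LL y \<and> LL y \<le> 8 * \<mu> ?z"
  have "NN ?z \<le> 18 * NN x" using NN_add_le[of x y] H NN_ge_1[of x] by linarith
  then have n0: "\<bar>ln (NN ?z) - ln (NN x)\<bar> \<le> ln 18"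
    using H ln_le_ln_add[of "NN ?z" "NN x" 18] ln_le_ln_add[of "NN x" "NN ?z" 18] by simp
  have "LL ?z \<le> 2 * LL y" using LL_add_le[of x y] H by linarith
  then have l0: "ln (LL ?z) \<le> ln 2 + ln (LL y)" by (intro ln_le_ln_add) auto
  have "NN y \<le> LL y" using H NN_ge_1[of y] by linarith
  then have m: "ln (NN y) \<le> ln (LL y)" by simp
  have lam: "ln (\<mu> ?z) \<le> ln 2 + ln (LL y)" using H by (intro ln_le_ln_add) auto
  have 1: "2 * s1 * (ln (NN ?z) - ln (NN x)) \<le> \<bar>2 * s1\<bar> * ln 18" by (rule mult_le_abs_mult[OF n0])
  have 2: "2 * a * ln (LL ?z) \<le> 2 * a * (ln 2 + ln (LL y))" using a_pos l0 by (intro mult_left_mono) auto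
  \<comment> \<open>Again a nonpositive power of the large modulation is exchanged for one of
    \<open>NN y\<close>.\<close>
  have 3: "(2 * a - 2 * b2 + g1) * ln (LL y) \<le> (2 * a - 2 * b2 + g1) * ln (NN y)"
    by (rule mult_left_mono_neg[OF m tail(2)])
  \<comment> \<open>Integration over \<open>LL x \<le> 8 * \<mu> (x + y)\<close> produces a factor
    \<open>\<mu> (x + y) powr g1\<close>, which is reserved here.\<close>
  have 4: "g1 * ln (\<mu> ?z) \<le> g1 * (ln 2 + ln (LL y))" using g1(1) lam by (intro mult_left_mono) auto
  have "(K x y)\<^sup>2 \<le> exp (\<bar>2 * s1\<bar> * ln 18 + 2 * a * ln 2 + g1 * ln 2) * exp (- 2 * (s0 + s1) * ln (NN ?z) - g1 * ln (\<mu> ?z)) *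
      (NN y powr (2 * a - 2 * b2 + g1 - 2 * s2) * LL x powr (- 2 * b1))"
    unfolding K_square powr_eq_exp[OF NN_pos] powr_eq_exp[OF LL_pos] mult_exp_exp exp_le_cancel_iff
    using 1 2 3 4 by (simp add: algebra_simps)
  then show "NN y \<le> 18 * NN ?z \<and> LL x \<le> 8 * \<mu> ?z \<and> (K x y)\<^sup>2 \<le>
      exp (\<bar>2 * s1\<bar> * ln 18 + 2 * a * ln 2 + g1 * ln 2) * exp (- 2 * (s0 + s1) * ln (NN ?z) - g1 * ln (\<mu> ?z)) *
      (NN y powr (2 * a - 2 * b2 + g1 - 2 * s2) * LL x powr (- 2 * b1))"
    using H LL_ge_1[of x] by (smt (verit))
next
  fix z :: "real \<times> (real^3)"
  have lp: "0 < \<mu> z" using \<mu> by auto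
  have l: "ln (18 * NN z) = ln 18 + ln (NN z)" "ln (8 * \<mu> z) = ln 8 + ln (\<mu> z)" using lp by (simp_all add: ln_mult_pos)
  show "exp (\<bar>2 * s1\<bar> * ln 18 + 2 * a * ln 2 + g1 * ln 2) * exp (- 2 * (s0 + s1) * ln (NN z) - g1 * ln (\<mu> z)) *
    ((18 * NN z) powr (2 * (s0 + s1)) * (8 * \<mu> z) powr g1) \<le> exp (\<bar>2 * s1\<bar> * ln 18 + 2 * a * ln 2 + g1 * ln 2 + 2 * (s0 + s1) * ln 18 + g1 * ln 8)"
    unfolding powr_eq_exp[OF mult_pos_pos[OF zero_less_numeral NN_pos]] powr_eq_exp[OF mult_pos_pos[OF zero_less_numeral lp]] l mult_exp_exp
    by (simp add: algebra_simps)
qed simp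

section \<open>Two high input frequencies: direct tests\<close>

text \<open>The ordering of the modulations is part of the definition because the two inputs may be
  exchanged.\<close>

definition high_high :: "real \<times> (real^3) \<Rightarrow> real \<times> (real^3) \<Rightarrow> bool" where
  "high_high x y \<longleftrightarrow> 16 * NN (x + y) \<le> NN x \<and> 16 * NN (x + y) \<le> NN y \<and> LL y \<le> LL x"

lemma pred_high_high [measurable]: "Measurable.pred (borel \<Otimes>\<^sub>M borel) (\<lambda>p. high_high (fst p) (snd p))"
  unfolding high_high_def by measurable

lemma high_high_ln_NN:
  assumes "high_high x y" shows "\<bar>ln (NN x) - ln (NN y)\<bar> \<le> ln 2"
proof -
  have "NN x \<le> 2 * NN y" "NN y \<le> 2 * NN x"
    using assms NN_le_add[of x y] NN_le_add'[of y x] NN_ge_1[of x] NN_ge_1[of y] unfolding high_high_def by linarith+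
  then show ?thesis using ln_le_ln_add[of "NN x" "NN y" 2] ln_le_ln_add[of "NN y" "NN x" 2] by simp
qed

text \<open>For fixed \<open>x\<close>, the variable \<open>y\<close> is measured by the output
  frequency, through the centre \<open>- snd x\<close>. The output frequency is below
  \<open>LL x\<close>, so a nonpositive power of \<open>LL x\<close> is traded as before, and the
  growth up to \<open>NN x\<close> is paid for by \<open>s1 + s2\<close>.\<close>

lemma trilinear_bound_high_high_first_modulation:
  "trilinear_bound (\<lambda>x y. if high_high x y \<and> NN (x + y) \<le> LL x \<and> LL (x + y) \<le> 8 * LL x then ennreal (K x y) else 0)"
proof (rule trilinear_bound_fix_first_pointwise[where c = "\<lambda>x. - snd x" and R = NN and \<Lambda> = LL
    and \<beta> = "2 * a - 2 * b1 + g2 - 2 * s0" and \<kappa> = "2 * (s1 + s2)" and \<gamma> = g2 and b = b2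
    and A = "\<lambda>x. exp (\<bar>2 * s2\<bar> * ln 2 + 2 * a * ln 8) * exp (- 2 * (s1 + s2) * ln (NN x) - g2 * ln (LL x))"
    and D = "exp (\<bar>2 * s2\<bar> * ln 2 + 2 * a * ln 8)"])
  show "0 \<le> g2" "1 - 2 * b2 \<le> g2" "g2 = 0 \<Longrightarrow> 1 - 2 * b2 < 0" by (fact g2)+
  show "0 \<le> 2 * (s1 + s2)" "2 * a - 2 * b1 + g2 - 2 * s0 + 3 \<le> 2 * (s1 + s2)"
    "2 * (s1 + s2) = 0 \<Longrightarrow> 2 * a - 2 * b1 + g2 - 2 * s0 + 3 < 0"
    using pairs a_pos total1 by (smt (verit))+
  show "(\<lambda>p. K (fst p) (snd p)) \<in> borel_measurable (borel \<Otimes>\<^sub>M borel)" by (rule K_measurable)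
  show "Measurable.pred (borel \<Otimes>\<^sub>M borel) (\<lambda>p. high_high (fst p) (snd p) \<and> NN ((fst p) + (snd p)) \<le> LL (fst p) \<and> LL ((fst p) + (snd p)) \<le> 8 * LL (fst p))"
    unfolding high_high_def opposite_signs_def by measurable
  fix x y :: "real \<times> (real^3)"
  assume H: "high_high x y \<and> NN (x + y) \<le> LL x \<and> LL (x + y) \<le> 8 * LL x"
  have N: "1 + norm (snd y - - snd x) = NN (x + y)" by (simp add: NN_def add.commute)
  have l0: "ln (LL (x + y)) \<le> ln 8 + ln (LL x)" using H by (intro ln_le_ln_add) auto
  have m: "ln (NN (x + y)) \<le> ln (LL x)" using H by simp
  have 1: "2 * s2 * (ln (NN x) - ln (NN y)) \<le> \<bar>2 * s2\<bar> * ln 2" using H by (intro mult_le_abs_mult high_high_ln_NN) auto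
  have 2: "2 * a * ln (LL (x + y)) \<le> 2 * a * (ln 8 + ln (LL x))" using a_pos l0 by (intro mult_left_mono) auto
  have 3: "(2 * a - 2 * b1 + g2) * ln (LL x) \<le> (2 * a - 2 * b1 + g2) * ln (NN (x + y))"
    by (rule mult_left_mono_neg[OF m tail(1)])
  have "(K x y)\<^sup>2 \<le> exp (\<bar>2 * s2\<bar> * ln 2 + 2 * a * ln 8) * exp (- 2 * (s1 + s2) * ln (NN x) - g2 * ln (LL x)) *
      (NN (x + y) powr (2 * a - 2 * b1 + g2 - 2 * s0) * LL y powr (- 2 * b2))"
    unfolding K_square powr_eq_exp[OF NN_pos] powr_eq_exp[OF LL_pos] mult_exp_exp exp_le_cancel_iff
    using 1 2 3 by (simp add: algebra_simps)
  moreover have "NN (x + y) \<le> NN x" "LL y \<le> LL x" using H NN_ge_1[of "x + y"] unfolding high_high_def by linarith+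
  ultimately show "1 + norm (snd y - - snd x) \<le> NN x \<and> LL y \<le> LL x \<and> (K x y)\<^sup>2 \<le>
      exp (\<bar>2 * s2\<bar> * ln 2 + 2 * a * ln 8) * exp (- 2 * (s1 + s2) * ln (NN x) - g2 * ln (LL x)) *
      ((1 + norm (snd y - - snd x)) powr (2 * a - 2 * b1 + g2 - 2 * s0) * LL y powr (- 2 * b2))"
    unfolding N by blast
next
  fix x :: "real \<times> (real^3)"
  show "exp (\<bar>2 * s2\<bar> * ln 2 + 2 * a * ln 8) * exp (- 2 * (s1 + s2) * ln (NN x) - g2 * ln (LL x)) *
    (NN x powr (2 * (s1 + s2)) * LL x powr g2) \<le> exp (\<bar>2 * s2\<bar> * ln 2 + 2 * a * ln 8)"
    by (simp add: powr_eq_exp mult_exp_exp algebra_simps)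
qed simp

text \<open>An output modulation above the input modulations is still at most a multiple of
  \<open>NN x\<close>, at the cost of \<open>2 * a\<close> in the exponent of the high frequency.
  The hypothesis \<open>a \<le> s1 + s2\<close> keeps the remaining exponent \<open>\<kappa>\<close>
  nonnegative.\<close>

lemma trilinear_bound_high_high_output_modulation:
  "trilinear_bound (\<lambda>x y. if high_high x y \<and> NN (x + y) \<le> LL x \<and> 8 * LL x < LL (x + y) then ennreal (K x y) else 0)"
proof (rule trilinear_bound_fix_first_pointwise[where c = "\<lambda>x. - snd x" and R = NN and \<Lambda> = LL
    and \<beta> = "- 2 * b1 + g2 - 2 * s0" and \<kappa> = "2 * (s1 + s2) - 2 * a" and \<gamma> = g2 and b = b2
    and A = "\<lambda>x. exp (\<bar>2 * s2\<bar> * ln 2 + 2 * a * ln 6) * exp ((2 * a - 2 * (s1 + s2)) * ln (NN x) - g2 * ln (LL x))"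
    and D = "exp (\<bar>2 * s2\<bar> * ln 2 + 2 * a * ln 6)"])
  show "0 \<le> g2" "1 - 2 * b2 \<le> g2" "g2 = 0 \<Longrightarrow> 1 - 2 * b2 < 0" by (fact g2)+
  show "0 \<le> 2 * (s1 + s2) - 2 * a" "- 2 * b1 + g2 - 2 * s0 + 3 \<le> 2 * (s1 + s2) - 2 * a"
    "2 * (s1 + s2) - 2 * a = 0 \<Longrightarrow> - 2 * b1 + g2 - 2 * s0 + 3 < 0"
    using pairs a_pos total1 total_eq1 by (smt (verit))+
  show "(\<lambda>p. K (fst p) (snd p)) \<in> borel_measurable (borel \<Otimes>\<^sub>M borel)" by (rule K_measurable)
  show "Measurable.pred (borel \<Otimes>\<^sub>M borel) (\<lambda>p. high_high (fst p) (snd p) \<and> NN ((fst p) + (snd p)) \<le> LL (fst p) \<and> 8 * LL (fst p) < LL ((fst p) + (snd p)))"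
    unfolding high_high_def opposite_signs_def by measurable
  fix x y :: "real \<times> (real^3)"
  assume H: "high_high x y \<and> NN (x + y) \<le> LL x \<and> 8 * LL x < LL (x + y)"
  have N: "1 + norm (snd y - - snd x) = NN (x + y)" by (simp add: NN_def add.commute)
  have "LL y \<le> LL x" "NN y \<le> NN (x + y) + NN x" "16 * NN (x + y) \<le> NN x" using H NN_le_add' unfolding high_high_def by auto
  \<comment> \<open>The two input modulations are each below an eighth of the output modulation and
    are absorbed on the left.\<close>
  then have "LL (x + y) \<le> 6 * NN x" using H LL_add_le[of x y] NN_ge_1[of x] by linarith
  then have l0: "ln (LL (x + y)) \<le> ln 6 + ln (NN x)" by (intro ln_le_ln_add) auto
  have m: "ln (NN (x + y)) \<le> ln (LL x)" using H by simp
  have 1: "2 * s2 * (ln (NN x) - ln (NN y)) \<le> \<bar>2 * s2\<bar> * ln 2" using H by (intro mult_le_abs_mult high_high_ln_NN) auto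
  have 2: "2 * a * ln (LL (x + y)) \<le> 2 * a * (ln 6 + ln (NN x))" using a_pos l0 by (intro mult_left_mono) auto
  have 3: "(- 2 * b1 + g2) * ln (LL x) \<le> (- 2 * b1 + g2) * ln (NN (x + y))"
    using tail(1) a_pos by (intro mult_left_mono_neg[OF m]) auto
  have "(K x y)\<^sup>2 \<le> exp (\<bar>2 * s2\<bar> * ln 2 + 2 * a * ln 6) * exp ((2 * a - 2 * (s1 + s2)) * ln (NN x) - g2 * ln (LL x)) *
      (NN (x + y) powr (- 2 * b1 + g2 - 2 * s0) * LL y powr (- 2 * b2))"
    unfolding K_square powr_eq_exp[OF NN_pos] powr_eq_exp[OF LL_pos] mult_exp_exp exp_le_cancel_iff
    using 1 2 3 by (simp add: algebra_simps)
  moreover have "NN (x + y) \<le> NN x" "LL y \<le> LL x" using H NN_ge_1[of "x + y"] unfolding high_high_def by linarith+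
  ultimately show "1 + norm (snd y - - snd x) \<le> NN x \<and> LL y \<le> LL x \<and> (K x y)\<^sup>2 \<le>
      exp (\<bar>2 * s2\<bar> * ln 2 + 2 * a * ln 6) * exp ((2 * a - 2 * (s1 + s2)) * ln (NN x) - g2 * ln (LL x)) *
      ((1 + norm (snd y - - snd x)) powr (- 2 * b1 + g2 - 2 * s0) * LL y powr (- 2 * b2))"
    unfolding N by blast
next
  fix x :: "real \<times> (real^3)"
  show "exp (\<bar>2 * s2\<bar> * ln 2 + 2 * a * ln 6) * exp ((2 * a - 2 * (s1 + s2)) * ln (NN x) - g2 * ln (LL x)) *
    (NN x powr (2 * (s1 + s2) - 2 * a) * LL x powr g2) \<le> exp (\<bar>2 * s2\<bar> * ln 2 + 2 * a * ln 6)"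
    by (simp add: powr_eq_exp mult_exp_exp algebra_simps)
qed simp

text \<open>Here the curvature of the cone is invisible at the scale \<open>NN (x + y)\<close> of the output frequency.\<close>

lemma trilinear_bound_high_high_flat:
  "trilinear_bound (\<lambda>x y. if high_high x y \<and> opposite_signs x y \<and> LL x < NN (x + y) \<and> (NN (x + y))\<^sup>2 \<le> NN x * LL x then ennreal (K x y) else 0)"
proof -
  \<comment> \<open>Output frequencies up to \<open>sqrt (NN x * LL x)\<close> contribute half of
    \<open>\<kappa>\<close> to the exponent of \<open>NN x\<close> and half to that of
    \<open>LL x\<close>. As \<open>LL x\<close> ranges from 1 to \<open>NN x\<close>, the two bounds
    in the minimum are the conditions at the two ends; \<open>low\<close> and \<open>total1\<close>
    show that the minimum is large enough.\<close>
  define \<kappa> where "\<kappa> = min (4 * (s1 + s2)) (2 * (s1 + s2) + 2 * b1 - g2)"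
  have \<kappa>: "0 < \<kappa>" "\<kappa> \<le> 4 * (s1 + s2)" "\<kappa> \<le> 2 * (s1 + s2) + 2 * b1 - g2" "2 * a - 2 * s0 + 3 \<le> \<kappa>"
  proof -
    have "0 < 4 * (s1 + s2)" using pairs(1) a_pos by (smt (verit))
    moreover have "0 < 2 * (s1 + s2) + 2 * b1 - g2" using pairs(1) a_pos tail(1) by (smt (verit))
    moreover have "2 * a - 2 * s0 + 3 \<le> 4 * (s1 + s2)" using low by linarith
    moreover have "2 * a - 2 * s0 + 3 \<le> 2 * (s1 + s2) + 2 * b1 - g2" using total1 by (smt (verit))
    ultimately show "0 < \<kappa>" "\<kappa> \<le> 4 * (s1 + s2)" "\<kappa> \<le> 2 * (s1 + s2) + 2 * b1 - g2" "2 * a - 2 * s0 + 3 \<le> \<kappa>"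
      by (simp_all add: \<kappa>_def)
  qed
  \<comment> \<open>No \<open>y\<close> contributes when \<open>LL x\<close> exceeds
    \<open>NN x\<close>; the value 0 makes the final estimate trivial there.\<close>
  define R where "R x = (if LL x \<le> NN x then sqrt (NN x * LL x) else 0)" for x
  show ?thesis
  proof (rule trilinear_bound_fix_first_pointwise[where c = "\<lambda>x. - snd x" and R = R and \<Lambda> = LL
    and \<beta> = "2 * a - 2 * s0" and \<kappa> = \<kappa> and \<gamma> = g2 and b = b2
    and A = "\<lambda>x. exp (\<bar>2 * s2\<bar> * ln 2 + 2 * a * ln 3) * exp (- 2 * (s1 + s2) * ln (NN x) - 2 * b1 * ln (LL x))"
    and D = "exp (\<bar>2 * s2\<bar> * ln 2 + 2 * a * ln 3)"])
  show "0 \<le> g2" "1 - 2 * b2 \<le> g2" "g2 = 0 \<Longrightarrow> 1 - 2 * b2 < 0" by (fact g2)+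
  show "0 \<le> \<kappa>" "2 * a - 2 * s0 + 3 \<le> \<kappa>" "\<kappa> = 0 \<Longrightarrow> 2 * a - 2 * s0 + 3 < 0" using \<kappa> by auto
  show "(\<lambda>p. K (fst p) (snd p)) \<in> borel_measurable (borel \<Otimes>\<^sub>M borel)" by (rule K_measurable)
  show "Measurable.pred (borel \<Otimes>\<^sub>M borel) (\<lambda>p. high_high (fst p) (snd p) \<and> opposite_signs (fst p) (snd p) \<and> LL (fst p) < NN ((fst p) + (snd p)) \<and> (NN ((fst p) + (snd p)))\<^sup>2 \<le> NN (fst p) * LL (fst p))"
    unfolding high_high_def opposite_signs_def by measurable
  fix x y :: "real \<times> (real^3)"
  assume H: "high_high x y \<and> opposite_signs x y \<and> LL x < NN (x + y) \<and> (NN (x + y))\<^sup>2 \<le> NN x * LL x"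
  have N: "1 + norm (snd y - - snd x) = NN (x + y)" by (simp add: NN_def add.commute)
  have "LL y \<le> LL x" using H by (auto simp: high_high_def)
  then have "LL (x + y) \<le> 3 * NN (x + y)" using H LL_add_le_opposite[of x y] by linarith
  then have l0: "ln (LL (x + y)) \<le> ln 3 + ln (NN (x + y))" by (intro ln_le_ln_add) auto
  have 1: "2 * s2 * (ln (NN x) - ln (NN y)) \<le> \<bar>2 * s2\<bar> * ln 2" using H by (intro mult_le_abs_mult high_high_ln_NN) auto
  have 2: "2 * a * ln (LL (x + y)) \<le> 2 * a * (ln 3 + ln (NN (x + y)))" using a_pos l0 by (intro mult_left_mono) auto
  have "(K x y)\<^sup>2 \<le> exp (\<bar>2 * s2\<bar> * ln 2 + 2 * a * ln 3) * exp (- 2 * (s1 + s2) * ln (NN x) - 2 * b1 * ln (LL x)) *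
      (NN (x + y) powr (2 * a - 2 * s0) * LL y powr (- 2 * b2))"
    unfolding K_square powr_eq_exp[OF NN_pos] powr_eq_exp[OF LL_pos] mult_exp_exp exp_le_cancel_iff
    using 1 2 by (simp add: algebra_simps)
  moreover have "LL x \<le> NN x" using H NN_ge_1[of "x + y"] unfolding high_high_def by linarith
  moreover have "NN (x + y) \<le> sqrt (NN x * LL x)" using H by (intro real_le_rsqrt) auto
  ultimately show "1 + norm (snd y - - snd x) \<le> R x \<and> LL y \<le> LL x \<and> (K x y)\<^sup>2 \<le>
      exp (\<bar>2 * s2\<bar> * ln 2 + 2 * a * ln 3) * exp (- 2 * (s1 + s2) * ln (NN x) - 2 * b1 * ln (LL x)) *
      ((1 + norm (snd y - - snd x)) powr (2 * a - 2 * s0) * LL y powr (- 2 * b2))"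
    unfolding N R_def using \<open>LL y \<le> LL x\<close> by simp
next
  fix x :: "real \<times> (real^3)"
  show "exp (\<bar>2 * s2\<bar> * ln 2 + 2 * a * ln 3) * exp (- 2 * (s1 + s2) * ln (NN x) - 2 * b1 * ln (LL x)) *
    (R x powr \<kappa> * LL x powr g2) \<le> exp (\<bar>2 * s2\<bar> * ln 2 + 2 * a * ln 3)"
  proof (cases "LL x \<le> NN x")
    case True
    define n l where "n = ln (NN x)" and "l = ln (LL x)"
    have nl: "0 \<le> l" "l \<le> n" using True by (simp_all add: n_def l_def)
    have "ln (sqrt (NN x * LL x)) = (n + l) / 2" unfolding ln_sqrt[OF less_imp_le[OF mult_pos_pos[OF NN_pos LL_pos]]] ln_mult_pos[OF NN_pos LL_pos] n_def l_def by simp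
    then have R: "R x powr \<kappa> = exp (\<kappa> * ((n + l) / 2))" using True by (simp add: R_def powr_eq_exp)
    have "(\<kappa> / 2 - 2 * (s1 + s2)) * n \<le> (\<kappa> / 2 - 2 * (s1 + s2)) * l"
      using \<kappa> by (intro mult_left_mono_neg nl) auto
    moreover have "(\<kappa> - 2 * (s1 + s2) - 2 * b1 + g2) * l \<le> 0"
      using \<kappa> nl by (intro mult_nonpos_nonneg) auto
    moreover have "- 2 * (s1 + s2) * n - 2 * b1 * l + (\<kappa> * ((n + l) / 2) + g2 * l)
      = ((\<kappa> / 2 - 2 * (s1 + s2)) * n - (\<kappa> / 2 - 2 * (s1 + s2)) * l) + (\<kappa> - 2 * (s1 + s2) - 2 * b1 + g2) * l"
      by (simp add: field_simps)
    ultimately have "- 2 * (s1 + s2) * n - 2 * b1 * l + (\<kappa> * ((n + l) / 2) + g2 * l) \<le> 0"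
      by (smt (verit))
    then show ?thesis unfolding R powr_eq_exp[OF LL_pos] n_def[symmetric] l_def[symmetric] mult_exp_exp exp_le_cancel_iff by simp
  qed (simp add: R_def)
  qed simp
qed

end

subsection \<open>Intersections of two thickened cones\<close>

lemma emeasure_lborel_shift:
  assumes [measurable]: "Measurable.pred borel P"
  shows "emeasure lborel {x. P (c + x)} = emeasure lborel {x::'a::euclidean_space. P x}"
proof -
  have "emeasure lborel {x. P (c + x)} = (\<integral>\<^sup>+x. (if P (c + x) then 1 else 0) \<partial>lborel)"
    by (subst emeasure_eq_nn_integral_if) auto
  also have "\<dots> = (\<integral>\<^sup>+x. (if P x then 1 else 0) \<partial>lborel)"
    by (rule nn_integral_lborel_shift[of "\<lambda>x. if P x then 1 else 0"]) measurable
  finally show ?thesis by (subst (asm) emeasure_eq_nn_integral_if) auto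
qed

lemma emeasure_lborel_reflect:
  assumes [measurable]: "Measurable.pred borel P"
  shows "emeasure lborel {x. P (c - x)} = emeasure lborel {x::'a::euclidean_space. P x}"
proof -
  have "emeasure lborel {x. P (c - x)} = (\<integral>\<^sup>+x. (if P (c - x) then 1 else 0) \<partial>lborel)"
    by (subst emeasure_eq_nn_integral_if) auto
  also have "\<dots> = (\<integral>\<^sup>+x. (if P x then 1 else 0) \<partial>lborel)"
    by (rule nn_integral_lborel_reflect[of "\<lambda>x. if P x then 1 else 0"]) measurable
  finally show ?thesis by (subst (asm) emeasure_eq_nn_integral_if) auto
qed

definition sgnb :: "bool \<Rightarrow> real" where "sgnb s = (if s then 1 else - 1)"

text \<open>On a fixed sign pattern each modulation bounds the distance of the time frequency from
  one sheet of the cone, and the slab estimate applies.\<close>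

lemma emeasure_two_modulations_sign_le:
  fixes P :: "real^3 \<Rightarrow> bool"
  assumes [measurable]: "Measurable.pred borel P" and "1 \<le> l" "1 \<le> m"
  shows "emeasure lborel {x. P (snd x) \<and> (0 \<le> fst x) = s \<and> (0 \<le> fst (z - x)) = s' \<and> LL x \<le> l \<and> LL (z - x) \<le> m}
    \<le> ennreal (2 * min l m) * emeasure lborel {\<xi>. P \<xi> \<and> \<bar>sgnb s * norm \<xi> + sgnb s' * norm (snd z - \<xi>) - fst z\<bar> \<le> l + m}"
proof -
  have "emeasure lborel {x. P (snd x) \<and> (0 \<le> fst x) = s \<and> (0 \<le> fst (z - x)) = s' \<and> LL x \<le> l \<and> LL (z - x) \<le> m}
    \<le> emeasure lborel {x. P (snd x) \<and> \<bar>fst x - sgnb s * norm (snd x)\<bar> \<le> l \<and> \<bar>fst z - fst x - sgnb s' * norm (snd z - snd x)\<bar> \<le> m}"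
  proof (rule emeasure_mono)
    show "{x. P (snd x) \<and> \<bar>fst x - sgnb s * norm (snd x)\<bar> \<le> l \<and> \<bar>fst z - fst x - sgnb s' * norm (snd z - snd x)\<bar> \<le> m} \<in> sets lborel"
      by measurable
    show "{x. P (snd x) \<and> (0 \<le> fst x) = s \<and> (0 \<le> fst (z - x)) = s' \<and> LL x \<le> l \<and> LL (z - x) \<le> m} \<subseteq>
      {x. P (snd x) \<and> \<bar>fst x - sgnb s * norm (snd x)\<bar> \<le> l \<and> \<bar>fst z - fst x - sgnb s' * norm (snd z - snd x)\<bar> \<le> m}"
    proof
      fix x assume "x \<in> {x. P (snd x) \<and> (0 \<le> fst x) = s \<and> (0 \<le> fst (z - x)) = s' \<and> LL x \<le> l \<and> LL (z - x) \<le> m}"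
      then have H: "P (snd x)" "s = (0 \<le> fst x)" "s' = (0 \<le> fst (z - x))" "LL x \<le> l" "LL (z - x) \<le> m" by simp_all
      have aux: "\<bar>t - sgnb (0 \<le> t) * r\<bar> \<le> k" if "1 + \<bar>\<bar>t\<bar> - r\<bar> \<le> k" for t r k :: real
        using that by (auto simp: sgnb_def)
      from aux[of "fst x" "norm (snd x)" l] aux[of "fst (z - x)" "norm (snd (z - x))" m] H
      show "x \<in> {x. P (snd x) \<and> \<bar>fst x - sgnb s * norm (snd x)\<bar> \<le> l \<and> \<bar>fst z - fst x - sgnb s' * norm (snd z - snd x)\<bar> \<le> m}"
        by (simp add: LL_def)
    qed
  qed
  also have "\<dots> \<le> ennreal (2 * min l m) * emeasure lborel {\<xi>. P \<xi> \<and> \<bar>sgnb s * norm \<xi> + sgnb s' * norm (snd z - \<xi>) - fst z\<bar> \<le> l + m}"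
    by (rule emeasure_slab_le) (use assms in auto)
  finally show ?thesis .
qed

text \<open>\<open>W\<close> selects the admissible sign patterns, at most four of them. A volume
  linear in \<open>l + m\<close>, multiplied by \<open>min l m\<close>, is at most a multiple of
  \<open>l * m\<close>, the product form needed for integrating in both modulations.\<close>

lemma emeasure_two_modulations_le:
  fixes P :: "real^3 \<Rightarrow> bool"
  assumes [measurable]: "Measurable.pred borel P" and lm: "1 \<le> l" "1 \<le> m" and "0 \<le> V"
    and V: "\<And>s s'. W s s' \<Longrightarrow> emeasure lborel {\<xi>. P \<xi> \<and> \<bar>sgnb s * norm \<xi> + sgnb s' * norm (snd z - \<xi>) - fst z\<bar> \<le> l + m} \<le> ennreal (V * (l + m))"
  shows "emeasure lborel {x. P (snd x) \<and> W (0 \<le> fst x) (0 \<le> fst (z - x)) \<and> LL x \<le> l \<and> LL (z - x) \<le> m} \<le> ennreal (l * m * (16 * V))"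
proof -
  let ?S = "\<lambda>q. {x. P (snd x) \<and> (0 \<le> fst x) = fst q \<and> (0 \<le> fst (z - x)) = snd q \<and> LL x \<le> l \<and> LL (z - x) \<le> m}"
  let ?I = "{q. W (fst q) (snd q)}"
  have m[measurable]: "?S q \<in> sets borel" for q by measurable
  have one: "emeasure lborel (?S q) \<le> ennreal (4 * V * l * m)" if "q \<in> ?I" for q
  proof -
    have "emeasure lborel (?S q) \<le> ennreal (2 * min l m) * ennreal (V * (l + m))"
      using that by (intro order_trans[OF emeasure_two_modulations_sign_le] mult_left_mono V lm) auto
    also have "\<dots> = ennreal (2 * min l m * (V * (l + m)))" using lm by (intro ennreal_mult'[symmetric]) auto
    also have "\<dots> \<le> ennreal (4 * V * l * m)"
    proof (rule ennreal_leI)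
      have "min l m * (l + m) \<le> 2 * (l * m)"
      proof (cases "l \<le> m")
        case True
        then have "l * (l + m) \<le> l * (m + m)" using lm by (intro mult_left_mono) auto
        with True show ?thesis by (simp add: algebra_simps)
      next
        case False
        then have "m * (l + m) \<le> m * (l + l)" using lm by (intro mult_left_mono) auto
        with False show ?thesis by (simp add: algebra_simps)
      qed
      then have "2 * V * (min l m * (l + m)) \<le> 2 * V * (2 * (l * m))" using assms(4) by (intro mult_left_mono) auto
      then show "2 * min l m * (V * (l + m)) \<le> 4 * V * l * m" by (simp add: ac_simps)
    qed
    finally show ?thesis .
  qed
  have "{x. P (snd x) \<and> W (0 \<le> fst x) (0 \<le> fst (z - x)) \<and> LL x \<le> l \<and> LL (z - x) \<le> m} = (\<Union>q\<in>?I. ?S q)" by auto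
  then have "emeasure lborel {x. P (snd x) \<and> W (0 \<le> fst x) (0 \<le> fst (z - x)) \<and> LL x \<le> l \<and> LL (z - x) \<le> m}
    = emeasure lborel (\<Union>q\<in>?I. ?S q)" by simp
  also have "\<dots> \<le> (\<Sum>q\<in>?I. emeasure lborel (?S q))" by (rule emeasure_subadditive_finite) auto
  also have "\<dots> \<le> (\<Sum>q\<in>?I. ennreal (4 * V * l * m))" by (intro sum_mono one)
  also have "\<dots> \<le> (\<Sum>q\<in>(UNIV :: (bool \<times> bool) set). ennreal (4 * V * l * m))" by (rule sum_mono2) auto
  also have "\<dots> = ennreal (l * m * (16 * V))"
  proof -
    have "card (UNIV :: (bool \<times> bool) set) = 4" by (simp add: card_UNIV_bool card_cartesian_product flip: UNIV_Times_UNIV)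
    then have "(\<Sum>q\<in>(UNIV :: (bool \<times> bool) set). ennreal (4 * V * l * m)) = ennreal 4 * ennreal (4 * V * l * m)" by simp
    also have "\<dots> = ennreal (4 * (4 * V * l * m))" by (rule ennreal_mult'[symmetric]) simp
    finally show ?thesis by (simp add: ac_simps)
  qed
  finally show ?thesis .
qed

text \<open>Bipolar coordinates replace the ball volume \<open>t ^ 3\<close> by
  \<open>t\<^sup>2\<close> times the thickness of the phase, as long as \<open>NN z\<close> is at
  most twice \<open>norm (snd z)\<close>. They degenerate as \<open>snd z\<close> tends to 0; there
  \<open>t\<close> is at most 36 and the ball volume is good enough.\<close>

lemma emeasure_low_second_le:
  assumes t: "1 \<le> t" "t \<le> 18 * NN z" and lm: "1 \<le> l" "1 \<le> m"
  shows "emeasure lborel {x. (NN (z - x) \<le> t \<and> NN x \<le> 18 * NN z) \<and> LL x \<le> l \<and> LL (z - x) \<le> m} \<le> ennreal (l * m * (9216 * t\<^sup>2))"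
proof (cases "norm (snd z) < 1")
  case True
  have "emeasure lborel {x. (NN (z - x) \<le> t \<and> NN x \<le> 18 * NN z) \<and> LL x \<le> l \<and> LL (z - x) \<le> m}
    \<le> emeasure lborel {x. 1 + norm (snd x - snd z) \<le> t \<and> LL x \<le> l}"
    by (rule emeasure_mono) (auto simp: NN_def norm_minus_commute)
  also have "\<dots> \<le> ennreal (t powr 3 * l * 20)" by (rule emeasure_frequency_modulation_le) (use t lm in auto)
  also have "\<dots> \<le> ennreal (l * m * (9216 * t\<^sup>2))"
  proof (rule ennreal_leI)
    have "t \<le> 36" using t True by (simp add: NN_def)
    then have "t\<^sup>2 * t \<le> t\<^sup>2 * 36" by (intro mult_left_mono) auto
    then have 1: "t ^ 3 \<le> 36 * t\<^sup>2" by (simp add: power2_eq_square power3_eq_cube)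
    have "t powr 3 * l * 20 = t ^ 3 * (l * 20)" using t by simp
    also have "\<dots> \<le> 36 * t\<^sup>2 * (l * 20)" using lm by (intro mult_right_mono 1) auto
    also have "\<dots> = (l * (720 * t\<^sup>2)) * 1" by simp
    also have "\<dots> \<le> (l * (720 * t\<^sup>2)) * m" using lm by (intro mult_left_mono) auto
    also have "\<dots> \<le> l * m * (9216 * t\<^sup>2)" using lm by (simp add: mult_right_mono mult.assoc mult.left_commute)
    finally show "t powr 3 * l * 20 \<le> l * m * (9216 * t\<^sup>2)" .
  qed
  finally show ?thesis .
next
  case False
  then have z0: "snd z \<noteq> 0" by auto
  have zN: "NN z \<le> 2 * norm (snd z)" using False by (simp add: NN_def)
  let ?P = "\<lambda>\<xi>. 1 + norm (snd z - \<xi>) \<le> t \<and> 1 + norm \<xi> \<le> 18 * NN z"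
  have "emeasure lborel {x. ?P (snd x) \<and> True \<and> LL x \<le> l \<and> LL (z - x) \<le> m} \<le> ennreal (l * m * (16 * (576 * t\<^sup>2)))"
  proof (rule emeasure_two_modulations_le)
    fix s s'
    \<comment> \<open>Reflection of \<open>\<xi>\<close> to \<open>snd z - \<xi>\<close> makes the
      small frequency the one with norm at most \<open>t\<close>, and multiplication by
      \<open>sgnb s\<close> normalises the coefficient of the other norm to 1.\<close>
    let ?B = "\<lambda>x. norm x \<le> t \<and> norm (snd z - x) \<le> 18 * NN z \<and> \<bar>norm (snd z - x) + (sgnb s * sgnb s') * norm x - sgnb s * fst z\<bar> \<le> l + m"
    have "{\<xi>. ?P \<xi> \<and> \<bar>sgnb s * norm \<xi> + sgnb s' * norm (snd z - \<xi>) - fst z\<bar> \<le> l + m} \<subseteq> {\<xi>. ?B (snd z - \<xi>)}"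
    proof
      fix \<xi> assume "\<xi> \<in> {\<xi>. ?P \<xi> \<and> \<bar>sgnb s * norm \<xi> + sgnb s' * norm (snd z - \<xi>) - fst z\<bar> \<le> l + m}"
      then have H: "?P \<xi>" "\<bar>sgnb s * norm \<xi> + sgnb s' * norm (snd z - \<xi>) - fst z\<bar> \<le> l + m" by auto
      have "norm \<xi> + sgnb s * sgnb s' * norm (snd z - \<xi>) - sgnb s * fst z = sgnb s * (sgnb s * norm \<xi> + sgnb s' * norm (snd z - \<xi>) - fst z)"
        by (simp add: sgnb_def algebra_simps)
      then have "\<bar>norm \<xi> + sgnb s * sgnb s' * norm (snd z - \<xi>) - sgnb s * fst z\<bar> \<le> l + m"
      proof -
        assume *: "norm \<xi> + sgnb s * sgnb s' * norm (snd z - \<xi>) - sgnb s * fst z = sgnb s * (sgnb s * norm \<xi> + sgnb s' * norm (snd z - \<xi>) - fst z)"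
        have "\<bar>sgnb s\<bar> = 1" by (simp add: sgnb_def)
        then show ?thesis using H(2) unfolding * abs_mult by simp
      qed
      with H(1) show "\<xi> \<in> {\<xi>. ?B (snd z - \<xi>)}" by simp
    qed
    then have "emeasure lborel {\<xi>. ?P \<xi> \<and> \<bar>sgnb s * norm \<xi> + sgnb s' * norm (snd z - \<xi>) - fst z\<bar> \<le> l + m} \<le> emeasure lborel {\<xi>. ?B (snd z - \<xi>)}"
      by (rule emeasure_mono) measurable
    also have "\<dots> = emeasure lborel {x. ?B x}" by (rule emeasure_lborel_reflect) measurable
    also have "\<dots> \<le> ennreal (16 * t\<^sup>2 * (18 * NN z) * (l + m) / norm (snd z))"
      by (rule emeasure_bipolar_le) (use z0 t lm in \<open>auto simp: NN_def\<close>)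
    also have "\<dots> \<le> ennreal (576 * t\<^sup>2 * (l + m))"
    proof (rule ennreal_leI)
      have "NN z / norm (snd z) \<le> 2" using zN z0 by (simp add: divide_le_eq)
      then have "16 * t\<^sup>2 * 18 * (l + m) * (NN z / norm (snd z)) \<le> 16 * t\<^sup>2 * 18 * (l + m) * 2" using lm by (intro mult_left_mono) auto
      then show "16 * t\<^sup>2 * (18 * NN z) * (l + m) / norm (snd z) \<le> 576 * t\<^sup>2 * (l + m)" by (simp add: ac_simps)
    qed
    finally show "emeasure lborel {\<xi>. ?P \<xi> \<and> \<bar>sgnb s * norm \<xi> + sgnb s' * norm (snd z - \<xi>) - fst z\<bar> \<le> l + m} \<le> ennreal (576 * t\<^sup>2 * (l + m))" .
  qed (use lm in auto)
  then show ?thesis by (simp add: NN_def conj_ac)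
qed

text \<open>Heron's formula for the triangle with sides \<open>norm v\<close>, \<open>norm u\<close>
  and \<open>norm (v - u)\<close>: the height over \<open>u\<close> is expressed by the sides, and
  the factor with \<open>norm u + norm (v - u)\<close> is absorbed by \<open>norm u\<close>. What
  remains is the defect in the triangle inequality, which the modulations control.\<close>

lemma norm_perpendicular_le:
  fixes u v :: "real^3"
  assumes u: "u \<noteq> 0" and "norm (v - u) \<le> 2 * norm u"
  defines "e \<equiv> u /\<^sub>R norm u"
  shows "(norm (v - (v \<bullet> e) *\<^sub>R e))\<^sup>2 \<le> 9 / 2 * norm v * (norm v - \<bar>norm u - norm (v - u)\<bar>)"
proof -
  define r0 r1 r2 where r: "r0 = norm v" "r1 = norm u" "r2 = norm (v - u)"
  have r1: "r1 > 0" using u by (simp add: r)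
  have tri: "r0 \<le> r1 + r2" "r1 \<le> r0 + r2" "r2 \<le> r0 + r1" "0 \<le> r0" "0 \<le> r2" "r2 \<le> 2 * r1"
    using norm_triangle_ineq[of "v - u" u] norm_triangle_ineq4[of v u] norm_triangle_ineq4[of v "v - u"] assms(2) by (simp_all add: r)
  have ne: "norm e = 1" using u by (simp add: e_def)
  have "(norm (v - (v \<bullet> e) *\<^sub>R e))\<^sup>2 = r0\<^sup>2 - (v \<bullet> e)\<^sup>2"
    using ne unfolding r power2_norm_eq_inner norm_eq_1
    by (simp add: inner_diff_left inner_diff_right inner_commute power2_eq_square algebra_simps)
  moreover have "r1 * (v \<bullet> e) = v \<bullet> u" using u by (simp add: e_def r)
  moreover have "r2\<^sup>2 = r0\<^sup>2 - 2 * (v \<bullet> u) + r1\<^sup>2"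
    unfolding r power2_norm_eq_inner by (simp add: inner_diff_left inner_diff_right inner_commute)
  ultimately have e1: "(norm (v - (v \<bullet> e) *\<^sub>R e))\<^sup>2 = r0\<^sup>2 - (v \<bullet> e)\<^sup>2" and e2: "2 * r1 * (v \<bullet> e) = r0\<^sup>2 + r1\<^sup>2 - r2\<^sup>2" by auto
  let ?q = "(norm (v - (v \<bullet> e) *\<^sub>R e))\<^sup>2"
  have "4 * r1\<^sup>2 * ?q = 4 * r1\<^sup>2 * r0\<^sup>2 - (2 * r1 * (v \<bullet> e))\<^sup>2" unfolding e1 by (simp add: algebra_simps power_mult_distrib)
  also have "\<dots> = (r0\<^sup>2 - (r1 - r2)\<^sup>2) * ((r1 + r2)\<^sup>2 - r0\<^sup>2)" unfolding e2 by (simp add: algebra_simps power2_eq_square)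
  also have "\<dots> \<le> (r0\<^sup>2 - (r1 - r2)\<^sup>2) * (9 * r1\<^sup>2)"
  proof (rule mult_left_mono)
    have "(r1 + r2)\<^sup>2 \<le> (3 * r1)\<^sup>2" using tri r1 by (intro power_mono) auto
    then have "(r1 + r2)\<^sup>2 \<le> 9 * r1\<^sup>2" by (simp add: power_mult_distrib)
    then show "(r1 + r2)\<^sup>2 - r0\<^sup>2 \<le> 9 * r1\<^sup>2" using zero_le_power2[of r0] by (smt (verit))
    have "\<bar>r1 - r2\<bar> \<le> \<bar>r0\<bar>" using tri by auto
    then show "0 \<le> r0\<^sup>2 - (r1 - r2)\<^sup>2" by (simp only: abs_le_square_iff diff_ge_0_iff_ge)
  qed
  finally have "r1\<^sup>2 * (4 * ?q) \<le> r1\<^sup>2 * (9 * (r0\<^sup>2 - (r1 - r2)\<^sup>2))" by (simp add: algebra_simps)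
  then have "4 * ?q \<le> 9 * (r0\<^sup>2 - (r1 - r2)\<^sup>2)" using r1 by simp
  also have "r0\<^sup>2 - (r1 - r2)\<^sup>2 = (r0 - \<bar>r1 - r2\<bar>) * (r0 + \<bar>r1 - r2\<bar>)" by (simp add: algebra_simps power2_eq_square)
  also have "9 * ((r0 - \<bar>r1 - r2\<bar>) * (r0 + \<bar>r1 - r2\<bar>)) \<le> 9 * ((r0 - \<bar>r1 - r2\<bar>) * (2 * r0))"
    using tri by (intro mult_left_mono) auto
  finally show ?thesis by (simp add: r[symmetric] algebra_simps)
qed

text \<open>For opposite signs \<open>\<bar>fst x + fst y\<bar>\<close> is a difference of absolute
  values, hence within the input modulations of the difference of the norms. The alternatives
  distinguish whether it lies below or above the norm of the output frequency.\<close>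

lemma opposite_modulation:
  assumes "opposite_signs x y"
  shows "\<bar>(LL (x + y) - 1) - (norm (snd x + snd y) - \<bar>norm (snd x) - norm (snd y)\<bar>)\<bar> \<le> (LL x - 1) + (LL y - 1)
     \<or> norm (snd x + snd y) - \<bar>norm (snd x) - norm (snd y)\<bar> + (LL (x + y) - 1) \<le> (LL x - 1) + (LL y - 1)"
proof -
  define t1 t2 r0 r1 r2 where d: "t1 = fst x" "t2 = fst y" "r0 = norm (snd x + snd y)" "r1 = norm (snd x)" "r2 = norm (snd y)"
  define p0 p1 p2 where p: "p0 = \<bar>t1 + t2\<bar>" "p1 = \<bar>t1\<bar>" "p2 = \<bar>t2\<bar>"
  have "p0 = \<bar>p1 - p2\<bar>" using assms by (auto simp: opposite_signs_def p d abs_if)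
  then have "\<bar>\<bar>p0 - r0\<bar> - (r0 - \<bar>r1 - r2\<bar>)\<bar> \<le> \<bar>p1 - r1\<bar> + \<bar>p2 - r2\<bar>
     \<or> r0 - \<bar>r1 - r2\<bar> + \<bar>p0 - r0\<bar> \<le> \<bar>p1 - r1\<bar> + \<bar>p2 - r2\<bar>" by (smt (verit))
  then show ?thesis by (simp add: LL_def d p)
qed

context wave_exponents
begin

text \<open>All modulations are at most multiples of \<open>NN y\<close>, so the test at a fixed sum
  uses both input modulation weights. The bipolar volume gives \<open>t\<^sup>2\<close>, the
  modulations up to \<open>16 * t\<close> give the exponent \<open>g1 + g2\<close>, and
  \<open>total\<close> is the condition for integrating in \<open>NN y\<close>.\<close>

lemma trilinear_bound_low_second_small_modulations:
  "trilinear_bound (\<lambda>x y. if NN y \<le> NN x \<and> NN x \<le> 18 * NN (x + y) \<and> LL x \<le> NN y \<and> LL y \<le> 16 * NN y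
     then ennreal (K x y) else 0)"
proof -
  define G where "G x y \<longleftrightarrow> NN y \<le> NN x \<and> NN x \<le> 18 * NN (x + y) \<and> LL x \<le> NN y \<and> LL y \<le> 16 * NN y" for x y
  define \<kappa> \<beta> d where "\<kappa> = 2 * (s0 + s1)" and "\<beta> = 2 * a - 2 * s2" and "d = 2 + (g1 + g2)"
  have \<kappa>: "0 \<le> \<kappa>" "\<beta> + d \<le> \<kappa>" "\<kappa> = 0 \<Longrightarrow> \<beta> + d < 0" "0 \<le> d"
    using pairs total total_eq g1(1) g2(1) unfolding \<kappa>_def \<beta>_def d_def by (smt (verit))+
  obtain C1 where C1: "0 \<le> C1" "\<And>(Q :: real \<times> (real^3) \<Rightarrow> bool) L1 L2 \<Lambda> V. Measurable.pred borel Q \<Longrightarrow> L1 \<in> borel_measurable borel \<Longrightarrow> L2 \<in> borel_measurable borel \<Longrightarrow>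
     (\<And>x. 1 \<le> L1 x) \<Longrightarrow> (\<And>x. 1 \<le> L2 x) \<Longrightarrow> 0 \<le> V \<Longrightarrow>
     (\<And>l m. 1 \<le> l \<Longrightarrow> l \<le> \<Lambda> \<Longrightarrow> 1 \<le> m \<Longrightarrow> m \<le> \<Lambda> \<Longrightarrow> emeasure lborel {x. Q x \<and> L1 x \<le> l \<and> L2 x \<le> m} \<le> ennreal (l * m * V)) \<Longrightarrow>
     (\<integral>\<^sup>+x. (if Q x \<and> L1 x \<le> \<Lambda> \<and> L2 x \<le> \<Lambda> then ennreal (L1 x powr (- 2 * b1) * L2 x powr (- 2 * b2)) else 0) \<partial>lborel) \<le> ennreal (C1 * \<Lambda> powr (g1 + g2) * V)"
    by (rule two_modulations_integral_bound[OF g1 g2, where 'x = "real \<times> (real^3)"]) auto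
  obtain C2 where C2: "0 \<le> C2" "\<And>(g :: real \<times> (real^3) \<Rightarrow> ennreal) N R A. g \<in> borel_measurable lborel \<Longrightarrow> N \<in> borel_measurable lborel \<Longrightarrow> (\<And>x. 1 \<le> N x) \<Longrightarrow>
    (\<And>t. 1 \<le> t \<Longrightarrow> t \<le> R \<Longrightarrow> (\<integral>\<^sup>+x. (if N x \<le> t then g x else 0) \<partial>lborel) \<le> ennreal (t powr d) * A) \<Longrightarrow>
    (\<integral>\<^sup>+x. (if N x \<le> R then ennreal (N x powr \<beta>) * g x else 0) \<partial>lborel) \<le> ennreal (C2 * R powr \<kappa>) * A"
    using dyadic_integral_bound[where M = "lborel :: (real \<times> (real^3)) measure", OF \<kappa>] by blast
  define c where "c = exp (\<bar>2 * s1\<bar> * ln 18 + 2 * a * ln 19)"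
  define D where "D = c * (C2 * 18 powr \<kappa> * (C1 * 16 powr (g1 + g2) * 9216))"
  have "trilinear_bound (\<lambda>x y. if G x y then ennreal (K x y) else 0)"
  proof (rule trilinear_bound_fix_sum[where C = D])
    have Gm[measurable]: "Measurable.pred (borel \<Otimes>\<^sub>M borel) (\<lambda>p. G (fst p) (snd p))" unfolding G_def by measurable
    show "(\<lambda>(x, y). if G x y then ennreal (K x y) else 0) \<in> borel_measurable borel"
    proof (rule borel_measurable_pairI)
      show "(\<lambda>(x, y). if G x y then ennreal (K x y) else 0) \<in> borel_measurable (borel \<Otimes>\<^sub>M borel)"
        unfolding case_prod_beta by measurable
    qed
    fix z :: "real \<times> (real^3)"
    let ?N = "\<lambda>x. NN (z - x)"
    \<comment> \<open>The cut-offs are multiples of \<open>NN (z - x)\<close>; on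
      \<open>NN (z - x) \<le> t\<close> they become the fixed bound \<open>16 * t\<close>.\<close>
    define g where "g x = (if NN x \<le> 18 * NN z \<and> LL x \<le> 16 * ?N x \<and> LL (z - x) \<le> 16 * ?N x
       then ennreal (LL x powr (- 2 * b1) * LL (z - x) powr (- 2 * b2)) else 0)" for x
    have [measurable]: "g \<in> borel_measurable borel" unfolding g_def by measurable
    have "(\<integral>\<^sup>+x. (if G x (z - x) then ennreal (K x (z - x)) else 0)\<^sup>2 \<partial>lborel)
      \<le> (\<integral>\<^sup>+x. ennreal (c * NN z powr (- \<kappa>)) * (if ?N x \<le> 18 * NN z then ennreal (?N x powr \<beta>) * g x else 0) \<partial>lborel)"
    proof (rule nn_integral_mono)
      fix x
      show "(if G x (z - x) then ennreal (K x (z - x)) else 0)\<^sup>2 \<le> ennreal (c * NN z powr (- \<kappa>)) * (if ?N x \<le> 18 * NN z then ennreal (?N x powr \<beta>) * g x else 0)"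
      proof (cases "G x (z - x)")
        case True
        define y where "y = z - x"
        have z: "z = x + y" by (simp add: y_def)
        from True have H: "NN y \<le> NN x" "NN x \<le> 18 * NN z" "LL x \<le> NN y" "LL y \<le> 16 * NN y" by (auto simp: G_def y_def)
        have "NN z \<le> 18 * NN x" using NN_add_le[of x y] H NN_ge_1[of x] unfolding z by linarith
        then have n0: "\<bar>ln (NN z) - ln (NN x)\<bar> \<le> ln 18"
          using H ln_le_ln_add[of "NN z" "NN x" 18] ln_le_ln_add[of "NN x" "NN z" 18] by simp
        have "LL z \<le> 19 * NN y" using LL_add_le[of x y] H unfolding z by linarith
        then have l0: "ln (LL z) \<le> ln 19 + ln (NN y)" by (intro ln_le_ln_add) auto
        have 1: "2 * s1 * (ln (NN z) - ln (NN x)) \<le> \<bar>2 * s1\<bar> * ln 18" by (rule mult_le_abs_mult[OF n0])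
        have 2: "2 * a * ln (LL z) \<le> 2 * a * (ln 19 + ln (NN y))" using a_pos l0 by (intro mult_left_mono) auto
        have "(K x y)\<^sup>2 \<le> c * NN z powr (- \<kappa>) * (NN y powr \<beta> * (LL x powr (- 2 * b1) * LL y powr (- 2 * b2)))"
          unfolding K_square z[symmetric] powr_eq_exp[OF NN_pos] powr_eq_exp[OF LL_pos] c_def mult_exp_exp exp_le_cancel_iff
          using 1 2 by (simp add: algebra_simps \<kappa>_def \<beta>_def)
        then have "ennreal ((K x y)\<^sup>2) \<le> ennreal (c * NN z powr (- \<kappa>) * (NN y powr \<beta> * (LL x powr (- 2 * b1) * LL y powr (- 2 * b2))))"
          by (rule ennreal_leI)
        also have "\<dots> = ennreal (c * NN z powr (- \<kappa>)) * (ennreal (NN y powr \<beta>) * ennreal (LL x powr (- 2 * b1) * LL y powr (- 2 * b2)))"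
        proof -
          have "0 \<le> c * NN z powr (- \<kappa>)" by (simp add: c_def)
          then show ?thesis by (simp only: ennreal_mult' powr_ge_zero)
        qed
        also have "\<dots> = ennreal (c * NN z powr (- \<kappa>)) * (if ?N x \<le> 18 * NN z then ennreal (?N x powr \<beta>) * g x else 0)"
        proof -
          have L: "LL x \<le> 16 * NN y" "NN y \<le> 18 * NN z" using H NN_ge_1[of y] by (smt (verit))+
          have gx: "g x = ennreal (LL x powr (- 2 * b1) * LL y powr (- 2 * b2))"
            unfolding g_def y_def[symmetric] by (rule if_P) (use H L in blast)
          show ?thesis unfolding gx y_def[symmetric] if_P[OF L(2)] ..
        qed
        finally show ?thesis using True K_nonneg[of x y] by (simp add: y_def[symmetric] ennreal_power)
      qed simp
    qed
    also have "\<dots> = ennreal (c * NN z powr (- \<kappa>)) * (\<integral>\<^sup>+x. (if ?N x \<le> 18 * NN z then ennreal (?N x powr \<beta>) * g x else 0) \<partial>lborel)"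
      by (rule nn_integral_cmult) measurable
    also have "\<dots> \<le> ennreal (c * NN z powr (- \<kappa>)) * (ennreal (C2 * (18 * NN z) powr \<kappa>) * ennreal (C1 * 16 powr (g1 + g2) * 9216))"
    proof (rule mult_left_mono, rule C2(2))
      fix t :: real assume t: "1 \<le> t" "t \<le> 18 * NN z"
      have "(\<integral>\<^sup>+x. (if ?N x \<le> t then g x else 0) \<partial>lborel)
        \<le> (\<integral>\<^sup>+x. (if (?N x \<le> t \<and> NN x \<le> 18 * NN z) \<and> LL x \<le> 16 * t \<and> LL (z - x) \<le> 16 * t then ennreal (LL x powr (- 2 * b1) * LL (z - x) powr (- 2 * b2)) else 0) \<partial>lborel)"
        by (intro nn_integral_mono) (auto simp: g_def)
      also have "\<dots> \<le> ennreal (C1 * (16 * t) powr (g1 + g2) * (9216 * t\<^sup>2))"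
      proof (rule C1(2))
        fix l m :: real assume "1 \<le> l" "1 \<le> m"
        then show "emeasure lborel {x. (?N x \<le> t \<and> NN x \<le> 18 * NN z) \<and> LL x \<le> l \<and> LL (z - x) \<le> m} \<le> ennreal (l * m * (9216 * t\<^sup>2))"
          by (rule emeasure_low_second_le[OF t])
      qed (use t in auto)
      also have "\<dots> = ennreal (t powr d * (C1 * 16 powr (g1 + g2) * 9216))"
        using t by (simp add: d_def powr_add powr_mult ac_simps)
      also have "\<dots> = ennreal (t powr d) * ennreal (C1 * 16 powr (g1 + g2) * 9216)" by (rule ennreal_mult') simp
      finally show "(\<integral>\<^sup>+x. (if ?N x \<le> t then g x else 0) \<partial>lborel) \<le> ennreal (t powr d) * ennreal (C1 * 16 powr (g1 + g2) * 9216)" .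
    qed auto
    also have "\<dots> = ennreal D"
    proof -
      have nn: "0 \<le> c * NN z powr (- \<kappa>)" "0 \<le> C2 * (18 * NN z) powr \<kappa>" using C2(1) by (simp_all add: c_def)
      have "NN z powr (- \<kappa>) * (18 * NN z) powr \<kappa> = 18 powr \<kappa>"
      proof -
        have "NN z \<noteq> 0" using NN_pos[of z] by linarith
        then have "NN z powr (- \<kappa>) * NN z powr \<kappa> = 1" by (simp add: powr_add[symmetric])
        moreover have "(18 * NN z) powr \<kappa> = 18 powr \<kappa> * NN z powr \<kappa>" by (rule powr_mult)
        ultimately show ?thesis by (simp add: mult.left_commute)
      qed
      then have "c * NN z powr (- \<kappa>) * (C2 * (18 * NN z) powr \<kappa> * (C1 * 16 powr (g1 + g2) * 9216)) = D"
      proof -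
        assume *: "NN z powr (- \<kappa>) * (18 * NN z) powr \<kappa> = 18 powr \<kappa>"
        have "c * NN z powr (- \<kappa>) * (C2 * (18 * NN z) powr \<kappa> * (C1 * 16 powr (g1 + g2) * 9216))
          = c * (C2 * (NN z powr (- \<kappa>) * (18 * NN z) powr \<kappa>) * (C1 * 16 powr (g1 + g2) * 9216))" by (simp only: ac_simps)
        then show ?thesis unfolding * D_def .
      qed
      then show ?thesis using nn by (simp only: ennreal_mult'[symmetric])
    qed
    finally show "(\<integral>\<^sup>+x. (if G x (z - x) then ennreal (K x (z - x)) else 0)\<^sup>2 \<partial>lborel) \<le> ennreal D" .
  qed
  then show ?thesis by (simp add: G_def)
qed

text \<open>The output modulation is controlled by \<open>LL x\<close>, so an output frequency of
  size at most \<open>m\<close> lies in a cylinder about the direction of \<open>snd x\<close> of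
  radius comparable to \<open>sqrt (LL x * m)\<close>. One power of \<open>m\<close> in the volume
  is thereby replaced by \<open>LL x\<close>.\<close>

lemma trilinear_bound_high_high_small_output_modulation:
  "trilinear_bound (\<lambda>x y. if high_high x y \<and> opposite_signs x y \<and> LL x < NN (x + y) \<and> LL (x + y) \<le> 8 * LL x then ennreal (K x y) else 0)"
proof -
  define G where "G x y \<longleftrightarrow> high_high x y \<and> opposite_signs x y \<and> LL x < NN (x + y) \<and> LL (x + y) \<le> 8 * LL x" for x y
  \<comment> \<open>The leftover power of \<open>LL x\<close>, including the one from the volume,
    may have either sign: a positive power is replaced by one of the larger
    \<open>NN (x + y)\<close>, a negative one by 1.\<close>
  define e where "e = max 0 (1 + 2 * a - 2 * b1 + g2)"
  define \<kappa> \<beta> where "\<kappa> = 2 * (s1 + s2)" and "\<beta> = e - 2 * s0"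
  have e: "0 \<le> e" "1 + 2 * a - 2 * b1 + g2 \<le> e" by (simp_all add: e_def)
  have \<kappa>: "0 \<le> \<kappa>" "\<beta> + 2 \<le> \<kappa>" "\<kappa> = 0 \<Longrightarrow> \<beta> + 2 < 0" "0 \<le> (2::real)"
    using pairs total total1 g1(1) g2(1) a_pos unfolding \<kappa>_def \<beta>_def e_def by (smt (verit))+
  obtain C where C: "0 \<le> C" "\<And>(Q :: real \<times> (real^3) \<Rightarrow> bool) N L R \<Lambda> V. Measurable.pred borel Q \<Longrightarrow> N \<in> borel_measurable borel \<Longrightarrow> L \<in> borel_measurable borel \<Longrightarrow>
     (\<And>x. 1 \<le> N x) \<Longrightarrow> (\<And>x. 1 \<le> L x) \<Longrightarrow> 0 \<le> V \<Longrightarrow>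
     (\<And>m l. 1 \<le> m \<Longrightarrow> m \<le> R \<Longrightarrow> 1 \<le> l \<Longrightarrow> l \<le> \<Lambda> \<Longrightarrow> emeasure lborel {x. Q x \<and> N x \<le> m \<and> L x \<le> l} \<le> ennreal (m powr 2 * l * V)) \<Longrightarrow>
     (\<integral>\<^sup>+x. (if Q x \<and> N x \<le> R \<and> L x \<le> \<Lambda> then ennreal (N x powr \<beta> * L x powr (- 2 * b2)) else 0) \<partial>lborel) \<le> ennreal (C * R powr \<kappa> * \<Lambda> powr g2 * V)"
    by (rule frequency_modulation_integral_bound[OF g2 \<kappa>, where 'x = "real \<times> (real^3)"]) auto
  define c where "c = exp (\<bar>2 * s2\<bar> * ln 2 + 2 * a * ln 8)"
  have Gm[measurable]: "Measurable.pred (borel \<Otimes>\<^sub>M borel) (\<lambda>p. G (fst p) (snd p))"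
    unfolding G_def high_high_def opposite_signs_def by measurable
  have Gx[measurable]: "Measurable.pred borel (\<lambda>y. G x y)" for x
    unfolding G_def high_high_def opposite_signs_def by measurable
  have vol: "emeasure lborel {y. G x y \<and> NN (x + y) \<le> m \<and> LL y \<le> l} \<le> ennreal (m powr 2 * l * (165600 * LL x))"
    if ml: "1 \<le> m" "1 \<le> l" for x m l
  proof (cases "LL x < m \<and> snd x \<noteq> 0")
    \<comment> \<open>The region requires \<open>LL x < NN (x + y)\<close> and forces
      \<open>NN x\<close> to be at least 16, so no \<open>y\<close> is left.\<close>
    case False
    have "{y. G x y \<and> NN (x + y) \<le> m \<and> LL y \<le> l} = {}"
    proof -
      have "LL x < m \<and> snd x \<noteq> 0" if "G x y" "NN (x + y) \<le> m" for y
      proof -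
        from that have "16 * NN (x + y) \<le> NN x" "LL x < NN (x + y)" by (auto simp: G_def high_high_def)
        moreover from this have "16 \<le> NN x" using NN_ge_1[of "x + y"] by linarith
        ultimately show ?thesis using that(2) by (auto simp: NN_def[of x])
      qed
      with False show ?thesis by auto
    qed
    then show ?thesis by (simp only: emeasure_empty zero_le)
  next
    case True
    define e where "e = snd x /\<^sub>R norm (snd x)"
    \<comment> \<open>The perpendicular bound reads \<open>9 / 2 * m * (10 * LL x)\<close>.\<close>
    define b where "b = sqrt (45 * LL x * m)"
    have e1: "norm e = 1" using True by (simp add: e_def)
    have "0 < 45 * LL x * m" using ml by (intro mult_pos_pos) auto
    then have b2: "b\<^sup>2 = 45 * LL x * m" and b0: "b > 0" by (simp_all add: b_def)
    have "LL x < m" using True by blast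
    then have "45 * LL x \<le> 49 * m" "0 \<le> m" using ml(1) by linarith+
    then have "45 * LL x * m \<le> 49 * m * m" by (rule mult_right_mono)
    then have "b\<^sup>2 \<le> (7 * m)\<^sup>2" unfolding b2 by (simp add: power2_eq_square)
    then have b7: "b \<le> 7 * m" by (rule power2_le_imp_le) (use ml in simp)
    let ?P = "\<lambda>\<eta>. \<bar>\<eta> \<bullet> e\<bar> \<le> m \<and> norm (\<eta> - (\<eta> \<bullet> e) *\<^sub>R e) \<le> b"
    have "{y. G x y \<and> NN (x + y) \<le> m \<and> LL y \<le> l} \<subseteq> {y. ?P (snd x + snd y) \<and> LL y \<le> l}"
    proof
      fix y assume "y \<in> {y. G x y \<and> NN (x + y) \<le> m \<and> LL y \<le> l}"
      then have H: "high_high x y" "opposite_signs x y" "LL x < NN (x + y)" "LL (x + y) \<le> 8 * LL x" "NN (x + y) \<le> m" "LL y \<le> l"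
        by (auto simp: G_def)
      define v where "v = snd x + snd y"
      have vy: "snd y = v - snd x" by (simp add: v_def)
      have vm: "norm v \<le> m" using H(5) by (simp add: NN_def v_def)
      have "\<bar>v \<bullet> e\<bar> \<le> norm v" using Cauchy_Schwarz_ineq2[of v e] e1 by simp
      then have 1: "\<bar>v \<bullet> e\<bar> \<le> m" using vm by simp
      have "16 * (1 + norm v) \<le> 1 + norm (snd x)" "LL y \<le> LL x" using H(1) by (auto simp: high_high_def NN_def v_def)
      moreover have "norm (v - snd x) \<le> norm v + norm (snd x)" by (rule norm_triangle_ineq4)
      ultimately have r2: "norm (v - snd x) \<le> 2 * norm (snd x)" using norm_ge_zero[of v] by (smt (verit))
      \<comment> \<open>The defect is at most the output modulation plus both input modulations, in
        units of \<open>LL x\<close>: \<open>8 + 1 + 1\<close>.\<close>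
      have rm: "norm v - \<bar>norm (snd x) - norm (v - snd x)\<bar> \<le> 10 * LL x"
        using opposite_modulation[OF H(2)] H(4) \<open>LL y \<le> LL x\<close> LL_ge_1[of x] LL_ge_1[of "x + y"] unfolding v_def add_diff_cancel_left' by (smt (verit))
      have "(norm (v - (v \<bullet> e) *\<^sub>R e))\<^sup>2 \<le> 9 / 2 * norm v * (norm v - \<bar>norm (snd x) - norm (v - snd x)\<bar>)"
        unfolding e_def by (rule norm_perpendicular_le) (use True r2 in auto)
      also have "\<dots> \<le> 9 / 2 * norm v * (10 * LL x)" by (intro mult_left_mono rm) auto
      also have "\<dots> \<le> 9 / 2 * m * (10 * LL x)" using vm less_imp_le[OF LL_pos[of x]] by (intro mult_right_mono) auto
      finally have "(norm (v - (v \<bullet> e) *\<^sub>R e))\<^sup>2 \<le> b\<^sup>2" unfolding b2 by (simp add: ac_simps)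
      then have "norm (v - (v \<bullet> e) *\<^sub>R e) \<le> b" by (rule power2_le_imp_le) (use b0 in simp)
      with 1 H(6) show "y \<in> {y. ?P (snd x + snd y) \<and> LL y \<le> l}" by (simp add: v_def)
    qed
    then have "emeasure lborel {y. G x y \<and> NN (x + y) \<le> m \<and> LL y \<le> l} \<le> emeasure lborel {y. ?P (snd x + snd y) \<and> LL y \<le> l}"
      by (rule emeasure_mono) measurable
    also have "\<dots> \<le> ennreal (4 * l) * emeasure lborel {\<eta>. ?P (snd x + \<eta>)}"
      by (rule emeasure_modulation_le) (use ml in auto)
    also have "emeasure lborel {\<eta>. ?P (snd x + \<eta>)} = emeasure lborel {\<eta>. ?P \<eta>}" by (rule emeasure_lborel_shift) measurable
    also have "ennreal (4 * l) * \<dots> \<le> ennreal (4 * l) * ennreal (40 * b\<^sup>2 * (2 * m + 3 * b))"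
      using ml b0 e1 by (intro mult_left_mono emeasure_cylinder_le) auto
    also have "\<dots> = ennreal (4 * l * (40 * b\<^sup>2 * (2 * m + 3 * b)))" using ml by (intro ennreal_mult'[symmetric]) auto
    also have "\<dots> \<le> ennreal (m powr 2 * l * (165600 * LL x))"
    proof (rule ennreal_leI)
      have "4 * l * (40 * b\<^sup>2 * (2 * m + 3 * b)) \<le> 4 * l * (40 * b\<^sup>2 * (23 * m))" using b7 ml by (intro mult_left_mono) auto
      also have "\<dots> = m powr 2 * l * (165600 * LL x)" using ml unfolding b2 by (simp add: power2_eq_square)
      finally show "4 * l * (40 * b\<^sup>2 * (2 * m + 3 * b)) \<le> m powr 2 * l * (165600 * LL x)" .
    qed
    finally show ?thesis .
  qed
  define D where "D = c * (C * 165600)"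
  have "trilinear_bound (\<lambda>x y. if G x y then ennreal (K x y) else 0)"
  proof (rule trilinear_bound_fix_first[where C = D])
    show "(\<lambda>(x, y). if G x y then ennreal (K x y) else 0) \<in> borel_measurable borel"
    proof (rule borel_measurable_pairI)
      show "(\<lambda>(x, y). if G x y then ennreal (K x y) else 0) \<in> borel_measurable (borel \<Otimes>\<^sub>M borel)"
        unfolding case_prod_beta by measurable
    qed
    fix x :: "real \<times> (real^3)"
    \<comment> \<open>One power of \<open>LL x\<close> pays for the volume, and \<open>g2\<close>
      more for the integral in \<open>LL y\<close>.\<close>
    define A where "A = c * (NN x powr (- \<kappa>) * LL x powr (- 1 - g2))"
    have A0: "0 \<le> A" by (simp add: A_def c_def)
    let ?I = "\<lambda>y. if G x y \<and> NN (x + y) \<le> NN x \<and> LL y \<le> LL x then ennreal (NN (x + y) powr \<beta> * LL y powr (- 2 * b2)) else 0"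
    have "(\<integral>\<^sup>+y. (if G x y then ennreal (K x y) else 0)\<^sup>2 \<partial>lborel) \<le> (\<integral>\<^sup>+y. ennreal A * ?I y \<partial>lborel)"
    proof (rule nn_integral_mono)
      fix y
      show "(if G x y then ennreal (K x y) else 0)\<^sup>2 \<le> ennreal A * ?I y"
      proof (cases "G x y")
        case True
        then have H: "high_high x y" "LL x < NN (x + y)" "LL (x + y) \<le> 8 * LL x" by (auto simp: G_def)
        have H2: "NN (x + y) \<le> NN x" "LL y \<le> LL x" using H(1) NN_ge_1[of "x + y"] unfolding high_high_def by linarith+
        have l0: "ln (LL (x + y)) \<le> ln 8 + ln (LL x)" using H by (intro ln_le_ln_add) auto
        have 1: "2 * s2 * (ln (NN x) - ln (NN y)) \<le> \<bar>2 * s2\<bar> * ln 2" using H by (intro mult_le_abs_mult high_high_ln_NN) auto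
        have 2: "2 * a * ln (LL (x + y)) \<le> 2 * a * (ln 8 + ln (LL x))" using a_pos l0 by (intro mult_left_mono) auto
        have "(1 + 2 * a - 2 * b1 + g2) * ln (LL x) \<le> e * ln (LL x)" using e by (intro mult_right_mono) auto
        also have "\<dots> \<le> e * ln (NN (x + y))" using H(2) e by (intro mult_left_mono) auto
        finally have 3: "(1 + 2 * a - 2 * b1 + g2) * ln (LL x) \<le> e * ln (NN (x + y))" .
        have "(K x y)\<^sup>2 \<le> A * (NN (x + y) powr \<beta> * LL y powr (- 2 * b2))"
          unfolding K_square powr_eq_exp[OF NN_pos] powr_eq_exp[OF LL_pos] A_def c_def mult_exp_exp exp_le_cancel_iff
          using 1 2 3 by (simp add: algebra_simps \<kappa>_def \<beta>_def)
        then have "ennreal ((K x y)\<^sup>2) \<le> ennreal (A * (NN (x + y) powr \<beta> * LL y powr (- 2 * b2)))" by (rule ennreal_leI)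
        also have "\<dots> = ennreal A * ?I y" using True H2 by (simp add: ennreal_mult'[OF A0])
        finally show ?thesis using True K_nonneg[of x y] by (simp add: ennreal_power)
      qed simp
    qed
    also have "\<dots> = ennreal A * (\<integral>\<^sup>+y. ?I y \<partial>lborel)" by (rule nn_integral_cmult) measurable
    also have "\<dots> \<le> ennreal A * ennreal (C * NN x powr \<kappa> * LL x powr g2 * (165600 * LL x))"
    proof (rule mult_left_mono, rule C(2))
      show "0 \<le> 165600 * LL x" using LL_ge_1[of x] by linarith
      fix m l :: real assume "1 \<le> m" "1 \<le> l"
      then show "emeasure lborel {y. G x y \<and> NN (x + y) \<le> m \<and> LL y \<le> l} \<le> ennreal (m powr 2 * l * (165600 * LL x))" by (rule vol)
    qed auto
    also have "\<dots> = ennreal (A * (C * NN x powr \<kappa> * LL x powr g2 * (165600 * LL x)))" by (rule ennreal_mult'[OF A0, symmetric])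
    also have "A * (C * NN x powr \<kappa> * LL x powr g2 * (165600 * LL x)) = D"
    proof -
      have "NN x powr (- \<kappa>) * NN x powr \<kappa> = 1" using NN_pos[of x] by (simp add: powr_add[symmetric] less_imp_neq[OF NN_pos, symmetric])
      moreover have "LL x powr (- 1 - g2) * LL x powr g2 * LL x = 1"
      proof -
        have "LL x powr (- 1 - g2) * LL x powr g2 * LL x powr 1 = LL x powr (- 1 - g2 + g2 + 1)" by (simp only: powr_add)
        then show ?thesis using LL_ge_1[of x] by simp
      qed
      moreover have "A * (C * NN x powr \<kappa> * LL x powr g2 * (165600 * LL x))
        = c * (C * 165600) * (NN x powr (- \<kappa>) * NN x powr \<kappa>) * (LL x powr (- 1 - g2) * LL x powr g2 * LL x)"
        unfolding A_def by (simp only: ac_simps)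
      ultimately show ?thesis by (simp add: D_def)
    qed
    finally show "(\<integral>\<^sup>+y. (if G x y then ennreal (K x y) else 0)\<^sup>2 \<partial>lborel) \<le> ennreal D" .
  qed
  then show ?thesis by (simp add: G_def)
qed

end

section \<open>Thin level sets of the phase\<close>

lemma norm_sgn_diff_le:
  fixes x y :: "'a::real_normed_vector"
  assumes "y \<noteq> 0"
  shows "norm (sgn x - sgn y) \<le> 2 * norm (x - y) / norm y"
proof (cases "x = 0")
  case True
  then show ?thesis using assms by (simp add: norm_sgn)
next
  case False
  have y: "norm y > 0" and x: "norm x > 0" using assms False by auto
  have "sgn x - sgn y = (x - y) /\<^sub>R norm y + (inverse (norm x) - inverse (norm y)) *\<^sub>R x"
    by (simp add: sgn_div_norm algebra_simps)
  then have "norm (sgn x - sgn y) \<le> norm ((x - y) /\<^sub>R norm y) + norm ((inverse (norm x) - inverse (norm y)) *\<^sub>R x)"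
    by (metis norm_triangle_ineq)
  also have "norm ((x - y) /\<^sub>R norm y) = norm (x - y) / norm y" by (simp add: divide_inverse mult.commute)
  also have "norm ((inverse (norm x) - inverse (norm y)) *\<^sub>R x) = \<bar>norm y - norm x\<bar> / norm y"
  proof -
    have "inverse (norm x) - inverse (norm y) = (norm y - norm x) / (norm x * norm y)"
      using x y by (simp add: field_simps)
    then have "norm ((inverse (norm x) - inverse (norm y)) *\<^sub>R x) = \<bar>norm y - norm x\<bar> / (norm x * norm y) * norm x"
      using x y by (simp add: abs_mult abs_of_pos)
    also have "\<dots> = \<bar>norm y - norm x\<bar> / norm y" using x y by (simp add: field_simps)
    finally show ?thesis .
  qed
  also have "\<bar>norm y - norm x\<bar> / norm y \<le> norm (x - y) / norm y"
    using y norm_triangle_ineq3[of x y] by (intro divide_right_mono) (simp_all add: abs_minus_commute)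
  finally show ?thesis by (simp add: add_divide_distrib[symmetric])
qed

text \<open>Convexity: \<open>sgn x\<close> is a subgradient of the norm at \<open>x\<close>,
  including the origin, where it is 0.\<close>

lemma norm_line_ge:
  fixes x d :: "'a::real_inner"
  shows "t * (d \<bullet> sgn x) \<le> norm (x + t *\<^sub>R d) - norm x"
proof (cases "x = 0")
  case False
  have "(x + t *\<^sub>R d) \<bullet> sgn x \<le> norm (x + t *\<^sub>R d) * norm (sgn x)" by (rule norm_cauchy_schwarz)
  moreover have "norm (sgn x) = 1" using False by (simp add: norm_sgn)
  moreover have "x \<bullet> sgn x = norm x"
    using False by (simp add: sgn_div_norm power2_norm_eq_inner[symmetric] power2_eq_square field_simps)
  ultimately show ?thesis by (simp add: inner_add_left)
qed simp

lemma norm_line_le: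
  fixes x d :: "'a::real_inner"
  shows "norm (x + t *\<^sub>R d) - norm x \<le> t * (d \<bullet> sgn (x + t *\<^sub>R d))"
  using norm_line_ge[of "- t" d "x + t *\<^sub>R d"] by simp

text \<open>On the ball the phase \<open>norm \<xi> + \<sigma> * norm (p - \<xi>)\<close> grows at rate at least \<open>m\<close> in a fixed
  direction, so that its level sets are thin in that direction.\<close>

lemma emeasure_level_set_le:
  fixes A :: "(real^3) set"
  assumes Am: "A \<in> sets borel" and sub: "A \<subseteq> cball y \<rho>" and pos: "0 < \<rho>" "0 < m" "0 < l"
    and \<sigma>: "\<sigma> = 1 \<or> \<sigma> = - 1"
    and A: "\<And>\<xi>. \<xi> \<in> A \<Longrightarrow> \<bar>norm \<xi> + \<sigma> * norm (p - \<xi>) - c\<bar> \<le> l \<and> \<xi> \<noteq> 0 \<and> p - \<xi> \<noteq> 0 \<and>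
      m \<le> norm (sgn \<xi> - \<sigma> *\<^sub>R sgn (p - \<xi>)) - 4 * \<rho> / norm \<xi> - 4 * \<rho> / norm (p - \<xi>)"
  shows "emeasure lborel A \<le> ennreal (80 * \<rho>\<^sup>2 * (3 * l / m))"
proof (cases "A = {}")
  case False
  then obtain x0 where x0: "x0 \<in> A" by blast
  \<comment> \<open>The gradient of the phase at one base point; its direction serves for the whole
    set.\<close>
  define D where "D = sgn x0 - \<sigma> *\<^sub>R sgn (p - x0)"
  define d where "d = sgn D"
  have nz: "x0 \<noteq> 0" "p - x0 \<noteq> 0" and mD: "m \<le> norm D - 4 * \<rho> / norm x0 - 4 * \<rho> / norm (p - x0)"
    using A[OF x0] by (auto simp: D_def)
  have "0 \<le> 4 * \<rho> / norm x0" "0 \<le> 4 * \<rho> / norm (p - x0)" using pos by simp_all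
  then have Dpos: "norm D > 0" using mD pos by (smt (verit))
  then have d: "norm d = 1" by (simp add: d_def norm_sgn)
  have dD: "d \<bullet> D = norm D"
    using Dpos by (simp add: d_def sgn_div_norm power2_norm_eq_inner[symmetric] power2_eq_square field_simps)
  \<comment> \<open>The gradients of the two norms are taken at possibly different points, because
    the convexity inequalities below evaluate them at different ends of a segment. Inside the ball
    each one moves by at most \<open>4 * \<rho>\<close> divided by the respective norm.\<close>
  have slope: "m \<le> d \<bullet> (sgn x - \<sigma> *\<^sub>R sgn (p - x'))" if "x \<in> A" "x' \<in> A" for x x'
  proof -
    have b: "norm (u - x0) \<le> 2 * \<rho>" if "u \<in> A" for u
    proof -
      have "dist u x0 \<le> dist y u + dist y x0" by (metis dist_commute dist_triangle)
      moreover have "dist y u \<le> \<rho>" "dist y x0 \<le> \<rho>" using that x0 sub by auto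
      ultimately show ?thesis unfolding dist_norm[of u x0] by (smt (verit))
    qed
    have 1: "norm (sgn x - sgn x0) \<le> 4 * \<rho> / norm x0"
    proof -
      have "norm (sgn x - sgn x0) \<le> 2 * norm (x - x0) / norm x0" by (rule norm_sgn_diff_le[OF nz(1)])
      also have "\<dots> \<le> 4 * \<rho> / norm x0" using b[OF that(1)] by (intro divide_right_mono) auto
      finally show ?thesis .
    qed
    have 2: "norm (sgn (p - x') - sgn (p - x0)) \<le> 4 * \<rho> / norm (p - x0)"
    proof -
      have "norm (sgn (p - x') - sgn (p - x0)) \<le> 2 * norm ((p - x') - (p - x0)) / norm (p - x0)" by (rule norm_sgn_diff_le[OF nz(2)])
      also have "\<dots> \<le> 4 * \<rho> / norm (p - x0)" using b[OF that(2)] by (intro divide_right_mono) (auto simp: norm_minus_commute)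
      finally show ?thesis .
    qed
    have "sgn x - \<sigma> *\<^sub>R sgn (p - x') = D + ((sgn x - sgn x0) - \<sigma> *\<^sub>R (sgn (p - x') - sgn (p - x0)))"
      by (simp add: D_def algebra_simps)
    then have "d \<bullet> (sgn x - \<sigma> *\<^sub>R sgn (p - x')) = norm D + d \<bullet> ((sgn x - sgn x0) - \<sigma> *\<^sub>R (sgn (p - x') - sgn (p - x0)))"
      by (simp only: inner_add_right dD)
    moreover have "\<bar>d \<bullet> ((sgn x - sgn x0) - \<sigma> *\<^sub>R (sgn (p - x') - sgn (p - x0)))\<bar> \<le> 4 * \<rho> / norm x0 + 4 * \<rho> / norm (p - x0)"
    proof -
      have "\<bar>d \<bullet> ((sgn x - sgn x0) - \<sigma> *\<^sub>R (sgn (p - x') - sgn (p - x0)))\<bar> \<le> norm ((sgn x - sgn x0) - \<sigma> *\<^sub>R (sgn (p - x') - sgn (p - x0)))"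
        using Cauchy_Schwarz_ineq2[of d] d by simp
      also have "\<dots> \<le> norm (sgn x - sgn x0) + norm (\<sigma> *\<^sub>R (sgn (p - x') - sgn (p - x0)))" by (rule norm_triangle_ineq4)
      also have "norm (\<sigma> *\<^sub>R (sgn (p - x') - sgn (p - x0))) = norm (sgn (p - x') - sgn (p - x0))" using \<sigma> by auto
      finally show ?thesis using 1 2 by (smt (verit))
    qed
    ultimately show ?thesis using mD by (smt (verit))
  qed
  have key: "t * m \<le> 2 * l" if t: "0 \<le> t" and x: "x \<in> A" "x + t *\<^sub>R d \<in> A" for x t
  proof -
    let ?x' = "x + t *\<^sub>R d"
    have 1: "t * (d \<bullet> sgn x) \<le> norm ?x' - norm x" by (rule norm_line_ge)
    have pn: "norm (p - x) = norm (x - p)" "norm (p - ?x') = norm ((x - p) + t *\<^sub>R d)"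
      by (simp_all add: norm_minus_commute algebra_simps)
    have sg: "sgn (p - x) = - sgn (x - p)" "sgn (p - ?x') = - sgn ((x - p) + t *\<^sub>R d)"
      by (metis minus_diff_eq sgn_minus, metis (no_types, lifting) add_diff_eq diff_add_eq minus_diff_eq sgn_minus)
    \<comment> \<open>For \<open>\<sigma> = 1\<close> the second term is convex and its gradient is
      taken at the starting point; for \<open>\<sigma> = - 1\<close> it is concave and the end point
      is used.\<close>
    obtain x'' where x'': "x'' \<in> A" "t * (d \<bullet> - (\<sigma> *\<^sub>R sgn (p - x''))) \<le> \<sigma> * (norm (p - ?x') - norm (p - x))"
    proof (cases "\<sigma> = 1")
      case True
      have "t * (d \<bullet> sgn (x - p)) \<le> norm ((x - p) + t *\<^sub>R d) - norm (x - p)" by (rule norm_line_ge)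
      then have "t * (d \<bullet> - (\<sigma> *\<^sub>R sgn (p - x))) \<le> \<sigma> * (norm (p - ?x') - norm (p - x))"
        unfolding True pn sg(1) by simp
      with x(1) show ?thesis by (rule that)
    next
      case False
      then have \<sigma>': "\<sigma> = - 1" using \<sigma> by simp
      have "norm ((x - p) + t *\<^sub>R d) - norm (x - p) \<le> t * (d \<bullet> sgn ((x - p) + t *\<^sub>R d))" by (rule norm_line_le)
      then have "t * (d \<bullet> - (\<sigma> *\<^sub>R sgn (p - ?x'))) \<le> \<sigma> * (norm (p - ?x') - norm (p - x))"
        unfolding \<sigma>' pn sg(2) by simp
      with x(2) show ?thesis by (rule that)
    qed
    have "t * m \<le> t * (d \<bullet> (sgn x - \<sigma> *\<^sub>R sgn (p - x'')))" using slope[OF x(1) x''(1)] t by (rule mult_left_mono)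
    also have "\<dots> = t * (d \<bullet> sgn x) + t * (d \<bullet> - (\<sigma> *\<^sub>R sgn (p - x'')))" by (simp add: inner_diff_right algebra_simps)
    also have "\<dots> \<le> (norm ?x' - norm x) + \<sigma> * (norm (p - ?x') - norm (p - x))" using 1 x''(2) by (rule add_mono)
    also have "\<dots> = (norm ?x' + \<sigma> * norm (p - ?x') - c) - (norm x + \<sigma> * norm (p - x) - c)" by (simp add: algebra_simps)
    also have "\<dots> \<le> 2 * l"
    proof -
      have "\<bar>norm ?x' + \<sigma> * norm (p - ?x') - c\<bar> \<le> l" "\<bar>norm x + \<sigma> * norm (p - x) - c\<bar> \<le> l" using A x by blast+
      then show ?thesis by (smt (verit))
    qed
    finally show ?thesis .
  qed
  show ?thesis
  proof (rule emeasure_packing_le[OF Am sub])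
    \<comment> \<open>The factor 3, in place of 2, gives the strict inequality demanded by the
      packing argument.\<close>
    show "0 < \<rho>" "0 < 3 * l / m" using pos by simp_all
    show "norm d = 1" by (fact d)
    fix x t assume x: "x \<in> A" "x + t *\<^sub>R d \<in> A"
    have "\<bar>t\<bar> * m \<le> 2 * l"
    proof (cases "0 \<le> t")
      case True then show ?thesis using key[OF True x] by simp
    next
      case False
      then have "0 \<le> - t" by simp
      moreover have "(x + t *\<^sub>R d) + (- t) *\<^sub>R d \<in> A" using x(1) by simp
      ultimately have "(- t) * m \<le> 2 * l" using key x(2) by blast
      with False show ?thesis by simp
    qed
    then show "\<bar>t\<bar> < 3 * l / m" using pos by (simp add: field_simps)
  qed
qed simp

text \<open>After multiplication by one sign only the product \<open>\<sigma>\<close> of the two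
  signs matters. The lower bound \<open>m\<close> for the gradient makes the level set thin, of
  order \<open>(l + k) / m\<close>, in a fixed direction.\<close>

lemma emeasure_localized_modulations_le:
  fixes P :: "real^3 \<Rightarrow> bool"
  assumes P[measurable]: "Measurable.pred borel P" and lm: "1 \<le> l" "1 \<le> k" and pos: "0 < \<rho>" "0 < m"
    and W: "\<And>s s'. W s s' \<Longrightarrow> sgnb s * sgnb s' = \<sigma>" and \<sigma>: "\<sigma> = 1 \<or> \<sigma> = - 1"
    and A: "\<And>\<xi>. P \<xi> \<Longrightarrow> dist \<xi> w \<le> \<rho> \<and> \<xi> \<noteq> 0 \<and> snd z - \<xi> \<noteq> 0 \<and>
      m \<le> norm (sgn \<xi> - \<sigma> *\<^sub>R sgn (snd z - \<xi>)) - 4 * \<rho> / norm \<xi> - 4 * \<rho> / norm (snd z - \<xi>)"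
  shows "emeasure lborel {x. P (snd x) \<and> W (0 \<le> fst x) (0 \<le> fst (z - x)) \<and> LL x \<le> l \<and> LL (z - x) \<le> k} \<le> ennreal (l * k * (16 * (240 * \<rho>\<^sup>2 / m)))"
proof (rule emeasure_two_modulations_le[OF P lm])
  show "0 \<le> 240 * \<rho>\<^sup>2 / m" using pos by simp
  fix s s' assume "W s s'"
  then have ss: "sgnb s * sgnb s' = \<sigma>" by (rule W)
  have "emeasure lborel {\<xi>. P \<xi> \<and> \<bar>sgnb s * norm \<xi> + sgnb s' * norm (snd z - \<xi>) - fst z\<bar> \<le> l + k} \<le> ennreal (80 * \<rho>\<^sup>2 * (3 * (l + k) / m))"
  proof (rule emeasure_level_set_le[where y = w and p = "snd z" and c = "sgnb s * fst z" and \<sigma> = \<sigma>])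
    show "{\<xi>. P \<xi> \<and> \<bar>sgnb s * norm \<xi> + sgnb s' * norm (snd z - \<xi>) - fst z\<bar> \<le> l + k} \<in> sets borel" by measurable
    show "{\<xi>. P \<xi> \<and> \<bar>sgnb s * norm \<xi> + sgnb s' * norm (snd z - \<xi>) - fst z\<bar> \<le> l + k} \<subseteq> cball w \<rho>"
      using A by (auto simp: dist_commute)
    show "0 < l + k" using lm by simp
    fix \<xi> assume "\<xi> \<in> {\<xi>. P \<xi> \<and> \<bar>sgnb s * norm \<xi> + sgnb s' * norm (snd z - \<xi>) - fst z\<bar> \<le> l + k}"
    then have H: "P \<xi>" "\<bar>sgnb s * norm \<xi> + sgnb s' * norm (snd z - \<xi>) - fst z\<bar> \<le> l + k" by auto
    have s2: "sgnb s * sgnb s = 1" "\<bar>sgnb s\<bar> = 1" by (simp_all add: sgnb_def)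
    have "norm \<xi> + \<sigma> * norm (snd z - \<xi>) - sgnb s * fst z = (sgnb s * sgnb s) * norm \<xi> + (sgnb s * sgnb s') * norm (snd z - \<xi>) - sgnb s * fst z"
      unfolding s2 ss by simp
    also have "\<dots> = sgnb s * (sgnb s * norm \<xi> + sgnb s' * norm (snd z - \<xi>) - fst z)" by (simp add: algebra_simps)
    finally have "\<bar>norm \<xi> + \<sigma> * norm (snd z - \<xi>) - sgnb s * fst z\<bar> \<le> l + k"
      using H(2) by (simp only: abs_mult s2) simp
    with A[OF H(1)] show "\<bar>norm \<xi> + \<sigma> * norm (snd z - \<xi>) - sgnb s * fst z\<bar> \<le> l + k \<and> \<xi> \<noteq> 0 \<and> snd z - \<xi> \<noteq> 0 \<and>
      m \<le> norm (sgn \<xi> - \<sigma> *\<^sub>R sgn (snd z - \<xi>)) - 4 * \<rho> / norm \<xi> - 4 * \<rho> / norm (snd z - \<xi>)" by blast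
  qed (use pos \<sigma> in auto)
  also have "80 * \<rho>\<^sup>2 * (3 * (l + k) / m) = 240 * \<rho>\<^sup>2 / m * (l + k)" by simp
  finally show "emeasure lborel {\<xi>. P \<xi> \<and> \<bar>sgnb s * norm \<xi> + sgnb s' * norm (snd z - \<xi>) - fst z\<bar> \<le> l + k} \<le> ennreal (240 * \<rho>\<^sup>2 / m * (l + k))" .
qed

lemma dyadic_index:
  assumes "1 \<le> (t::real)"
  obtains n :: nat where "2 ^ n \<le> t" "t < 2 ^ Suc n"
proof -
  define n where "n = nat \<lfloor>log 2 t\<rfloor>"
  have n0: "0 \<le> log 2 t" using assms by simp
  have "real n \<le> log 2 t" using n0 by (simp add: n_def)
  then have 1: "2 ^ n \<le> t" using assms by (simp add: le_log_iff powr_realpow)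
  have "log 2 t < real (Suc n)" using n0 by (simp add: n_def) linarith
  then have "t < 2 powr real (Suc n)" using assms by (simp only: log_less_iff)
  then have "t < 2 ^ Suc n" by (metis powr_realpow zero_less_numeral)
  with 1 show ?thesis by (rule that)
qed

lemma dyadic_index_unique:
  assumes "2 ^ i \<le> (t::real)" "t < 2 ^ Suc i" "2 ^ j \<le> t" "t < 2 ^ Suc j"
  shows "i = j"
proof -
  have "(2::real) ^ i < 2 ^ Suc j" "(2::real) ^ j < 2 ^ Suc i" using assms by (meson le_less_trans)+
  then have "i < Suc j" "j < Suc i" by (simp_all only: power_strict_increasing_iff one_less_numeral_iff semiring_norm)
  then show ?thesis by simp
qed

text \<open>The tail of a convergent geometric series is bounded by a multiple of its first
  term.\<close>

lemma sum_two_powr_ge: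
  fixes x :: real
  assumes "x < 0"
  obtains C where "0 \<le> C" "\<And>Z. 0 < Z \<Longrightarrow> (\<Sum>n. ennreal (if Z \<le> 2 ^ n then 2 powr (x * real n) else 0)) \<le> ennreal (C * Z powr x)"
proof -
  define q where "q = 2 powr x"
  have q: "0 < q" "q < 1" using assms by (auto simp: q_def powr_less_one)
  have eq: "2 powr (x * real n) = q ^ n" for n unfolding q_def by (simp add: powr_powr[symmetric] powr_realpow)
  show ?thesis
  proof (rule that[of "1 / (1 - q)"])
    show "0 \<le> 1 / (1 - q)" using q by simp
    fix Z :: real assume Z: "0 < Z"
    define f where "f n = (if Z \<le> 2 ^ n then q ^ n else 0)" for n :: nat
    have f0: "0 \<le> f n" "f n \<le> q ^ n" for n using q by (auto simp: f_def)
    have sf: "summable f" by (rule summable_comparison_test'[of "\<lambda>n. q ^ n"]) (use q f0 in auto)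
    obtain k where "Z < 2 ^ k" using real_arch_pow[of 2 Z] by auto
    then have ex: "\<exists>n. Z \<le> 2 ^ n" by (meson less_imp_le)
    define N where "N = (LEAST n. Z \<le> 2 ^ n)"
    have N: "Z \<le> 2 ^ N" unfolding N_def by (rule LeastI_ex[OF ex])
    have below: "f n = 0" if "n < N" for n using not_less_Least[OF that[unfolded N_def]] by (simp add: f_def)
    have "suminf f = (\<Sum>n. f (n + N)) + (\<Sum>n<N. f n)" by (rule suminf_split_initial_segment[OF sf])
    also have "(\<Sum>n<N. f n) = 0" using below by simp
    also have "(\<Sum>n. f (n + N)) \<le> (\<Sum>n. q ^ N * q ^ n)"
    proof (rule suminf_le)
      show "f (n + N) \<le> q ^ N * q ^ n" for n using f0(2)[of "n + N"] by (simp add: power_add mult.commute)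
      show "summable (\<lambda>n. f (n + N))" using sf by (simp add: summable_iff_shift)
      show "summable (\<lambda>n. q ^ N * q ^ n)" using q by (intro summable_mult summable_geometric) auto
    qed
    also have "(\<Sum>n. q ^ N * q ^ n) = q ^ N * (1 / (1 - q))" using q by (simp add: suminf_mult suminf_geometric summable_geometric)
    finally have le: "suminf f \<le> q ^ N * (1 / (1 - q))" by simp
    have "q ^ N = (2 ^ N) powr x" by (simp add: q_def powr_realpow[symmetric] powr_powr mult.commute)
    also have "\<dots> \<le> Z powr x" using N Z assms by (intro powr_mono2') auto
    finally have "q ^ N * (1 / (1 - q)) \<le> Z powr x * (1 / (1 - q))" using q by (intro mult_right_mono) auto
    with le have "suminf f \<le> Z powr x * (1 / (1 - q))" by (rule order_trans)
    then have "suminf f \<le> 1 / (1 - q) * Z powr x" by (simp only: mult.commute)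
    moreover have "(\<Sum>n. ennreal (if Z \<le> 2 ^ n then 2 powr (x * real n) else 0)) = ennreal (suminf f)"
      unfolding eq f_def[symmetric] by (rule suminf_ennreal2[OF f0(1) sf])
    ultimately show "(\<Sum>n. ennreal (if Z \<le> 2 ^ n then 2 powr (x * real n) else 0)) \<le> ennreal (1 / (1 - q) * Z powr x)"
      by (simp add: ennreal_leI)
  qed
qed

text \<open>The law of cosines; \<open>norm (sgn u + sgn v)\<close> measures the angle between
  \<open>u\<close> and \<open>- v\<close>.\<close>

lemma inner_sgn_square:
  fixes u v :: "'a::real_inner"
  assumes "u \<noteq> 0" "v \<noteq> 0"
  shows "norm u * norm v * (norm (sgn u + sgn v))\<^sup>2 = (norm (u + v))\<^sup>2 - (norm u - norm v)\<^sup>2"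
proof -
  have n: "sgn u \<bullet> sgn u = 1" "sgn v \<bullet> sgn v = 1"
    using assms by (simp_all add: norm_sgn power2_norm_eq_inner[symmetric])
  have "norm u * norm v * (sgn u \<bullet> sgn v) = u \<bullet> v" using assms by (simp add: sgn_div_norm field_simps)
  then have "norm u * norm v * (norm (sgn u + sgn v))\<^sup>2 = 2 * (norm u * norm v) + 2 * (u \<bullet> v)"
    unfolding power2_norm_eq_inner by (simp add: inner_add_left inner_add_right n inner_commute algebra_simps)
  moreover have "(norm (u + v))\<^sup>2 = (norm u)\<^sup>2 + 2 * (u \<bullet> v) + (norm v)\<^sup>2"
    unfolding power2_norm_eq_inner by (simp add: inner_add_left inner_add_right inner_commute)
  ultimately show ?thesis by (simp add: power2_diff)
qed

subsection \<open>High frequencies producing a low one\<close>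

lemma trilinear_bound_le:
  assumes "trilinear_bound k'" "\<And>x y. k x y \<le> k' x y"
  shows "trilinear_bound k"
proof -
  from assms(1) obtain C where C: "\<And>F0 F1 F2. F0 \<in> borel_measurable borel \<Longrightarrow> F1 \<in> borel_measurable borel \<Longrightarrow> F2 \<in> borel_measurable borel \<Longrightarrow>
     (\<integral>\<^sup>+x. \<integral>\<^sup>+y. k' x y * F0 (x + y) * F1 x * F2 y \<partial>lborel \<partial>lborel)\<^sup>2
       \<le> ennreal C * (\<integral>\<^sup>+x. (F0 x)\<^sup>2 \<partial>lborel) * (\<integral>\<^sup>+x. (F1 x)\<^sup>2 \<partial>lborel) * (\<integral>\<^sup>+x. (F2 x)\<^sup>2 \<partial>lborel)"
    unfolding trilinear_bound_def by blast
  show ?thesis unfolding trilinear_bound_def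
  proof (intro exI[of _ C] allI impI)
    fix F0 F1 F2 :: "'a \<Rightarrow> ennreal"
    assume F: "F0 \<in> borel_measurable borel" "F1 \<in> borel_measurable borel" "F2 \<in> borel_measurable borel"
    have "(\<integral>\<^sup>+x. \<integral>\<^sup>+y. k x y * F0 (x + y) * F1 x * F2 y \<partial>lborel \<partial>lborel)\<^sup>2
      \<le> (\<integral>\<^sup>+x. \<integral>\<^sup>+y. k' x y * F0 (x + y) * F1 x * F2 y \<partial>lborel \<partial>lborel)\<^sup>2"
      using assms(2) by (intro power_mono nn_integral_mono mult_right_mono) auto
    then show "(\<integral>\<^sup>+x. \<integral>\<^sup>+y. k x y * F0 (x + y) * F1 x * F2 y \<partial>lborel \<partial>lborel)\<^sup>2 \<le>
       ennreal C * (\<integral>\<^sup>+x. (F0 x)\<^sup>2 \<partial>lborel) * (\<integral>\<^sup>+x. (F1 x)\<^sup>2 \<partial>lborel) * (\<integral>\<^sup>+x. (F2 x)\<^sup>2 \<partial>lborel)"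
      using C[OF F] by (rule order_trans)
  qed
qed

lemma dyadic_ln:
  assumes "2 ^ n \<le> (t::real)" "t < 2 ^ Suc n"
  shows "\<bar>ln t - real n * ln 2\<bar> \<le> ln 2"
proof -
  have t: "0 < t" using assms(1) by (rule less_le_trans[rotated]) simp
  have "ln ((2::real) ^ n) \<le> ln t" using assms(1) t by (subst ln_le_cancel_iff) auto
  moreover have "ln t \<le> ln ((2::real) ^ Suc n)" using assms(2) t by (subst ln_le_cancel_iff) auto
  ultimately show ?thesis unfolding ln_realpow by (simp add: ln_realpow algebra_simps)
qed

text \<open>For equal signs the gradient of the phase is \<open>sgn \<xi> - sgn (p - \<xi>)\<close>.
  As \<open>p\<close> is much shorter than \<open>\<xi>\<close>, the unit vectors are almost
  opposite and the gradient has length nearly 2, which leaves room for its oscillation over a ball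
  of radius \<open>(1 + norm p) / 8\<close>.\<close>

lemma norm_sgn_same_direction_ge:
  fixes p \<xi> :: "real^3"
  assumes "16 * (1 + norm p) \<le> 1 + norm \<xi>" "0 < \<rho>" "8 * \<rho> \<le> 1 + norm p"
  shows "\<xi> \<noteq> 0 \<and> p - \<xi> \<noteq> 0 \<and> 1 \<le> norm (sgn \<xi> - 1 *\<^sub>R sgn (p - \<xi>)) - 4 * \<rho> / norm \<xi> - 4 * \<rho> / norm (p - \<xi>)"
proof -
  define N r1 r2 where d: "N = 1 + norm p" "r1 = norm \<xi>" "r2 = norm (p - \<xi>)"
  have N: "1 \<le> N" by (simp add: d)
  have "16 * N \<le> 1 + r1" using assms(1) by (simp only: d)
  then have r1: "15 * N \<le> r1" using N by (smt (verit))
  have "norm \<xi> \<le> norm p + norm (p - \<xi>)" using norm_triangle_ineq4[of p "p - \<xi>"] by simp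
  then have r2: "14 * N \<le> r2" using r1 N by (simp add: d)
  have "0 < r1" using r1 N by (smt (verit))
  moreover have "0 < r2" using r2 N by (smt (verit))
  ultimately have nz: "\<xi> \<noteq> 0" "p - \<xi> \<noteq> 0" by (auto simp: d)
  have "norm (sgn (\<xi> - p) - sgn \<xi>) \<le> 2 * norm ((\<xi> - p) - \<xi>) / norm \<xi>" by (rule norm_sgn_diff_le[OF nz(1)])
  also have "\<dots> \<le> 2 / 15"
  proof -
    have "2 * norm p * 15 \<le> 2 * r1" using r1 N by (simp add: d)
    then show ?thesis using r1 N by (simp add: d(2) divide_le_eq)
  qed
  finally have 1: "norm (sgn (\<xi> - p) - sgn \<xi>) \<le> 2 / 15" .
  have "sgn (p - \<xi>) = - sgn (\<xi> - p)" by (metis minus_diff_eq sgn_minus)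
  then have "sgn \<xi> - 1 *\<^sub>R sgn (p - \<xi>) = 2 *\<^sub>R sgn \<xi> + (sgn (\<xi> - p) - sgn \<xi>)" by (simp add: scaleR_2)
  then have "norm (2 *\<^sub>R sgn \<xi>) - norm (sgn (\<xi> - p) - sgn \<xi>) \<le> norm (sgn \<xi> - 1 *\<^sub>R sgn (p - \<xi>))"
    using norm_diff_ineq[of "2 *\<^sub>R sgn \<xi>" "sgn (\<xi> - p) - sgn \<xi>"] by (simp only:)
  then have 2: "2 - 2 / 15 \<le> norm (sgn \<xi> - 1 *\<^sub>R sgn (p - \<xi>))" using 1 nz by (simp add: norm_sgn)
  have "4 * \<rho> / norm \<xi> \<le> 1 / 28"
  proof -
    have "8 * \<rho> \<le> N" using assms(3) by (simp only: d)
    then have "4 * \<rho> * 28 \<le> r1" using r1 N by argo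
    then show ?thesis using r1 N by (simp add: d(2) divide_le_eq)
  qed
  moreover have "4 * \<rho> / norm (p - \<xi>) \<le> 1 / 28"
  proof -
    have "8 * \<rho> \<le> N" using assms(3) by (simp only: d)
    then have "4 * \<rho> * 28 \<le> r2" using r2 N by argo
    then show ?thesis using r2 N by (simp add: d(3) divide_le_eq)
  qed
  ultimately have "1 \<le> norm (sgn \<xi> - 1 *\<^sub>R sgn (p - \<xi>)) - 4 * \<rho> / norm \<xi> - 4 * \<rho> / norm (p - \<xi>)"
    using 2 by argo
  with nz show ?thesis by blast
qed

text \<open>For opposite signs the angle \<open>E\<close> between \<open>snd x\<close> and \<open>- snd y\<close> is governed by the identity
  \<open>|\<xi>| |\<eta>| E^2 = |\<xi> + \<eta>|^2 - (|\<xi>| - |\<eta>|)^2\<close>, whose right-hand side is comparable to \<open>NN (x + y) * LL (x + y)\<close>.\<close>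

lemma opposite_geometry:
  assumes H: "16 * NN (x + y) \<le> NN x" "LL y \<le> LL x" "opposite_signs x y" "NN x * LL x < (NN (x + y))\<^sup>2" "8 * LL x < LL (x + y)"
    and n: "2 ^ n \<le> NN (x + y)" "NN (x + y) < 2 ^ Suc n" and l: "2 ^ l \<le> LL (x + y)" "LL (x + y) < 2 ^ Suc l"
  defines "D \<equiv> 2 powr ((real n + real l) / 2)" and "E \<equiv> norm (sgn (snd x) + sgn (snd y))"
  shows "15 / 16 * NN x \<le> norm (snd x)" "7 / 8 * NN x \<le> norm (snd y)" "4 / 5 * D \<le> E * NN x" "E * NN x \<le> 7 / 2 * D"
    "D \<le> 2 * 2 ^ n" "13 * D \<le> NN x" "l \<le> n + 1"
proof -
  define N0 N1 L0 L1 r0 r1 r2 rm where d: "N0 = NN (x + y)" "N1 = NN x" "L0 = LL (x + y)" "L1 = LL x"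
    "r0 = norm (snd x + snd y)" "r1 = norm (snd x)" "r2 = norm (snd y)" "rm = r0 - \<bar>r1 - r2\<bar>"
  have N0r: "N0 = 1 + r0" and N1r: "N1 = 1 + r1" by (simp_all add: d NN_def)
  have ge1: "1 \<le> N0" "1 \<le> N1" "1 \<le> L0" "1 \<le> L1" by (simp_all add: d)
  have H1: "16 * N0 \<le> N1" "N1 * L1 < N0\<^sup>2" "8 * L1 < L0" using H by (simp_all add: d)
  have tri: "r0 \<le> r1 + r2" "r1 \<le> r0 + r2" "r2 \<le> r0 + r1" "0 \<le> r0" "0 \<le> r1" "0 \<le> r2"
    using norm_triangle_ineq[of "snd x" "snd y"] norm_triangle_ineq4[of "snd x + snd y" "snd y"]
    norm_triangle_ineq4[of "snd x + snd y" "snd x"] by (simp_all add: d)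
  have rm0: "0 \<le> rm" "rm \<le> r0" using tri by (simp_all add: d(8) abs_le_iff)
  \<comment> \<open>Both input modulations are below an eighth of \<open>L0\<close>. This excludes
    the second alternative and makes the defect \<open>rm\<close> comparable to the output
    modulation.\<close>
  have "\<bar>(L0 - 1) - rm\<bar> \<le> (L1 - 1) + (LL y - 1) \<or> rm + (L0 - 1) \<le> (L1 - 1) + (LL y - 1)"
    using opposite_modulation[OF H(3)] unfolding d by simp
  then have "3 / 4 * L0 \<le> rm \<and> rm \<le> 5 / 4 * L0"
    using H(2) H1(3) rm0 ge1 unfolding d(4)[symmetric] by (auto simp: abs_le_iff)
  then have rm: "3 / 4 * L0 \<le> rm" "rm \<le> 5 / 4 * L0" by simp_all
  \<comment> \<open>From \<open>N1 \<le> N1 * L1 < N0\<^sup>2\<close> and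
    \<open>16 * N0 \<le> N1\<close> it follows that \<open>N0 > 16\<close>, so that adding 1 to a
    norm changes it only by a small factor.\<close>
  have "N1 * 1 \<le> N1 * L1" using ge1 by (intro mult_left_mono) auto
  then have "16 * N0 < N0 * N0" using H1 by (simp add: power2_eq_square)
  then have N16: "16 < N0" using ge1 by (simp only: mult_less_cancel_right)
  have r0N: "15 / 16 * N0 \<le> r0" using N16 N0r by simp
  have r1N: "15 / 16 * N1 \<le> r1" "r1 \<le> N1" using H1(1) N16 N1r by simp_all
  have r2N: "7 / 8 * N1 \<le> r2" using tri H1(1) N0r N1r r1N N16 by argo
  have r2N': "r2 \<le> 17 / 16 * N1" using tri H1(1) N0r N1r r1N N16 by argo
  show "15 / 16 * NN x \<le> norm (snd x)" "7 / 8 * NN x \<le> norm (snd y)" using r1N r2N by (simp_all add: d)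
  have D0: "0 < D" by (simp add: D_def)
  have D2: "D\<^sup>2 = 2 ^ n * 2 ^ l"
  proof -
    have "D\<^sup>2 = 2 powr (real n + real l)" by (simp add: D_def power2_eq_square powr_add[symmetric])
    then show ?thesis by (simp add: powr_add powr_realpow)
  qed
  have DNL: "D\<^sup>2 \<le> N0 * L0" unfolding D2 d by (intro mult_mono n l) (auto simp: order_trans[OF zero_le_one])
  have NLD: "N0 * L0 \<le> 4 * D\<^sup>2"
  proof -
    have "N0 * L0 \<le> 2 ^ Suc n * 2 ^ Suc l" using n l ge1 unfolding d by (intro mult_mono) auto
    then show ?thesis unfolding D2 by simp
  qed
  have "0 < r1" using r1N(1) ge1(2) by argo
  moreover have "0 < r2" using r2N ge1(2) by argo
  ultimately have nz: "snd x \<noteq> 0" "snd y \<noteq> 0" by (auto simp: d)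
  have "r1 * r2 * E\<^sup>2 = r0\<^sup>2 - (r1 - r2)\<^sup>2" unfolding d E_def by (rule inner_sgn_square[OF nz])
  also have "\<dots> = rm * (r0 + \<bar>r1 - r2\<bar>)" by (simp add: d(8) algebra_simps power2_eq_square)
  \<comment> \<open>On the right the first factor is comparable to \<open>L0\<close> and the second
    to \<open>N0\<close>, which determines \<open>E * N1\<close> up to constants.\<close>
  finally have X: "r1 * r2 * E\<^sup>2 = rm * (r0 + \<bar>r1 - r2\<bar>)" .
  have "3 / 4 * L0 * (15 / 16 * N0) \<le> rm * (r0 + \<bar>r1 - r2\<bar>)"
  proof (intro mult_mono)
    show "15 / 16 * N0 \<le> r0 + \<bar>r1 - r2\<bar>" using r0N by linarith
  qed (use rm rm0 ge1 in auto)
  then have X1: "7 / 10 * D\<^sup>2 \<le> r1 * r2 * E\<^sup>2" unfolding X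
  proof (rule order_trans[rotated])
    have "3 / 4 * L0 * (15 / 16 * N0) = 45 / 64 * (N0 * L0)" by simp
    then show "7 / 10 * D\<^sup>2 \<le> 3 / 4 * L0 * (15 / 16 * N0)" using DNL zero_le_power2[of D] by linarith
  qed
  have "rm * (r0 + \<bar>r1 - r2\<bar>) \<le> 5 / 4 * L0 * (2 * N0)"
  proof (intro mult_mono)
    show "r0 + \<bar>r1 - r2\<bar> \<le> 2 * N0" using rm0 N0r d(8) by argo
  qed (use rm ge1 tri in auto)
  then have X2: "r1 * r2 * E\<^sup>2 \<le> 10 * D\<^sup>2" unfolding X
  proof (rule order_trans)
    have "5 / 4 * L0 * (2 * N0) = 5 / 2 * (N0 * L0)" by simp
    then show "5 / 4 * L0 * (2 * N0) \<le> 10 * D\<^sup>2" using NLD by linarith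
  qed
  have "r1 * r2 \<le> N1 * (17 / 16 * N1)" using r1N r2N' tri ge1 by (intro mult_mono) auto
  then have "r1 * r2 * E\<^sup>2 \<le> N1 * (17 / 16 * N1) * E\<^sup>2" by (intro mult_right_mono) auto
  then have "7 / 10 * D\<^sup>2 \<le> 17 / 16 * (E * N1)\<^sup>2" using X1 by (simp add: power_mult_distrib power2_eq_square algebra_simps)
  moreover have "(4 / 5 * D)\<^sup>2 = 16 / 25 * D\<^sup>2" by (simp add: power_mult_distrib power_divide)
  ultimately have "(4 / 5 * D)\<^sup>2 \<le> (E * N1)\<^sup>2" using zero_le_power2[of D] by argo
  then show "4 / 5 * D \<le> E * NN x" unfolding d(2)[symmetric] by (rule power2_le_imp_le) (use ge1 in \<open>simp add: E_def\<close>)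
  have "15 / 16 * N1 * (7 / 8 * N1) \<le> r1 * r2" using r1N r2N ge1 tri by (intro mult_mono) auto
  then have "15 / 16 * N1 * (7 / 8 * N1) * E\<^sup>2 \<le> r1 * r2 * E\<^sup>2" by (intro mult_right_mono) auto
  then have "105 / 128 * (E * N1)\<^sup>2 \<le> 10 * D\<^sup>2" using X2 by (simp add: power_mult_distrib power2_eq_square algebra_simps)
  moreover have "(7 / 2 * D)\<^sup>2 = 49 / 4 * D\<^sup>2" by (simp add: power_mult_distrib power_divide)
  ultimately have "(E * N1)\<^sup>2 \<le> (7 / 2 * D)\<^sup>2" using zero_le_power2[of D] by argo
  then show "E * NN x \<le> 7 / 2 * D" unfolding d(2)[symmetric] by (rule power2_le_imp_le) (use D0 in simp)
  have L0N0: "L0 \<le> 4 / 3 * N0" using rm rm0 N0r by simp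
  have "2 ^ l \<le> L0" "N0 < 2 * 2 ^ n" using n l by (simp_all add: d)
  then have ln: "2 ^ l \<le> 8 / 3 * (2::real) ^ n" using L0N0 by linarith
  then have "D\<^sup>2 \<le> 2 ^ n * (8 / 3 * 2 ^ n)" unfolding D2 by (intro mult_left_mono) auto
  also have "\<dots> \<le> (2 * 2 ^ n)\<^sup>2" by (simp add: power2_eq_square)
  finally show "D \<le> 2 * 2 ^ n" by (rule power2_le_imp_le) simp
  have "N0 * L0 \<le> N0 * (4 / 3 * N0)" using L0N0 ge1 by (intro mult_left_mono) auto
  also have "\<dots> \<le> (6 / 5 * N0)\<^sup>2" by (simp add: power2_eq_square)
  finally have "D\<^sup>2 \<le> (6 / 5 * N0)\<^sup>2" using DNL by linarith
  then have "D \<le> 6 / 5 * N0" by (rule power2_le_imp_le) (use ge1 in simp)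
  then show "13 * D \<le> NN x" using H1(1) ge1 unfolding d(2)[symmetric] by linarith
  have "(2::real) ^ (n + 2) = 4 * 2 ^ n" "0 < (2::real) ^ n" by (simp_all add: power_add)
  then have "(2::real) ^ l < 2 ^ (n + 2)" using ln by argo
  then have "l < n + 2" by (rule power_less_imp_less_exp[rotated]) simp
  then show "l \<le> n + 1" by simp
qed

lemma perpendicular_part_le:
  fixes e v :: "'a::real_inner"
  assumes "norm e = 1"
  shows "norm (v - (v \<bullet> e) *\<^sub>R e) \<le> norm v"
proof (rule power2_le_imp_le)
  have "(norm (v - (v \<bullet> e) *\<^sub>R e))\<^sup>2 = (norm v)\<^sup>2 - (v \<bullet> e)\<^sup>2"
    using assms unfolding power2_norm_eq_inner norm_eq_1
    by (simp add: inner_diff_left inner_diff_right inner_commute power2_eq_square algebra_simps)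
  then show "(norm (v - (v \<bullet> e) *\<^sub>R e))\<^sup>2 \<le> (norm v)\<^sup>2" by simp
qed simp

context wave_exponents
begin

lemma modulations_integral:
  obtains C where "0 \<le> C" "\<And>(Q :: real \<times> (real^3) \<Rightarrow> bool) z \<Lambda> V. Measurable.pred borel Q \<Longrightarrow> 0 \<le> V \<Longrightarrow>
     (\<And>l m. 1 \<le> l \<Longrightarrow> 1 \<le> m \<Longrightarrow> emeasure lborel {x. Q x \<and> LL x \<le> l \<and> LL (z - x) \<le> m} \<le> ennreal (l * m * V)) \<Longrightarrow>
     (\<integral>\<^sup>+x. (if Q x \<and> LL x \<le> \<Lambda> \<and> LL (z - x) \<le> \<Lambda> then ennreal (LL x powr (- 2 * b1) * LL (z - x) powr (- 2 * b2)) else 0) \<partial>lborel) \<le> ennreal (C * \<Lambda> powr (g1 + g2) * V)"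
proof -
  obtain C1 where C1: "0 \<le> C1" "\<And>(Q :: real \<times> (real^3) \<Rightarrow> bool) L1 L2 \<Lambda> V. Measurable.pred borel Q \<Longrightarrow> L1 \<in> borel_measurable borel \<Longrightarrow> L2 \<in> borel_measurable borel \<Longrightarrow>
     (\<And>x. 1 \<le> L1 x) \<Longrightarrow> (\<And>x. 1 \<le> L2 x) \<Longrightarrow> 0 \<le> V \<Longrightarrow>
     (\<And>l m. 1 \<le> l \<Longrightarrow> l \<le> \<Lambda> \<Longrightarrow> 1 \<le> m \<Longrightarrow> m \<le> \<Lambda> \<Longrightarrow> emeasure lborel {x. Q x \<and> L1 x \<le> l \<and> L2 x \<le> m} \<le> ennreal (l * m * V)) \<Longrightarrow>
     (\<integral>\<^sup>+x. (if Q x \<and> L1 x \<le> \<Lambda> \<and> L2 x \<le> \<Lambda> then ennreal (L1 x powr (- 2 * b1) * L2 x powr (- 2 * b2)) else 0) \<partial>lborel) \<le> ennreal (C1 * \<Lambda> powr (g1 + g2) * V)"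
    by (rule two_modulations_integral_bound[OF g1 g2, where 'x = "real \<times> (real^3)"]) auto
  show ?thesis
    by (rule that[OF C1(1)]) (rule C1(2); simp)
qed

section \<open>Equal signs of the time frequencies\<close>

text \<open>The phase has a gradient of length bounded below, so balls of the size
  \<open>2 ^ i\<close> of the output frequency suffice, and their overlap is comparable to their
  volume. The output modulation is bounded only by a multiple of \<open>NN x\<close>, which costs
  \<open>2 * a\<close>; the sum over \<open>i\<close> is governed by \<open>total\<close>.\<close>

lemma trilinear_bound_high_high_equal_signs:
  "trilinear_bound (\<lambda>x y. if high_high x y \<and> \<not> opposite_signs x y \<and> LL x < NN (x + y) then ennreal (K x y) else 0)"
proof -
  define G where "G x y \<longleftrightarrow> high_high x y \<and> \<not> opposite_signs x y \<and> LL x < NN (x + y)" for x y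
  define sh where "sh i t \<longleftrightarrow> 2 ^ i \<le> t \<and> t < 2 ^ Suc i" for i :: nat and t :: real
  define \<gamma> \<kappa> \<sigma> where "\<gamma> = g1 + g2" and "\<kappa> = 2 * (s1 + s2) - 2 * a" and "\<sigma> = 2 + \<gamma> - 2 * s0"
  have \<kappa>: "0 \<le> \<kappa>" "\<sigma> \<le> \<kappa>" "\<kappa> = 0 \<Longrightarrow> \<sigma> < 0"
    using pairs total total_eq unfolding \<kappa>_def \<sigma>_def \<gamma>_def by (smt (verit))+
  obtain Cg where Cg: "0 \<le> Cg" "\<And>R. 1 \<le> R \<Longrightarrow> (\<Sum>n. ennreal (if 2 ^ n \<le> R then 2 powr (\<sigma> * real n) else 0)) \<le> ennreal (Cg * R powr \<kappa>)"
    using sum_two_powr_le[OF \<kappa>] by blast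
  obtain C1 where C1: "0 \<le> C1" "\<And>(Q :: real \<times> (real^3) \<Rightarrow> bool) z \<Lambda> V. Measurable.pred borel Q \<Longrightarrow> 0 \<le> V \<Longrightarrow>
     (\<And>l m. 1 \<le> l \<Longrightarrow> 1 \<le> m \<Longrightarrow> emeasure lborel {x. Q x \<and> LL x \<le> l \<and> LL (z - x) \<le> m} \<le> ennreal (l * m * V)) \<Longrightarrow>
     (\<integral>\<^sup>+x. (if Q x \<and> LL x \<le> \<Lambda> \<and> LL (z - x) \<le> \<Lambda> then ennreal (LL x powr (- 2 * b1) * LL (z - x) powr (- 2 * b2)) else 0) \<partial>lborel) \<le> ennreal (C1 * \<Lambda> powr \<gamma> * V)"
    unfolding \<gamma>_def by (rule modulations_integral) auto
  define c where "c = exp (\<bar>2 * s2\<bar> * ln 2 + 2 * a * ln 6 + \<bar>2 * s0\<bar> * ln 2)"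
  have c0: "0 < c" by (simp add: c_def)
  define \<rho> where "\<rho> i = (2::real) ^ i / 8" for i :: nat
  define k where "k i x y = (if G x y \<and> sh i (NN (x + y)) then ennreal (K x y) else 0)" for i x y
  \<comment> \<open>\<open>\<phi>\<close> carries the powers to be summed over \<open>i\<close>. The
    factor \<open>q\<close> carries the modulation weights, normalised so that its integral over a
    ball is bounded uniformly in \<open>i\<close>.\<close>
  define \<phi> where "\<phi> i x = (if 2 ^ i \<le> NN x then ennreal (c * (2 powr (\<sigma> * real i) * NN x powr (- \<kappa>))) else 0)" for i :: nat and x
  define q where "q i x y = (if G x y \<and> sh i (NN (x + y)) then ennreal (2 powr (- (2 + \<gamma>) * real i) * (LL x powr (- 2 * b1) * LL y powr (- 2 * b2))) else 0)" for i x y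
  \<comment> \<open>\<open>snd y\<close> is the output frequency, of size at most
    \<open>2 * 2 ^ i\<close>, minus \<open>snd x\<close>, which is close to
    \<open>w\<close>.\<close>
  define Z where "Z i w y \<longleftrightarrow> norm (w + snd y) \<le> 3 * 2 ^ i" for i :: nat and w :: "real^3" and y :: "real \<times> (real^3)"
  define CA where "CA = C1 * 2 powr \<gamma> * 60"
  have CA0: "0 \<le> CA" using C1(1) by (simp add: CA_def)
  have Gm[measurable]: "Measurable.pred (borel \<Otimes>\<^sub>M borel) (\<lambda>p. G (fst p) (snd p))"
    unfolding G_def high_high_def opposite_signs_def by measurable
  have Gz[measurable]: "Measurable.pred borel (\<lambda>x. G x (z - x))" for z
    unfolding G_def high_high_def opposite_signs_def by measurable
  have "trilinear_bound (\<lambda>x y. \<integral>\<^sup>+i. k i x y \<partial>count_space UNIV)"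
  proof (rule trilinear_bound_localized[where q = q and \<phi> = \<phi> and S = "\<lambda>i. {z. sh i (NN z)}" and Z = Z and \<rho> = \<rho>
      and A = "\<lambda>_. ennreal CA" and M = "\<lambda>i. ennreal (135 * 8 ^ i)" and B = "\<lambda>_. ennreal (CA * 17280)" and C = "CA * 17280 * (c * Cg)"])
    fix i :: nat
    show "case_prod (k i) \<in> borel_measurable borel"
      by (rule borel_measurable_pairI, unfold case_prod_beta k_def sh_def) measurable
    show "case_prod (q i) \<in> borel_measurable borel"
      by (rule borel_measurable_pairI, unfold case_prod_beta q_def sh_def) measurable
    show "\<phi> i \<in> borel_measurable borel" unfolding \<phi>_def by measurable
    show "{z. sh i (NN z)} \<in> sets borel" unfolding sh_def by measurable
    show "{p. Z i (fst p) (snd p)} \<in> sets borel" unfolding Z_def by measurable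
    show "0 < \<rho> i" by (simp add: \<rho>_def)
    show "x + y \<in> {z. sh i (NN z)}" if "k i x y \<noteq> 0" for x y using that by (auto simp: k_def split: if_splits)
    show "Z i w y" if "k i x y \<noteq> 0" "dist (snd x) w \<le> \<rho> i" for x y w
    proof -
      from that(1) have "sh i (NN (x + y))" by (auto simp: k_def split: if_splits)
      then have "norm (snd x + snd y) \<le> 2 * 2 ^ i" by (simp add: sh_def NN_def)
      moreover have "w + snd y = (snd x + snd y) - (snd x - w)" by simp
      then have "norm (w + snd y) \<le> norm (snd x + snd y) + norm (snd x - w)" by (metis norm_triangle_ineq4)
      moreover have "norm (snd x - w) \<le> 2 ^ i / 8" using that(2) by (simp add: \<rho>_def dist_norm)
      moreover have "0 < (2::real) ^ i" by simp
      ultimately show ?thesis unfolding Z_def by linarith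
    qed
    show "(k i x y)\<^sup>2 \<le> \<phi> i x * q i x y" for x y
    proof (cases "G x y \<and> sh i (NN (x + y))")
      case True
      then have H: "high_high x y" "LL x < NN (x + y)" and s: "2 ^ i \<le> NN (x + y)" "NN (x + y) < 2 ^ Suc i" by (auto simp: G_def sh_def)
      have H2: "16 * NN (x + y) \<le> NN x" "LL y \<le> LL x" "NN y \<le> NN (x + y) + NN x" using H NN_le_add'[of y x] by (auto simp: high_high_def)
      then have "LL (x + y) \<le> 6 * NN x" using LL_add_le[of x y] H(2) NN_ge_1[of "x + y"] by (smt (verit))
      then have l0: "ln (LL (x + y)) \<le> ln 6 + ln (NN x)" by (intro ln_le_ln_add) auto
      have iN: "2 ^ i \<le> NN x" using s(1) H2(1) NN_ge_1[of "x + y"] by (smt (verit))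
      have 1: "2 * s2 * (ln (NN x) - ln (NN y)) \<le> \<bar>2 * s2\<bar> * ln 2" using H by (intro mult_le_abs_mult high_high_ln_NN) auto
      have 2: "2 * a * ln (LL (x + y)) \<le> 2 * a * (ln 6 + ln (NN x))" using a_pos l0 by (intro mult_left_mono) auto
      have 3: "- 2 * s0 * (ln (NN (x + y)) - real i * ln 2) \<le> \<bar>- 2 * s0\<bar> * ln 2" by (intro mult_le_abs_mult dyadic_ln s)
      have "(K x y)\<^sup>2 \<le> c * (2 powr (\<sigma> * real i) * NN x powr (- \<kappa>)) * (2 powr (- (2 + \<gamma>) * real i) * (LL x powr (- 2 * b1) * LL y powr (- 2 * b2)))"
        unfolding K_square powr_eq_exp[OF NN_pos] powr_eq_exp[OF LL_pos] powr_eq_exp[OF zero_less_numeral] c_def mult_exp_exp exp_le_cancel_iff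
        using 1 2 3 by (simp add: algebra_simps \<kappa>_def \<sigma>_def)
      then have "ennreal ((K x y)\<^sup>2) \<le> ennreal (c * (2 powr (\<sigma> * real i) * NN x powr (- \<kappa>)) * (2 powr (- (2 + \<gamma>) * real i) * (LL x powr (- 2 * b1) * LL y powr (- 2 * b2))))"
        by (rule ennreal_leI)
      also have "\<dots> = \<phi> i x * q i x y"
        using True iN c0 by (subst ennreal_mult') (simp_all add: \<phi>_def q_def)
      finally show ?thesis using True K_nonneg[of x y] by (simp add: k_def ennreal_power)
    qed (auto simp: k_def)
    show "emeasure lborel {w. Z i w y} \<le> ennreal (135 * 8 ^ i)" for y
    proof -
      have "emeasure lborel {w. Z i w y} = emeasure lborel {w. norm (snd y + w) \<le> 3 * 2 ^ i}" by (simp add: Z_def add.commute)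
      also have "\<dots> = emeasure lborel {w::real^3. norm w \<le> 3 * 2 ^ i}" by (rule emeasure_lborel_shift) measurable
      also have "{w::real^3. norm w \<le> 3 * 2 ^ i} = cball 0 (3 * 2 ^ i)" by auto
      also have "emeasure lborel \<dots> \<le> ennreal (5 * (3 * 2 ^ i) ^ 3)" by (rule emeasure_cball_le) simp
      also have "5 * (3 * (2::real) ^ i) ^ 3 = 135 * 8 ^ i" by (simp add: power_mult_distrib power_mult[symmetric] mult.commute[of i 3] power_mult)
      finally show ?thesis .
    qed
    show "{z. sh i (NN z)} \<inter> {z. sh j (NN z)} = {}" if "i \<noteq> j" for j
      using that dyadic_index_unique unfolding sh_def by blast
    \<comment> \<open>As \<open>4 * (\<rho> i) ^ 3 = 8 ^ i / 128\<close>, the loss is the constant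
      \<open>135 * 128 = 17280\<close>.\<close>
    show "ennreal CA * ennreal (135 * 8 ^ i) \<le> ennreal (CA * 17280) * emeasure lborel (cball (0::real^3) (\<rho> i))"
    proof -
      have "ennreal CA * ennreal (135 * 8 ^ i) = ennreal (CA * 17280) * ennreal (4 * (\<rho> i) ^ 3)"
      proof -
        have "4 * (\<rho> i) ^ 3 = 8 ^ i / 128" unfolding \<rho>_def by (simp add: power_divide power_mult[symmetric] mult.commute[of i 3] power_mult)
        then have "CA * (135 * 8 ^ i) = CA * 17280 * (4 * (\<rho> i) ^ 3)" by simp
        then show ?thesis using CA0 by (simp only: ennreal_mult'[symmetric] mult_nonneg_nonneg zero_le_numeral)
      qed
      also have "\<dots> \<le> ennreal (CA * 17280) * emeasure lborel (cball (0::real^3) (\<rho> i))"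
        by (intro mult_left_mono emeasure_cball_le) (auto simp: \<rho>_def)
      finally show ?thesis .
    qed
    show "(\<integral>\<^sup>+x. (if dist (snd x) w \<le> \<rho> i then q i x (z - x) else 0) \<partial>lborel) \<le> ennreal CA" for w z
    proof -
      define Q where "Q x \<longleftrightarrow> dist (snd x) w \<le> \<rho> i \<and> G x (z - x) \<and> sh i (NN z)" for x
      have [measurable]: "Measurable.pred borel Q" unfolding Q_def by measurable
      \<comment> \<open>Both input modulations are below \<open>NN z\<close>, hence below the outer
        radius of its shell.\<close>
      let ?\<Lambda> = "(2::real) ^ Suc i"
      have "(\<integral>\<^sup>+x. (if dist (snd x) w \<le> \<rho> i then q i x (z - x) else 0) \<partial>lborel)
        \<le> (\<integral>\<^sup>+x. ennreal (2 powr (- (2 + \<gamma>) * real i)) * (if Q x \<and> LL x \<le> ?\<Lambda> \<and> LL (z - x) \<le> ?\<Lambda> then ennreal (LL x powr (- 2 * b1) * LL (z - x) powr (- 2 * b2)) else 0) \<partial>lborel)"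
      proof (rule nn_integral_mono)
        fix x :: "real \<times> (real^3)"
        show "(if dist (snd x) w \<le> \<rho> i then q i x (z - x) else 0) \<le> ennreal (2 powr (- (2 + \<gamma>) * real i)) *
          (if Q x \<and> LL x \<le> ?\<Lambda> \<and> LL (z - x) \<le> ?\<Lambda> then ennreal (LL x powr (- 2 * b1) * LL (z - x) powr (- 2 * b2)) else 0)"
        proof (cases "Q x")
          case True
          then have "LL x < NN z" "LL (z - x) \<le> LL x" "NN z < ?\<Lambda>" by (auto simp: Q_def G_def high_high_def sh_def)
          then have "LL x \<le> ?\<Lambda>" "LL (z - x) \<le> ?\<Lambda>" by linarith+
          then show ?thesis using True by (simp add: Q_def q_def ennreal_mult')
        qed (auto simp: Q_def q_def)
      qed
      also have "\<dots> = ennreal (2 powr (- (2 + \<gamma>) * real i)) * (\<integral>\<^sup>+x. (if Q x \<and> LL x \<le> ?\<Lambda> \<and> LL (z - x) \<le> ?\<Lambda> then ennreal (LL x powr (- 2 * b1) * LL (z - x) powr (- 2 * b2)) else 0) \<partial>lborel)"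
        by (rule nn_integral_cmult) measurable
      also have "\<dots> \<le> ennreal (2 powr (- (2 + \<gamma>) * real i)) * ennreal (C1 * ?\<Lambda> powr \<gamma> * (60 * 4 ^ i))"
      proof (intro mult_left_mono C1(2))
        fix l m :: real assume lm: "1 \<le> l" "1 \<le> m"
        let ?P = "\<lambda>\<xi>. dist \<xi> w \<le> \<rho> i \<and> 16 * (1 + norm (snd z)) \<le> 1 + norm \<xi> \<and> 2 ^ i \<le> 1 + norm (snd z)"
        have "emeasure lborel {x. Q x \<and> LL x \<le> l \<and> LL (z - x) \<le> m}
          \<le> emeasure lborel {x. ?P (snd x) \<and> (0 \<le> fst x) = (0 \<le> fst (z - x)) \<and> LL x \<le> l \<and> LL (z - x) \<le> m}"
        proof (rule emeasure_mono)
          show "{x. Q x \<and> LL x \<le> l \<and> LL (z - x) \<le> m} \<subseteq> {x. ?P (snd x) \<and> (0 \<le> fst x) = (0 \<le> fst (z - x)) \<and> LL x \<le> l \<and> LL (z - x) \<le> m}"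
            by (auto simp: Q_def G_def high_high_def sh_def NN_def opposite_signs_def)
        qed measurable
        also have "\<dots> \<le> ennreal (l * m * (16 * (240 * (\<rho> i)\<^sup>2 / 1)))"
        proof (rule emeasure_localized_modulations_le[where w = w and \<sigma> = 1])
          fix \<xi> assume P: "?P \<xi>"
          have "0 < \<rho> i" "8 * \<rho> i \<le> 1 + norm (snd z)" using P by (simp_all add: \<rho>_def)
          with P norm_sgn_same_direction_ge[of "snd z" \<xi> "\<rho> i"]
          show "dist \<xi> w \<le> \<rho> i \<and> \<xi> \<noteq> 0 \<and> snd z - \<xi> \<noteq> 0 \<and>
            1 \<le> norm (sgn \<xi> - 1 *\<^sub>R sgn (snd z - \<xi>)) - 4 * \<rho> i / norm \<xi> - 4 * \<rho> i / norm (snd z - \<xi>)" by blast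
        qed (use lm in \<open>auto simp: \<rho>_def sgnb_def\<close>)
        also have "16 * (240 * (\<rho> i)\<^sup>2 / 1) = 60 * 4 ^ i"
          by (simp add: \<rho>_def power_divide power_mult[symmetric] mult.commute[of i 2] power_mult)
        finally show "emeasure lborel {x. Q x \<and> LL x \<le> l \<and> LL (z - x) \<le> m} \<le> ennreal (l * m * (60 * 4 ^ i))" .
      qed auto
      also have "\<dots> = ennreal (2 powr (- (2 + \<gamma>) * real i) * (C1 * ?\<Lambda> powr \<gamma> * (60 * 4 ^ i)))" by (rule ennreal_mult'[symmetric]) simp
      also have "2 powr (- (2 + \<gamma>) * real i) * (C1 * ?\<Lambda> powr \<gamma> * (60 * 4 ^ i)) = CA"
      proof -
        have "?\<Lambda> powr \<gamma> = 2 powr (\<gamma> + \<gamma> * real i)" by (subst powr_realpow[symmetric]) (auto simp: powr_powr algebra_simps)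
        moreover have "(4::real) ^ i = 2 powr (2 * real i)"
        proof -
          have "(4::real) ^ i = (2 ^ 2) ^ i" by simp
          also have "\<dots> = 2 ^ (2 * i)" by (rule power_mult[symmetric])
          also have "\<dots> = 2 powr (2 * real i)" by (subst powr_realpow[symmetric]) auto
          finally show ?thesis .
        qed
        ultimately have "2 powr (- (2 + \<gamma>) * real i) * (C1 * ?\<Lambda> powr \<gamma> * (60 * 4 ^ i))
          = C1 * 60 * (2 powr (- (2 + \<gamma>) * real i) * 2 powr (\<gamma> + \<gamma> * real i) * 2 powr (2 * real i))" by simp
        also have "2 powr (- (2 + \<gamma>) * real i) * 2 powr (\<gamma> + \<gamma> * real i) * 2 powr (2 * real i) = 2 powr \<gamma>"
          unfolding powr_add[symmetric] by (simp add: algebra_simps)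
        finally show ?thesis by (simp add: CA_def)
      qed
      finally show ?thesis .
    qed
  next
    fix x :: "real \<times> (real^3)"
    have "(\<integral>\<^sup>+i. ennreal (CA * 17280) * \<phi> i x \<partial>count_space UNIV)
      = (\<Sum>i. ennreal (CA * 17280) * (ennreal (c * NN x powr (- \<kappa>)) * ennreal (if 2 ^ i \<le> NN x then 2 powr (\<sigma> * real i) else 0)))"
      unfolding nn_integral_count_space_nat
    proof (rule arg_cong[where f = suminf], rule ext)
      fix i
      have "\<phi> i x = ennreal (c * NN x powr (- \<kappa>)) * ennreal (if 2 ^ i \<le> NN x then 2 powr (\<sigma> * real i) else 0)"
        using c0 by (simp add: \<phi>_def ennreal_mult'[symmetric] ac_simps)
      then show "ennreal (CA * 17280) * \<phi> i x = ennreal (CA * 17280) * (ennreal (c * NN x powr (- \<kappa>)) * ennreal (if 2 ^ i \<le> NN x then 2 powr (\<sigma> * real i) else 0))"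
        by simp
    qed
    also have "\<dots> = ennreal (CA * 17280) * (ennreal (c * NN x powr (- \<kappa>)) * (\<Sum>i. ennreal (if 2 ^ i \<le> NN x then 2 powr (\<sigma> * real i) else 0)))"
      by (simp only: ennreal_suminf_cmult)
    also have "\<dots> \<le> ennreal (CA * 17280) * (ennreal (c * NN x powr (- \<kappa>)) * ennreal (Cg * NN x powr \<kappa>))"
      by (intro mult_left_mono Cg) auto
    also have "\<dots> = ennreal (CA * 17280 * (c * NN x powr (- \<kappa>) * (Cg * NN x powr \<kappa>)))"
    proof -
      have "0 \<le> CA * 17280" "0 \<le> c * NN x powr (- \<kappa>)" using CA0 c0 by simp_all
      then show ?thesis by (simp only: ennreal_mult')
    qed
    also have "c * NN x powr (- \<kappa>) * (Cg * NN x powr \<kappa>) = c * Cg"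
    proof -
      have "NN x powr (- \<kappa>) * NN x powr \<kappa> = 1" by (simp add: powr_add[symmetric] less_imp_neq[OF NN_pos, symmetric])
      then show ?thesis by (metis (no_types, lifting) mult.assoc mult.commute mult.right_neutral)
    qed
    finally show "(\<integral>\<^sup>+i. ennreal (CA * 17280) * \<phi> i x \<partial>count_space UNIV) \<le> ennreal (CA * 17280 * (c * Cg))" .
  qed
  then show ?thesis
  proof (rule trilinear_bound_le)
    fix x y
    obtain i where i: "2 ^ i \<le> NN (x + y)" "NN (x + y) < 2 ^ Suc i" by (rule dyadic_index[OF NN_ge_1])
    have "(if high_high x y \<and> \<not> opposite_signs x y \<and> LL x < NN (x + y) then ennreal (K x y) else 0) = k i x y"
      unfolding k_def G_def sh_def using i by auto
    also have "\<dots> \<le> (\<integral>\<^sup>+i. k i x y \<partial>count_space UNIV)" by (rule nn_integral_ge_point) simp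
    finally show "(if high_high x y \<and> \<not> opposite_signs x y \<and> LL x < NN (x + y) then ennreal (K x y) else 0) \<le> (\<integral>\<^sup>+i. k i x y \<partial>count_space UNIV)" .
  qed
qed

end

section \<open>Opposite signs of the time frequencies\<close>

lemma perpendicular_part_shift:
  fixes e v :: "'a::real_inner"
  assumes "norm e = 1"
  shows "(v + t *\<^sub>R e) - ((v + t *\<^sub>R e) \<bullet> e) *\<^sub>R e = v - (v \<bullet> e) *\<^sub>R e"
proof -
  have "e \<bullet> e = 1" using assms by (simp add: norm_eq_1)
  then show ?thesis by (simp add: inner_add_left scaleR_add_left)
qed

text \<open>\<open>w + y\<close> equals \<open>norm x *\<^sub>R (sgn x + sgn y) + (w - x)\<close> up
  to a multiple of \<open>sgn y\<close>, which does not contribute to the perpendicular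
  part.\<close>

lemma norm_perpendicular_sum_le:
  fixes x y w :: "'a::real_inner"
  assumes "y \<noteq> 0"
  shows "norm ((w + y) - ((w + y) \<bullet> sgn y) *\<^sub>R sgn y) \<le> norm x * norm (sgn x + sgn y) + norm (w - x)"
proof -
  define v where "v = norm x *\<^sub>R (sgn x + sgn y) + (w - x)"
  have e: "norm (sgn y) = 1" using assms by (simp add: norm_sgn)
  have "norm x *\<^sub>R sgn x = x" "norm y *\<^sub>R sgn y = y" by (cases "x = 0"; simp add: sgn_div_norm) (cases "y = 0"; simp add: sgn_div_norm)
  then have "w + y = v + (norm y - norm x) *\<^sub>R sgn y" unfolding v_def by (simp add: algebra_simps)
  then have "norm ((w + y) - ((w + y) \<bullet> sgn y) *\<^sub>R sgn y) = norm (v - (v \<bullet> sgn y) *\<^sub>R sgn y)"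
    by (simp only: perpendicular_part_shift[OF e])
  also have "\<dots> \<le> norm v" by (rule perpendicular_part_le[OF e])
  also have "\<dots> \<le> norm (norm x *\<^sub>R (sgn x + sgn y)) + norm (w - x)" unfolding v_def by (rule norm_triangle_ineq)
  finally show ?thesis by simp
qed

context wave_exponents
begin

text \<open>For a negative exponent the lower end of the range dominates, and
  \<open>\<sigma> / 2 \<le> \<kappa>\<close> is equivalent to \<open>low\<close>. Otherwise the
  upper end dominates, and \<open>\<sigma> \<le> \<kappa>\<close> is equivalent to
  \<open>total\<close>. At \<open>\<sigma> = 0\<close> the sum is logarithmic, and the strict form
  of \<open>low\<close> makes \<open>\<kappa>\<close> positive.\<close>

lemma low_frequency_sum:
  defines "\<sigma> \<equiv> 1 + 2 * a - 2 * s0 + 2 * (g1 + g2)" and "\<kappa> \<equiv> 2 * (s1 + s2) + (g1 + g2) - 1"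
  obtains C where "0 \<le> C" "\<And>N. 1 \<le> N \<Longrightarrow> (\<Sum>n. ennreal (if sqrt N / 2 \<le> 2 ^ n \<and> 2 ^ n \<le> N then 2 powr (\<sigma> * real n) else 0)) \<le> ennreal (C * N powr \<kappa>)"
proof (cases "\<sigma> < 0")
  case True
  obtain C where C: "0 \<le> C" "\<And>Z. 0 < Z \<Longrightarrow> (\<Sum>n. ennreal (if Z \<le> 2 ^ n then 2 powr (\<sigma> * real n) else 0)) \<le> ennreal (C * Z powr \<sigma>)"
    using sum_two_powr_ge[OF True] by blast
  show ?thesis
  proof (rule that[of "C * 2 powr (- \<sigma>)"])
    fix N :: real assume N: "1 \<le> N"
    have "(\<Sum>n. ennreal (if sqrt N / 2 \<le> 2 ^ n \<and> 2 ^ n \<le> N then 2 powr (\<sigma> * real n) else 0))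
      \<le> (\<Sum>n. ennreal (if sqrt N / 2 \<le> 2 ^ n then 2 powr (\<sigma> * real n) else 0))"
      by (intro suminf_le ennreal_leI) auto
    also have "\<dots> \<le> ennreal (C * (sqrt N / 2) powr \<sigma>)" using N by (intro C) simp
    also have "(sqrt N / 2) powr \<sigma> = 2 powr (- \<sigma>) * N powr (\<sigma> / 2)"
      using N by (simp add: powr_divide powr_minus_divide powr_half_sqrt[symmetric] powr_powr)
    also have "ennreal (C * (2 powr (- \<sigma>) * N powr (\<sigma> / 2))) \<le> ennreal (C * (2 powr (- \<sigma>) * N powr \<kappa>))"
    proof (intro ennreal_leI mult_left_mono powr_mono N C(1))
      show "\<sigma> / 2 \<le> \<kappa>" using low unfolding \<sigma>_def \<kappa>_def by (simp add: field_simps)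
    qed auto
    finally show "(\<Sum>n. ennreal (if sqrt N / 2 \<le> 2 ^ n \<and> 2 ^ n \<le> N then 2 powr (\<sigma> * real n) else 0)) \<le> ennreal (C * 2 powr (- \<sigma>) * N powr \<kappa>)"
      by (simp add: mult.assoc)
  qed (use C in simp)
next
  case False
  have le: "\<sigma> \<le> \<kappa>" using total unfolding \<sigma>_def \<kappa>_def by (simp add: algebra_simps)
  have "0 < \<kappa>"
  proof (cases "\<sigma> = 0")
    case True
    then have "3 / 2 + a < s0 + 2 * (s1 + s2)" using low_eq unfolding \<sigma>_def by simp
    with True show ?thesis unfolding \<sigma>_def \<kappa>_def by argo
  qed (use False le in auto)
  then have "0 \<le> \<kappa>" "\<kappa> = 0 \<Longrightarrow> \<sigma> < 0" by auto
  then obtain C where C: "0 \<le> C" "\<And>R. 1 \<le> R \<Longrightarrow> (\<Sum>n. ennreal (if 2 ^ n \<le> R then 2 powr (\<sigma> * real n) else 0)) \<le> ennreal (C * R powr \<kappa>)"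
    using sum_two_powr_le[OF _ le] by blast
  show ?thesis
  proof (rule that[OF C(1)])
    fix N :: real assume N: "1 \<le> N"
    have "(\<Sum>n. ennreal (if sqrt N / 2 \<le> 2 ^ n \<and> 2 ^ n \<le> N then 2 powr (\<sigma> * real n) else 0))
      \<le> (\<Sum>n. ennreal (if 2 ^ n \<le> N then 2 powr (\<sigma> * real n) else 0))"
      by (intro suminf_le ennreal_leI) auto
    also have "\<dots> \<le> ennreal (C * N powr \<kappa>)" using N by (rule C)
    finally show "(\<Sum>n. ennreal (if sqrt N / 2 \<le> 2 ^ n \<and> 2 ^ n \<le> N then 2 powr (\<sigma> * real n) else 0)) \<le> ennreal (C * N powr \<kappa>)" .
  qed
qed

text \<open>Localising \<open>snd x\<close> to balls of radius comparable to \<open>D = sqrt (NN (x + y) * LL (x + y))\<close> makes the two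
  wave fronts transversal, with normals at an angle of at least about \<open>D / NN x\<close>, and confines \<open>snd y\<close>
  to a tube of width \<open>D\<close> and length \<open>NN (x + y)\<close>.\<close>

lemma trilinear_bound_high_high_curved:
  "trilinear_bound (\<lambda>x y. if high_high x y \<and> opposite_signs x y \<and> NN x * LL x < (NN (x + y))\<^sup>2 \<and> 8 * LL x < LL (x + y) then ennreal (K x y) else 0)"
proof -
  define G where "G x y \<longleftrightarrow> high_high x y \<and> opposite_signs x y \<and> NN x * LL x < (NN (x + y))\<^sup>2 \<and> 8 * LL x < LL (x + y)" for x y
  define sh where "sh i t \<longleftrightarrow> 2 ^ i \<le> t \<and> t < 2 ^ Suc i" for i :: nat and t :: real
  define \<gamma> \<kappa> \<sigma> where "\<gamma> = g1 + g2" and "\<kappa> = 2 * (s1 + s2) + (g1 + g2) - 1" and "\<sigma> = 1 + 2 * a - 2 * s0 + 2 * (g1 + g2)"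
  obtain Cg where Cg: "0 \<le> Cg" "\<And>N. 1 \<le> N \<Longrightarrow> (\<Sum>n. ennreal (if sqrt N / 2 \<le> 2 ^ n \<and> 2 ^ n \<le> N then 2 powr (\<sigma> * real n) else 0)) \<le> ennreal (Cg * N powr \<kappa>)"
    unfolding \<kappa>_def \<sigma>_def by (rule low_frequency_sum) auto
  \<comment> \<open>The exponent of the output modulation is positive, so the sum over the
    modulation shells is governed by the largest one.\<close>
  have a2: "0 \<le> 2 * a" "2 * a \<le> 2 * a" "2 * a = 0 \<Longrightarrow> 2 * a < 0" using a_pos by auto
  obtain Ca where Ca: "0 \<le> Ca" "\<And>R. 1 \<le> R \<Longrightarrow> (\<Sum>n. ennreal (if 2 ^ n \<le> R then 2 powr (2 * a * real n) else 0)) \<le> ennreal (Ca * R powr (2 * a))"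
    using sum_two_powr_le[OF a2] by blast
  obtain C1 where C1: "0 \<le> C1" "\<And>(Q :: real \<times> (real^3) \<Rightarrow> bool) z \<Lambda> V. Measurable.pred borel Q \<Longrightarrow> 0 \<le> V \<Longrightarrow>
     (\<And>l m. 1 \<le> l \<Longrightarrow> 1 \<le> m \<Longrightarrow> emeasure lborel {x. Q x \<and> LL x \<le> l \<and> LL (z - x) \<le> m} \<le> ennreal (l * m * V)) \<Longrightarrow>
     (\<integral>\<^sup>+x. (if Q x \<and> LL x \<le> \<Lambda> \<and> LL (z - x) \<le> \<Lambda> then ennreal (LL x powr (- 2 * b1) * LL (z - x) powr (- 2 * b2)) else 0) \<partial>lborel) \<le> ennreal (C1 * \<Lambda> powr \<gamma> * V)"
    unfolding \<gamma>_def by (rule modulations_integral) auto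
  define c where "c = exp (\<bar>2 * s2\<bar> * ln 2 + 2 * a * ln 2 + \<bar>2 * s0\<bar> * ln 2)"
  have c0: "0 < c" by (simp add: c_def)
  define D where "D i = 2 powr ((real (fst i) + real (snd i)) / 2)" for i :: "nat \<times> nat"
  \<comment> \<open>Over such a ball a unit normal turns by at most \<open>D i / 8\<close> divided
    by its frequency, a fraction of the angle between the two normals.\<close>
  define \<rho> where "\<rho> i = D i / 32" for i :: "nat \<times> nat"
  have D0: "0 < D i" for i by (simp add: D_def)
  define T where "T i x y \<longleftrightarrow> G x y \<and> sh (fst i) (NN (x + y)) \<and> sh (snd i) (LL (x + y))" for i :: "nat \<times> nat" and x y
  define k where "k i x y = (if T i x y then ennreal (K x y) else 0)" for i x y
  \<comment> \<open>Unlike for equal signs, the lower bound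
    \<open>sqrt (NN x) / 2 \<le> 2 ^ fst i\<close> is retained, since the sum over output
    frequencies may depend on it.\<close>
  define \<phi> where "\<phi> i x = (if snd i \<le> fst i + 1 \<and> sqrt (NN x) / 2 \<le> 2 ^ fst i \<and> 2 ^ fst i \<le> NN x
    then ennreal (c * (2 powr (2 * a * real (snd i) + (2 * \<gamma> - 2 * s0) * real (fst i)) * NN x powr (- \<kappa>))) else 0)" for i :: "nat \<times> nat" and x
  \<comment> \<open>The factor \<open>NN x powr (\<gamma> - 1)\<close> anticipates the integral:
    transversality costs \<open>NN x / D i\<close>, and the modulations reach up to about
    \<open>4 ^ fst i / NN x\<close>.\<close>
  define q where "q i x y = (if T i x y then ennreal (2 powr (- 2 * \<gamma> * real (fst i)) * (NN x powr (\<gamma> - 1) * (LL x powr (- 2 * b1) * LL y powr (- 2 * b2)))) else 0)" for i x y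
  \<comment> \<open>The tube follows the direction of \<open>snd y\<close>, because its volume is
    measured in \<open>w\<close> at a fixed \<open>y\<close>.\<close>
  define Z where "Z i w y \<longleftrightarrow> snd i \<le> fst i + 1 \<and> snd y \<noteq> 0 \<and> \<bar>(w + snd y) \<bullet> sgn (snd y)\<bar> \<le> 3 * 2 ^ fst i \<and>
    norm ((w + snd y) - ((w + snd y) \<bullet> sgn (snd y)) *\<^sub>R sgn (snd y)) \<le> 4 * D i" for i :: "nat \<times> nat" and w :: "real^3" and y :: "real \<times> (real^3)"
  define CA where "CA = 2 powr \<bar>\<gamma> - 1\<bar> * (C1 * 8 powr \<gamma> * 15)"
  have CA0: "0 \<le> CA" using C1(1) by (simp add: CA_def)
  \<comment> \<open>The number 8192 is the ratio of \<open>(D i) ^ 3\<close> to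
    \<open>4 * (\<rho> i) ^ 3\<close>.\<close>
  define CB where "CB = CA * 19200 * 8192"
  have CB0: "0 \<le> CB" using CA0 by (simp add: CB_def)
  have TG: "G x y" "2 ^ fst i \<le> NN (x + y)" "NN (x + y) < 2 ^ Suc (fst i)" "2 ^ snd i \<le> LL (x + y)" "LL (x + y) < 2 ^ Suc (snd i)"
    if "T i x y" for i x y using that by (auto simp: T_def sh_def)
  have geo: "15 / 16 * NN x \<le> norm (snd x)" "7 / 8 * NN x \<le> norm (snd y)" "4 / 5 * D i \<le> norm (sgn (snd x) + sgn (snd y)) * NN x"
    "norm (sgn (snd x) + sgn (snd y)) * NN x \<le> 7 / 2 * D i" "D i \<le> 2 * 2 ^ fst i" "13 * D i \<le> NN x" "snd i \<le> fst i + 1" if "T i x y" for i x y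
  proof -
    have H: "16 * NN (x + y) \<le> NN x" "LL y \<le> LL x" "opposite_signs x y" "NN x * LL x < (NN (x + y))\<^sup>2" "8 * LL x < LL (x + y)"
      using TG(1)[OF that] by (simp_all only: G_def high_high_def)
    note g = opposite_geometry[OF H TG(2-5)[OF that], folded D_def]
    show "15 / 16 * NN x \<le> norm (snd x)" "7 / 8 * NN x \<le> norm (snd y)" "4 / 5 * D i \<le> norm (sgn (snd x) + sgn (snd y)) * NN x"
      "norm (sgn (snd x) + sgn (snd y)) * NN x \<le> 7 / 2 * D i" "D i \<le> 2 * 2 ^ fst i" "13 * D i \<le> NN x" "snd i \<le> fst i + 1"
      by (fact g)+
  qed
  have Gm[measurable]: "Measurable.pred (borel \<Otimes>\<^sub>M borel) (\<lambda>p. T i (fst p) (snd p))" for i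
    unfolding T_def G_def high_high_def opposite_signs_def sh_def by measurable
  have Gz[measurable]: "Measurable.pred borel (\<lambda>x. T i x (z - x))" for i z
    unfolding T_def G_def high_high_def opposite_signs_def sh_def by measurable
  have "trilinear_bound (\<lambda>x y. \<integral>\<^sup>+i. k i x y \<partial>count_space UNIV)"
  proof (rule trilinear_bound_localized[where q = q and \<phi> = \<phi> and S = "\<lambda>i. {z. sh (fst i) (NN z) \<and> sh (snd i) (LL z)}" and Z = Z and \<rho> = \<rho>
      and A = "\<lambda>i. ennreal (CA * D i)" and M = "\<lambda>i. ennreal (19200 * (D i)\<^sup>2 * 2 ^ fst i)" and B = "\<lambda>i. ennreal (CB * 2 ^ fst i)" and C = "CB * c * (Ca * 2 powr (2 * a)) * Cg"])
    fix i :: "nat \<times> nat"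
    show "case_prod (k i) \<in> borel_measurable borel"
      by (rule borel_measurable_pairI, unfold case_prod_beta k_def) measurable
    show "case_prod (q i) \<in> borel_measurable borel"
      by (rule borel_measurable_pairI, unfold case_prod_beta q_def) measurable
    show "\<phi> i \<in> borel_measurable borel" unfolding \<phi>_def by measurable
    show "{z. sh (fst i) (NN z) \<and> sh (snd i) (LL z)} \<in> sets borel" unfolding sh_def by measurable
    show "{p. Z i (fst p) (snd p)} \<in> sets borel" unfolding Z_def by measurable
    show "0 < \<rho> i" using D0 by (simp add: \<rho>_def)
    show "x + y \<in> {z. sh (fst i) (NN z) \<and> sh (snd i) (LL z)}" if "k i x y \<noteq> 0" for x y using that by (auto simp: k_def T_def split: if_splits)
    show "Z i w y" if "k i x y \<noteq> 0" "dist (snd x) w \<le> \<rho> i" for x y w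
    proof -
      from that(1) have T: "T i x y" by (auto simp: k_def split: if_splits)
      note g = geo[OF T]
      have "0 < norm (snd y)" using g(2) NN_pos[of x] by argo
      then have y0: "snd y \<noteq> 0" by simp
      have d: "norm (w - snd x) \<le> D i / 32" using that(2) by (simp add: \<rho>_def dist_norm norm_minus_commute)
      have "norm (snd x + snd y) \<le> 2 * 2 ^ fst i" using TG(3)[OF T] by (simp add: NN_def)
      moreover have "norm (w + snd y) \<le> norm (snd x + snd y) + norm (w - snd x)"
        using norm_triangle_ineq[of "snd x + snd y" "w - snd x"] by (simp add: algebra_simps)
      moreover have "\<bar>(w + snd y) \<bullet> sgn (snd y)\<bar> \<le> norm (w + snd y)"
        using Cauchy_Schwarz_ineq2[of "w + snd y" "sgn (snd y)"] y0 by (simp add: norm_sgn)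
      moreover have "0 < (2::real) ^ fst i" by simp
      ultimately have 1: "\<bar>(w + snd y) \<bullet> sgn (snd y)\<bar> \<le> 3 * 2 ^ fst i" using d g(5) by linarith
      have "norm (snd x) * norm (sgn (snd x) + sgn (snd y)) \<le> NN x * norm (sgn (snd x) + sgn (snd y))"
        by (intro mult_right_mono) (auto simp: NN_def)
      also have "\<dots> \<le> 7 / 2 * D i" using g(4) by (simp only: mult.commute)
      finally have "norm ((w + snd y) - ((w + snd y) \<bullet> sgn (snd y)) *\<^sub>R sgn (snd y)) \<le> 4 * D i"
        using norm_perpendicular_sum_le[OF y0, of w "snd x"] d D0[of i] by linarith
      with 1 y0 g(7) show ?thesis unfolding Z_def by blast
    qed
    show "(k i x y)\<^sup>2 \<le> \<phi> i x * q i x y" for x y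
    proof (cases "T i x y")
      case True
      note s = TG[OF True]
      have H: "high_high x y" "16 * NN (x + y) \<le> NN x" "NN x * LL x < (NN (x + y))\<^sup>2" using s(1) by (auto simp: G_def high_high_def)
      have iN: "2 ^ fst i \<le> NN x" using s(2) H(2) NN_ge_1[of "x + y"] by linarith
      \<comment> \<open>The origin of the lower limit for the output frequency: modulations are at
        least 1, so \<open>NN x\<close> is below the square of the output frequency.\<close>
      have "NN x * 1 \<le> NN x * LL x" by (intro mult_left_mono less_imp_le[OF NN_pos] LL_ge_1)
      also have "\<dots> \<le> (NN (x + y))\<^sup>2" using H(3) by (rule less_imp_le)
      also have "\<dots> \<le> (2 * 2 ^ fst i)\<^sup>2" by (rule power_mono[OF _ less_imp_le[OF NN_pos]]) (use s(3) in simp)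
      finally have "NN x \<le> (2 * 2 ^ fst i)\<^sup>2" by simp
      from real_sqrt_le_mono[OF this] have sq: "sqrt (NN x) / 2 \<le> 2 ^ fst i" by (simp only: real_sqrt_abs) simp
      have 1: "2 * s2 * (ln (NN x) - ln (NN y)) \<le> \<bar>2 * s2\<bar> * ln 2" using H by (intro mult_le_abs_mult high_high_ln_NN) auto
      have "ln (LL (x + y)) - real (snd i) * ln 2 \<le> ln 2" using dyadic_ln[OF s(4,5)] by linarith
      then have 2: "2 * a * (ln (LL (x + y)) - real (snd i) * ln 2) \<le> 2 * a * ln 2" using a_pos by (intro mult_left_mono) auto
      have 3: "- 2 * s0 * (ln (NN (x + y)) - real (fst i) * ln 2) \<le> \<bar>- 2 * s0\<bar> * ln 2" by (intro mult_le_abs_mult dyadic_ln s)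
      have "(K x y)\<^sup>2 \<le> c * (2 powr (2 * a * real (snd i) + (2 * \<gamma> - 2 * s0) * real (fst i)) * NN x powr (- \<kappa>)) *
          (2 powr (- 2 * \<gamma> * real (fst i)) * (NN x powr (\<gamma> - 1) * (LL x powr (- 2 * b1) * LL y powr (- 2 * b2))))"
        unfolding K_square powr_eq_exp[OF NN_pos] powr_eq_exp[OF LL_pos] powr_eq_exp[OF zero_less_numeral] c_def mult_exp_exp exp_le_cancel_iff
        using 1 2 3 by (simp add: algebra_simps \<kappa>_def \<gamma>_def)
      then have "ennreal ((K x y)\<^sup>2) \<le> ennreal (c * (2 powr (2 * a * real (snd i) + (2 * \<gamma> - 2 * s0) * real (fst i)) * NN x powr (- \<kappa>)) *
          (2 powr (- 2 * \<gamma> * real (fst i)) * (NN x powr (\<gamma> - 1) * (LL x powr (- 2 * b1) * LL y powr (- 2 * b2)))))"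
        by (rule ennreal_leI)
      also have "\<dots> = \<phi> i x * q i x y"
        using True iN sq geo(7)[OF True] c0 by (subst ennreal_mult') (simp_all add: \<phi>_def q_def)
      finally show ?thesis using True K_nonneg[of x y] by (simp add: k_def ennreal_power)
    qed (simp add: k_def)
    show "emeasure lborel {w. Z i w y} \<le> ennreal (19200 * (D i)\<^sup>2 * 2 ^ fst i)" for y
    proof (cases "snd i \<le> fst i + 1 \<and> snd y \<noteq> 0")
      case True
      let ?e = "sgn (snd y)"
      let ?S = "\<lambda>w. \<bar>w \<bullet> ?e\<bar> \<le> 3 * 2 ^ fst i \<and> norm (w - (w \<bullet> ?e) *\<^sub>R ?e) \<le> 4 * D i"
      have "D i \<le> 2 powr (real (fst i) + 1)" unfolding D_def using True by (intro powr_mono) auto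
      also have "\<dots> = 2 * 2 ^ fst i" by (simp add: powr_add powr_realpow)
      finally have D2: "D i \<le> 2 * 2 ^ fst i" .
      have "emeasure lborel {w. Z i w y} = emeasure lborel {w. ?S (snd y + w)}" using True by (simp add: Z_def add.commute)
      also have "\<dots> = emeasure lborel {w::real^3. ?S w}" by (rule emeasure_lborel_shift) measurable
      also have "\<dots> \<le> ennreal (40 * (4 * D i)\<^sup>2 * (2 * (3 * 2 ^ fst i) + 3 * (4 * D i)))"
        by (rule emeasure_cylinder_le) (use True D0 in \<open>auto simp: norm_sgn\<close>)
      also have "\<dots> \<le> ennreal (19200 * (D i)\<^sup>2 * 2 ^ fst i)"
      proof (rule ennreal_leI)
        have "40 * (4 * D i)\<^sup>2 * (2 * (3 * 2 ^ fst i) + 3 * (4 * D i)) \<le> 40 * (4 * D i)\<^sup>2 * (30 * 2 ^ fst i)"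
          using D2 by (intro mult_left_mono) auto
        then show "40 * (4 * D i)\<^sup>2 * (2 * (3 * 2 ^ fst i) + 3 * (4 * D i)) \<le> 19200 * (D i)\<^sup>2 * 2 ^ fst i"
          by (simp add: power_mult_distrib)
      qed
      finally show ?thesis .
    next
      case False
      then have "{w. Z i w y} = {}" by (auto simp: Z_def)
      then show ?thesis by simp
    qed
    show "{z. sh (fst i) (NN z) \<and> sh (snd i) (LL z)} \<inter> {z. sh (fst j) (NN z) \<and> sh (snd j) (LL z)} = {}" if "i \<noteq> j" for j
    proof (rule ccontr)
      assume "\<not> ?thesis"
      then obtain z where "sh (fst i) (NN z)" "sh (snd i) (LL z)" "sh (fst j) (NN z)" "sh (snd j) (LL z)" by blast
      then have "fst i = fst j" "snd i = snd j" using dyadic_index_unique unfolding sh_def by blast+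
      with that show False by (simp add: prod_eq_iff)
    qed
    \<comment> \<open>Up to constants the product of integral bound and overlap is
      \<open>(D i) ^ 3 * 2 ^ fst i\<close>. The ball volume removes the cube, and one factor
      \<open>2 ^ fst i\<close> is left for the summation.\<close>
    show "ennreal (CA * D i) * ennreal (19200 * (D i)\<^sup>2 * 2 ^ fst i) \<le> ennreal (CB * 2 ^ fst i) * emeasure lborel (cball (0::real^3) (\<rho> i))"
    proof -
      have "ennreal (CA * D i) * ennreal (19200 * (D i)\<^sup>2 * 2 ^ fst i) = ennreal (CA * D i * (19200 * (D i)\<^sup>2 * 2 ^ fst i))"
        using CA0 D0[of i] by (intro ennreal_mult'[symmetric]) simp
      also have "CA * D i * (19200 * (D i)\<^sup>2 * 2 ^ fst i) = CB * 2 ^ fst i * (4 * (\<rho> i) ^ 3)"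
        by (simp add: CB_def \<rho>_def power_divide power2_eq_square power3_eq_cube)
      also have "ennreal \<dots> = ennreal (CB * 2 ^ fst i) * ennreal (4 * (\<rho> i) ^ 3)" using CB0 by (intro ennreal_mult') simp
      also have "\<dots> \<le> ennreal (CB * 2 ^ fst i) * emeasure lborel (cball (0::real^3) (\<rho> i))"
        using D0[of i] by (intro mult_left_mono emeasure_cball_le) (auto simp: \<rho>_def)
      finally show ?thesis .
    qed
    show "(\<integral>\<^sup>+x. (if dist (snd x) w \<le> \<rho> i then q i x (z - x) else 0) \<partial>lborel) \<le> ennreal (CA * D i)" for w z
    proof -
      \<comment> \<open>On the part of the ball that contributes, \<open>NN x\<close> is comparable
        to the constant \<open>Y\<close>, so its powers can be taken out of the integral.\<close>
      define Y where "Y = 1 + norm w"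
      have Y0: "0 < Y" by (simp add: Y_def add_pos_nonneg)
      define Q where "Q x \<longleftrightarrow> dist (snd x) w \<le> \<rho> i \<and> T i x (z - x)" for x
      have [measurable]: "Measurable.pred borel Q" unfolding Q_def by measurable
      have NY: "NN x \<le> 2 * Y \<and> Y \<le> 2 * NN x" if "Q x" for x
      proof -
        have "norm (snd x - w) \<le> D i / 32" "13 * D i \<le> NN x" using that geo(6)[of i x "z - x"] unfolding Q_def \<rho>_def dist_norm by auto
        moreover have "\<bar>norm (snd x) - norm w\<bar> \<le> norm (snd x - w)" by (rule norm_triangle_ineq3)
        ultimately show ?thesis using D0[of i] unfolding Y_def NN_def abs_le_iff by argo
      qed
      \<comment> \<open>The bound comes from \<open>NN x * LL x < (NN z)\<^sup>2\<close>, with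
        \<open>NN z < 2 * 2 ^ fst i\<close> and \<open>Y \<le> 2 * NN x\<close>.\<close>
      define \<Lambda> where "\<Lambda> = 8 * 4 ^ fst i / Y"
      have \<Lambda>: "LL x \<le> \<Lambda> \<and> LL (z - x) \<le> \<Lambda>" if "Q x" for x
      proof -
        from that have T: "T i x (z - x)" by (simp add: Q_def)
        have G: "NN x * LL x < (NN z)\<^sup>2" "LL (z - x) \<le> LL x" using TG(1)[OF T] by (simp_all add: G_def high_high_def)
        have "(NN z)\<^sup>2 \<le> (2 * 2 ^ fst i)\<^sup>2" by (rule power_mono[OF _ less_imp_le[OF NN_pos]]) (use TG(3)[OF T] in simp)
        also have "(2 * (2::real) ^ fst i)\<^sup>2 = 4 * 4 ^ fst i" by (simp add: power_mult_distrib power_mult[symmetric] mult.commute[of "fst i" 2] power_mult)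
        finally have "NN x * LL x \<le> 4 * 4 ^ fst i" using G by linarith
        moreover have "Y / 2 * LL x \<le> NN x * LL x" using NY[OF that] by (intro mult_right_mono less_imp_le[OF LL_pos]) simp
        ultimately have "LL x * Y \<le> 8 * 4 ^ fst i" by argo
        then have "LL x \<le> \<Lambda>" using Y0 by (simp add: \<Lambda>_def pos_le_divide_eq)
        with G show ?thesis by simp
      qed
      let ?c = "2 powr (- 2 * \<gamma> * real (fst i)) * (2 powr \<bar>\<gamma> - 1\<bar> * Y powr (\<gamma> - 1))"
      have "(\<integral>\<^sup>+x. (if dist (snd x) w \<le> \<rho> i then q i x (z - x) else 0) \<partial>lborel)
        \<le> (\<integral>\<^sup>+x. ennreal ?c * (if Q x \<and> LL x \<le> \<Lambda> \<and> LL (z - x) \<le> \<Lambda> then ennreal (LL x powr (- 2 * b1) * LL (z - x) powr (- 2 * b2)) else 0) \<partial>lborel)"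
      proof (rule nn_integral_mono)
        fix x :: "real \<times> (real^3)"
        show "(if dist (snd x) w \<le> \<rho> i then q i x (z - x) else 0) \<le> ennreal ?c *
          (if Q x \<and> LL x \<le> \<Lambda> \<and> LL (z - x) \<le> \<Lambda> then ennreal (LL x powr (- 2 * b1) * LL (z - x) powr (- 2 * b2)) else 0)"
        proof (cases "Q x")
          case True
          have "ln (NN x) \<le> ln 2 + ln Y" "ln Y \<le> ln 2 + ln (NN x)" using NY[OF True] Y0 by (auto intro!: ln_le_ln_add)
          then have "(\<gamma> - 1) * (ln (NN x) - ln Y) \<le> \<bar>\<gamma> - 1\<bar> * ln 2" by (intro mult_le_abs_mult) auto
          then have "NN x powr (\<gamma> - 1) \<le> 2 powr \<bar>\<gamma> - 1\<bar> * Y powr (\<gamma> - 1)"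
            unfolding powr_eq_exp[OF NN_pos] powr_eq_exp[OF Y0] powr_eq_exp[OF zero_less_numeral] mult_exp_exp exp_le_cancel_iff
            by (simp add: algebra_simps)
          then have "2 powr (- 2 * \<gamma> * real (fst i)) * (NN x powr (\<gamma> - 1) * (LL x powr (- 2 * b1) * LL (z - x) powr (- 2 * b2)))
            \<le> 2 powr (- 2 * \<gamma> * real (fst i)) * (2 powr \<bar>\<gamma> - 1\<bar> * Y powr (\<gamma> - 1) * (LL x powr (- 2 * b1) * LL (z - x) powr (- 2 * b2)))"
            by (intro mult_left_mono mult_right_mono) auto
          also have "\<dots> = ?c * (LL x powr (- 2 * b1) * LL (z - x) powr (- 2 * b2))" by simp
          finally have "q i x (z - x) \<le> ennreal (?c * (LL x powr (- 2 * b1) * LL (z - x) powr (- 2 * b2)))"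
            using True by (simp add: q_def Q_def ennreal_leI)
          also have "\<dots> = ennreal ?c * ennreal (LL x powr (- 2 * b1) * LL (z - x) powr (- 2 * b2))" by (rule ennreal_mult') simp
          finally show ?thesis using True \<Lambda>[OF True] by (simp add: Q_def)
        qed (auto simp: Q_def q_def)
      qed
      also have "\<dots> = ennreal ?c * (\<integral>\<^sup>+x. (if Q x \<and> LL x \<le> \<Lambda> \<and> LL (z - x) \<le> \<Lambda> then ennreal (LL x powr (- 2 * b1) * LL (z - x) powr (- 2 * b2)) else 0) \<partial>lborel)"
        by (rule nn_integral_cmult) measurable
      also have "\<dots> \<le> ennreal ?c * ennreal (C1 * \<Lambda> powr \<gamma> * (15 * D i * Y))"
      proof (intro mult_left_mono C1(2))
        fix l m :: real assume lm: "1 \<le> l" "1 \<le> m"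
        let ?P = "\<lambda>\<xi>. dist \<xi> w \<le> \<rho> i \<and> \<xi> \<noteq> 0 \<and> snd z - \<xi> \<noteq> 0 \<and>
          D i / (4 * Y) \<le> norm (sgn \<xi> - (- 1) *\<^sub>R sgn (snd z - \<xi>)) - 4 * \<rho> i / norm \<xi> - 4 * \<rho> i / norm (snd z - \<xi>)"
        have sub: "?P (snd x) \<and> (0 \<le> fst x) \<noteq> (0 \<le> fst (z - x))" if "Q x" for x
        proof -
          from that have T: "T i x (z - x)" by (simp add: Q_def)
          note g = geo[OF T]
          define r1 r2 E where d: "r1 = norm (snd x)" "r2 = norm (snd z - snd x)" "E = norm (sgn (snd x) + sgn (snd z - snd x))"
          have r: "15 / 16 * NN x \<le> r1" "7 / 8 * NN x \<le> r2" "4 / 5 * D i \<le> E * NN x" using g(1,2,3) by (simp_all add: d)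
          have "0 < r1" using r(1) NN_pos[of x] by argo
          have "0 < r2" using r(2) NN_pos[of x] by argo
          have E1: "D i / 8 / r1 \<le> D i / 8 / (15 / 16 * NN x)" using \<open>0 < r1\<close> D0[of i] by (intro divide_left_mono r(1)) auto
          have E2: "D i / 8 / r2 \<le> D i / 8 / (7 / 8 * NN x)" using \<open>0 < r2\<close> D0[of i] by (intro divide_left_mono r(2)) auto
          have E3: "4 / 5 * (D i / NN x) \<le> E" using r(3) by (simp add: pos_divide_le_eq)
          have E4: "D i / (2 * Y) \<le> D i / NN x" using NY[OF that] Y0 D0[of i] by (intro divide_left_mono) auto
          have E5: "0 \<le> D i / NN x" using D0[of i] by (intro divide_nonneg_nonneg less_imp_le[OF NN_pos]) simp
          have eq: "D i / 8 / (15 / 16 * NN x) = 2 / 15 * (D i / NN x)" "D i / 8 / (7 / 8 * NN x) = 1 / 7 * (D i / NN x)"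
            "D i / (4 * Y) = 1 / 2 * (D i / (2 * Y))" "4 * \<rho> i / r1 = D i / 8 / r1" "4 * \<rho> i / r2 = D i / 8 / r2"
            by (simp_all add: \<rho>_def)
          \<comment> \<open>The numerical margin: \<open>4 / 5 - 2 / 15 - 1 / 7\<close> still
            exceeds \<open>1 / 2\<close>.\<close>
          have arith: "p \<le> 2 / 15 * t \<Longrightarrow> p' \<le> 1 / 7 * t \<Longrightarrow> 4 / 5 * t \<le> E \<Longrightarrow> y \<le> t \<Longrightarrow> 0 \<le> t \<Longrightarrow> 1 / 2 * y \<le> E - p - p'"
            for p p' t y by linarith
          have "D i / (4 * Y) \<le> E - 4 * \<rho> i / r1 - 4 * \<rho> i / r2"
            unfolding eq(3-5) by (rule arith[OF E1[unfolded eq(1)] E2[unfolded eq(2)] E3 E4 E5])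
          then show ?thesis using that \<open>0 < r1\<close> \<open>0 < r2\<close> TG(1)[OF T] by (auto simp: Q_def d G_def opposite_signs_def)
        qed
        have "emeasure lborel {x. Q x \<and> LL x \<le> l \<and> LL (z - x) \<le> m}
          \<le> emeasure lborel {x. ?P (snd x) \<and> (0 \<le> fst x) \<noteq> (0 \<le> fst (z - x)) \<and> LL x \<le> l \<and> LL (z - x) \<le> m}"
          by (rule emeasure_mono, use sub in blast) measurable
        also have "\<dots> \<le> ennreal (l * m * (16 * (240 * (\<rho> i)\<^sup>2 / (D i / (4 * Y)))))"
          by (rule emeasure_localized_modulations_le[where w = w and \<sigma> = "- 1"]) (use lm D0[of i] Y0 in \<open>auto simp: \<rho>_def sgnb_def\<close>)
        also have "16 * (240 * (\<rho> i)\<^sup>2 / (D i / (4 * Y))) = 15 * D i * Y"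
          using D0[of i] Y0 by (simp add: \<rho>_def power2_eq_square)
        finally show "emeasure lborel {x. Q x \<and> LL x \<le> l \<and> LL (z - x) \<le> m} \<le> ennreal (l * m * (15 * D i * Y))" .
      qed (use D0[of i] Y0 in auto)
      also have "\<dots> = ennreal (?c * (C1 * \<Lambda> powr \<gamma> * (15 * D i * Y)))" by (rule ennreal_mult'[symmetric]) simp
      also have "?c * (C1 * \<Lambda> powr \<gamma> * (15 * D i * Y)) = CA * D i"
      proof -
        have "(4::real) ^ fst i = 2 powr (2 * real (fst i))"
        proof -
          have "(4::real) ^ fst i = (2 ^ 2) ^ fst i" by simp
          also have "\<dots> = 2 ^ (2 * fst i)" by (rule power_mult[symmetric])
          also have "\<dots> = 2 powr (2 * real (fst i))" by (subst powr_realpow[symmetric]) auto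
          finally show ?thesis .
        qed
        then have "\<Lambda> powr \<gamma> = 8 powr \<gamma> * 2 powr (2 * \<gamma> * real (fst i)) * Y powr (- \<gamma>)"
          using Y0 by (simp add: \<Lambda>_def powr_divide powr_mult powr_powr powr_minus_divide mult.commute mult.left_commute)
        \<comment> \<open>All powers of \<open>Y\<close> and of \<open>2 ^ fst i\<close> cancel, and
          only \<open>D i\<close> survives.\<close>
        then have "?c * (C1 * \<Lambda> powr \<gamma> * (15 * D i * Y))
          = 2 powr \<bar>\<gamma> - 1\<bar> * (C1 * 8 powr \<gamma> * 15) * D i * (2 powr (- 2 * \<gamma> * real (fst i)) * 2 powr (2 * \<gamma> * real (fst i))) * (Y powr (\<gamma> - 1) * Y powr (- \<gamma>) * Y powr 1)"
          using Y0 by simp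
        also have "2 powr (- 2 * \<gamma> * real (fst i)) * 2 powr (2 * \<gamma> * real (fst i)) = 1" unfolding powr_add[symmetric] by simp
        also have "Y powr (\<gamma> - 1) * Y powr (- \<gamma>) * Y powr 1 = 1" unfolding powr_add[symmetric] using Y0 by simp
        finally show ?thesis by (simp add: CA_def)
      qed
      finally show ?thesis .
    qed
  next
    fix x :: "real \<times> (real^3)"
    define R where "R n \<longleftrightarrow> sqrt (NN x) / 2 \<le> 2 ^ n \<and> 2 ^ n \<le> NN x" for n :: nat
    let ?b = "\<lambda>n. if R n then CB * c * NN x powr (- \<kappa>) * 2 powr ((1 + 2 * \<gamma> - 2 * s0) * real n) else 0"
    \<comment> \<open>The output modulation is summed at a fixed output frequency. Its largest value
      is comparable to that frequency and contributes the summand \<open>2 * a\<close> in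
      \<open>\<sigma>\<close>.\<close>
    have inner: "(\<Sum>l. ennreal (CB * 2 ^ n) * \<phi> (n, l) x) \<le> ennreal (CB * c * (Ca * 2 powr (2 * a)) * NN x powr (- \<kappa>)) * ennreal (if R n then 2 powr (\<sigma> * real n) else 0)" for n
    proof -
      have b0: "0 \<le> ?b n" using CB0 c0 by simp
      have "(\<Sum>l. ennreal (CB * 2 ^ n) * \<phi> (n, l) x) \<le> (\<Sum>l. ennreal (?b n) * ennreal (if 2 ^ l \<le> (2::real) ^ (n + 1) then 2 powr (2 * a * real l) else 0))"
      proof (rule suminf_le)
        fix l :: nat
        show "ennreal (CB * 2 ^ n) * \<phi> (n, l) x \<le> ennreal (?b n) * ennreal (if 2 ^ l \<le> (2::real) ^ (n + 1) then 2 powr (2 * a * real l) else 0)"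
        proof (cases "l \<le> n + 1 \<and> R n")
          case True
          then have p: "(2::real) ^ l \<le> 2 ^ (n + 1)" by (intro power_increasing) auto
          have "(2::real) ^ n = 2 powr real n" by (simp add: powr_realpow)
          then have "CB * 2 ^ n * (c * (2 powr (2 * a * real l + (2 * \<gamma> - 2 * s0) * real n) * NN x powr (- \<kappa>)))
            = CB * c * NN x powr (- \<kappa>) * (2 powr real n * 2 powr (2 * a * real l + (2 * \<gamma> - 2 * s0) * real n))" by simp
          also have "2 powr real n * 2 powr (2 * a * real l + (2 * \<gamma> - 2 * s0) * real n) = 2 powr ((1 + 2 * \<gamma> - 2 * s0) * real n) * 2 powr (2 * a * real l)"
            unfolding powr_add[symmetric] by (simp add: algebra_simps)
          finally have "CB * 2 ^ n * (c * (2 powr (2 * a * real l + (2 * \<gamma> - 2 * s0) * real n) * NN x powr (- \<kappa>)))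
            = ?b n * 2 powr (2 * a * real l)" using True by simp
          moreover have "ennreal (CB * 2 ^ n) * \<phi> (n, l) x = ennreal (CB * 2 ^ n * (c * (2 powr (2 * a * real l + (2 * \<gamma> - 2 * s0) * real n) * NN x powr (- \<kappa>))))"
            using True CB0 by (subst ennreal_mult') (auto simp: \<phi>_def R_def)
          moreover have "ennreal (?b n) * ennreal (2 powr (2 * a * real l)) = ennreal (?b n * 2 powr (2 * a * real l))"
            by (rule ennreal_mult'[symmetric, OF b0])
          ultimately show ?thesis unfolding if_P[OF p] by (metis order_refl)
        qed (auto simp: \<phi>_def R_def)
      qed auto
      also have "\<dots> = ennreal (?b n) * (\<Sum>l. ennreal (if 2 ^ l \<le> (2::real) ^ (n + 1) then 2 powr (2 * a * real l) else 0))" by simp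
      also have "\<dots> \<le> ennreal (?b n) * ennreal (Ca * (2 ^ (n + 1)) powr (2 * a))" by (intro mult_left_mono Ca one_le_power) auto
      also have "\<dots> = ennreal (?b n * (Ca * (2 ^ (n + 1)) powr (2 * a)))" by (rule ennreal_mult'[symmetric, OF b0])
      also have "?b n * (Ca * (2 ^ (n + 1)) powr (2 * a)) = CB * c * (Ca * 2 powr (2 * a)) * NN x powr (- \<kappa>) * (if R n then 2 powr (\<sigma> * real n) else 0)"
      proof -
        have "((2::real) ^ (n + 1)) powr (2 * a) = 2 powr (2 * a) * 2 powr (2 * a * real n)"
          by (subst powr_realpow[symmetric]) (auto simp: powr_powr powr_add[symmetric] algebra_simps)
        then have "CB * c * NN x powr (- \<kappa>) * 2 powr ((1 + 2 * \<gamma> - 2 * s0) * real n) * (Ca * (2 ^ (n + 1)) powr (2 * a))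
          = CB * c * (Ca * 2 powr (2 * a)) * NN x powr (- \<kappa>) * (2 powr ((1 + 2 * \<gamma> - 2 * s0) * real n) * 2 powr (2 * a * real n))" by simp
        also have "2 powr ((1 + 2 * \<gamma> - 2 * s0) * real n) * 2 powr (2 * a * real n) = 2 powr (\<sigma> * real n)"
          unfolding powr_add[symmetric] by (simp add: \<sigma>_def \<gamma>_def algebra_simps)
        finally show ?thesis by auto
      qed
      also have "ennreal \<dots> = ennreal (CB * c * (Ca * 2 powr (2 * a)) * NN x powr (- \<kappa>)) * ennreal (if R n then 2 powr (\<sigma> * real n) else 0)"
        using CB0 c0 Ca(1) by (intro ennreal_mult') simp
      finally show ?thesis .
    qed
    have "(\<integral>\<^sup>+i. ennreal (CB * 2 ^ fst i) * \<phi> i x \<partial>count_space UNIV)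
      = (\<integral>\<^sup>+n. \<integral>\<^sup>+l. ennreal (CB * 2 ^ n) * \<phi> (n, l) x \<partial>count_space UNIV \<partial>count_space UNIV)"
      by (subst nn_integral_fst_count_space[symmetric]) simp
    also have "\<dots> = (\<Sum>n. \<Sum>l. ennreal (CB * 2 ^ n) * \<phi> (n, l) x)" by (simp only: nn_integral_count_space_nat)
    also have "\<dots> \<le> (\<Sum>n. ennreal (CB * c * (Ca * 2 powr (2 * a)) * NN x powr (- \<kappa>)) * ennreal (if R n then 2 powr (\<sigma> * real n) else 0))"
      by (rule suminf_le[OF inner]) auto
    also have "\<dots> = ennreal (CB * c * (Ca * 2 powr (2 * a)) * NN x powr (- \<kappa>)) * (\<Sum>n. ennreal (if R n then 2 powr (\<sigma> * real n) else 0))"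
      by (simp only: ennreal_suminf_cmult)
    also have "\<dots> \<le> ennreal (CB * c * (Ca * 2 powr (2 * a)) * NN x powr (- \<kappa>)) * ennreal (Cg * NN x powr \<kappa>)"
      unfolding R_def by (intro mult_left_mono Cg) auto
    also have "\<dots> = ennreal (CB * c * (Ca * 2 powr (2 * a)) * NN x powr (- \<kappa>) * (Cg * NN x powr \<kappa>))"
      using CB0 c0 Ca(1) by (intro ennreal_mult'[symmetric]) simp
    also have "CB * c * (Ca * 2 powr (2 * a)) * NN x powr (- \<kappa>) * (Cg * NN x powr \<kappa>) = CB * c * (Ca * 2 powr (2 * a)) * Cg"
    proof -
      have "NN x powr (- \<kappa>) * NN x powr \<kappa> = 1" by (simp add: powr_add[symmetric] less_imp_neq[OF NN_pos, symmetric])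
      moreover have "CB * c * (Ca * 2 powr (2 * a)) * NN x powr (- \<kappa>) * (Cg * NN x powr \<kappa>)
        = CB * c * (Ca * 2 powr (2 * a)) * Cg * (NN x powr (- \<kappa>) * NN x powr \<kappa>)" by (simp only: ac_simps)
      ultimately show ?thesis by (simp only: mult_1_right)
    qed
    finally show "(\<integral>\<^sup>+i. ennreal (CB * 2 ^ fst i) * \<phi> i x \<partial>count_space UNIV) \<le> ennreal (CB * c * (Ca * 2 powr (2 * a)) * Cg)" .
  qed
  then show ?thesis
  proof (rule trilinear_bound_le)
    fix x y
    obtain n where n: "2 ^ n \<le> NN (x + y)" "NN (x + y) < 2 ^ Suc n" by (rule dyadic_index[OF NN_ge_1])
    obtain l where l: "2 ^ l \<le> LL (x + y)" "LL (x + y) < 2 ^ Suc l" by (rule dyadic_index[OF LL_ge_1])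
    have "(if high_high x y \<and> opposite_signs x y \<and> NN x * LL x < (NN (x + y))\<^sup>2 \<and> 8 * LL x < LL (x + y) then ennreal (K x y) else 0) = k (n, l) x y"
      unfolding k_def T_def G_def sh_def using n l by auto
    also have "\<dots> \<le> (\<integral>\<^sup>+i. k i x y \<partial>count_space UNIV)" by (rule nn_integral_ge_point) simp
    finally show "(if high_high x y \<and> opposite_signs x y \<and> NN x * LL x < (NN (x + y))\<^sup>2 \<and> 8 * LL x < LL (x + y) then ennreal (K x y) else 0)
      \<le> (\<integral>\<^sup>+i. k i x y \<partial>count_space UNIV)" .
  qed
qed

end

subsection \<open>The product estimate\<close>

context wave_exponents
begin

lemma region_kernel_measurable:
  assumes [measurable]: "Measurable.pred (borel \<Otimes>\<^sub>M borel) (\<lambda>p. P (fst p) (snd p))"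
  shows "case_prod (\<lambda>x y. if P x y then ennreal (K x y) else 0) \<in> borel_measurable borel"
  by (rule borel_measurable_pairI, unfold case_prod_beta) measurable

text \<open>The regions need only cover, since an overlap merely increases the sum of the
  nonnegative kernels.\<close>

lemma trilinear_bound_cover:
  assumes "trilinear_bound (\<lambda>x y. if P x y then ennreal (K x y) else 0)"
    and "trilinear_bound (\<lambda>x y. if Q x y then ennreal (K x y) else 0)"
    and "Measurable.pred (borel \<Otimes>\<^sub>M borel) (\<lambda>p. P (fst p) (snd p))"
    and "Measurable.pred (borel \<Otimes>\<^sub>M borel) (\<lambda>p. Q (fst p) (snd p))"
    and "\<And>x y. R x y \<Longrightarrow> P x y \<or> Q x y"
  shows "trilinear_bound (\<lambda>x y. if R x y then ennreal (K x y) else 0)"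
  using trilinear_bound_add[OF assms(1,2) region_kernel_measurable[OF assms(3)] region_kernel_measurable[OF assms(4)]]
proof (rule trilinear_bound_le)
  show "(if R x y then ennreal (K x y) else 0) \<le> (if P x y then ennreal (K x y) else 0) + (if Q x y then ennreal (K x y) else 0)" for x y
    using assms(5)[of x y] by auto
qed

lemma trilinear_bound_low_second:
  "trilinear_bound (\<lambda>x y. if NN y \<le> NN x \<and> NN x \<le> 18 * NN (x + y) then ennreal (K x y) else 0)"
proof -
  define B where "B \<mu> x y \<longleftrightarrow> NN y \<le> NN x \<and> NN x \<le> 18 * NN (x + y) \<and> 16 * NN y \<le> LL y \<and> 16 * LL x \<le> LL y \<and>
      \<mu> (x + y) \<le> 2 * LL y \<and> LL y \<le> 8 * \<mu> (x + y)" for \<mu> :: "real \<times> (real^3) \<Rightarrow> real" and x y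
  define A where "A x y \<longleftrightarrow> NN y \<le> NN x \<and> NN x \<le> 18 * NN (x + y) \<and> NN y \<le> LL x \<and> LL y \<le> 16 * LL x" for x y
  define C where "C x y \<longleftrightarrow> NN y \<le> NN x \<and> NN x \<le> 18 * NN (x + y) \<and> LL x \<le> NN y \<and> LL y \<le> 16 * NN y" for x y
  have [measurable]: "Measurable.pred (borel \<Otimes>\<^sub>M borel) (\<lambda>p. A (fst p) (snd p))"
    "Measurable.pred (borel \<Otimes>\<^sub>M borel) (\<lambda>p. C (fst p) (snd p))"
    "Measurable.pred (borel \<Otimes>\<^sub>M borel) (\<lambda>p. B NN (fst p) (snd p))"
    "Measurable.pred (borel \<Otimes>\<^sub>M borel) (\<lambda>p. B LL (fst p) (snd p))"
    unfolding A_def B_def C_def by measurable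
  have B: "trilinear_bound (\<lambda>x y. if B NN x y then ennreal (K x y) else 0)"
    "trilinear_bound (\<lambda>x y. if B LL x y then ennreal (K x y) else 0)"
    unfolding B_def by (rule trilinear_bound_low_second_own_modulation; simp)+
  have "trilinear_bound (\<lambda>x y. if B LL x y \<or> B NN x y then ennreal (K x y) else 0)"
    by (rule trilinear_bound_cover[OF B(2,1)]; (measurable; fail)?) auto?
  moreover have "trilinear_bound (\<lambda>x y. if A x y \<or> C x y then ennreal (K x y) else 0)"
    using trilinear_bound_low_second_first_modulation trilinear_bound_low_second_small_modulations
    unfolding A_def[symmetric] C_def[symmetric] by (rule trilinear_bound_cover; (measurable; fail)?) auto?
  ultimately show ?thesis
  proof (rule trilinear_bound_cover)
    fix x y
    assume *: "NN y \<le> NN x \<and> NN x \<le> 18 * NN (x + y)"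
    show "(B LL x y \<or> B NN x y) \<or> (A x y \<or> C x y)"
    \<comment> \<open>Below either threshold, \<open>A\<close> or \<open>C\<close> applies according
      to the order of \<open>LL x\<close> and \<open>NN y\<close>; above both, \<open>LL y\<close>
      dominates the other input modulation and the low frequency.\<close>
    proof (cases "LL y \<le> 16 * LL x \<or> LL y \<le> 16 * NN y")
      case True
      then show ?thesis using * unfolding A_def C_def by linarith
    next
      case False
      then have f: "16 * LL x \<le> LL y" "16 * NN y \<le> LL y" by auto
      show ?thesis
      proof (cases "8 * LL (x + y) < LL y")
        case True
        then have "B NN x y" using * f LL_high_modulation[OF f True] NN_pos[of "x + y"] unfolding B_def by linarith
        then show ?thesis by simp
      next
        case h: False
        have "LL (x + y) \<le> 2 * LL y" using LL_add_le[of x y] f * NN_pos[of y] LL_pos[of x] by argo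
        then have "B LL x y" using * f h unfolding B_def by linarith
        then show ?thesis by simp
      qed
    qed
  qed measurable
qed

lemma trilinear_bound_high_high: "trilinear_bound (\<lambda>x y. if high_high x y then ennreal (K x y) else 0)"
proof -
  have m[measurable]: "Measurable.pred (borel \<Otimes>\<^sub>M borel) (\<lambda>p. opposite_signs (fst p) (snd p))"
    "Measurable.pred (borel \<Otimes>\<^sub>M borel) (\<lambda>p. high_high (fst p) (snd p))" by (rule pred_opposite_signs pred_high_high)+
  define A where "A x y \<longleftrightarrow> high_high x y \<and> NN (x + y) \<le> LL x \<and> LL (x + y) \<le> 8 * LL x" for x y
  define B where "B x y \<longleftrightarrow> high_high x y \<and> NN (x + y) \<le> LL x \<and> 8 * LL x < LL (x + y)" for x y
  define C where "C x y \<longleftrightarrow> high_high x y \<and> opposite_signs x y \<and> LL x < NN (x + y) \<and> (NN (x + y))\<^sup>2 \<le> NN x * LL x" for x y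
  define D where "D x y \<longleftrightarrow> high_high x y \<and> opposite_signs x y \<and> LL x < NN (x + y) \<and> LL (x + y) \<le> 8 * LL x" for x y
  define E where "E x y \<longleftrightarrow> high_high x y \<and> \<not> opposite_signs x y \<and> LL x < NN (x + y)" for x y
  define F where "F x y \<longleftrightarrow> high_high x y \<and> opposite_signs x y \<and> NN x * LL x < (NN (x + y))\<^sup>2 \<and> 8 * LL x < LL (x + y)" for x y
  have [measurable]: "Measurable.pred (borel \<Otimes>\<^sub>M borel) (\<lambda>p. A (fst p) (snd p))"
    "Measurable.pred (borel \<Otimes>\<^sub>M borel) (\<lambda>p. B (fst p) (snd p))"
    "Measurable.pred (borel \<Otimes>\<^sub>M borel) (\<lambda>p. C (fst p) (snd p))"
    "Measurable.pred (borel \<Otimes>\<^sub>M borel) (\<lambda>p. D (fst p) (snd p))"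
    "Measurable.pred (borel \<Otimes>\<^sub>M borel) (\<lambda>p. E (fst p) (snd p))"
    "Measurable.pred (borel \<Otimes>\<^sub>M borel) (\<lambda>p. F (fst p) (snd p))"
    unfolding A_def B_def C_def D_def E_def F_def by measurable
  have AB: "trilinear_bound (\<lambda>x y. if A x y \<or> B x y then ennreal (K x y) else 0)"
    using trilinear_bound_high_high_first_modulation trilinear_bound_high_high_output_modulation unfolding A_def[symmetric] B_def[symmetric]
    by (rule trilinear_bound_cover; (measurable; fail)?) auto?
  have CD: "trilinear_bound (\<lambda>x y. if C x y \<or> D x y then ennreal (K x y) else 0)"
    using trilinear_bound_high_high_flat trilinear_bound_high_high_small_output_modulation unfolding C_def[symmetric] D_def[symmetric]
    by (rule trilinear_bound_cover; (measurable; fail)?) auto?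
  have EF: "trilinear_bound (\<lambda>x y. if E x y \<or> F x y then ennreal (K x y) else 0)"
    using trilinear_bound_high_high_equal_signs trilinear_bound_high_high_curved unfolding E_def[symmetric] F_def[symmetric]
    by (rule trilinear_bound_cover; (measurable; fail)?) auto?
  have CDEF: "trilinear_bound (\<lambda>x y. if (C x y \<or> D x y) \<or> (E x y \<or> F x y) then ennreal (K x y) else 0)"
    using CD EF by (rule trilinear_bound_cover; (measurable; fail)?) auto?
  show ?thesis
    using AB CDEF
  proof (rule trilinear_bound_cover)
    \<comment> \<open>A modulation \<open>LL x\<close> above the output frequency is settled by
      \<open>A\<close> and \<open>B\<close>. Otherwise equal signs give \<open>E\<close>; for
      opposite signs \<open>C\<close> takes the flat case and \<open>D\<close> small output
      modulations, and \<open>F\<close> is what remains.\<close>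
    fix x y assume "high_high x y"
    then show "(A x y \<or> B x y) \<or> ((C x y \<or> D x y) \<or> (E x y \<or> F x y))"
      unfolding A_def B_def C_def D_def E_def F_def by (meson not_le)
  qed measurable
qed

lemma trilinear_bound_half:
  "trilinear_bound (\<lambda>x y. if (NN y \<le> NN x \<and> NN x \<le> 18 * NN (x + y)) \<or> (16 * NN (x + y) \<le> NN x \<and> 16 * NN (x + y) \<le> NN y \<and> LL y \<le> LL x)
    then ennreal (K x y) else 0)"
proof (rule trilinear_bound_cover[OF trilinear_bound_low_second trilinear_bound_high_high _ pred_high_high])
  show "Measurable.pred (borel \<Otimes>\<^sub>M borel) (\<lambda>p. NN (snd p) \<le> NN (fst p) \<and> NN (fst p) \<le> 18 * NN (fst p + snd p))"
    by measurable
qed (simp add: high_high_def)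

text \<open>The kernel and the assumptions of the locale are invariant under exchanging the two
  inputs, so the half in which one input is distinguished implies the other.\<close>

lemma trilinear_bound_K: "trilinear_bound (\<lambda>x y. ennreal (K x y))"
proof -
  define P where "P x y \<longleftrightarrow> (NN y \<le> NN x \<and> NN x \<le> 18 * NN (x + y)) \<or> (16 * NN (x + y) \<le> NN x \<and> 16 * NN (x + y) \<le> NN y \<and> LL y \<le> LL x)" for x y
  have P[measurable]: "Measurable.pred (borel \<Otimes>\<^sub>M borel) (\<lambda>p. P (fst p) (snd p))"
    "Measurable.pred (borel \<Otimes>\<^sub>M borel) (\<lambda>p. P (snd p) (fst p))" unfolding P_def by measurable
  interpret mirror: wave_exponents a s0 s2 s1 b2 b1 g2 g1
    using a_pos b_ge g1 g2 total total_eq tail pairs low low_eq by unfold_locales (auto simp: algebra_simps)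
  have K: "mirror.K y x = K x y" for x y unfolding mirror.K_def K_def by (simp add: add.commute)
  have "trilinear_bound (\<lambda>y x. if P y x then ennreal (mirror.K y x) else 0)"
    unfolding P_def by (rule mirror.trilinear_bound_half)
  from trilinear_bound_swap[OF this mirror.region_kernel_measurable[OF P(1)]]
  have 2: "trilinear_bound (\<lambda>x y. if P y x then ennreal (K x y) else 0)" by (simp only: K)
  have 1: "trilinear_bound (\<lambda>x y. if P x y then ennreal (K x y) else 0)"
    unfolding P_def by (rule trilinear_bound_half)
  have "trilinear_bound (\<lambda>x y. if True then ennreal (K x y) else 0)"
  proof (rule trilinear_bound_cover[OF 1 2 P])
    fix x y
    \<comment> \<open>If \<open>NN y \<le> NN x\<close> and \<open>NN x > 18 * NN (x + y)\<close>,
      then \<open>NN y\<close> exceeds \<open>17 * NN (x + y)\<close>; the gap between 18 and 16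
      thus leaves room for the triangle inequality.\<close>
    have "NN x \<le> NN (x + y) + NN y" "NN y \<le> NN (x + y) + NN x" using NN_le_add[of x y] NN_le_add'[of y x] by simp_all
    then show "P x y \<or> P y x" unfolding P_def add.commute[of y x] using NN_pos[of "x + y"] by argo
  qed
  then show ?thesis by simp
qed

end

section \<open>Transfer to wave-Sobolev norms\<close>

lemma japbr_pos: "0 < japbr t"
  unfolding japbr_def by (simp add: add_pos_nonneg)

lemma abs_ln_japbr_diff_le: "\<bar>ln (japbr t) - ln (1 + \<bar>t\<bar>)\<bar> \<le> ln 2"
proof -
  have 1: "japbr t \<le> 1 + \<bar>t\<bar>" unfolding japbr_def by (rule real_le_lsqrt) (auto simp: power2_eq_square algebra_simps)
  have "1 \<le> japbr t" "\<bar>t\<bar> \<le> japbr t" unfolding japbr_def by (simp, rule real_le_rsqrt) simp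
  then have 2: "1 + \<bar>t\<bar> \<le> 2 * japbr t" by simp
  have "ln (japbr t) \<le> ln (1 + \<bar>t\<bar>)" using 1 japbr_pos[of t] by simp
  moreover have "ln (1 + \<bar>t\<bar>) \<le> ln 2 + ln (japbr t)" using 2 japbr_pos[of t] by (intro ln_le_ln_add) auto
  ultimately show ?thesis by (smt (verit) ln_ge_zero)
qed

text \<open>The exponents may have either sign, so both directions of the comparability of the
  brackets enter, again through logarithms.\<close>

lemma japbr_weight_compare:
  fixes w :: "real \<times> (real^3)"
  shows "japbr (norm (snd w)) powr s * japbr (\<bar>fst w\<bar> - norm (snd w)) powr b \<le> exp ((\<bar>s\<bar> + \<bar>b\<bar>) * ln 2) * (NN w powr s * LL w powr b)" (is "?J \<le> ?c * ?W")
    and "NN w powr s * LL w powr b \<le> exp ((\<bar>s\<bar> + \<bar>b\<bar>) * ln 2) * (japbr (norm (snd w)) powr s * japbr (\<bar>fst w\<bar> - norm (snd w)) powr b)"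
proof -
  have N: "\<bar>ln (japbr (norm (snd w))) - ln (NN w)\<bar> \<le> ln 2" using abs_ln_japbr_diff_le[of "norm (snd w)"] by (simp add: NN_def)
  have L: "\<bar>ln (japbr (\<bar>fst w\<bar> - norm (snd w))) - ln (LL w)\<bar> \<le> ln 2" using abs_ln_japbr_diff_le[of "\<bar>fst w\<bar> - norm (snd w)"] by (simp add: LL_def)
  note e = powr_eq_exp[OF NN_pos] powr_eq_exp[OF LL_pos] powr_eq_exp[OF japbr_pos] mult_exp_exp exp_le_cancel_iff
  show "?J \<le> ?c * ?W" unfolding e
    using mult_le_abs_mult[OF N, of s] mult_le_abs_mult[OF L, of b] by (simp add: algebra_simps)
  show "?W \<le> ?c * ?J" unfolding e
    using mult_le_abs_mult[of "ln (NN w) - ln (japbr (norm (snd w)))" "ln 2" s]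
      mult_le_abs_mult[of "ln (LL w) - ln (japbr (\<bar>fst w\<bar> - norm (snd w)))" "ln 2" b] N L
    by (simp add: abs_minus_commute algebra_simps)
qed

lemma borel_measurable_japbr [measurable]: "japbr \<in> borel_measurable borel"
  unfolding japbr_def[abs_def] by measurable

lemma wave_weight_H_norm:
  fixes u :: "real \<times> (real^3) \<Rightarrow> complex" and s b :: real
  assumes [measurable]: "u \<in> borel_measurable borel"
  defines "c \<equiv> (exp ((\<bar>s\<bar> + \<bar>b\<bar>) * ln 2))\<^sup>2"
  shows "H_norm_sq s b u \<le> ennreal c * (\<integral>\<^sup>+w. (ennreal (NN w powr s * LL w powr b * cmod (fourier u w)))\<^sup>2 \<partial>lborel)"
    and "(\<integral>\<^sup>+w. (ennreal (NN w powr s * LL w powr b * cmod (fourier u w)))\<^sup>2 \<partial>lborel) \<le> ennreal c * H_norm_sq s b u"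
proof -
  have step: "ennreal ((x * t)\<^sup>2) \<le> ennreal c * ennreal ((y * t)\<^sup>2)"
    if "0 \<le> x" "0 \<le> t" "x \<le> exp ((\<bar>s\<bar> + \<bar>b\<bar>) * ln 2) * y" for x y t :: real
  proof -
    have "x * t \<le> exp ((\<bar>s\<bar> + \<bar>b\<bar>) * ln 2) * y * t" using that by (intro mult_right_mono) auto
    then have "(x * t)\<^sup>2 \<le> (exp ((\<bar>s\<bar> + \<bar>b\<bar>) * ln 2) * y * t)\<^sup>2" using that by (intro power_mono) auto
    also have "\<dots> = c * (y * t)\<^sup>2" by (simp add: c_def power_mult_distrib)
    finally show ?thesis by (subst ennreal_mult'[symmetric]) (auto simp: c_def intro: ennreal_leI)
  qed
  have "H_norm_sq s b u \<le> (\<integral>\<^sup>+w. ennreal c * ennreal ((NN w powr s * LL w powr b * cmod (fourier u w))\<^sup>2) \<partial>lborel)"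
    unfolding H_norm_sq_def by (intro nn_integral_mono step japbr_weight_compare(1)) auto
  also have "\<dots> = ennreal c * (\<integral>\<^sup>+w. ennreal ((NN w powr s * LL w powr b * cmod (fourier u w))\<^sup>2) \<partial>lborel)"
    by (rule nn_integral_cmult) measurable
  finally show "H_norm_sq s b u \<le> ennreal c * (\<integral>\<^sup>+w. (ennreal (NN w powr s * LL w powr b * cmod (fourier u w)))\<^sup>2 \<partial>lborel)"
    by (simp add: ennreal_power)
  have "(\<integral>\<^sup>+w. ennreal ((NN w powr s * LL w powr b * cmod (fourier u w))\<^sup>2) \<partial>lborel)
    \<le> (\<integral>\<^sup>+w. ennreal c * ennreal ((japbr (norm (snd w)) powr s * japbr (\<bar>fst w\<bar> - norm (snd w)) powr b * cmod (fourier u w))\<^sup>2) \<partial>lborel)"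
    by (intro nn_integral_mono step japbr_weight_compare(2)) auto
  also have "\<dots> = ennreal c * H_norm_sq s b u"
    unfolding H_norm_sq_def by (rule nn_integral_cmult) measurable
  finally show "(\<integral>\<^sup>+w. (ennreal (NN w powr s * LL w powr b * cmod (fourier u w)))\<^sup>2 \<partial>lborel) \<le> ennreal c * H_norm_sq s b u"
    by (simp add: ennreal_power)
qed

lemma (in wave_exponents) is_product: "is_product TYPE(3) s0 s1 s2 (- a) b1 b2"
proof -
  have "case_prod (\<lambda>x y. ennreal (K x y)) \<in> borel_measurable borel"
    by (rule borel_measurable_pairI, unfold case_prod_beta) measurable
  from trilinear_bound_imp_convolution_bound[OF trilinear_bound_K this]
  obtain C where C: "\<And>F1 F2. F1 \<in> borel_measurable borel \<Longrightarrow> F2 \<in> borel_measurable borel \<Longrightarrow>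
     (\<integral>\<^sup>+z. (\<integral>\<^sup>+x. ennreal (K x (z - x)) * F1 x * F2 (z - x) \<partial>lborel)\<^sup>2 \<partial>lborel)
       \<le> ennreal C * (\<integral>\<^sup>+x. (F1 x)\<^sup>2 \<partial>lborel) * (\<integral>\<^sup>+x. (F2 x)\<^sup>2 \<partial>lborel)" by blast
  define c0 c1 c2 where "c0 = (exp ((\<bar>- s0\<bar> + \<bar>a\<bar>) * ln 2))\<^sup>2" and "c1 = (exp ((\<bar>s1\<bar> + \<bar>b1\<bar>) * ln 2))\<^sup>2" and "c2 = (exp ((\<bar>s2\<bar> + \<bar>b2\<bar>) * ln 2))\<^sup>2"
  show ?thesis unfolding is_product_def minus_minus
  proof (intro exI[of _ "c0 * (c1 * (c2 * max 0 C))"] allI impI)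
    fix u v :: "real \<times> (real^3) \<Rightarrow> complex" assume uv: "schwartz u" "schwartz v"
    have [measurable]: "u \<in> borel_measurable borel" "v \<in> borel_measurable borel"
      using uv schwartz_continuous by (auto intro: borel_measurable_continuous_onI)
    define F1 where "F1 x = ennreal (NN x powr s1 * LL x powr b1 * cmod (fourier u x))" for x
    define F2 where "F2 x = ennreal (NN x powr s2 * LL x powr b2 * cmod (fourier v x))" for x
    have [measurable]: "F1 \<in> borel_measurable borel" "F2 \<in> borel_measurable borel" unfolding F1_def F2_def by measurable
    \<comment> \<open>The weights in \<open>F1\<close> and \<open>F2\<close> cancel those of the
      inputs in \<open>K\<close>, leaving the output weight times the convolution of the
      transforms.\<close>
    have pt: "ennreal (NN z powr (- s0) * LL z powr a * cmod (fourier (\<lambda>z. u z * v z) z))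
      \<le> (\<integral>\<^sup>+x. ennreal (K x (z - x)) * F1 x * F2 (z - x) \<partial>lborel)" for z
    proof -
      have "ennreal (NN z powr (- s0) * LL z powr a * cmod (fourier (\<lambda>z. u z * v z) z))
        = ennreal (NN z powr (- s0) * LL z powr a) * ennreal (cmod (fourier (\<lambda>z. u z * v z) z))" by (rule ennreal_mult') simp
      also have "\<dots> \<le> ennreal (NN z powr (- s0) * LL z powr a) * (\<integral>\<^sup>+x. ennreal (cmod (fourier u x)) * ennreal (cmod (fourier v (z - x))) \<partial>lborel)"
        by (intro mult_left_mono fourier_schwartz_mult_le uv) simp
      also have "\<dots> = (\<integral>\<^sup>+x. ennreal (NN z powr (- s0) * LL z powr a) * (ennreal (cmod (fourier u x)) * ennreal (cmod (fourier v (z - x)))) \<partial>lborel)"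
        by (rule nn_integral_cmult[symmetric]) measurable
      also have "\<dots> = (\<integral>\<^sup>+x. ennreal (K x (z - x)) * F1 x * F2 (z - x) \<partial>lborel)"
      proof (rule nn_integral_cong)
        fix x :: "real \<times> (real^3)"
        have inv: "t powr (- p) * t powr p = 1" if "0 < t" for t p :: real using that by (simp add: powr_add[symmetric])
        have "K x (z - x) * (NN x powr s1 * LL x powr b1 * cmod (fourier u x)) * (NN (z - x) powr s2 * LL (z - x) powr b2 * cmod (fourier v (z - x)))
          = NN z powr (- s0) * LL z powr a * (cmod (fourier u x) * cmod (fourier v (z - x))) * (NN x powr (- s1) * NN x powr s1) * (LL x powr (- b1) * LL x powr b1)
             * (NN (z - x) powr (- s2) * NN (z - x) powr s2) * (LL (z - x) powr (- b2) * LL (z - x) powr b2)"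
          unfolding K_def by simp
        also have "\<dots> = NN z powr (- s0) * LL z powr a * (cmod (fourier u x) * cmod (fourier v (z - x)))"
          by (simp only: inv[OF NN_pos] inv[OF LL_pos] mult_1_right)
        finally have eq: "K x (z - x) * (NN x powr s1 * LL x powr b1 * cmod (fourier u x)) * (NN (z - x) powr s2 * LL (z - x) powr b2 * cmod (fourier v (z - x)))
          = NN z powr (- s0) * LL z powr a * (cmod (fourier u x) * cmod (fourier v (z - x)))" .
        have "ennreal (K x (z - x)) * F1 x * F2 (z - x) = ennreal (K x (z - x) * (NN x powr s1 * LL x powr b1 * cmod (fourier u x)) * (NN (z - x) powr s2 * LL (z - x) powr b2 * cmod (fourier v (z - x))))"
          unfolding F1_def F2_def using K_nonneg[of x "z - x"] by (subst ennreal_mult', simp)+ simp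
        also have "\<dots> = ennreal (NN z powr (- s0) * LL z powr a) * (ennreal (cmod (fourier u x)) * ennreal (cmod (fourier v (z - x))))"
          unfolding eq by (subst ennreal_mult', simp)+ simp
        finally show "ennreal (NN z powr (- s0) * LL z powr a) * (ennreal (cmod (fourier u x)) * ennreal (cmod (fourier v (z - x))))
          = ennreal (K x (z - x)) * F1 x * F2 (z - x)" by (rule sym)
      qed
      finally show ?thesis .
    qed
    have "H_norm_sq (- s0) a (\<lambda>z. u z * v z) \<le> ennreal c0 * (\<integral>\<^sup>+w. (ennreal (NN w powr (- s0) * LL w powr a * cmod (fourier (\<lambda>z. u z * v z) w)))\<^sup>2 \<partial>lborel)"
      unfolding c0_def by (rule wave_weight_H_norm) measurable
    also have "\<dots> \<le> ennreal c0 * (\<integral>\<^sup>+z. (\<integral>\<^sup>+x. ennreal (K x (z - x)) * F1 x * F2 (z - x) \<partial>lborel)\<^sup>2 \<partial>lborel)"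
      by (intro mult_left_mono nn_integral_mono power_mono pt) auto
    also have "\<dots> \<le> ennreal c0 * (ennreal C * (\<integral>\<^sup>+x. (F1 x)\<^sup>2 \<partial>lborel) * (\<integral>\<^sup>+x. (F2 x)\<^sup>2 \<partial>lborel))"
      by (intro mult_left_mono C) auto
    also have "\<dots> \<le> ennreal c0 * (ennreal (max 0 C) * (ennreal c1 * H_norm_sq s1 b1 u) * (ennreal c2 * H_norm_sq s2 b2 v))"
    proof (intro mult_left_mono mult_mono)
      show "(\<integral>\<^sup>+x. (F1 x)\<^sup>2 \<partial>lborel) \<le> ennreal c1 * H_norm_sq s1 b1 u"
        unfolding F1_def c1_def by (rule wave_weight_H_norm) measurable
      show "(\<integral>\<^sup>+x. (F2 x)\<^sup>2 \<partial>lborel) \<le> ennreal c2 * H_norm_sq s2 b2 v"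
        unfolding F2_def c2_def by (rule wave_weight_H_norm) measurable
    qed (auto intro: ennreal_leI)
    also have "\<dots> = (ennreal c0 * (ennreal c1 * (ennreal c2 * ennreal (max 0 C)))) * H_norm_sq s1 b1 u * H_norm_sq s2 b2 v"
      by (simp only: ac_simps)
    also have "ennreal c0 * (ennreal c1 * (ennreal c2 * ennreal (max 0 C))) = ennreal (c0 * (c1 * (c2 * max 0 C)))"
    proof -
      have "0 \<le> c0" "0 \<le> c1" "0 \<le> c2" by (simp_all add: c0_def c1_def c2_def)
      then show ?thesis by (simp only: ennreal_mult')
    qed
    finally show "H_norm_sq (- s0) a (\<lambda>z. u z * v z) \<le> ennreal (c0 * (c1 * (c2 * max 0 C))) * H_norm_sq s1 b1 u * H_norm_sq s2 b2 v" .
  qed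
qed

theorem theoremP:
  fixes s0 s1 s2 b0 b1 b2 :: real
  defines "S \<equiv> s0 + s1 + s2"
  assumes a: "b0 < 0" "0 < b1" "0 < b2"
    and b: "b0 + b1 + b2 \<ge> 1/2"
    and c: "b0 + b1 \<ge> 0"
    and d: "b0 + b2 \<ge> 0"
    and e: "S \<ge> 2 - (b0 + b1 + b2)"
    and f: "S \<ge> 3/2 - (b0 + b1)"
    and g: "S \<ge> 3/2 - (b0 + b2)"
    and h: "S \<ge> 1 - b0"
    and i: "s0 + 2 * (s1 + s2) + b0 \<ge> 3/2"
    and j: "s1 + s2 \<ge> - b0"
    and k: "s0 + s2 \<ge> 0"
    and l: "s0 + s1 \<ge> 0"
    and ex1: "b1 = 1/2 \<Longrightarrow> S > 2 - (b0 + b1 + b2) \<and> S > 3/2 - (b0 + b1)"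
    and ex2: "b2 = 1/2 \<Longrightarrow> S > 2 - (b0 + b1 + b2) \<and> S > 3/2 - (b0 + b2)"
    and ex3: "b1 + b2 = 1 \<Longrightarrow> S > 2 - (b0 + b1 + b2)"
    and ex4: "s0 + b0 \<in> {1/2, 3/2 - 2 * b1, 3/2 - 2 * b2, 5/2 - 2 * (b1 + b2)}
              \<Longrightarrow> s0 + 2 * (s1 + s2) + b0 > 3/2"
    and ex5: "b0 + b1 + b2 = 1/2 \<Longrightarrow> b0 + b1 > 0 \<and> b0 + b2 > 0"
    and ex6: "S = 2 - (b0 + b1 + b2) \<or> S = 3/2 - (b0 + b1) \<or> S = 3/2 - (b0 + b2) \<or> S = 1 - b0
              \<Longrightarrow> s1 + s2 > - b0 \<and> s0 + s2 > 0 \<and> s0 + s1 > 0"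
  shows "is_product TYPE(3) s0 s1 s2 b0 b1 b2"
proof -
  \<comment> \<open>The growth exponents away from \<open>bi = 1/2\<close>, where no logarithm
    occurs.\<close>
  define m1 m2 where "m1 = max 0 (1 - 2 * b1)" and "m2 = max 0 (1 - 2 * b2)"
  \<comment> \<open>\<open>\<delta>\<close> is the slack in \<open>total\<close>; it is nonnegative
    by (e) to (h), one for each choice in the two maxima. \<open>X = 0\<close> means that
    \<open>s0 + b0\<close> is \<open>1/2 + m1 + m2\<close>, one of the exceptional values for
    (i).\<close>
  define \<delta> X where "\<delta> = 2 * S - 2 + 2 * b0 - m1 - m2" and "X = 1 - 2 * b0 - 2 * s0 + 2 * (m1 + m2)"
  have \<delta>0: "0 \<le> \<delta>" using e f g h unfolding \<delta>_def m1_def m2_def by linarith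
  \<comment> \<open>At \<open>bi = 1/2\<close> the maximum for the other exponent decides which
    condition is active: (e), or else (f) respectively (g). Both are strict by the
    exceptions.\<close>
  have \<delta>1: "0 < \<delta>" if "b1 = 1/2 \<or> b2 = 1/2"
    using that ex1 ex2 e f g h unfolding \<delta>_def m1_def m2_def by linarith
  \<comment> \<open>For \<open>b2 = 1/2\<close> an equality here would be an equality in
    (b).\<close>
  have t1: "0 < b0 + b1" if "b2 = 1/2" using that ex5 b by linarith
  have t2: "0 < b0 + b2" if "b1 = 1/2" using that ex5 b by linarith
  \<comment> \<open>A third of \<open>\<delta>\<close> leaves room for raising both growth exponents
    and for one more \<open>\<epsilon>\<close> to keep the inequality strict. The other two entries
    preserve \<open>tail\<close>.\<close>
  define e1 where "e1 = min (if b1 = 1/2 \<or> b2 = 1/2 then \<delta> / 3 else 1) (min (if b2 = 1/2 then b0 + b1 else 1) (if b1 = 1/2 then b0 + b2 else 1))"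
  \<comment> \<open>Raising one or both growth exponents shifts \<open>X\<close> by
    \<open>2 * \<epsilon>\<close> or \<open>4 * \<epsilon>\<close>. For negative \<open>X\<close>
    the bound \<open>- X / 8\<close> keeps the shifted value negative, and otherwise it is positive;
    so the equality in \<open>low_eq\<close> cannot arise from a shift.\<close>
  define \<epsilon> where "\<epsilon> = (if X < 0 then min e1 (- X / 8) else e1)"
  have "0 < e1" using \<delta>1 t1 t2 by (auto simp: e1_def)
  then have eps: "0 < \<epsilon>" "\<epsilon> \<le> e1" "X + 2 * \<epsilon> \<noteq> 0" "X + 4 * \<epsilon> \<noteq> 0" unfolding \<epsilon>_def by (auto simp: min_def)
  have eps': "3 * \<epsilon> \<le> \<delta>" if "b1 = 1/2 \<or> b2 = 1/2" using that eps(2) by (auto simp: e1_def)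
  have eps1: "\<epsilon> \<le> b0 + b1" if "b2 = 1/2" using that eps(2) by (auto simp: e1_def)
  have eps2: "\<epsilon> \<le> b0 + b2" if "b1 = 1/2" using that eps(2) by (auto simp: e1_def)
  define g1 g2 where "g1 = (if b1 = 1/2 then \<epsilon> else m1)" and "g2 = (if b2 = 1/2 then \<epsilon> else m2)"
  have m_half: "m1 = 0" if "b1 = 1/2" using that by (simp add: m1_def)
  have m_half': "m2 = 0" if "b2 = 1/2" using that by (simp add: m2_def)
  interpret wave_exponents "- b0" s0 s1 s2 b1 b2 g1 g2
  proof
    show "0 < - b0" "- b0 \<le> b1" "- b0 \<le> b2" using a c d by auto
    show "0 \<le> g1" "1 - 2 * b1 \<le> g1" "0 \<le> g2" "1 - 2 * b2 \<le> g2" using eps(1) by (auto simp: g1_def g2_def m1_def m2_def)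
    show "1 - 2 * b1 < 0" if "g1 = 0" using that eps(1) by (auto simp: g1_def m1_def max_def split: if_splits)
    show "1 - 2 * b2 < 0" if "g2 = 0" using that eps(1) by (auto simp: g2_def m2_def max_def split: if_splits)
    have tot: "2 + 2 * (- b0) + g1 + g2 \<le> 2 * (s0 + s1 + s2) - (if b1 = 1/2 \<or> b2 = 1/2 then \<epsilon> else 0)"
      using \<delta>0 eps(1) eps' m_half m_half' unfolding g1_def g2_def \<delta>_def S_def by auto
    then show "2 + 2 * (- b0) + g1 + g2 \<le> 2 * (s0 + s1 + s2)" using eps(1) by (auto split: if_splits)
    show "- b0 < s1 + s2 \<and> 0 < s0 + s1 \<and> 0 < s0 + s2" if eq: "2 + 2 * (- b0) + g1 + g2 = 2 * (s0 + s1 + s2)"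
    proof -
      \<comment> \<open>The reserved \<open>\<epsilon>\<close> excludes equality in
        \<open>total\<close> at \<open>bi = 1/2\<close>; hence the equality comes from one of (e) to
        (h).\<close>
      have nh: "b1 \<noteq> 1/2" "b2 \<noteq> 1/2" using tot eq eps(1) by (auto split: if_splits)
      then have "\<delta> = 0" using eq unfolding \<delta>_def g1_def g2_def S_def by simp
      then have "S = 2 - (b0 + b1 + b2) \<or> S = 3/2 - (b0 + b1) \<or> S = 3/2 - (b0 + b2) \<or> S = 1 - b0"
        unfolding \<delta>_def m1_def m2_def max_def by (auto split: if_splits)
      then show ?thesis using ex6 by blast
    qed
    show "2 * (- b0) - 2 * b1 + g2 \<le> 0"
      using b c eps1 t1 eps(1) by (cases "b2 = 1/2") (auto simp: g2_def m2_def)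
    show "2 * (- b0) - 2 * b2 + g1 \<le> 0"
      using b d eps2 t2 eps(1) by (cases "b1 = 1/2") (auto simp: g1_def m1_def)
    show "- b0 \<le> s1 + s2" "0 \<le> s0 + s1" "0 \<le> s0 + s2" by (rule j l k)+
    show "3 / 2 + - b0 \<le> s0 + 2 * (s1 + s2)" using i by simp
    show "3 / 2 + - b0 < s0 + 2 * (s1 + s2)" if eq: "1 + 2 * (- b0) - 2 * s0 + 2 * (g1 + g2) = 0"
    proof -
      have nh: "b1 \<noteq> 1/2 \<and> b2 \<noteq> 1/2"
      proof (rule ccontr)
        assume "\<not> ?thesis"
        then have "X + 2 * \<epsilon> = 0 \<or> X + 4 * \<epsilon> = 0"
          using eq m_half m_half' unfolding X_def g1_def g2_def by (auto split: if_splits)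
        with eps show False by blast
      qed
      then have "X = 0" using eq unfolding X_def g1_def g2_def by simp
      then have "s0 + b0 = 1/2 + m1 + m2" unfolding X_def by argo
      then have "s0 + b0 \<in> {1/2, 3/2 - 2 * b1, 3/2 - 2 * b2, 5/2 - 2 * (b1 + b2)}"
        unfolding m1_def m2_def max_def by (auto split: if_splits)
      then show ?thesis using ex4 by simp
    qed
  qed
  show ?thesis using is_product by simp
qed

end
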